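(* For any number $n\in\mathbb{N}$, assume that a prime number $q$ and real numbers $\varepsilon,\delta\in(0,1)$ satisfy the following conditions: $2\le n\le q$ and $$\varepsilon'+\left(1-\frac1q-\varepsilon'\right)\sqrt{\frac{\Delta}{1+q\varepsilon'}}<\varepsilon\le 1-\frac1q$$ for a certain number $\varepsilon'\in(0,1)$, where $\Delta=2(n-1)\log(q^2/(1-\delta))$. Then there exists a quantum list decoder for a $(q,n,q-n+1)_q$-generalized Reed-Solomon code with bias $\varepsilon$ and confidence $\delta$ running in time polynomial in $(n,q,1/\delta,1/(1-\delta))$.
   Context: The $(q,n,q-n+1)_q$-generalized Reed-Solomon code is $C=\mathrm{GRS}^{(q,n,q)}:(\mathbb{F}_q)^n\times\mathbb{F}_q\to\mathbb{F}_q$, $C(x,r)=\sum_{i=1}^n x_ir^{i-1}\bmod q$; the codeword of a message $x=(x_1,\dots,x_n)\in(\mathbb{F}_q)^n$ is $C_x=C(x,\cdot)$. Elements of $\mathbb{F}_q$ are encoded as binary strings of a fixed length $m'$. A quantumly corrupted codeword for $C$ is a unitary operator $O$ such that, for all $r\in\mathbb{F}_q$ and $s\in\{0,1\}^{m'}$, $O|r\rangle|s\rangle|0^{\ell}\rangle=\sum_{z\in\{0,1\}^{m'}}\alpha_{r,z}|r\rangle|s\oplus z\rangle|\phi_{r,z}\rangle$, where $\oplus$ is bitwise XOR, $|\phi_{r,z}\rangle$ are unit-norm states of $\ell$ qubits, and $\sum_z|\alpha_{r,z}|^2=1$ for every $r$. The presence of $C_x$ in $O$ is $\mathrm{Pre}_O(C_x)=\frac1q\sum_{r\in\mathbb{F}_q}|\alpha_{r,C_x(r)}|^2$.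 A quantum list decoder for $C$ with bias $\varepsilon$ and confidence $\delta$ is a quantum algorithm that, given $n$ and $1/\varepsilon$ and oracle access (to $O$ and $O^{-1}$, unit cost per query) to an arbitrary quantumly corrupted codeword $O$ for $C$, outputs with probability at least $\delta$ a list of messages including all $x\in(\mathbb{F}_q)^n$ with $\mathrm{Pre}_O(C_x)\ge 1/q+\varepsilon$.
   Formalization: The auxiliary number ε' is additionally required to satisfy ε' < 1 − 1/q; for larger ε' the factor (1 − 1/q − ε') is negative and the claim fails (e.g. n = q, δ = 1/2, ε' near 1 would force superpolynomially long lists). *)

theory Defs
  imports
    "HOL-Computational_Algebra.Primes"
    "HOL-Probability.Probability_Mass_Function"
    "Jordan_Normal_Form.Schur_Decomposition"
begin

unbundle bit_operations_syntax
no_notation Finite_Cartesian_Product.vec_nth (infixl "$" 90)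

section \<open>Generalized Reed-Solomon codes\<close>

text \<open>
  For prime \<open>q\<close>, the field with \<open>q\<close> elements is \<open>{0..<q}\<close> with arithmetic modulo \<open>q\<close>. The message
  \<open>(x\<^sub>1, \<dots>, x\<^sub>n)\<close> is the list \<open>x\<close> with \<open>x ! i\<close> standing for \<open>x\<^sub>i\<^sub>+\<^sub>1\<close>, which absorbs the exponent
  shift in \<open>r\<^sup>i\<^sup>-\<^sup>1\<close>. As \<open>0 ^ 0 = 1\<close>, the codeword takes the value \<open>x\<^sub>1\<close> at \<open>r = 0\<close>.
\<close>

definition messages :: "nat \<Rightarrow> nat \<Rightarrow> nat list set" where
  "messages q n = {x. length x = n \<and> set x \<subseteq> {0..<q}}"

definition GRS :: "nat \<Rightarrow> nat \<Rightarrow> nat list \<Rightarrow> nat \<Rightarrow> nat" where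
  "GRS q n x r = (\<Sum>i<n. x ! i * r ^ i) mod q"


section \<open>Quantumly corrupted codewords\<close>

text \<open>
  A string of \<open>k\<close> bits is identified with the number below \<open>2 ^ k\<close> having this binary expansion
  (least significant bit first), so bitwise exclusive or of strings is \<open>XOR\<close> on numbers.
  Field elements are encoded in binary with the least sufficient number of bits.
\<close>

definition code_bits :: "nat \<Rightarrow> nat" where
  "code_bits q = (LEAST m. q \<le> 2 ^ m)"

definition is_unitary :: "nat \<Rightarrow> complex mat \<Rightarrow> bool" where
  "is_unitary N U \<longleftrightarrow> U \<in> carrier_mat N N \<and>
     mat_adjoint U * U = 1\<^sub>m N \<and> U * mat_adjoint U = 1\<^sub>m N"

text \<open>
  The vector \<open>|r\<rangle>|s\<rangle>|v\<rangle>\<close> on \<open>m + m + l\<close> qubits, where \<open>v\<close> is an \<open>l\<close>-qubit vector: the basis state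
  \<open>|r\<rangle>|s\<rangle>|w\<rangle>\<close> has index \<open>r + 2 ^ m * s + 2 ^ (2 * m) * w\<close>.
\<close>

definition ket3 :: "nat \<Rightarrow> nat \<Rightarrow> nat \<Rightarrow> nat \<Rightarrow> complex vec \<Rightarrow> complex vec" where
  "ket3 m l r s v = vec (2 ^ (2 * m + l)) (\<lambda>i.
     if i mod 2 ^ m = r \<and> i div 2 ^ m mod 2 ^ m = s then v $ (i div 2 ^ (2 * m)) else 0)"

text \<open>
  \<open>U\<close> is a quantumly corrupted codeword whose amplitudes and residual states are
  \<open>\<alpha>\<close> and \<open>\<phi>\<close>. Nothing but unitarity is required on basis states whose first register does not
  encode a field element or whose ancilla is nonzero.
\<close>

definition corrupted_codeword ::
  "nat \<Rightarrow> nat \<Rightarrow> complex mat \<Rightarrow> (nat \<Rightarrow> nat \<Rightarrow> complex) \<Rightarrow> (nat \<Rightarrow> nat \<Rightarrow> complex vec) \<Rightarrow> bool" where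
  "corrupted_codeword q l U \<alpha> \<phi> \<longleftrightarrow> (let m = code_bits q; N = 2 ^ (2 * m + l) in
     is_unitary N U \<and>
     (\<forall>r<q. \<forall>z<2 ^ m. \<phi> r z \<in> carrier_vec (2 ^ l) \<and> (\<Sum>w<2 ^ l. (cmod (\<phi> r z $ w))\<^sup>2) = 1) \<and>
     (\<forall>r<q. (\<Sum>z<2 ^ m. (cmod (\<alpha> r z))\<^sup>2) = 1) \<and>
     (\<forall>r<q. \<forall>s<2 ^ m. U *\<^sub>v ket3 m l r s (unit_vec (2 ^ l) 0) =
        vec N (\<lambda>i. \<Sum>z<2 ^ m. (\<alpha> r z \<cdot>\<^sub>v ket3 m l r (s XOR z) (\<phi> r z)) $ i)))"

text \<open>
  The presence of the codeword \<open>c\<close>. The numbers \<open>cmod (\<alpha> r z)\<close> are determined by the operator, so the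
  presence does not depend on the choice of \<open>\<alpha>\<close> and \<open>\<phi>\<close> representing it.
\<close>

definition presence :: "nat \<Rightarrow> (nat \<Rightarrow> nat \<Rightarrow> complex) \<Rightarrow> (nat \<Rightarrow> nat) \<Rightarrow> real" where
  "presence q \<alpha> c = 1 / real q * (\<Sum>r<q. (cmod (\<alpha> r (c r)))\<^sup>2)"


section \<open>Quantum oracle algorithms\<close>

text \<open>
  The machine model is a random access machine that controls a quantum memory (a QRAM machine).
  Cells of the classical memory and qubits of the quantum memory are both addressed by natural
  numbers. Arguments of commands are addresses of classical cells (except for the literal in
  \<open>Const\<close>); for quantum commands, these cells contain the addresses of the qubits.

  Every command, every test and every oracle query takes one step. Since there is no
  multiplication, the bit length of the cell contents grows by at most one per step, so that
  the unit-cost measure is polynomially related to Turing machine time.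
\<close>

datatype command =
    Const nat nat           \<comment> \<open>cell, literal\<close>
  | Plus nat nat nat        \<comment> \<open>target, summands\<close>
  | Minus nat nat nat       \<comment> \<open>truncated subtraction\<close>
  | Half nat nat            \<comment> \<open>right shift\<close>
  | Load nat nat            \<comment> \<open>target, pointer\<close>
  | Store nat nat           \<comment> \<open>pointer, source\<close>
  | Emit nat                \<comment> \<open>append to the output\<close>
  | XGate nat
  | HGate nat
  | TGate nat
  | CNotGate nat nat        \<comment> \<open>control, target\<close>
  | Meas nat nat            \<comment> \<open>target cell, qubit\<close>
  | Query nat nat nat       \<comment> \<open>first qubits of the three registers of the oracle\<close>
  | QueryInv nat nat nat
  | Cond nat "command list" "command list"
  | Loop nat "command list" \<comment> \<open>repeat while the cell is nonzero\<close>

text \<open>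
  A basis state of the quantum memory is the finite set of the qubits having value one. A state
  assigns amplitudes to these; all states occurring in a run have finite support.
\<close>

type_synonym qstate = "nat set \<Rightarrow> complex"

definition read_qubits :: "nat list \<Rightarrow> nat set \<Rightarrow> nat" where
  "read_qubits qs S = (\<Sum>i<length qs. if qs ! i \<in> S then 2 ^ i else 0)"

definition write_qubits :: "nat list \<Rightarrow> nat \<Rightarrow> nat set \<Rightarrow> nat set" where
  "write_qubits qs j S = (S - set qs) \<union> {qs ! i | i. i < length qs \<and> bit j i}"

text \<open>Application of \<open>U\<close> to the qubits \<open>qs\<close>; an ill-formed application (repeated qubits) has no effect.\<close>

definition apply_op :: "complex mat \<Rightarrow> nat list \<Rightarrow> qstate \<Rightarrow> qstate" where
  "apply_op U qs \<psi> = (if distinct qs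
     then (\<lambda>S. \<Sum>j<2 ^ length qs. U $$ (read_qubits qs S, j) * \<psi> (write_qubits qs j S))
     else \<psi>)"

definition X_mat :: "complex mat" where
  "X_mat = mat_of_rows_list 2 [[0, 1], [1, 0]]"

definition H_mat :: "complex mat" where
  "H_mat = (1 / complex_of_real (sqrt 2)) \<cdot>\<^sub>m mat_of_rows_list 2 [[1, 1], [1, -1]]"

definition T_mat :: "complex mat" where
  "T_mat = mat_of_rows_list 2 [[1, 0], [0, cis (pi / 4)]]"

text \<open>The control is the least significant bit of the index.\<close>

definition CNOT_mat :: "complex mat" where
  "CNOT_mat = mat_of_rows_list 4 [[1, 0, 0, 0], [0, 0, 0, 1], [0, 0, 1, 0], [0, 1, 0, 0]]"

definition outcome_prob :: "nat \<Rightarrow> bool \<Rightarrow> qstate \<Rightarrow> real" where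
  "outcome_prob a b \<psi> = (\<Sum>S | \<psi> S \<noteq> 0 \<and> (a \<in> S \<longleftrightarrow> b). (cmod (\<psi> S))\<^sup>2)"

definition post_measurement :: "nat \<Rightarrow> bool \<Rightarrow> qstate \<Rightarrow> qstate" where
  "post_measurement a b \<psi> = (\<lambda>S.
     if a \<in> S \<longleftrightarrow> b then \<psi> S / complex_of_real (sqrt (outcome_prob a b \<psi>)) else 0)"

text \<open>The control component is the list of the commands that remain to be executed.\<close>

record config =
  ctrl :: "command list"
  cells :: "nat \<Rightarrow> nat"
  qubits :: qstate
  emitted :: "nat list"

definition oracle_qubits :: "nat \<Rightarrow> nat \<Rightarrow> nat \<Rightarrow> nat \<Rightarrow> nat \<Rightarrow> nat list" where
  "oracle_qubits m l a b c = [a..<a + m] @ [b..<b + m] @ [c..<c + l]"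

fun exec :: "nat \<Rightarrow> nat \<Rightarrow> complex mat \<Rightarrow> command \<Rightarrow> config \<Rightarrow> config pmf" where
  "exec m l U (Const a k) c = return_pmf (c\<lparr>cells := (cells c)(a := k)\<rparr>)"
| "exec m l U (Plus a b d) c = return_pmf (c\<lparr>cells := (cells c)(a := cells c b + cells c d)\<rparr>)"
| "exec m l U (Minus a b d) c = return_pmf (c\<lparr>cells := (cells c)(a := cells c b - cells c d)\<rparr>)"
| "exec m l U (Half a b) c = return_pmf (c\<lparr>cells := (cells c)(a := cells c b div 2)\<rparr>)"
| "exec m l U (Load a b) c = return_pmf (c\<lparr>cells := (cells c)(a := cells c (cells c b))\<rparr>)"
| "exec m l U (Store a b) c = return_pmf (c\<lparr>cells := (cells c)(cells c a := cells c b)\<rparr>)"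
| "exec m l U (Emit a) c = return_pmf (c\<lparr>emitted := emitted c @ [cells c a]\<rparr>)"
| "exec m l U (XGate a) c = return_pmf (c\<lparr>qubits := apply_op X_mat [cells c a] (qubits c)\<rparr>)"
| "exec m l U (HGate a) c = return_pmf (c\<lparr>qubits := apply_op H_mat [cells c a] (qubits c)\<rparr>)"
| "exec m l U (TGate a) c = return_pmf (c\<lparr>qubits := apply_op T_mat [cells c a] (qubits c)\<rparr>)"
| "exec m l U (CNotGate a b) c =
     return_pmf (c\<lparr>qubits := apply_op CNOT_mat [cells c a, cells c b] (qubits c)\<rparr>)"
| "exec m l U (Meas a b) c =
     map_pmf (\<lambda>v. c\<lparr>cells := (cells c)(a := of_bool v),
                    qubits := post_measurement (cells c b) v (qubits c)\<rparr>)
       (bernoulli_pmf (outcome_prob (cells c b) True (qubits c)))"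
| "exec m l U (Query a b d) c =
     return_pmf (c\<lparr>qubits := apply_op U
       (oracle_qubits m l (cells c a) (cells c b) (cells c d)) (qubits c)\<rparr>)"
| "exec m l U (QueryInv a b d) c =
     return_pmf (c\<lparr>qubits := apply_op (mat_adjoint U)
       (oracle_qubits m l (cells c a) (cells c b) (cells c d)) (qubits c)\<rparr>)"
| "exec m l U (Cond a P Q) c =
     return_pmf (c\<lparr>ctrl := (if cells c a \<noteq> 0 then P else Q) @ ctrl c\<rparr>)"
| "exec m l U (Loop a P) c =
     return_pmf (if cells c a \<noteq> 0 then c\<lparr>ctrl := P @ Loop a P # ctrl c\<rparr> else c)"

definition step :: "nat \<Rightarrow> nat \<Rightarrow> complex mat \<Rightarrow> config \<Rightarrow> config pmf" where
  "step m l U c = (case ctrl c of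
     [] \<Rightarrow> return_pmf c
   | i # K \<Rightarrow> exec m l U i (c\<lparr>ctrl := K\<rparr>))"

fun run :: "nat \<Rightarrow> nat \<Rightarrow> complex mat \<Rightarrow> nat \<Rightarrow> config \<Rightarrow> config pmf" where
  "run m l U 0 c = return_pmf c"
| "run m l U (Suc t) c = bind_pmf (step m l U c) (run m l U t)"

definition initial :: "command list \<Rightarrow> nat list \<Rightarrow> config" where
  "initial P inp = \<lparr>ctrl = P,
     cells = (\<lambda>i. if i < length inp then inp ! i else 0),
     qubits = (\<lambda>S. if S = {} then 1 else 0),
     emitted = []\<rparr>"


section \<open>Quantum list decoders\<close>

text \<open>
  The numerical inputs are \<open>n\<close> and \<open>1/\<epsilon>\<close>, the parameters \<open>q\<close>, \<open>1/\<delta>\<close> and \<open>1/(1 - \<delta>)\<close> of the code and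
  of the decoding task, and the sizes of the oracle's registers; real parameters are rounded up.
\<close>

definition decoder_input :: "nat \<Rightarrow> nat \<Rightarrow> real \<Rightarrow> real \<Rightarrow> nat \<Rightarrow> nat list" where
  "decoder_input n q \<epsilon> \<delta> l =
     [n, nat \<lceil>1 / \<epsilon>\<rceil>, q, nat \<lceil>1 / \<delta>\<rceil>, nat \<lceil>1 / (1 - \<delta>)\<rceil>, code_bits q, l]"

text \<open>
  \<open>P\<close> is a quantum list decoder for the code \<open>C\<close> with message length \<open>n\<close> over \<open>q\<close> symbols, with bias \<open>\<epsilon>\<close> and
  confidence \<open>\<delta>\<close>, that always halts within time \<open>B\<close>. A list of messages is output symbol by symbol.
\<close>

definition quantum_list_decoder ::
  "(nat list \<Rightarrow> nat \<Rightarrow> nat) \<Rightarrow> nat \<Rightarrow> nat \<Rightarrow> real \<Rightarrow> real \<Rightarrow> real \<Rightarrow> command list \<Rightarrow> bool" where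
  "quantum_list_decoder C q n \<epsilon> \<delta> B P \<longleftrightarrow>
     (\<forall>l U \<alpha> \<phi>. corrupted_codeword q l U \<alpha> \<phi> \<longrightarrow>
       (\<exists>t. real t \<le> B \<and>
         (let R = run (code_bits q) l U t (initial P (decoder_input n q \<epsilon> \<delta> l)) in
           (\<forall>c\<in>set_pmf R. ctrl c = []) \<and>
           measure_pmf.prob R {c. \<exists>xs. emitted c = concat xs \<and> set xs \<subseteq> messages q n \<and>
             {x \<in> messages q n. presence q \<alpha> (C x) \<ge> 1 / real q + \<epsilon>} \<subseteq> set xs} \<ge> \<delta>)))"

definition polynomial4 :: "(real \<Rightarrow> real \<Rightarrow> real \<Rightarrow> real \<Rightarrow> real) \<Rightarrow> bool" where
  "polynomial4 p \<longleftrightarrow> (\<exists>(d::nat) a. \<forall>w x y z. p w x y z =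
     (\<Sum>i\<le>d. \<Sum>j\<le>d. \<Sum>k\<le>d. \<Sum>h\<le>d. a i j k h * w ^ i * x ^ j * y ^ k * z ^ h))"

end

theory Submission
  imports Defs "HOL-Number_Theory.Cong"
begin

text \<open>
  Measuring the answer to a query \<open>r\<close> yields the symbol of the codeword \<open>C\<^sub>x\<close> with probability
  \<open>\<bar>\<alpha> r (C\<^sub>x r)\<bar>\<^sup>2\<close>. A word of \<open>q\<close> such symbols therefore agrees with the codeword of a message of large presence
  in at least \<open>1 + q \<epsilon>\<close> positions on average. The hypothesis on \<open>\<epsilon>\<close> makes this larger than
  \<open>sqrt (2 (n - 1) q) + 1\<close>, while Sudan's list decoding needs an agreement larger than
  \<open>sqrt (2 (n - 1) q)\<close>. By Markov's inequality, a single word has the required agreement with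
  probability at least \<open>1 / q\<close>, and polynomially many words suffice to find all messages with
  probability \<open>\<delta>\<close>. Queries are made only in order to sample; amplitude amplification is not needed.

  Sudan's algorithm interpolates the word by a bivariate polynomial \<open>Q\<close> of small weighted degree,
  such that every message polynomial \<open>p\<close> with large agreement satisfies \<open>Q (x, p (x)) = 0\<close>. Factorization of
  \<open>Q\<close> is avoided as follows. As the degree of \<open>Q\<close> in \<open>y\<close> is less than the characteristic \<open>q\<close>, \<open>p\<close> is a
  simple root of some iterated \<open>y\<close>-derivative of \<open>Q\<close>, and it stays simple at some point \<open>x\<^sub>0\<close>. From the
  value at \<open>x\<^sub>0\<close>, the power series \<open>p (x\<^sub>0 + x)\<close> is determined coefficient by coefficient. Since time
  polynomial in \<open>q\<close> is available, all derivatives, all starting points and all values of the next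
  coefficient are tried; superfluous messages in the output list are harmless.
\<close>

text \<open>One program has to serve all parameters and all oracles, and its time bound may not
  depend on the number \<open>l\<close> of ancilla qubits. The program does not compute the
  threshold either: it tries every bound below \<open>q\<close> on the weighted degree and every
  vector of the solution space, and correctness means that one choice succeeds. The number
  \<open>q ^ 8 * D\<close> of rounds comes from a union bound: at most \<open>q ^ 7\<close> messages
  are to be found, and each is missed by all rounds with probability at most
  \<open>q / (q ^ 8 * D)\<close>. The logarithm in \<Delta> is at least \<open>9 / 4\<close>; the
  factor \<open>3 / 2\<close> that this yields under the square root pays for rounding the threshold
  to an integer. The same estimate gives \<open>n < q\<close> and \<open>5 \<le> q\<close>.\<close>

hide_const (open) module.smult

section \<open>A structured language and its compilation\<close>

text \<open>
  Memory consists of the arrays \<open>0, \<dots>, 62\<close>; element \<open>i\<close> of array \<open>k\<close> is kept in cell \<open>64 * i + k\<close>, and the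
  array with number 63 is reserved for the temporaries of compiled code. A scalar variable is
  element 0 of an array, so the inputs of the decoder are the variables \<open>0, \<dots>, 6\<close>. In particular,
  variable 2 contains \<open>q\<close>.

  The operations \<open>Mul\<close> and \<open>Red\<close> (reduction modulo \<open>q\<close>) are compiled to loops. These are cut off
  after \<open>q\<close> iterations, and \<open>For v p P\<close> runs \<open>v\<close> up to the value of a variable \<open>p\<close> that \<open>P\<close> may not
  modify. Hence the running time is bounded by a function of the program text and of a bound \<open>W\<close>
  on the read-only variables.
\<close>

datatype exp =
    Lit nat
  | Arr nat exp
  | Add exp exp
  | Sub exp exp
  | Mul exp exp
  | Red exp
  | Hlf exp

datatype stmt =
    Assign nat exp exp
  | Out exp
  | Flip exp
  | Ask exp exp exp
  | Measure nat exp
  | Seq stmt stmt (infixr ";;" 60)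
  | Ite exp stmt stmt
  | For nat nat stmt

record st =
  mem :: "nat \<Rightarrow> nat \<Rightarrow> nat"
  qst :: qstate
  outp :: "nat list"

text \<open>\<open>Mul\<close> and \<open>Red\<close> get exactly the values that their cut-off
  loops compute, so compilation is correct without side conditions. They are the true product and
  residue if the second factor is at most \<open>q\<close> and the reduced number is below
  \<open>q * q + q\<close>.\<close>

fun val :: "(nat \<Rightarrow> nat \<Rightarrow> nat) \<Rightarrow> exp \<Rightarrow> nat" where
  "val M (Lit n) = n"
| "val M (Arr k e) = M k (val M e)"
| "val M (Add a b) = val M a + val M b"
| "val M (Sub a b) = val M a - val M b"
| "val M (Mul a b) = val M a * min (val M b) (M 2 0)"
| "val M (Red a) = val M a - M 2 0 * min (M 2 0) (val M a div M 2 0)"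
| "val M (Hlf a) = val M a div 2"

primrec mfold :: "(nat \<Rightarrow> 'a \<Rightarrow> 'a pmf) \<Rightarrow> nat list \<Rightarrow> 'a \<Rightarrow> 'a pmf" where
  "mfold f [] s = return_pmf s"
| "mfold f (i # is) s = bind_pmf (f i s) (mfold f is)"

definition setm :: "nat \<Rightarrow> nat \<Rightarrow> nat \<Rightarrow> st \<Rightarrow> st" where
  "setm k i v s = s\<lparr>mem := (mem s)(k := (mem s k)(i := v))\<rparr>"

primrec sem :: "nat \<Rightarrow> nat \<Rightarrow> complex mat \<Rightarrow> stmt \<Rightarrow> st \<Rightarrow> st pmf" where
  "sem m l U (Assign k i e) = (\<lambda>s. return_pmf (setm k (val (mem s) i) (val (mem s) e) s))"
| "sem m l U (Out e) = (\<lambda>s. return_pmf (s\<lparr>outp := outp s @ [val (mem s) e]\<rparr>))"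
| "sem m l U (Flip e) = (\<lambda>s. return_pmf (s\<lparr>qst := apply_op X_mat [val (mem s) e] (qst s)\<rparr>))"
| "sem m l U (Ask a b d) = (\<lambda>s. return_pmf (s\<lparr>qst := apply_op U
     (oracle_qubits m l (val (mem s) a) (val (mem s) b) (val (mem s) d)) (qst s)\<rparr>))"
| "sem m l U (Measure k e) = (\<lambda>s.
     map_pmf (\<lambda>v. setm k 0 (of_bool v) (s\<lparr>qst := post_measurement (val (mem s) e) v (qst s)\<rparr>))
       (bernoulli_pmf (outcome_prob (val (mem s) e) True (qst s))))"
| "sem m l U (P ;; Q) = (\<lambda>s. bind_pmf (sem m l U P s) (sem m l U Q))"
| "sem m l U (Ite e P Q) = (\<lambda>s. if val (mem s) e \<noteq> 0 then sem m l U P s else sem m l U Q s)"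
| "sem m l U (For k p P) = (\<lambda>s. mfold (\<lambda>i t. sem m l U P (setm k 0 i t)) [0..<mem s p 0] s)"

fun names :: "exp \<Rightarrow> nat set" where
  "names (Lit n) = {}"
| "names (Arr k e) = insert k (names e)"
| "names (Add a b) = names a \<union> names b"
| "names (Sub a b) = names a \<union> names b"
| "names (Mul a b) = names a \<union> names b"
| "names (Red a) = names a"
| "names (Hlf a) = names a"

fun mods :: "stmt \<Rightarrow> nat set" where
  "mods (Assign k i e) = {k}"
| "mods (Measure k e) = {k}"
| "mods (P ;; Q) = mods P \<union> mods Q"
| "mods (Ite e P Q) = mods P \<union> mods Q"
| "mods (For k p P) = insert k (mods P)"
| "mods _ = {}"

fun wfs :: "nat set \<Rightarrow> stmt \<Rightarrow> bool" where
  "wfs L (Assign k i e) \<longleftrightarrow> k < 63 \<and> names i \<subseteq> {..<63} \<and> names e \<subseteq> {..<63}"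
| "wfs L (Out e) \<longleftrightarrow> names e \<subseteq> {..<63}"
| "wfs L (Flip e) \<longleftrightarrow> names e \<subseteq> {..<63}"
| "wfs L (Ask a b d) \<longleftrightarrow> names a \<subseteq> {..<63} \<and> names b \<subseteq> {..<63} \<and> names d \<subseteq> {..<63}"
| "wfs L (Measure k e) \<longleftrightarrow> k < 63 \<and> names e \<subseteq> {..<63}"
| "wfs L (P ;; Q) \<longleftrightarrow> wfs L P \<and> wfs L Q"
| "wfs L (Ite e P Q) \<longleftrightarrow> names e \<subseteq> {..<63} \<and> wfs L P \<and> wfs L Q"
| "wfs L (For k p P) \<longleftrightarrow> k < 63 \<and> p < 63 \<and> p \<in> L \<and> wfs L P"

text \<open>The temporaries form a stack: code compiled at depth \<open>d\<close> writes only those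
  with index at least \<open>d\<close>.\<close>

definition tm :: "nat \<Rightarrow> nat" where
  "tm d = 64 * d + 63"

lemma tm_eq_iff [simp]: "tm i = tm j \<longleftrightarrow> i = j"
  by (simp add: tm_def)

lemma tm_neq: "64 * i + k \<noteq> tm j" if "k < 63" for i j k :: nat
proof
  assume "64 * i + k = tm j"
  then have "(64 * i + k) mod 64 = (64 * j + 63) mod 64" by (simp only: tm_def)
  then show False using that by simp
qed

lemma two_neq_tm [simp]: "tm d \<noteq> 2" "2 \<noteq> tm d"
  using tm_neq[of 2 0 d] by simp_all

text \<open>The counter \<open>tm (d+4)\<close> starts at \<open>q\<close> whatever the factor is;
  once the factor in \<open>tm (d+1)\<close> is used up, the remaining iterations only count.
  \<open>tm (d+3)\<close> holds the constant 1.\<close>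

definition mul_loop :: "nat \<Rightarrow> command" where
  "mul_loop d = Loop (tm (d+4))
     [Cond (tm (d+1)) [Plus (tm (d+2)) (tm (d+2)) (tm d), Minus (tm (d+1)) (tm (d+1)) (tm (d+3))] [],
      Minus (tm (d+4)) (tm (d+4)) (tm (d+3))]"

text \<open>\<open>tm (d+2)\<close> holds \<open>q - 1\<close>, so for positive \<open>q\<close> the
  truncated difference is nonzero exactly if the current value is at least \<open>q\<close>.\<close>

definition red_loop :: "nat \<Rightarrow> command" where
  "red_loop d = Loop (tm (d+3))
     [Minus (tm (d+4)) (tm d) (tm (d+2)), Cond (tm (d+4)) [Minus (tm d) (tm d) 2] [],
      Minus (tm (d+3)) (tm (d+3)) (tm (d+1))]"

text \<open>Six doublings produce the factor 64 of the memory layout.\<close>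

definition addr :: "nat \<Rightarrow> nat \<Rightarrow> command list" where
  "addr d k =
     [Plus (tm d) (tm d) (tm d), Plus (tm d) (tm d) (tm d), Plus (tm d) (tm d) (tm d),
      Plus (tm d) (tm d) (tm d), Plus (tm d) (tm d) (tm d), Plus (tm d) (tm d) (tm d),
      Const (tm (d+1)) k, Plus (tm d) (tm d) (tm (d+1))]"

fun compile_exp :: "nat \<Rightarrow> exp \<Rightarrow> command list" where
  "compile_exp d (Lit n) = [Const (tm d) n]"
| "compile_exp d (Arr k e) = compile_exp d e @ addr d k @ [Load (tm d) (tm d)]"
| "compile_exp d (Add a b) = compile_exp d a @ compile_exp (d+1) b @ [Plus (tm d) (tm d) (tm (d+1))]"
| "compile_exp d (Sub a b) = compile_exp d a @ compile_exp (d+1) b @ [Minus (tm d) (tm d) (tm (d+1))]"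
| "compile_exp d (Mul a b) = compile_exp d a @ compile_exp (d+1) b @
     [Const (tm (d+2)) 0, Const (tm (d+3)) 1, Plus (tm (d+4)) 2 (tm (d+2)),
      mul_loop d, Plus (tm d) (tm (d+2)) (tm (d+4))]"
| "compile_exp d (Red a) = compile_exp d a @
     [Const (tm (d+1)) 1, Minus (tm (d+2)) 2 (tm (d+1)), Const (tm (d+4)) 0, Plus (tm (d+3)) 2 (tm (d+4)),
      red_loop d]"
| "compile_exp d (Hlf a) = compile_exp d a @ [Half (tm d) (tm d)]"

text \<open>In a \<open>For\<close>, the temporary \<open>tm d\<close> counts down and the loop
  variable is recomputed from it as \<open>p - tm d\<close>. The body is compiled at depth
  \<open>d + 1\<close>, so neither nested code nor an assignment to the loop variable can disturb
  the counter.\<close>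

fun compile :: "nat \<Rightarrow> stmt \<Rightarrow> command list" where
  "compile d (Assign k i e) = compile_exp d i @ addr d k @ compile_exp (d+1) e @ [Store (tm d) (tm (d+1))]"
| "compile d (Out e) = compile_exp d e @ [Emit (tm d)]"
| "compile d (Flip e) = compile_exp d e @ [XGate (tm d)]"
| "compile d (Ask a b c) = compile_exp d a @ compile_exp (d+1) b @ compile_exp (d+2) c @ [Query (tm d) (tm (d+1)) (tm (d+2))]"
| "compile d (Measure k e) = compile_exp d e @ [Meas k (tm d)]"
| "compile d (P ;; Q) = compile d P @ compile d Q"
| "compile d (Ite e P Q) = compile_exp d e @ [Cond (tm d) (compile d P) (compile d Q)]"
| "compile d (For k p P) = [Const (tm d) 0, Plus (tm d) p (tm d),
     Loop (tm d) (Minus k p (tm d) # compile (d+1) P @ [Const (tm (d+1)) 1, Minus (tm d) (tm d) (tm (d+1))])]"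

fun costE :: "nat \<Rightarrow> exp \<Rightarrow> nat" where
  "costE W (Lit n) = 1"
| "costE W (Arr k e) = costE W e + 9"
| "costE W (Add a b) = costE W a + costE W b + 1"
| "costE W (Sub a b) = costE W a + costE W b + 1"
| "costE W (Mul a b) = costE W a + costE W b + 5 * W + 5"
| "costE W (Red a) = costE W a + 5 * W + 5"
| "costE W (Hlf a) = costE W a + 1"

text \<open>A loop iteration adds four commands to its body (test, loop variable, constant 1,
  counter); two commands for the initialisation and the last test give the 3.\<close>

fun cost :: "nat \<Rightarrow> stmt \<Rightarrow> nat" where
  "cost W (Assign k i e) = costE W i + costE W e + 9"
| "cost W (Out e) = costE W e + 1"
| "cost W (Flip e) = costE W e + 1"
| "cost W (Ask a b c) = costE W a + costE W b + costE W c + 1"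
| "cost W (Measure k e) = costE W e + 1"
| "cost W (P ;; Q) = cost W P + cost W Q"
| "cost W (Ite e P Q) = costE W e + 1 + cost W P + cost W Q"
| "cost W (For k p P) = W * (cost W P + 4) + 3"

section \<open>Polynomial growth of the cost of a fixed program\<close>

lemma poly_bound_add:
  fixes f g :: "nat \<Rightarrow> nat"
  assumes "\<exists>C k. \<forall>W\<ge>1. f W \<le> C * W ^ k" "\<exists>C k. \<forall>W\<ge>1. g W \<le> C * W ^ k"
  shows "\<exists>C k. \<forall>W\<ge>1. f W + g W \<le> C * W ^ k"
proof -
  obtain C k D j where 1: "\<forall>W\<ge>1. f W \<le> C * W ^ k" "\<forall>W\<ge>1. g W \<le> D * W ^ j"
    using assms by blast
  have "f W + g W \<le> (C + D) * W ^ (k + j)" if "W \<ge> 1" for W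
  proof -
    have "W ^ k \<le> W ^ (k + j)" "W ^ j \<le> W ^ (k + j)" using that by (auto intro: power_increasing)
    then have "f W \<le> C * W ^ (k + j)" "g W \<le> D * W ^ (k + j)"
      using 1 that by (meson le_trans mult_le_mono2)+
    then show ?thesis by (simp add: algebra_simps)
  qed
  then show ?thesis by blast
qed

lemma poly_bound_const: "\<exists>C k. \<forall>W\<ge>1. (c::nat) \<le> C * W ^ k"
  by (rule exI[of _ c], rule exI[of _ 0]) simp

lemma poly_bound_mult:
  fixes f :: "nat \<Rightarrow> nat"
  assumes "\<exists>C k. \<forall>W\<ge>1. f W \<le> C * W ^ k"
  shows "\<exists>C k. \<forall>W\<ge>1. W * f W \<le> C * W ^ k"
proof -
  obtain C k where "\<forall>W\<ge>1. f W \<le> C * W ^ k" using assms by blast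
  then have "W * f W \<le> C * W ^ Suc k" if "W \<ge> 1" for W
    using mult_le_mono2[of "f W" "C * W ^ k" W] that by (simp add: mult_ac)
  then show ?thesis by blast
qed

lemmas poly_bounds = poly_bound_add poly_bound_const poly_bound_mult

lemma poly_bound_id: "\<exists>C k. \<forall>W\<ge>(1::nat). c * W \<le> C * W ^ (k::nat)"
  by (rule exI[of _ c], rule exI[of _ 1]) simp

lemma costE_poly: "\<exists>C k. \<forall>W\<ge>1. costE W e \<le> C * W ^ k"
  by (induction e) (unfold costE.simps, (intro poly_bounds poly_bound_id; assumption)+)

lemma cost_poly: "\<exists>C k. \<forall>W\<ge>1. cost W P \<le> C * W ^ k"
proof (induction P)
  case (Ite e P Q)
  then show ?case unfolding cost.simps by (intro poly_bounds costE_poly)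
next
  case (For k p P)
  then show ?case unfolding cost.simps by (intro poly_bounds)
qed (unfold cost.simps, (intro poly_bounds costE_poly, assumption?)+)

section \<open>Execution of compiled code\<close>

context
  fixes m l :: nat and U :: "complex mat"
begin

text \<open>Each random branch may stop on its own after at most \<open>T\<close> steps. An exact
  step count would not compose, as the alternatives of a \<open>Cond\<close> take different
  times.\<close>

inductive ev :: "nat \<Rightarrow> config \<Rightarrow> config pmf \<Rightarrow> bool" where
  ev_0: "ev T c (return_pmf c)"
| ev_Suc: "(\<And>c'. c' \<in> set_pmf (step m l U c) \<Longrightarrow> ev T c' (f c')) \<Longrightarrow> ev (Suc T) c (bind_pmf (step m l U c) f)"

lemma ev_mono: "ev T c R \<Longrightarrow> T \<le> T' \<Longrightarrow> ev T' c R"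
proof (induction arbitrary: T' rule: ev.induct)
  case (ev_Suc c T f)
  then obtain T'' where "T' = Suc T''" "T \<le> T''" by (cases T') auto
  with ev_Suc show ?case by (auto intro!: ev.ev_Suc)
qed (rule ev_0)

lemma ev_bind:
  "ev T1 c R \<Longrightarrow> (\<And>c'. c' \<in> set_pmf R \<Longrightarrow> ev T2 c' (f c')) \<Longrightarrow> ev (T1 + T2) c (bind_pmf R f)"
proof (induction rule: ev.induct)
  case (ev_0 T c)
  then show ?case by (auto simp: bind_return_pmf intro: ev_mono)
next
  case (ev_Suc c T g)
  have "ev (Suc (T + T2)) c (bind_pmf (step m l U c) (\<lambda>c'. bind_pmf (g c') f))"
    using ev_Suc by (intro ev.ev_Suc) auto
  then show ?case by (simp add: bind_assoc_pmf)
qed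

lemma run_halted: "ctrl c = [] \<Longrightarrow> run m l U t c = return_pmf c"
  by (induction t) (simp_all add: step_def bind_return_pmf)

text \<open>Halted configurations are fixed by \<open>step\<close>, so branches that stopped early
  just wait until time \<open>T\<close>.\<close>

lemma ev_run: "ev T c R \<Longrightarrow> (\<And>c'. c' \<in> set_pmf R \<Longrightarrow> ctrl c' = []) \<Longrightarrow> run m l U T c = R"
proof (induction rule: ev.induct)
  case (ev_0 T c)
  then show ?case by (simp add: run_halted)
next
  case (ev_Suc c T f)
  then show ?case by (auto intro!: bind_pmf_cong)
qed

lemma ev_det: "step m l U c = return_pmf c' \<Longrightarrow> ev T c' R \<Longrightarrow> ev (Suc T) c R"
  using ev_Suc[of c T "\<lambda>_. R"] by (simp add: bind_return_pmf)

abbreviation cfg :: "command list \<Rightarrow> (nat \<Rightarrow> nat) \<Rightarrow> qstate \<Rightarrow> nat list \<Rightarrow> config" where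
  "cfg K \<sigma> \<psi> out \<equiv> \<lparr>ctrl = K, cells = \<sigma>, qubits = \<psi>, emitted = out\<rparr>"

lemma ev_intros:
  "ev T (cfg K (\<sigma>(a := k)) \<psi> out) R \<Longrightarrow> ev (Suc T) (cfg (Const a k # K) \<sigma> \<psi> out) R"
  "ev T (cfg K (\<sigma>(a := \<sigma> b + \<sigma> d)) \<psi> out) R \<Longrightarrow> ev (Suc T) (cfg (Plus a b d # K) \<sigma> \<psi> out) R"
  "ev T (cfg K (\<sigma>(a := \<sigma> b - \<sigma> d)) \<psi> out) R \<Longrightarrow> ev (Suc T) (cfg (Minus a b d # K) \<sigma> \<psi> out) R"
  "ev T (cfg K (\<sigma>(a := \<sigma> b div 2)) \<psi> out) R \<Longrightarrow> ev (Suc T) (cfg (Half a b # K) \<sigma> \<psi> out) R"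
  "ev T (cfg K (\<sigma>(a := \<sigma> (\<sigma> b))) \<psi> out) R \<Longrightarrow> ev (Suc T) (cfg (Load a b # K) \<sigma> \<psi> out) R"
  "ev T (cfg K (\<sigma>(\<sigma> a := \<sigma> b)) \<psi> out) R \<Longrightarrow> ev (Suc T) (cfg (Store a b # K) \<sigma> \<psi> out) R"
  "ev T (cfg K \<sigma> \<psi> (out @ [\<sigma> a])) R \<Longrightarrow> ev (Suc T) (cfg (Emit a # K) \<sigma> \<psi> out) R"
  "ev T (cfg K \<sigma> (apply_op X_mat [\<sigma> a] \<psi>) out) R \<Longrightarrow> ev (Suc T) (cfg (XGate a # K) \<sigma> \<psi> out) R"
  "ev T (cfg K \<sigma> (apply_op U (oracle_qubits m l (\<sigma> a) (\<sigma> b) (\<sigma> d)) \<psi>) out) R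
    \<Longrightarrow> ev (Suc T) (cfg (Query a b d # K) \<sigma> \<psi> out) R"
  "ev T (cfg ((if \<sigma> a \<noteq> 0 then P else Q) @ K) \<sigma> \<psi> out) R \<Longrightarrow> ev (Suc T) (cfg (Cond a P Q # K) \<sigma> \<psi> out) R"
  "\<sigma> a \<noteq> 0 \<Longrightarrow> ev T (cfg (P @ Loop a P # K) \<sigma> \<psi> out) R \<Longrightarrow> ev (Suc T) (cfg (Loop a P # K) \<sigma> \<psi> out) R"
  "\<sigma> a = 0 \<Longrightarrow> ev T (cfg K \<sigma> \<psi> out) R \<Longrightarrow> ev (Suc T) (cfg (Loop a P # K) \<sigma> \<psi> out) R"
  by (rule ev_det; simp add: step_def)+

definition absm :: "(nat \<Rightarrow> nat) \<Rightarrow> nat \<Rightarrow> nat \<Rightarrow> nat" where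
  "absm \<sigma> k i = (if k < 63 then \<sigma> (64 * i + k) else 0)"

definition agree :: "nat \<Rightarrow> (nat \<Rightarrow> nat) \<Rightarrow> (nat \<Rightarrow> nat) \<Rightarrow> bool" where
  "agree d \<sigma> \<sigma>' \<longleftrightarrow> (\<forall>x. (\<forall>j\<ge>d. x \<noteq> tm j) \<longrightarrow> \<sigma>' x = \<sigma> x)"

text \<open>Continuation style for deterministic classical code: whatever can be reached from
  \<open>\<sigma>'\<close> with remaining code \<open>K\<close> can be reached from
  \<open>\<sigma>\<close> with \<open>P\<close> in front, at the price of \<open>t\<close>
  steps.\<close>

definition goes :: "nat \<Rightarrow> command list \<Rightarrow> (nat \<Rightarrow> nat) \<Rightarrow> (nat \<Rightarrow> nat) \<Rightarrow> bool" where
  "goes t P \<sigma> \<sigma>' \<longleftrightarrow> (\<forall>T K \<psi> out R. ev T (cfg K \<sigma>' \<psi> out) R \<longrightarrow> ev (t + T) (cfg (P @ K) \<sigma> \<psi> out) R)"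

lemma goes_append: "goes t P \<sigma> \<sigma>' \<Longrightarrow> goes t' Q \<sigma>' \<sigma>'' \<Longrightarrow> goes (t + t') (P @ Q) \<sigma> \<sigma>''"
  by (auto simp: goes_def add.assoc)

lemma goes_Nil: "goes 0 [] \<sigma> \<sigma>"
  by (simp add: goes_def)

lemma goes_mono: "goes t P \<sigma> \<sigma>' \<Longrightarrow> t \<le> t' \<Longrightarrow> goes t' P \<sigma> \<sigma>'"
  unfolding goes_def by (meson add_le_mono1 ev_mono)

lemma goes_Cons:
  "goes t K (\<sigma>(a := k)) \<sigma>' \<Longrightarrow> goes (Suc t) (Const a k # K) \<sigma> \<sigma>'"
  "goes t K (\<sigma>(a := \<sigma> b + \<sigma> d)) \<sigma>' \<Longrightarrow> goes (Suc t) (Plus a b d # K) \<sigma> \<sigma>'"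
  "goes t K (\<sigma>(a := \<sigma> b - \<sigma> d)) \<sigma>' \<Longrightarrow> goes (Suc t) (Minus a b d # K) \<sigma> \<sigma>'"
  "goes t K (\<sigma>(a := \<sigma> b div 2)) \<sigma>' \<Longrightarrow> goes (Suc t) (Half a b # K) \<sigma> \<sigma>'"
  "goes t K (\<sigma>(a := \<sigma> (\<sigma> b))) \<sigma>' \<Longrightarrow> goes (Suc t) (Load a b # K) \<sigma> \<sigma>'"
  "goes t K (\<sigma>(\<sigma> a := \<sigma> b)) \<sigma>' \<Longrightarrow> goes (Suc t) (Store a b # K) \<sigma> \<sigma>'"
  "goes t ((if \<sigma> a \<noteq> 0 then P else Q) @ K) \<sigma> \<sigma>' \<Longrightarrow> goes (Suc t) (Cond a P Q # K) \<sigma> \<sigma>'"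
  "\<sigma> a \<noteq> 0 \<Longrightarrow> goes t (P @ Loop a P # K) \<sigma> \<sigma>' \<Longrightarrow> goes (Suc t) (Loop a P # K) \<sigma> \<sigma>'"
  "\<sigma> a = 0 \<Longrightarrow> goes t K \<sigma> \<sigma>' \<Longrightarrow> goes (Suc t) (Loop a P # K) \<sigma> \<sigma>'"
  unfolding goes_def by (auto intro: ev_intros)

lemma agree_absm: "agree d \<sigma> \<sigma>' \<Longrightarrow> absm \<sigma>' = absm \<sigma>"
  by (auto simp: agree_def absm_def fun_eq_iff tm_neq)

lemma agree_trans: "agree d \<sigma> \<sigma>' \<Longrightarrow> agree d' \<sigma>' \<sigma>'' \<Longrightarrow> d \<le> d' \<Longrightarrow> agree d \<sigma> \<sigma>''"
  by (auto simp: agree_def)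

lemma agree_upd: "agree d \<sigma> \<sigma>' \<Longrightarrow> d \<le> j \<Longrightarrow> agree d \<sigma> (\<sigma>'(tm j := v))"
  by (auto simp: agree_def)

lemma agree_refl: "agree d \<sigma> \<sigma>"
  by (auto simp: agree_def)

lemma agree_tm: "agree d \<sigma> \<sigma>' \<Longrightarrow> j < d \<Longrightarrow> \<sigma>' (tm j) = \<sigma> (tm j)"
  by (auto simp: agree_def)

lemma agree_2: "agree d \<sigma> \<sigma>' \<Longrightarrow> \<sigma>' 2 = \<sigma> 2"
  by (auto simp: agree_def)

lemma goes_addr: "\<exists>\<sigma>'. goes 8 (addr d k) \<sigma> \<sigma>' \<and> \<sigma>' (tm d) = 64 * \<sigma> (tm d) + k \<and> agree d \<sigma> \<sigma>'"
  unfolding addr_def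
  apply (intro exI conjI)
    apply (rule goes_mono)
     apply (rule goes_Cons goes_Nil)+
    apply (auto intro!: agree_upd agree_refl)
  done

text \<open>Five steps per iteration: loop test, conditional, two commands in its branch, and the
  counter; the final test is the additional one.\<close>

lemma goes_mul:
  assumes "\<sigma> (tm (d + 4)) = j" "\<sigma> (tm (d + 3)) = 1"
  shows "\<exists>\<sigma>'. goes (5 * j + 1) [mul_loop d] \<sigma> \<sigma>' \<and>
      \<sigma>' (tm (d+2)) = \<sigma> (tm (d+2)) + \<sigma> (tm d) * min (\<sigma> (tm (d+1))) j \<and> \<sigma>' (tm (d+4)) = 0 \<and>
      agree (d+1) \<sigma> \<sigma>'"
  using assms
proof (induction j arbitrary: \<sigma>)
  case 0
  then show ?case
    by (auto intro!: exI[of _ \<sigma>] goes_Cons goes_Nil agree_refl simp: mul_loop_def)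
next
  case (Suc j)
  define \<tau> where "\<tau> = (if \<sigma> (tm (d + 1)) = 0 then \<sigma>(tm (d + 4) := j) else
    \<sigma>(tm (d + 2) := \<sigma> (tm (d + 2)) + \<sigma> (tm d), tm (d + 1) := \<sigma> (tm (d + 1)) - 1, tm (d + 4) := j))"
  have "\<tau> (tm (d + 4)) = j" "\<tau> (tm (d + 3)) = 1"
    using Suc.prems by (auto simp: \<tau>_def)
  from Suc.IH[OF this] obtain \<sigma>' where 1: "goes (5 * j + 1) [mul_loop d] \<tau> \<sigma>'"
    and 2: "\<sigma>' (tm (d+2)) = \<tau> (tm (d+2)) + \<tau> (tm d) * min (\<tau> (tm (d+1))) j" "\<sigma>' (tm (d+4)) = 0"
        "agree (d+1) \<tau> \<sigma>'"
    by blast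
  have "goes (5 * Suc j + 1) [mul_loop d] \<sigma> \<sigma>'"
  proof (cases "\<sigma> (tm (d + 1)) = 0")
    case True
    show ?thesis
      apply (rule goes_mono[of "Suc (Suc (Suc (5 * j + 1)))"])
       apply (subst mul_loop_def, rule goes_Cons(8), simp add: Suc.prems, fold mul_loop_def)
       apply (simp only: append.simps, rule goes_Cons(7), simp add: True[simplified])
       apply (rule goes_Cons(3))
       apply (use 1 Suc.prems True in \<open>simp add: \<tau>_def\<close>)
      apply simp
      done
  next
    case False
    show ?thesis
      apply (rule goes_mono[of "Suc (Suc (Suc (Suc (Suc (5 * j + 1)))))"])
       apply (subst mul_loop_def, rule goes_Cons(8), simp add: Suc.prems, fold mul_loop_def)
       apply (simp only: append.simps, rule goes_Cons(7), simp add: False[simplified])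
       apply (rule goes_Cons(2), rule goes_Cons(3), rule goes_Cons(3))
       apply (use 1 Suc.prems False in \<open>simp add: \<tau>_def\<close>)
      apply simp
      done
  qed
  moreover have "agree (d+1) \<sigma> \<tau>"
    by (auto simp: \<tau>_def intro!: agree_upd agree_refl)
  then have "agree (d+1) \<sigma> \<sigma>'"
    using 2 agree_trans by blast
  moreover have "\<tau> (tm (d+2)) + \<tau> (tm d) * min (\<tau> (tm (d+1))) j =
      \<sigma> (tm (d+2)) + \<sigma> (tm d) * min (\<sigma> (tm (d+1))) (Suc j)"
  proof (cases "\<sigma> (tm (d+1))")
    case (Suc x)
    then show ?thesis by (simp add: \<tau>_def)
  qed (simp add: \<tau>_def)
  ultimately show ?case using 2 by metis
qed

lemma goes_red:
  assumes "\<sigma> (tm (d + 3)) = j" "\<sigma> (tm (d + 1)) = 1" "\<sigma> (tm (d + 2)) = \<sigma> 2 - 1"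
  shows "\<exists>\<sigma>'. goes (5 * j + 1) [red_loop d] \<sigma> \<sigma>' \<and>
      \<sigma>' (tm d) = \<sigma> (tm d) - \<sigma> 2 * min j (\<sigma> (tm d) div \<sigma> 2) \<and> agree d \<sigma> \<sigma>'"
  using assms
proof (induction j arbitrary: \<sigma>)
  case 0
  then show ?case
    by (auto intro!: exI[of _ \<sigma>] goes_Cons goes_Nil agree_refl simp: red_loop_def)
next
  case (Suc j)
  define q where "q = \<sigma> 2"
  define e where "e = \<sigma> (tm d)"
  define \<tau> where "\<tau> = (if e - (q - 1) \<noteq> 0 then \<sigma>(tm (d + 4) := e - (q - 1), tm d := e - q, tm (d + 3) := j)
    else \<sigma>(tm (d + 4) := e - (q - 1), tm (d + 3) := j))"
  have "\<tau> (tm (d + 3)) = j" "\<tau> (tm (d + 1)) = 1" "\<tau> (tm (d + 2)) = \<tau> 2 - 1" "\<tau> 2 = q"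
    using Suc.prems by (auto simp: \<tau>_def q_def)
  with Suc.IH[of \<tau>] obtain \<sigma>' where 1: "goes (5 * j + 1) [red_loop d] \<tau> \<sigma>'"
    and 2: "\<sigma>' (tm d) = \<tau> (tm d) - q * min j (\<tau> (tm d) div q)" "agree d \<tau> \<sigma>'"
    by auto
  have "\<tau> (tm d) - q * min j (\<tau> (tm d) div q) = e - q * min (Suc j) (e div q)"
  proof (cases "q = 0 \<or> e < q")
    case False
    then have "e div q = Suc ((e - q) div q)" by (simp add: le_div_geq)
    then show ?thesis using False by (simp add: \<tau>_def)
  qed (auto simp: \<tau>_def e_def)
  moreover have "goes (5 * Suc j + 1) [red_loop d] \<sigma> \<sigma>'"
  proof (cases "e - (q - 1) = 0")
    case True
    show ?thesis
      apply (rule goes_mono[of "Suc (Suc (Suc (Suc (5 * j + 1))))"])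
       apply (subst red_loop_def, rule goes_Cons(8), simp add: Suc.prems, fold red_loop_def)
       apply (simp only: append.simps, rule goes_Cons(3), rule goes_Cons(7))
       apply (use True Suc.prems in \<open>simp add: e_def q_def\<close>)
       apply (rule goes_Cons(3))
       apply (use 1 Suc.prems True in \<open>simp add: \<tau>_def e_def q_def\<close>)
      apply simp
      done
  next
    case False
    show ?thesis
      apply (rule goes_mono[of "Suc (Suc (Suc (Suc (Suc (5 * j + 1)))))"])
       apply (subst red_loop_def, rule goes_Cons(8), simp add: Suc.prems, fold red_loop_def)
       apply (simp only: append.simps, rule goes_Cons(3), rule goes_Cons(7))
       apply (use False Suc.prems in \<open>simp add: e_def q_def\<close>)
       apply (rule goes_Cons(3), rule goes_Cons(3))
       apply (use 1 Suc.prems False in \<open>simp add: \<tau>_def e_def q_def\<close>)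
      apply simp
      done
  qed
  moreover have "agree d \<sigma> \<tau>"
    by (auto simp: \<tau>_def intro!: agree_upd agree_refl)
  then have "agree d \<sigma> \<sigma>'"
    using 2 agree_trans by blast
  ultimately show ?case using 2 by (auto simp: e_def q_def)
qed

text \<open>The second operand is evaluated from depth \<open>d + 1\<close> on, so
  \<open>agree\<close> preserves the value of the first one in \<open>tm d\<close>.\<close>

lemma compile_exp_goes:
  assumes "names e \<subseteq> {..<63}" "\<sigma> 2 \<le> W"
  shows "\<exists>\<sigma>'. goes (costE W e) (compile_exp d e) \<sigma> \<sigma>' \<and> \<sigma>' (tm d) = val (absm \<sigma>) e \<and> agree d \<sigma> \<sigma>'"
  using assms
proof (induction e arbitrary: d \<sigma>)
  case (Lit n)
  show ?case by (auto intro!: exI[of _ "\<sigma>(tm d := n)"] goes_Cons goes_Nil agree_upd agree_refl)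
next
  case (Arr k e)
  from Arr.IH[of \<sigma> d] Arr.prems obtain \<sigma>1 where 1: "goes (costE W e) (compile_exp d e) \<sigma> \<sigma>1"
    "\<sigma>1 (tm d) = val (absm \<sigma>) e" "agree d \<sigma> \<sigma>1" by auto
  obtain \<sigma>2 where 2: "goes 8 (addr d k) \<sigma>1 \<sigma>2" "\<sigma>2 (tm d) = 64 * \<sigma>1 (tm d) + k" "agree d \<sigma>1 \<sigma>2"
    using goes_addr by blast
  define \<sigma>3 where "\<sigma>3 = \<sigma>2(tm d := \<sigma>2 (\<sigma>2 (tm d)))"
  have 3: "goes 1 [Load (tm d) (tm d)] \<sigma>2 \<sigma>3"
    unfolding \<sigma>3_def One_nat_def by (intro goes_Cons goes_Nil)
  have "goes (costE W (Arr k e)) (compile_exp d (Arr k e)) \<sigma> \<sigma>3"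
    using goes_append[OF 1(1) goes_append[OF 2(1) 3]] by simp
  moreover have ag: "agree d \<sigma> \<sigma>2" using 1 2 agree_trans by blast
  then have "agree d \<sigma> \<sigma>3" by (auto simp: \<sigma>3_def intro: agree_upd)
  moreover have "\<sigma>3 (tm d) = val (absm \<sigma>) (Arr k e)"
    using Arr.prems 1 2 fun_cong[OF fun_cong[OF agree_absm[OF ag], of k], of "val (absm \<sigma>) e"]
    by (simp add: \<sigma>3_def absm_def)
  ultimately show ?case by blast
next
  case (Add a b)
  from Add.IH(1)[of \<sigma> d] Add.prems obtain \<sigma>1 where 1: "goes (costE W a) (compile_exp d a) \<sigma> \<sigma>1"
    "\<sigma>1 (tm d) = val (absm \<sigma>) a" "agree d \<sigma> \<sigma>1" by auto
  from Add.IH(2)[of \<sigma>1 "d + 1"] Add.prems agree_2[OF 1(3)] obtain \<sigma>2 where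
    2: "goes (costE W b) (compile_exp (d + 1) b) \<sigma>1 \<sigma>2"
    "\<sigma>2 (tm (d + 1)) = val (absm \<sigma>1) b" "agree (d + 1) \<sigma>1 \<sigma>2" by auto
  define \<tau> where "\<tau> = \<sigma>2(tm d := \<sigma>2 (tm d) + \<sigma>2 (tm (d + 1)))"
  have 3: "goes 1 [Plus (tm d) (tm d) (tm (d + 1))] \<sigma>2 \<tau>"
    unfolding One_nat_def \<tau>_def by (intro goes_Cons goes_Nil)
  have "\<tau> (tm d) = \<sigma>2 (tm d) + \<sigma>2 (tm (d + 1))" "agree d \<sigma> \<tau>"
    using agree_trans[OF 1(3) 2(3)] by (auto simp: \<tau>_def intro: agree_upd)
  then show ?case
    using goes_append[OF 1(1) goes_append[OF 2(1) 3]] 1 2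
      agree_tm[OF 2(3), of d] agree_absm[OF 1(3)]
    by (intro exI[of _ \<tau>]) simp
next
  case (Sub a b)
  from Sub.IH(1)[of \<sigma> d] Sub.prems obtain \<sigma>1 where 1: "goes (costE W a) (compile_exp d a) \<sigma> \<sigma>1"
    "\<sigma>1 (tm d) = val (absm \<sigma>) a" "agree d \<sigma> \<sigma>1" by auto
  from Sub.IH(2)[of \<sigma>1 "d + 1"] Sub.prems agree_2[OF 1(3)] obtain \<sigma>2 where
    2: "goes (costE W b) (compile_exp (d + 1) b) \<sigma>1 \<sigma>2"
    "\<sigma>2 (tm (d + 1)) = val (absm \<sigma>1) b" "agree (d + 1) \<sigma>1 \<sigma>2" by auto
  define \<tau> where "\<tau> = \<sigma>2(tm d := \<sigma>2 (tm d) - \<sigma>2 (tm (d + 1)))"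
  have 3: "goes 1 [Minus (tm d) (tm d) (tm (d + 1))] \<sigma>2 \<tau>"
    unfolding One_nat_def \<tau>_def by (intro goes_Cons goes_Nil)
  have "\<tau> (tm d) = \<sigma>2 (tm d) - \<sigma>2 (tm (d + 1))" "agree d \<sigma> \<tau>"
    using agree_trans[OF 1(3) 2(3)] by (auto simp: \<tau>_def intro: agree_upd)
  then show ?case
    using goes_append[OF 1(1) goes_append[OF 2(1) 3]] 1 2
      agree_tm[OF 2(3), of d] agree_absm[OF 1(3)]
    by (intro exI[of _ \<tau>]) simp
next
  case (Mul a b)
  from Mul.IH(1)[of \<sigma> d] Mul.prems obtain \<sigma>1 where 1: "goes (costE W a) (compile_exp d a) \<sigma> \<sigma>1"
    "\<sigma>1 (tm d) = val (absm \<sigma>) a" "agree d \<sigma> \<sigma>1" by auto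
  from Mul.IH(2)[of \<sigma>1 "d + 1"] Mul.prems agree_2[OF 1(3)] obtain \<sigma>2 where
    2: "goes (costE W b) (compile_exp (d + 1) b) \<sigma>1 \<sigma>2"
    "\<sigma>2 (tm (d + 1)) = val (absm \<sigma>1) b" "agree (d + 1) \<sigma>1 \<sigma>2" by auto
  note ag = agree_trans[OF 1(3) 2(3)]
  define \<sigma>3 where "\<sigma>3 = \<sigma>2(tm (d+2) := 0, tm (d+3) := 1, tm (d+4) := \<sigma>2 2)"
  have 3: "goes 3 [Const (tm (d+2)) 0, Const (tm (d+3)) 1, Plus (tm (d+4)) 2 (tm (d+2))] \<sigma>2 \<sigma>3"
    unfolding numeral_3_eq_3 \<sigma>3_def by (intro goes_Cons) (simp add: goes_Nil)
  have ag3: "agree (d + 1) \<sigma>2 \<sigma>3" unfolding \<sigma>3_def by (intro agree_upd agree_refl) auto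
  obtain \<sigma>4 where 4: "goes (5 * \<sigma>2 2 + 1) [mul_loop d] \<sigma>3 \<sigma>4"
      "\<sigma>4 (tm (d+2)) = \<sigma>3 (tm (d+2)) + \<sigma>3 (tm d) * min (\<sigma>3 (tm (d+1))) (\<sigma>2 2)" "\<sigma>4 (tm (d+4)) = 0"
      "agree (d+1) \<sigma>3 \<sigma>4"
    using goes_mul[of \<sigma>3 d "\<sigma>2 2"] by (auto simp: \<sigma>3_def)
  define \<sigma>5 where "\<sigma>5 = \<sigma>4(tm d := \<sigma>4 (tm (d+2)) + \<sigma>4 (tm (d+4)))"
  have 5: "goes 1 [Plus (tm d) (tm (d+2)) (tm (d+4))] \<sigma>4 \<sigma>5"
    unfolding One_nat_def \<sigma>5_def by (intro goes_Cons goes_Nil)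
  have q: "\<sigma>2 2 = \<sigma> 2" using agree_2[OF 1(3)] agree_2[OF 2(3)] by simp
  have "goes (costE W (Mul a b)) (compile_exp d (Mul a b)) \<sigma> \<sigma>5"
    using goes_append[OF 1(1) goes_append[OF 2(1) goes_append[OF 3 goes_append[OF 4(1) 5]]]] Mul.prems q
    by (auto elim!: goes_mono)
  moreover have "\<sigma>5 (tm d) = val (absm \<sigma>) (Mul a b)"
    using 1 2 4 agree_tm[OF 2(3), of d] agree_absm[OF 1(3)] q
    by (auto simp: \<sigma>5_def \<sigma>3_def absm_def numeral_2_eq_2)
  moreover have "agree d \<sigma> \<sigma>5"
    unfolding \<sigma>5_def
    by (rule agree_upd[OF agree_trans[OF agree_trans[OF ag ag3] 4(4)]]) auto
  ultimately show ?case by blast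
next
  case (Red a)
  from Red.IH[of \<sigma> d] Red.prems obtain \<sigma>1 where 1: "goes (costE W a) (compile_exp d a) \<sigma> \<sigma>1"
    "\<sigma>1 (tm d) = val (absm \<sigma>) a" "agree d \<sigma> \<sigma>1" by auto
  define \<sigma>2 where "\<sigma>2 = \<sigma>1(tm (d+1) := 1, tm (d+2) := \<sigma>1 2 - 1, tm (d+4) := 0, tm (d+3) := \<sigma>1 2)"
  have 2: "goes 4 [Const (tm (d+1)) 1, Minus (tm (d+2)) 2 (tm (d+1)), Const (tm (d+4)) 0,
      Plus (tm (d+3)) 2 (tm (d+4))] \<sigma>1 \<sigma>2"
    apply (rule goes_mono[of "Suc (Suc (Suc (Suc 0)))"])
    unfolding \<sigma>2_def by (intro goes_Cons) (simp_all add: goes_Nil)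
  have ag2: "agree d \<sigma>1 \<sigma>2" unfolding \<sigma>2_def by (intro agree_upd agree_refl) auto
  have q: "\<sigma>2 2 = \<sigma> 2" "\<sigma>1 2 = \<sigma> 2" using agree_2[OF 1(3)] agree_2[OF ag2] by simp_all
  obtain \<sigma>3 where 3: "goes (5 * \<sigma> 2 + 1) [red_loop d] \<sigma>2 \<sigma>3"
      "\<sigma>3 (tm d) = \<sigma>2 (tm d) - \<sigma>2 2 * min (\<sigma> 2) (\<sigma>2 (tm d) div \<sigma>2 2)" "agree d \<sigma>2 \<sigma>3"
    using goes_red[of \<sigma>2 d "\<sigma> 2"] q by (auto simp: \<sigma>2_def)
  have "goes (costE W (Red a)) (compile_exp d (Red a)) \<sigma> \<sigma>3"
    using goes_append[OF 1(1) goes_append[OF 2 3(1)]] Red.prems q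
    by (auto elim!: goes_mono)
  moreover have "\<sigma>3 (tm d) = val (absm \<sigma>) (Red a)"
    using 1 3 q by (auto simp: \<sigma>2_def absm_def numeral_2_eq_2)
  moreover have "agree d \<sigma> \<sigma>3"
    using agree_trans[OF agree_trans[OF 1(3) ag2] 3(3)] by simp
  ultimately show ?case by blast
next
  case (Hlf a)
  from Hlf.IH[of \<sigma> d] Hlf.prems obtain \<sigma>1 where 1: "goes (costE W a) (compile_exp d a) \<sigma> \<sigma>1"
    "\<sigma>1 (tm d) = val (absm \<sigma>) a" "agree d \<sigma> \<sigma>1" by auto
  define \<tau> where "\<tau> = \<sigma>1(tm d := \<sigma>1 (tm d) div 2)"
  have 3: "goes 1 [Half (tm d) (tm d)] \<sigma>1 \<tau>"
    unfolding One_nat_def \<tau>_def by (intro goes_Cons goes_Nil)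
  have "\<tau> (tm d) = \<sigma>1 (tm d) div 2" "agree d \<sigma> \<tau>"
    using 1 by (auto simp: \<tau>_def intro: agree_upd)
  then show ?case
    using goes_append[OF 1(1) 3] 1 by (intro exI[of _ \<tau>]) simp
qed

definition abst :: "config \<Rightarrow> st" where
  "abst c = \<lparr>mem = absm (cells c), qst = qubits c, outp = emitted c\<rparr>"

lemma goes_ev: "goes t P \<sigma> \<sigma>' \<Longrightarrow> ev T (cfg K \<sigma>' \<psi> out) R \<Longrightarrow> ev (t + T) (cfg (P @ K) \<sigma> \<psi> out) R"
  by (simp add: goes_def)

lemma absm_upd: "k < 63 \<Longrightarrow> absm (\<sigma>(64 * i + k := v)) = (absm \<sigma>)(k := (absm \<sigma> k)(i := v))"
proof (intro ext)
  fix k' i' assume k: "k < 63"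
  have "i' = i \<and> k' = k" if "64 * i' + k' = 64 * i + k" "k' < 63"
  proof -
    have "(64 * i' + k') mod 64 = (64 * i + k) mod 64" using that by simp
    then have "k' mod 64 = k mod 64" by (simp only: mod_mult_self4)
    then have "k' = k" using that(2) k by simp
    then show ?thesis using that by simp
  qed
  then show "absm (\<sigma>(64 * i + k := v)) k' i' = ((absm \<sigma>)(k := (absm \<sigma> k)(i := v))) k' i'"
    using k by (auto simp: absm_def)
qed

lemma sem_mods: "s' \<in> set_pmf (sem m l U P s) \<Longrightarrow> k \<notin> mods P \<Longrightarrow> mem s' k = mem s k"
proof (induction P arbitrary: s s')
  case (For v p P)
  have "s' \<in> set_pmf (mfold (\<lambda>i t. sem m l U P (setm v 0 i t)) is s) \<Longrightarrow> mem s' k = mem s k" for "is" s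
  proof (induction "is" arbitrary: s)
    case (Cons i "is")
    then obtain t where "t \<in> set_pmf (sem m l U P (setm v 0 i s))"
      "s' \<in> set_pmf (mfold (\<lambda>i t. sem m l U P (setm v 0 i t)) is t)" by auto
    then have "mem s' k = mem t k" "mem t k = mem (setm v 0 i s) k"
      using Cons.IH For by auto
    then show ?case using For.prems by (simp add: setm_def)
  qed simp
  then show ?case using For.prems by simp
qed (auto simp: setm_def split: if_splits)

text \<open>The temporaries below \<open>d\<close> are required to survive on every branch because
  the counters of the enclosing loops are kept there.\<close>

definition implements :: "nat \<Rightarrow> nat \<Rightarrow> command list \<Rightarrow> (nat \<Rightarrow> nat) \<Rightarrow> qstate \<Rightarrow> nat list \<Rightarrow> st pmf \<Rightarrow> bool" where
  "implements T d P \<sigma> \<psi> out S \<longleftrightarrow> (\<forall>K. \<exists>R. ev T (cfg (P @ K) \<sigma> \<psi> out) R \<and> map_pmf abst R = S \<and>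
     (\<forall>c\<in>set_pmf R. ctrl c = K \<and> (\<forall>j<d. cells c (tm j) = \<sigma> (tm j))))"

lemma implements_goes:
  assumes "goes t Q \<sigma> \<sigma>'" "agree d \<sigma> \<sigma>'" "implements T d P \<sigma>' \<psi> out S"
  shows "implements (t + T) d (Q @ P) \<sigma> \<psi> out S"
proof (unfold implements_def, intro allI)
  fix K
  obtain R where "ev T (cfg (P @ K) \<sigma>' \<psi> out) R" "map_pmf abst R = S"
    "\<forall>c\<in>set_pmf R. ctrl c = K \<and> (\<forall>j<d. cells c (tm j) = \<sigma>' (tm j))"
    using assms(3) unfolding implements_def by blast
  then show "\<exists>R. ev (t + T) (cfg ((Q @ P) @ K) \<sigma> \<psi> out) R \<and> map_pmf abst R = S \<and>
     (\<forall>c\<in>set_pmf R. ctrl c = K \<and> (\<forall>j<d. cells c (tm j) = \<sigma> (tm j)))"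
    using goes_ev[OF assms(1)] agree_tm[OF assms(2)] by (intro exI[of _ R]) simp
qed

lemma implements_mono: "implements T d P \<sigma> \<psi> out S \<Longrightarrow> T \<le> T' \<Longrightarrow> implements T' d P \<sigma> \<psi> out S"
  unfolding implements_def by (meson ev_mono)

lemma implements_return:
  assumes "\<And>K R T. ev T (cfg K \<sigma>' \<psi>' out') R \<Longrightarrow> ev (t + T) (cfg (P @ K) \<sigma> \<psi> out) R"
    "\<And>j. j < d \<Longrightarrow> \<sigma>' (tm j) = \<sigma> (tm j)" "S = return_pmf \<lparr>mem = absm \<sigma>', qst = \<psi>', outp = out'\<rparr>"
  shows "implements t d P \<sigma> \<psi> out S"
proof (unfold implements_def, intro allI)
  fix K
  have "ev (t + 0) (cfg (P @ K) \<sigma> \<psi> out) (return_pmf (cfg K \<sigma>' \<psi>' out'))"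
    by (rule assms(1), rule ev_0)
  then show "\<exists>R. ev t (cfg (P @ K) \<sigma> \<psi> out) R \<and> map_pmf abst R = S \<and>
     (\<forall>c\<in>set_pmf R. ctrl c = K \<and> (\<forall>j<d. cells c (tm j) = \<sigma> (tm j)))"
    using assms(2,3) by (intro exI[of _ "return_pmf (cfg K \<sigma>' \<psi>' out')"]) (simp add: abst_def)
qed

text \<open>Configurations with the same abstract state may differ in their temporaries, so the
  distribution reached by \<open>Q\<close> is chosen for each configuration; only the images under
  \<open>abst\<close> have to fit together.\<close>

lemma implements_bind:
  assumes P: "implements T1 d P \<sigma> \<psi> out S"
    and Q: "\<And>\<sigma>' \<psi>' out'. \<lparr>mem = absm \<sigma>', qst = \<psi>', outp = out'\<rparr> \<in> set_pmf S \<Longrightarrow>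
      (\<And>j. j < d \<Longrightarrow> \<sigma>' (tm j) = \<sigma> (tm j)) \<Longrightarrow>
      implements T2 d' Q \<sigma>' \<psi>' out' (F \<lparr>mem = absm \<sigma>', qst = \<psi>', outp = out'\<rparr>)"
    and "d' \<le> d"
  shows "implements (T1 + T2) d' (P @ Q) \<sigma> \<psi> out (bind_pmf S F)"
proof (unfold implements_def, intro allI)
  fix K
  obtain R where R: "ev T1 (cfg (P @ Q @ K) \<sigma> \<psi> out) R" "map_pmf abst R = S"
    "\<And>c. c \<in> set_pmf R \<Longrightarrow> ctrl c = Q @ K \<and> (\<forall>j<d. cells c (tm j) = \<sigma> (tm j))"
    using P unfolding implements_def by metis
  have "\<exists>R'. ev T2 c R' \<and> map_pmf abst R' = F (abst c) \<and>
      (\<forall>c'\<in>set_pmf R'. ctrl c' = K \<and> (\<forall>j<d'. cells c' (tm j) = \<sigma> (tm j)))" if c: "c \<in> set_pmf R" for c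
  proof -
    have ctrl: "c = cfg (Q @ K) (cells c) (qubits c) (emitted c)" using R(3)[OF c] by (cases c) simp
    have "abst c \<in> set_pmf S" using c R(2) by auto
    then have "implements T2 d' Q (cells c) (qubits c) (emitted c) (F (abst c))"
      using Q[of "cells c" "qubits c" "emitted c"] R(3)[OF c] by (simp add: abst_def)
    then obtain R' where "ev T2 c R'" "map_pmf abst R' = F (abst c)"
      "\<forall>c'\<in>set_pmf R'. ctrl c' = K \<and> (\<forall>j<d'. cells c' (tm j) = cells c (tm j))"
      unfolding implements_def using ctrl by metis
    then show ?thesis using R(3)[OF c] \<open>d' \<le> d\<close> by (intro exI[of _ R']) auto
  qed
  then obtain f where f: "\<And>c. c \<in> set_pmf R \<Longrightarrow> ev T2 c (f c) \<and> map_pmf abst (f c) = F (abst c) \<and>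
      (\<forall>c'\<in>set_pmf (f c). ctrl c' = K \<and> (\<forall>j<d'. cells c' (tm j) = \<sigma> (tm j)))" by metis
  have "ev (T1 + T2) (cfg ((P @ Q) @ K) \<sigma> \<psi> out) (bind_pmf R f)"
    using ev_bind[OF R(1), of T2 f] f by simp
  moreover have "map_pmf abst (bind_pmf R f) = bind_pmf S F"
    using f unfolding map_bind_pmf R(2)[symmetric] bind_map_pmf by (intro bind_pmf_cong) auto
  ultimately show "\<exists>R. ev (T1 + T2) (cfg ((P @ Q) @ K) \<sigma> \<psi> out) R \<and> map_pmf abst R = bind_pmf S F \<and>
     (\<forall>c\<in>set_pmf R. ctrl c = K \<and> (\<forall>j<d'. cells c (tm j) = \<sigma> (tm j)))"
    using f by (intro exI[of _ "bind_pmf R f"]) auto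
qed

lemma implements_ev:
  assumes "\<And>K T R. ev T (cfg (P @ K) \<sigma> \<psi> out) R \<Longrightarrow> ev (t + T) (cfg (P' @ K) \<sigma>' \<psi> out) R"
    "\<And>j. j < d \<Longrightarrow> \<sigma>' (tm j) = \<sigma> (tm j)"
    "implements T d P \<sigma> \<psi> out S"
  shows "implements (t + T) d P' \<sigma>' \<psi> out S"
  using assms unfolding implements_def by metis

text \<open>Variables in \<open>L\<close> keep their initial values by \<open>sem_mods\<close>. Thus
  the bound \<open>W\<close> on the initial state still limits the iterations of loops, of
  \<open>Mul\<close> and of \<open>Red\<close> in every state reached later.\<close>

lemma compile_implements:
  assumes "wfs L P" "mods P \<inter> L = {}" "2 \<in> L" "\<And>p. p \<in> L \<Longrightarrow> p < 63 \<and> \<sigma> p \<le> W"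
  shows "implements (cost W P) d (compile d P) \<sigma> \<psi> out (sem m l U P \<lparr>mem = absm \<sigma>, qst = \<psi>, outp = out\<rparr>)"
  using assms
proof (induction P arbitrary: \<sigma> d \<psi> out)
  case (Assign k i e)
  have W: "\<sigma> 2 \<le> W" using Assign.prems by blast
  obtain \<sigma>1 where 1: "goes (costE W i) (compile_exp d i) \<sigma> \<sigma>1" "\<sigma>1 (tm d) = val (absm \<sigma>) i" "agree d \<sigma> \<sigma>1"
    using compile_exp_goes[of i \<sigma> W d] Assign.prems W by auto
  obtain \<sigma>2 where 2: "goes 8 (addr d k) \<sigma>1 \<sigma>2" "\<sigma>2 (tm d) = 64 * \<sigma>1 (tm d) + k" "agree d \<sigma>1 \<sigma>2"
    using goes_addr by blast
  note ag2 = agree_trans[OF 1(3) 2(3) order.refl]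
  obtain \<sigma>3 where 3: "goes (costE W e) (compile_exp (d+1) e) \<sigma>2 \<sigma>3" "\<sigma>3 (tm (d+1)) = val (absm \<sigma>2) e" "agree (d+1) \<sigma>2 \<sigma>3"
    using compile_exp_goes[of e \<sigma>2 W "d+1"] Assign.prems W agree_2[OF ag2] by auto
  note ag3 = agree_trans[OF ag2 3(3)]
  have a: "\<sigma>3 (tm d) = 64 * val (absm \<sigma>) i + k" using agree_tm[OF 3(3), of d] 1 2 by simp
  have "implements 1 d [Store (tm d) (tm (d+1))] \<sigma>3 \<psi> out
    (sem m l U (Assign k i e) \<lparr>mem = absm \<sigma>, qst = \<psi>, outp = out\<rparr>)"
  proof (rule implements_return)
    show "\<And>K R T. ev T (cfg K (\<sigma>3(\<sigma>3 (tm d) := \<sigma>3 (tm (d+1)))) \<psi> out) R \<Longrightarrow>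
        ev (1 + T) (cfg ([Store (tm d) (tm (d+1))] @ K) \<sigma>3 \<psi> out) R"
      by (auto intro: ev_intros)
    show "(\<sigma>3(\<sigma>3 (tm d) := \<sigma>3 (tm (d+1)))) (tm j) = \<sigma>3 (tm j)" for j
      using a tm_neq[of k "val (absm \<sigma>) i" j] Assign.prems by auto
    show "sem m l U (Assign k i e) \<lparr>mem = absm \<sigma>, qst = \<psi>, outp = out\<rparr> =
       return_pmf \<lparr>mem = absm (\<sigma>3(\<sigma>3 (tm d) := \<sigma>3 (tm (d+1)))), qst = \<psi>, outp = out\<rparr>"
      using a 3 Assign.prems agree_absm[OF ag2] agree_absm[OF ag3] by (simp add: absm_upd setm_def)
  qed
  from implements_goes[OF 1(1) 1(3) implements_goes[OF 2(1) 2(3) implements_goes[OF 3(1) _ this]]]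
  show ?case using 3(3) by (auto simp: add_ac agree_def elim!: implements_mono)
next
  case (Out e)
  obtain \<sigma>1 where 1: "goes (costE W e) (compile_exp d e) \<sigma> \<sigma>1" "\<sigma>1 (tm d) = val (absm \<sigma>) e" "agree d \<sigma> \<sigma>1"
    using compile_exp_goes[of e \<sigma> W d] Out.prems by auto
  have "implements 1 d [Emit (tm d)] \<sigma>1 \<psi> out (sem m l U (Out e) \<lparr>mem = absm \<sigma>, qst = \<psi>, outp = out\<rparr>)"
    by (rule implements_return[of \<sigma>1 \<psi> "out @ [\<sigma>1 (tm d)]"])
       (use 1 agree_absm[OF 1(3)] in \<open>auto intro: ev_intros\<close>)
  from implements_goes[OF 1(1) 1(3) this] show ?case by simp
next
  case (Flip e)
  obtain \<sigma>1 where 1: "goes (costE W e) (compile_exp d e) \<sigma> \<sigma>1" "\<sigma>1 (tm d) = val (absm \<sigma>) e" "agree d \<sigma> \<sigma>1"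
    using compile_exp_goes[of e \<sigma> W d] Flip.prems by auto
  have "implements 1 d [XGate (tm d)] \<sigma>1 \<psi> out (sem m l U (Flip e) \<lparr>mem = absm \<sigma>, qst = \<psi>, outp = out\<rparr>)"
    by (rule implements_return[of \<sigma>1 "apply_op X_mat [\<sigma>1 (tm d)] \<psi>" out])
       (use 1 agree_absm[OF 1(3)] in \<open>auto intro: ev_intros\<close>)
  from implements_goes[OF 1(1) 1(3) this] show ?case by simp
next
  case (Ask a b e)
  have W: "\<sigma> 2 \<le> W" using Ask.prems by blast
  obtain \<sigma>1 where 1: "goes (costE W a) (compile_exp d a) \<sigma> \<sigma>1" "\<sigma>1 (tm d) = val (absm \<sigma>) a" "agree d \<sigma> \<sigma>1"
    using compile_exp_goes[of a \<sigma> W d] Ask.prems W by auto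
  obtain \<sigma>2 where 2: "goes (costE W b) (compile_exp (d+1) b) \<sigma>1 \<sigma>2" "\<sigma>2 (tm (d+1)) = val (absm \<sigma>1) b" "agree (d+1) \<sigma>1 \<sigma>2"
    using compile_exp_goes[of b \<sigma>1 W "d+1"] Ask.prems W agree_2[OF 1(3)] by auto
  note ag2 = agree_trans[OF 1(3) 2(3)]
  obtain \<sigma>3 where 3: "goes (costE W e) (compile_exp (d+2) e) \<sigma>2 \<sigma>3" "\<sigma>3 (tm (d+2)) = val (absm \<sigma>2) e" "agree (d+2) \<sigma>2 \<sigma>3"
    using compile_exp_goes[of e \<sigma>2 W "d+2"] Ask.prems W agree_2[OF ag2] by auto
  note ag3 = agree_trans[OF ag2 3(3)]
  have v: "\<sigma>3 (tm d) = val (absm \<sigma>) a" "\<sigma>3 (tm (d+1)) = val (absm \<sigma>) b" "\<sigma>3 (tm (d+2)) = val (absm \<sigma>) e"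
    using 1 2 3 agree_tm[OF 3(3), of d] agree_tm[OF 3(3), of "d+1"] agree_tm[OF 2(3), of d]
      agree_absm[OF 1(3)] agree_absm[OF ag2] by simp_all
  have "implements 1 d [Query (tm d) (tm (d+1)) (tm (d+2))] \<sigma>3 \<psi> out
      (sem m l U (Ask a b e) \<lparr>mem = absm \<sigma>, qst = \<psi>, outp = out\<rparr>)"
    by (rule implements_return[of \<sigma>3
          "apply_op U (oracle_qubits m l (\<sigma>3 (tm d)) (\<sigma>3 (tm (d+1))) (\<sigma>3 (tm (d+2)))) \<psi>" out])
       (use v agree_absm[OF ag3] in \<open>auto intro: ev_intros\<close>)
  from implements_goes[OF 1(1) 1(3) implements_goes[OF 2(1) _ implements_goes[OF 3(1) _ this]]]
  show ?case using 2(3) 3(3) by (auto simp: add_ac agree_def elim!: implements_mono)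
next
  case (Measure k e)
  obtain \<sigma>1 where 1: "goes (costE W e) (compile_exp d e) \<sigma> \<sigma>1" "\<sigma>1 (tm d) = val (absm \<sigma>) e" "agree d \<sigma> \<sigma>1"
    using compile_exp_goes[of e \<sigma> W d] Measure.prems by auto
  have k: "k < 63" using Measure.prems by simp
  have "implements 1 d [Meas k (tm d)] \<sigma>1 \<psi> out (sem m l U (Measure k e) \<lparr>mem = absm \<sigma>, qst = \<psi>, outp = out\<rparr>)"
  proof (unfold implements_def, intro allI)
    fix K
    define R where "R = step m l U (cfg ([Meas k (tm d)] @ K) \<sigma>1 \<psi> out)"
    have "ev (Suc 0) (cfg ([Meas k (tm d)] @ K) \<sigma>1 \<psi> out) R"
      using ev_Suc[of "cfg ([Meas k (tm d)] @ K) \<sigma>1 \<psi> out" 0 return_pmf] ev_0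
      by (simp add: R_def bind_return_pmf')
    moreover have "map_pmf abst R = sem m l U (Measure k e) \<lparr>mem = absm \<sigma>, qst = \<psi>, outp = out\<rparr>"
      using 1 agree_absm[OF 1(3)] absm_upd[OF k, of \<sigma>1 0]
      by (simp add: R_def step_def map_pmf_comp abst_def setm_def)
    moreover have "ctrl c = K \<and> (\<forall>j<d. cells c (tm j) = \<sigma>1 (tm j))" if "c \<in> set_pmf R" for c
      using that k tm_neq[of k 0, symmetric] by (auto simp: R_def step_def)
    ultimately show "\<exists>R. ev 1 (cfg ([Meas k (tm d)] @ K) \<sigma>1 \<psi> out) R \<and>
      map_pmf abst R = sem m l U (Measure k e) \<lparr>mem = absm \<sigma>, qst = \<psi>, outp = out\<rparr> \<and>
      (\<forall>c\<in>set_pmf R. ctrl c = K \<and> (\<forall>j<d. cells c (tm j) = \<sigma>1 (tm j)))" by auto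
  qed
  from implements_goes[OF 1(1) 1(3) this] show ?case by simp
next
  case (Seq P Q)
  have "implements (cost W P) d (compile d P) \<sigma> \<psi> out (sem m l U P \<lparr>mem = absm \<sigma>, qst = \<psi>, outp = out\<rparr>)"
    using Seq.prems by (intro Seq.IH) auto
  then show ?case unfolding sem.simps cost.simps compile.simps
  proof (rule implements_bind)
    fix \<sigma>' \<psi>' out'
    assume *: "\<lparr>mem = absm \<sigma>', qst = \<psi>', outp = out'\<rparr> \<in>
       set_pmf (sem m l U P \<lparr>mem = absm \<sigma>, qst = \<psi>, outp = out\<rparr>)"
    have "\<sigma>' p = \<sigma> p" if "p \<in> L" for p
      using fun_cong[OF sem_mods[OF *, of p], of 0] that Seq.prems(2) Seq.prems(4)[OF that]
      by (auto simp: absm_def)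
    then show "implements (cost W Q) d (compile d Q) \<sigma>' \<psi>' out' (sem m l U Q \<lparr>mem = absm \<sigma>', qst = \<psi>', outp = out'\<rparr>)"
      using Seq.prems by (intro Seq.IH) auto
  qed simp
next
  case (Ite e P Q)
  obtain \<sigma>1 where 1: "goes (costE W e) (compile_exp d e) \<sigma> \<sigma>1" "\<sigma>1 (tm d) = val (absm \<sigma>) e" "agree d \<sigma> \<sigma>1"
    using compile_exp_goes[of e \<sigma> W d] Ite.prems by auto
  have s1: "\<sigma>1 p \<le> W" if "p \<in> L" for p
    using fun_cong[OF fun_cong[OF agree_absm[OF 1(3)], of p], of 0] Ite.prems(4)[OF that] by (simp add: absm_def)
  have "implements (1 + (cost W P + cost W Q)) d [Cond (tm d) (compile d P) (compile d Q)] \<sigma>1 \<psi> out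
    (sem m l U (Ite e P Q) \<lparr>mem = absm \<sigma>, qst = \<psi>, outp = out\<rparr>)"
  proof (rule implements_ev)
    show "implements (cost W P + cost W Q) d (if \<sigma>1 (tm d) \<noteq> 0 then compile d P else compile d Q) \<sigma>1 \<psi> out
       (sem m l U (Ite e P Q) \<lparr>mem = absm \<sigma>, qst = \<psi>, outp = out\<rparr>)"
      using Ite.IH(1)[of \<sigma>1 d \<psi> out] Ite.IH(2)[of \<sigma>1 d \<psi> out] Ite.prems s1 1(2) agree_absm[OF 1(3)]
      by (auto simp: Int_Un_distrib2 elim!: implements_mono)
  qed (auto intro: ev_intros)
  from implements_goes[OF 1(1) 1(3) this] show ?case by (simp add: add_ac)
next
  case (For k p P)
  let ?B = "\<lambda>i t. sem m l U P (setm k 0 i t)"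
  let ?body = "Minus k p (tm d) # compile (d+1) P @ [Const (tm (d+1)) 1, Minus (tm d) (tm d) (tm (d+1))]"
  define N where "N = \<sigma> p"
  have kp: "k < 63" "p < 63" "p \<in> L" "k \<noteq> p" "p \<notin> mods P" using For.prems by auto
  \<comment> \<open>\<open>j\<close> is the number of iterations left, which treat the last
    \<open>j\<close> elements of \<open>[0..<N]\<close>.\<close>
  have *: "implements (j * (cost W P + 4) + 1) d [Loop (tm d) ?body] \<tau> \<psi> out
      (mfold ?B [N - j..<N] \<lparr>mem = absm \<tau>, qst = \<psi>, outp = out\<rparr>)"
    if "j \<le> N" "\<tau> (tm d) = j" "\<And>p. p \<in> L \<Longrightarrow> \<tau> p = \<sigma> p" for j \<tau> \<psi> out
    using that
  proof (induction j arbitrary: \<tau> \<psi> out)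
    case 0
    then show ?case
      by (intro implements_return[of \<tau> \<psi> out]) (auto intro: ev_intros)
  next
    case (Suc j)
    define \<tau>' where "\<tau>' = \<tau>(k := N - Suc j)"
    have \<tau>': "\<tau>' p = \<sigma> p" "\<tau>' p \<le> W" if "p \<in> L" for p
      using that Suc.prems(3)[OF that] For.prems(2,4) by (auto simp: \<tau>'_def)
    have abs': "\<lparr>mem = absm \<tau>', qst = \<psi>, outp = out\<rparr> = setm k 0 (N - Suc j) \<lparr>mem = absm \<tau>, qst = \<psi>, outp = out\<rparr>"
      using absm_upd[OF kp(1), of \<tau> 0 "N - Suc j"] by (simp add: \<tau>'_def setm_def)
    have tmk: "\<tau>' (tm j) = \<tau> (tm j)" for j using tm_neq[of k 0 j] kp by (auto simp: \<tau>'_def)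
    have "implements (cost W P) (d+1) (compile (d+1) P) \<tau>' \<psi> out (sem m l U P \<lparr>mem = absm \<tau>', qst = \<psi>, outp = out\<rparr>)"
      using For.prems \<tau>' by (intro For.IH) auto
    then have "implements (cost W P + (2 + (j * (cost W P + 4) + 1))) d
      (compile (d+1) P @ [Const (tm (d+1)) 1, Minus (tm d) (tm d) (tm (d+1))] @ [Loop (tm d) ?body]) \<tau>' \<psi> out
      (bind_pmf (sem m l U P \<lparr>mem = absm \<tau>', qst = \<psi>, outp = out\<rparr>) (mfold ?B [N - j..<N]))"
    proof (rule implements_bind)
      fix \<sigma>' \<psi>' out'
      assume s: "\<lparr>mem = absm \<sigma>', qst = \<psi>', outp = out'\<rparr> \<in>
         set_pmf (sem m l U P \<lparr>mem = absm \<tau>', qst = \<psi>, outp = out\<rparr>)"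
        and d: "\<And>j. j < d + 1 \<Longrightarrow> \<sigma>' (tm j) = \<tau>' (tm j)"
      define \<sigma>'' where "\<sigma>'' = \<sigma>'(tm (d+1) := 1, tm d := j)"
      have g: "goes 2 [Const (tm (d+1)) 1, Minus (tm d) (tm d) (tm (d+1))] \<sigma>' \<sigma>''"
        using d[of d] tmk[of d] Suc.prems(2) unfolding \<sigma>''_def numeral_2_eq_2
        by (intro goes_Cons) (simp add: goes_Nil)
      have tmd: "\<sigma>'' (tm d) = j" by (simp add: \<sigma>''_def)
      have ag: "agree d \<sigma>' \<sigma>''" unfolding \<sigma>''_def by (intro agree_upd agree_refl) auto
      have "\<sigma>'' p = \<sigma> p" if "p \<in> L" for p
        using fun_cong[OF sem_mods[OF s, of p], of 0] fun_cong[OF fun_cong[OF agree_absm[OF ag], of p], of 0]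
          that For.prems(2) For.prems(4)[OF that] \<tau>'[OF that]
        by (auto simp: absm_def)
      then have "implements (j * (cost W P + 4) + 1) d [Loop (tm d) ?body] \<sigma>'' \<psi>' out'
        (mfold ?B [N - j..<N] \<lparr>mem = absm \<sigma>', qst = \<psi>', outp = out'\<rparr>)"
        using Suc.IH[of \<sigma>'' \<psi>' out'] Suc.prems(1) agree_absm[OF ag] tmd by simp
      from implements_goes[OF g ag this]
      show "implements (2 + (j * (cost W P + 4) + 1)) d
         ([Const (tm (d+1)) 1, Minus (tm d) (tm d) (tm (d+1))] @ [Loop (tm d) ?body]) \<sigma>' \<psi>' out'
         (mfold ?B [N - j..<N] \<lparr>mem = absm \<sigma>', qst = \<psi>', outp = out'\<rparr>)" .
    qed simp
    then have "implements (2 + (cost W P + (2 + (j * (cost W P + 4) + 1)))) d [Loop (tm d) ?body] \<tau> \<psi> out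
      (bind_pmf (sem m l U P \<lparr>mem = absm \<tau>', qst = \<psi>, outp = out\<rparr>) (mfold ?B [N - j..<N]))"
    proof (rule implements_ev[rotated 2])
      fix K T R
      assume a: "ev T (cfg ((compile (d+1) P @ [Const (tm (d+1)) 1, Minus (tm d) (tm d) (tm (d+1))] @ [Loop (tm d) ?body]) @ K) \<tau>' \<psi> out) R"
      have "\<tau>' = \<tau>(k := \<tau> p - \<tau> (tm d))" using Suc.prems kp by (simp add: \<tau>'_def N_def)
      with a have "ev (Suc T) (cfg (?body @ Loop (tm d) ?body # K) \<tau> \<psi> out) R"
        by (auto intro!: ev_intros(3))
      then have "ev (Suc (Suc T)) (cfg (Loop (tm d) ?body # K) \<tau> \<psi> out) R"
        using Suc.prems by (intro ev_intros(11)) auto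
      then show "ev (2 + T) (cfg ([Loop (tm d) ?body] @ K) \<tau> \<psi> out) R" by simp
    qed (use tmk in auto)
    moreover have "[N - Suc j..<N] = (N - Suc j) # [N - j..<N]"
      using Suc.prems(1) by (simp add: upt_conv_Cons Suc_diff_Suc)
    ultimately show ?case by (auto simp: abs' algebra_simps elim!: implements_mono)
  qed
  define \<tau> where "\<tau> = \<sigma>(tm d := \<sigma> p)"
  have g: "goes 2 [Const (tm d) 0, Plus (tm d) p (tm d)] \<sigma> \<tau>"
    using tm_neq[of p 0 d] kp unfolding \<tau>_def numeral_2_eq_2 by (intro goes_Cons) (simp add: goes_Nil)
  have tmd: "\<tau> (tm d) = N" by (simp add: \<tau>_def N_def)
  have ag: "agree d \<sigma> \<tau>" unfolding \<tau>_def by (intro agree_upd agree_refl) auto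
  have "\<tau> p = \<sigma> p" if "p \<in> L" for p
    using fun_cong[OF fun_cong[OF agree_absm[OF ag], of p], of 0] For.prems(4)[OF that] by (simp add: absm_def)
  then have "implements (N * (cost W P + 4) + 1) d [Loop (tm d) ?body] \<tau> \<psi> out
      (mfold ?B [0..<N] \<lparr>mem = absm \<sigma>, qst = \<psi>, outp = out\<rparr>)"
    using *[of N \<tau> \<psi> out] agree_absm[OF ag] tmd by simp
  from implements_goes[OF g ag this] kp(2)
  have "implements (2 + (N * (cost W P + 4) + 1)) d (compile d (For k p P)) \<sigma> \<psi> out
     (sem m l U (For k p P) \<lparr>mem = absm \<sigma>, qst = \<psi>, outp = out\<rparr>)"
    by (simp add: N_def absm_def)
  moreover have "N * (cost W P + 4) \<le> W * (cost W P + 4)"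
    using For.prems(4)[OF kp(3)] by (intro mult_le_mono1) (simp add: N_def)
  ultimately show ?case by (elim implements_mono) simp
qed

end

section \<open>Sampling from a corrupted codeword\<close>

definition mass :: "qstate \<Rightarrow> nat set set \<Rightarrow> real" where
  "mass \<psi> A = (\<Sum>S | \<psi> S \<noteq> 0 \<and> S \<in> A. (cmod (\<psi> S))\<^sup>2)"

definition qnorm :: "qstate \<Rightarrow> bool" where
  "qnorm \<psi> \<longleftrightarrow> finite {S. \<psi> S \<noteq> 0} \<and> mass \<psi> UNIV = 1"

text \<open>All qubits from \<open>f\<close> on are zero, and therefore not entangled with the
  others.\<close>

definition fresh :: "nat \<Rightarrow> qstate \<Rightarrow> bool" where
  "fresh f \<psi> \<longleftrightarrow> (\<forall>S. \<psi> S \<noteq> 0 \<longrightarrow> S \<subseteq> {..<f})"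

lemma mass_superset:
  "finite X \<Longrightarrow> {S. \<psi> S \<noteq> 0} \<subseteq> X \<Longrightarrow> mass \<psi> A = (\<Sum>S\<in>X \<inter> A. (cmod (\<psi> S))\<^sup>2)"
  unfolding mass_def by (rule sum.mono_neutral_left) auto

lemma mass_nonneg: "0 \<le> mass \<psi> A"
  unfolding mass_def by (intro sum_nonneg) auto

lemma mass_mono: "qnorm \<psi> \<Longrightarrow> A \<subseteq> B \<Longrightarrow> mass \<psi> A \<le> mass \<psi> B"
  unfolding mass_def qnorm_def by (intro sum_mono2) (auto intro: finite_subset[of _ "{S. \<psi> S \<noteq> 0}"])

lemma mass_le_1: "qnorm \<psi> \<Longrightarrow> mass \<psi> A \<le> 1"
  using mass_mono[of \<psi> A UNIV] by (simp add: qnorm_def)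

lemma outcome_prob_mass: "outcome_prob a b \<psi> = mass \<psi> {S. a \<in> S \<longleftrightarrow> b}"
  by (simp add: outcome_prob_def mass_def)

lemma mass_split:
  assumes "qnorm \<psi>"
  shows "mass \<psi> (A \<inter> B) + mass \<psi> (A - B) = mass \<psi> A"
proof -
  have "{S. \<psi> S \<noteq> 0 \<and> S \<in> A} = {S. \<psi> S \<noteq> 0 \<and> S \<in> A \<inter> B} \<union> {S. \<psi> S \<noteq> 0 \<and> S \<in> A - B}" by auto
  then show ?thesis using assms unfolding mass_def qnorm_def
    by (simp only:) (rule sum.union_disjoint[symmetric]; auto intro: finite_subset[of _ "{S. \<psi> S \<noteq> 0}"])
qed

lemma outcome_prob_False: "qnorm \<psi> \<Longrightarrow> outcome_prob a False \<psi> = 1 - outcome_prob a True \<psi>"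
  using mass_split[of \<psi> UNIV "{S. a \<in> S}"]
  by (simp add: outcome_prob_mass qnorm_def Compl_eq[symmetric] Diff_eq) (simp add: Collect_neg_eq[symmetric])

lemma pmf_outcome:
  assumes "qnorm \<psi>"
  shows "pmf (bernoulli_pmf (outcome_prob a True \<psi>)) v = outcome_prob a v \<psi>"
proof -
  have "0 \<le> outcome_prob a True \<psi>" "outcome_prob a True \<psi> \<le> 1"
    using assms mass_nonneg mass_le_1 by (auto simp: outcome_prob_mass)
  then show ?thesis using outcome_prob_False[OF assms] by (cases v) auto
qed

lemma post_measurement_qnorm:
  assumes "qnorm \<psi>" "outcome_prob a v \<psi> > 0"
  shows "qnorm (post_measurement a v \<psi>)"
proof -
  let ?p = "outcome_prob a v \<psi>"
  have supp: "{S. post_measurement a v \<psi> S \<noteq> 0} = {S. \<psi> S \<noteq> 0 \<and> (a \<in> S \<longleftrightarrow> v)}"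
    using assms(2) by (auto simp: post_measurement_def)
  have "mass (post_measurement a v \<psi>) UNIV = (\<Sum>S | \<psi> S \<noteq> 0 \<and> (a \<in> S \<longleftrightarrow> v). (cmod (\<psi> S))\<^sup>2 / ?p)"
    using assms(2) unfolding mass_def UNIV_I simp_thms supp
    by (intro sum.cong) (auto simp: post_measurement_def norm_divide power_divide)
  also have "\<dots> = 1"
    using assms(2) by (simp add: sum_divide_distrib[symmetric] outcome_prob_def)
  finally show ?thesis using assms(1) supp by (auto simp: qnorm_def)
qed

text \<open>In product form the normalisation cancels, so the probabilities of successive outcomes
  multiply to a mass of the state before the measurements.\<close>

lemma mass_post_measurement:
  assumes "outcome_prob a v \<psi> > 0"
  shows "outcome_prob a v \<psi> * mass (post_measurement a v \<psi>) A = mass \<psi> ({S. a \<in> S \<longleftrightarrow> v} \<inter> A)"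
proof -
  let ?p = "outcome_prob a v \<psi>"
  have supp: "{S. post_measurement a v \<psi> S \<noteq> 0 \<and> S \<in> A} = {S. \<psi> S \<noteq> 0 \<and> S \<in> {S. a \<in> S \<longleftrightarrow> v} \<inter> A}"
    using assms by (auto simp: post_measurement_def)
  have "?p * mass (post_measurement a v \<psi>) A = (\<Sum>S | \<psi> S \<noteq> 0 \<and> S \<in> {S. a \<in> S \<longleftrightarrow> v} \<inter> A. (cmod (\<psi> S))\<^sup>2)"
    using assms unfolding mass_def supp sum_distrib_left
    by (intro sum.cong) (auto simp: post_measurement_def norm_divide power_divide)
  then show ?thesis by (simp add: mass_def)
qed

lemma post_measurement_fresh: "fresh f \<psi> \<Longrightarrow> fresh f (post_measurement a v \<psi>)"
  by (auto simp: fresh_def post_measurement_def)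

definition flip :: "nat \<Rightarrow> nat set \<Rightarrow> nat set" where
  "flip a S = (if a \<in> S then S - {a} else insert a S)"

lemma apply_X: "apply_op X_mat [a] \<psi> S = \<psi> (flip a S)"
proof -
  have w: "write_qubits [a] j S = (S - {a}) \<union> (if odd j then {a} else {})" for j
    by (auto simp: write_qubits_def bit_0)
  have r: "read_qubits [a] S = of_bool (a \<in> S)" by (simp add: read_qubits_def)
  have X: "X_mat $$ (0, 0) = 0" "X_mat $$ (0, Suc 0) = 1" "X_mat $$ (Suc 0, 0) = 1" "X_mat $$ (Suc 0, Suc 0) = 0"
    by (auto simp: X_mat_def mat_of_rows_list_def)
  have "{..<2::nat} = {0, 1}" by auto
  then have "apply_op X_mat [a] \<psi> S = X_mat $$ (read_qubits [a] S, 0) * \<psi> (write_qubits [a] 0 S) +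
      X_mat $$ (read_qubits [a] S, 1) * \<psi> (write_qubits [a] 1 S)"
    by (simp add: apply_op_def)
  then show ?thesis by (cases "a \<in> S") (auto simp: X r w flip_def)
qed

definition rbits :: "nat \<Rightarrow> nat \<Rightarrow> nat \<Rightarrow> nat set" where
  "rbits f i r = {f + j | j. j < i \<and> bit r j}"

text \<open>The tensor product of \<open>\<psi>\<close> on the qubits below \<open>f\<close> with
  the basis state of the lowest \<open>i\<close> bits of \<open>r\<close>.\<close>

definition loaded :: "nat \<Rightarrow> nat \<Rightarrow> nat \<Rightarrow> qstate \<Rightarrow> qstate" where
  "loaded f i r \<psi> = (\<lambda>S. if S \<inter> {f..} = rbits f i r then \<psi> (S \<inter> {..<f}) else 0)"

lemma loaded_0: "fresh f \<psi> \<Longrightarrow> loaded f 0 r \<psi> = \<psi>"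
proof
  fix S assume f: "fresh f \<psi>"
  show "loaded f 0 r \<psi> S = \<psi> S"
  proof (cases "S \<inter> {f..} = {}")
    case True
    then have "S \<inter> {..<f} = S" by force
    then show ?thesis using True by (simp add: loaded_def rbits_def)
  next
    case False
    then have "\<not> S \<subseteq> {..<f}" by force
    then show ?thesis using False f by (auto simp: loaded_def rbits_def fresh_def)
  qed
qed

lemma loaded_Suc:
  "loaded f (Suc i) r \<psi> = (if bit r i then apply_op X_mat [f + i] (loaded f i r \<psi>) else loaded f i r \<psi>)"
proof (cases "bit r i")
  case True
  have 1: "rbits f (Suc i) r = insert (f + i) (rbits f i r)" "f + i \<notin> rbits f i r"
    using True by (auto simp: rbits_def less_Suc_eq)
  have "loaded f (Suc i) r \<psi> S = loaded f i r \<psi> (flip (f + i) S)" for S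
  proof -
    have "S \<inter> {f..} = insert (f + i) (rbits f i r) \<longleftrightarrow> flip (f + i) S \<inter> {f..} = rbits f i r"
    proof -
      have 2: "flip (f + i) S \<inter> {f..} = flip (f + i) (S \<inter> {f..})" by (auto simp: flip_def)
      have 3: "insert (f + i) (rbits f i r) = flip (f + i) (rbits f i r)" using 1(2) by (simp add: flip_def)
      have "flip a (flip a X) = X" for a X by (auto simp: flip_def)
      then show ?thesis unfolding 2 3 by metis
    qed
    moreover have "flip (f + i) S \<inter> {..<f} = S \<inter> {..<f}" by (auto simp: flip_def)
    ultimately show ?thesis by (simp add: loaded_def 1)
  qed
  then show ?thesis using True by (auto simp: apply_X)
next
  case False
  then have "rbits f (Suc i) r = rbits f i r" by (auto simp: rbits_def less_Suc_eq)
  then show ?thesis using False by (simp add: loaded_def)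
qed

definition ridx :: "nat \<Rightarrow> nat \<Rightarrow> nat set \<Rightarrow> nat" where
  "ridx f L S = (\<Sum>i<L. if f + i \<in> S then 2 ^ i else 0)"

lemma ridx_horner: "ridx f L S = horner_sum of_bool 2 (map (\<lambda>i. f + i \<in> S) [0..<L])"
  unfolding ridx_def horner_sum_eq_sum by (rule sum.cong) (simp_all add: lessThan_atLeast0)

lemma bit_ridx: "bit (ridx f L S) i \<longleftrightarrow> i < L \<and> f + i \<in> S"
  by (auto simp: ridx_horner bit_horner_sum_bit_iff)

lemma not_bit_less: "j < 2 ^ L \<Longrightarrow> L \<le> i \<Longrightarrow> \<not> bit (j::nat) i"
  by (metis bit_take_bit_iff linorder_not_less take_bit_nat_eq_self)

lemma ridx_less: "ridx f L S < 2 ^ L"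
proof -
  have "take_bit L (ridx f L S) = ridx f L S"
    by (rule bit_eqI) (auto simp: bit_take_bit_iff bit_ridx)
  then show ?thesis by (metis take_bit_nat_less_exp)
qed

lemma bit_eq_less: "i < 2 ^ L \<Longrightarrow> j < 2 ^ L \<Longrightarrow> (\<And>k. k < L \<Longrightarrow> bit i k = bit (j::nat) k) \<Longrightarrow> i = j"
  by (rule bit_eqI) (metis not_bit_less linorder_not_less)

lemma rbits_inter: "rbits f L i \<inter> {..<f} = {}" "rbits f L i \<subseteq> {f..<f + L}"
  by (auto simp: rbits_def)

lemma rbits_mem: "f + k \<in> rbits f L i \<longleftrightarrow> k < L \<and> bit i k"
  by (auto simp: rbits_def)

text \<open>The oracle is applied to a basis state with zero symbol and ancilla registers, so only
  column \<open>r\<close> of \<open>U\<close> occurs, and it multiplies the amplitudes of the old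
  qubits.\<close>

definition queried :: "nat \<Rightarrow> nat \<Rightarrow> complex mat \<Rightarrow> nat \<Rightarrow> qstate \<Rightarrow> qstate" where
  "queried f L U r \<psi> = (\<lambda>S. if S \<inter> {f + L..} = {} then U $$ (ridx f L S, r) * \<psi> (S \<inter> {..<f}) else 0)"

lemma apply_query:
  assumes "r < 2 ^ m" "m \<le> L"
  shows "apply_op U [f..<f + L] (loaded f m r \<psi>) = queried f L U r \<psi>"
proof
  fix S
  have rd: "read_qubits [f..<f + L] S = ridx f L S"
    by (auto simp: read_qubits_def ridx_def intro!: sum.cong)
  have wr: "write_qubits [f..<f + L] j S = (S - {f..<f + L}) \<union> rbits f L j" for j
    by (auto simp: write_qubits_def rbits_def)
  have r: "r < 2 ^ L" using assms by (meson less_le_trans one_le_numeral power_increasing)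
  \<comment> \<open>Among the register contents \<open>j\<close>, only \<open>r\<close> has a
    nonzero amplitude before the query, which collapses the sum in \<open>apply_op\<close> to one
    term.\<close>
  have eq: "loaded f m r \<psi> ((S - {f..<f + L}) \<union> rbits f L j) =
      (if j = r then if S \<inter> {f + L..} = {} then \<psi> (S \<inter> {..<f}) else 0 else 0)" if "j < 2 ^ L" for j
  proof -
    have "((S - {f..<f + L}) \<union> rbits f L j) \<inter> {f..} = rbits f m r \<longleftrightarrow> j = r \<and> S \<inter> {f + L..} = {}"
    proof
      assume h: "((S - {f..<f + L}) \<union> rbits f L j) \<inter> {f..} = rbits f m r"
      have "bit j k = bit r k" if "k < L" for k
      proof -
        have "f + k \<in> ((S - {f..<f + L}) \<union> rbits f L j) \<inter> {f..} \<longleftrightarrow> bit j k"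
          using that by (auto simp: rbits_mem)
        then have "bit j k \<longleftrightarrow> k < m \<and> bit r k" by (simp only: h rbits_mem)
        then show ?thesis using not_bit_less[OF assms(1), of k] by auto
      qed
      then have "j = r" using bit_eq_less[OF \<open>j < 2 ^ L\<close> r] by blast
      moreover have "x \<notin> S" if "f + L \<le> x" for x
      proof
        assume "x \<in> S"
        then have "x \<in> ((S - {f..<f + L}) \<union> rbits f L j) \<inter> {f..}" using that by simp
        then have "x \<in> rbits f m r" by (simp only: h)
        then show False using rbits_inter(2)[of f m r] assms(2) that by auto
      qed
      ultimately show "j = r \<and> S \<inter> {f + L..} = {}" by auto
    next
      assume h: "j = r \<and> S \<inter> {f + L..} = {}"
      then have "x < f + L" if "x \<in> S" for x using that by force
      then have 1: "((S - {f..<f + L}) \<union> rbits f L j) \<inter> {f..} = rbits f L r"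
        using h rbits_inter(2)[of f L r] by auto
      have "rbits f L r = rbits f m r"
      proof
        show "rbits f L r \<subseteq> rbits f m r"
          using not_bit_less[OF assms(1)] unfolding rbits_def by (smt (verit) Collect_mono linorder_not_less)
        show "rbits f m r \<subseteq> rbits f L r" using assms(2) by (auto simp: rbits_def)
      qed
      then show "((S - {f..<f + L}) \<union> rbits f L j) \<inter> {f..} = rbits f m r" using 1 by simp
    qed
    moreover have "((S - {f..<f + L}) \<union> rbits f L j) \<inter> {..<f} = S \<inter> {..<f}"
      using rbits_inter(2)[of f L j] by auto
    ultimately show ?thesis by (auto simp: loaded_def)
  qed
  have "apply_op U [f..<f + L] (loaded f m r \<psi>) S = (\<Sum>j<2 ^ L. U $$ (ridx f L S, j) *
      (if j = r then if S \<inter> {f + L..} = {} then \<psi> (S \<inter> {..<f}) else 0 else 0))"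
    by (simp add: apply_op_def rd wr eq)
  also have "\<dots> = queried f L U r \<psi> S"
    using r by (simp add: queried_def if_distrib[of "\<lambda>x. _ * x"] sum.delta cong: if_cong)
  finally show "apply_op U [f..<f + L] (loaded f m r \<psi>) S = queried f L U r \<psi> S" .
qed

lemma queried_fresh: "fresh f \<psi> \<Longrightarrow> fresh (f + L) (queried f L U r \<psi>)"
  by (force simp: fresh_def queried_def)

text \<open>A basis state in the new support splits uniquely into one of the old support and a
  register content \<open>i\<close>. Its amplitude is a product, and the squares of the old factors
  sum to 1.\<close>

lemma mass_queried:
  assumes "fresh f \<psi>" "qnorm \<psi>"
  shows "finite {S. queried f L U r \<psi> S \<noteq> 0}"
    and "mass (queried f L U r \<psi>) {S. P (ridx f L S)} = (\<Sum>i | i < 2 ^ L \<and> P i. (cmod (U $$ (i, r)))\<^sup>2)"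
proof -
  let ?\<psi>' = "queried f L U r \<psi>"
  let ?A = "{A. \<psi> A \<noteq> 0}"
  let ?g = "\<lambda>(A, i). A \<union> rbits f L i"
  have fin: "finite ?A" using assms(2) by (simp add: qnorm_def)
  have g: "(A \<union> rbits f L i) \<inter> {..<f} = A" "ridx f L (A \<union> rbits f L i) = i" "(A \<union> rbits f L i) \<inter> {f + L..} = {}"
    if "A \<in> ?A" "i < 2 ^ L" for A i
  proof -
    have A: "A \<subseteq> {..<f}" using that assms(1) by (auto simp: fresh_def)
    show "(A \<union> rbits f L i) \<inter> {..<f} = A" "(A \<union> rbits f L i) \<inter> {f + L..} = {}"
      using A rbits_inter(2)[of f L i] by force+
    show "ridx f L (A \<union> rbits f L i) = i"
      using A by (intro bit_eq_less[OF ridx_less that(2)]) (auto simp: bit_ridx rbits_mem)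
  qed
  have inj: "inj_on ?g (?A \<times> {..<2 ^ L})"
  proof (rule inj_on_inverseI[of _ "\<lambda>S. (S \<inter> {..<f}, ridx f L S)"])
    fix x :: "nat set \<times> nat" assume "x \<in> ?A \<times> {..<2 ^ L}"
    then show "(?g x \<inter> {..<f}, ridx f L (?g x)) = x" using g(1,2)[of "fst x" "snd x"] by (cases x) simp
  qed
  have supp: "{S. ?\<psi>' S \<noteq> 0} \<subseteq> ?g ` (?A \<times> {..<2 ^ L})"
  proof
    fix S assume "S \<in> {S. ?\<psi>' S \<noteq> 0}"
    then have S: "S \<inter> {f + L..} = {}" "\<psi> (S \<inter> {..<f}) \<noteq> 0" by (auto simp: queried_def split: if_splits)
    have "x \<in> S \<longleftrightarrow> x \<in> rbits f L (ridx f L S)" if "\<not> x < f" for x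
    proof -
      define k where "k = x - f"
      have x: "x = f + k" using that by (simp add: k_def)
      have "k < L" if "x \<in> S"
      proof (rule ccontr)
        assume "\<not> k < L"
        then have "x \<in> S \<inter> {f + L..}" using that x by simp
        then show False using S(1) by blast
      qed
      then show ?thesis unfolding x rbits_mem bit_ridx by blast
    qed
    then have "S = ?g (S \<inter> {..<f}, ridx f L S)"
      using rbits_inter(1)[of f L "ridx f L S"] by fastforce
    then show "S \<in> ?g ` (?A \<times> {..<2 ^ L})" using S(2) ridx_less by blast
  qed
  show "finite {S. ?\<psi>' S \<noteq> 0}" using finite_subset[OF supp] fin by simp
  have "mass ?\<psi>' {S. P (ridx f L S)} = (\<Sum>S\<in>?g ` (?A \<times> {..<2 ^ L}) \<inter> {S. P (ridx f L S)}. (cmod (?\<psi>' S))\<^sup>2)"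
    by (rule mass_superset) (use fin supp in auto)
  also have "?g ` (?A \<times> {..<2 ^ L}) \<inter> {S. P (ridx f L S)} = ?g ` (?A \<times> {i. i < 2 ^ L \<and> P i})"
    using g(2) by fastforce
  also have "(\<Sum>S\<in>?g ` (?A \<times> {i. i < 2 ^ L \<and> P i}). (cmod (?\<psi>' S))\<^sup>2) =
      (\<Sum>(A, i)\<in>?A \<times> {i. i < 2 ^ L \<and> P i}. (cmod (\<psi> A))\<^sup>2 * (cmod (U $$ (i, r)))\<^sup>2)"
    by (subst sum.reindex[OF inj_on_subset[OF inj]])
       (auto intro!: sum.cong simp: queried_def g norm_mult power_mult_distrib)
  also have "\<dots> = (\<Sum>A\<in>?A. (cmod (\<psi> A))\<^sup>2) * (\<Sum>i | i < 2 ^ L \<and> P i. (cmod (U $$ (i, r)))\<^sup>2)"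
    by (simp add: sum_product sum.cartesian_product)
  also have "(\<Sum>A\<in>?A. (cmod (\<psi> A))\<^sup>2) = 1" using assms(2) by (simp add: qnorm_def mass_def)
  finally show "mass ?\<psi>' {S. P (ridx f L S)} = (\<Sum>i | i < 2 ^ L \<and> P i. (cmod (U $$ (i, r)))\<^sup>2)" by simp
qed

text \<open>The defining equation is used with \<open>s = 0\<close> and zero ancilla only: there the
  input is the basis vector with index \<open>r\<close>, and \<open>0 XOR z = z\<close> leaves the
  symbol itself in the middle register.\<close>

lemma corrupted_column:
  assumes c: "corrupted_codeword q l U \<alpha> \<phi>" and r: "r < q" "q \<le> 2 ^ m" and m: "m = code_bits q"
    and i: "i < 2 ^ (2 * m + l)"
  shows "U $$ (i, r) = (if i mod 2 ^ m = r then \<alpha> r (i div 2 ^ m mod 2 ^ m) *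
     \<phi> r (i div 2 ^ m mod 2 ^ m) $ (i div 2 ^ (2 * m)) else 0)"
proof -
  let ?N = "2 ^ (2 * m + l) :: nat"
  have U: "U \<in> carrier_mat ?N ?N"
    and eq: "U *\<^sub>v ket3 m l r 0 (unit_vec (2 ^ l) 0) =
        vec ?N (\<lambda>i. \<Sum>z<2 ^ m. (\<alpha> r z \<cdot>\<^sub>v ket3 m l r (0 XOR z) (\<phi> r z)) $ i)"
    using c r unfolding corrupted_codeword_def m is_unitary_def Let_def by auto
  have rm: "r < 2 ^ m" using r by simp
  have le: "(2::nat) ^ m \<le> 2 ^ (2 * m + l)" by (rule power_increasing) auto
  have rN: "r < ?N" using rm le by linarith
  have "ket3 m l r 0 (unit_vec (2 ^ l) 0) = unit_vec ?N r"
  proof (rule eq_vecI)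
    fix j assume "j < dim_vec (unit_vec ?N r)"
    then have j: "j < ?N" by simp
    then have jl: "j div 2 ^ (2 * m) < 2 ^ l" by (simp add: div_less_iff_less_mult power_add mult.commute)
    have "j = r \<longleftrightarrow> j mod 2 ^ m = r \<and> j div 2 ^ m mod 2 ^ m = 0 \<and> j div 2 ^ (2 * m) = 0"
    proof
      assume h: "j mod 2 ^ m = r \<and> j div 2 ^ m mod 2 ^ m = 0 \<and> j div 2 ^ (2 * m) = 0"
      have "j div 2 ^ (2 * m) = j div 2 ^ m div 2 ^ m"
        by (simp add: div_mult2_eq[symmetric] power_add[symmetric] mult_2)
      with h have "j div 2 ^ m = 0" by (metis div_mult_mod_eq mult_0 add_0)
      with h show "j = r" by (metis div_mult_mod_eq mult_0 add_0)
    next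
      assume "j = r"
      moreover have "r div 2 ^ (2 * m) = 0" using rm
        by (metis div_less power_increasing less_le_trans one_le_numeral le_add1 mult_2)
      ultimately show "j mod 2 ^ m = r \<and> j div 2 ^ m mod 2 ^ m = 0 \<and> j div 2 ^ (2 * m) = 0"
        using rm by simp
    qed
    then show "ket3 m l r 0 (unit_vec (2 ^ l) 0) $ j = unit_vec ?N r $ j"
      using j jl rN by (auto simp: ket3_def unit_vec_def)
  qed (simp add: ket3_def)
  then have "U $$ (i, r) = (U *\<^sub>v ket3 m l r 0 (unit_vec (2 ^ l) 0)) $ i"
    using U i rN by simp
  also have "\<dots> = (\<Sum>z<2 ^ m. \<alpha> r z * (if i mod 2 ^ m = r \<and> i div 2 ^ m mod 2 ^ m = z
      then \<phi> r z $ (i div 2 ^ (2 * m)) else 0))"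
    unfolding eq using i by (simp add: ket3_def)
  also have "\<dots> = (\<Sum>z<2 ^ m. if z = i div 2 ^ m mod 2 ^ m then (if i mod 2 ^ m = r then \<alpha> r z * \<phi> r z $ (i div 2 ^ (2 * m)) else 0) else 0)"
    by (intro sum.cong) auto
  finally show ?thesis by (simp add: sum.delta')
qed

text \<open>The Born rule for reading the symbol register: the unit norm of the residual states
  removes them from the sum.\<close>

lemma column_mass:
  assumes c: "corrupted_codeword q l U \<alpha> \<phi>" and r: "r < q" "q \<le> 2 ^ m" and m: "m = code_bits q"
  shows "z < 2 ^ m \<Longrightarrow> (\<Sum>i | i < 2 ^ (2 * m + l) \<and> i div 2 ^ m mod 2 ^ m = z. (cmod (U $$ (i, r)))\<^sup>2) = (cmod (\<alpha> r z))\<^sup>2"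
    and "(\<Sum>i<2 ^ (2 * m + l). (cmod (U $$ (i, r)))\<^sup>2) = 1"
proof -
  let ?I = "\<lambda>z. {i. i < 2 ^ (2 * m + l) \<and> i div 2 ^ m mod 2 ^ m = z} :: nat set"
  have rm: "r < 2 ^ m" using r by simp
  have phi: "(\<Sum>w<2 ^ l. (cmod (\<phi> r z $ w))\<^sup>2) = 1" if "z < 2 ^ m" for z
    using c r that unfolding corrupted_codeword_def m Let_def by auto
  have alpha: "(\<Sum>z<2 ^ m. (cmod (\<alpha> r z))\<^sup>2) = 1"
    using c r unfolding corrupted_codeword_def m Let_def by auto
  have *: "(\<Sum>i\<in>?I z. (cmod (U $$ (i, r)))\<^sup>2) = (cmod (\<alpha> r z))\<^sup>2" if z: "z < 2 ^ m" for z
  proof -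
    \<comment> \<open>Enumerates the indices with first register \<open>r\<close> and middle
      register \<open>z\<close> by the ancilla content \<open>w\<close>; at the other indices with
      middle register \<open>z\<close> the column vanishes.\<close>
    let ?h = "\<lambda>w. r + 2 ^ m * (z + 2 ^ m * w)"
    have h: "?h w mod 2 ^ m = r" "?h w div 2 ^ m mod 2 ^ m = z" "?h w div 2 ^ (2 * m) = w" for w
    proof -
      show "?h w mod 2 ^ m = r" using rm by simp
      have d: "?h w div 2 ^ m = z + 2 ^ m * w" using rm by simp
      then show "?h w div 2 ^ m mod 2 ^ m = z" using z by simp
      have "?h w div 2 ^ (2 * m) = ?h w div 2 ^ m div 2 ^ m"
        by (simp only: div_mult2_eq[symmetric] power_add[symmetric] mult_2)
      also have "\<dots> = w" unfolding d using z by simp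
      finally show "?h w div 2 ^ (2 * m) = w" .
    qed
    have sub: "?h ` {..<2 ^ l} \<subseteq> ?I z"
    proof
      fix i assume "i \<in> ?h ` {..<2 ^ l}"
      then obtain w where w: "w < 2 ^ l" "i = ?h w" by auto
      then have "i div 2 ^ (2 * m) < 2 ^ l" using h(3) by simp
      then have "i < 2 ^ l * 2 ^ (2 * m)" by (simp add: div_less_iff_less_mult)
      then show "i \<in> ?I z" unfolding w
        using h(2) by (simp add: power_add mult.commute)
    qed
    have "(\<Sum>i\<in>?I z. (cmod (U $$ (i, r)))\<^sup>2) = (\<Sum>i\<in>?h ` {..<2 ^ l}. (cmod (U $$ (i, r)))\<^sup>2)"
    proof (rule sum.mono_neutral_right[OF _ sub])
      show "\<forall>i\<in>?I z - ?h ` {..<2 ^ l}. (cmod (U $$ (i, r)))\<^sup>2 = 0"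
      proof
        fix i assume i: "i \<in> ?I z - ?h ` {..<2 ^ l}"
        have "i mod 2 ^ m \<noteq> r"
        proof
          assume a: "i mod 2 ^ m = r"
          have "i = r + 2 ^ m * (i div 2 ^ m)"
            unfolding a[symmetric] by (simp only: mod_mult_div_eq)
          moreover have z': "i div 2 ^ m mod 2 ^ m = z" using i by simp
          have "i div 2 ^ m = z + 2 ^ m * (i div 2 ^ m div 2 ^ m)"
            unfolding z'[symmetric] by (simp only: mod_mult_div_eq)
          ultimately have e: "i = ?h (i div 2 ^ m div 2 ^ m)" by simp
          have "i div 2 ^ m div 2 ^ m < 2 ^ l"
            using i by (simp add: div_less_iff_less_mult power_add[symmetric] mult_2 add_ac)
          then show False using i e by blast
        qed
        then show "(cmod (U $$ (i, r)))\<^sup>2 = 0"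
          using corrupted_column[OF c r m, of i] i by simp
      qed
    qed simp
    also have "\<dots> = (\<Sum>w<2 ^ l. (cmod (U $$ (?h w, r)))\<^sup>2)"
      by (subst sum.reindex) (auto simp: inj_on_def)
    also have "\<dots> = (\<Sum>w<2 ^ l. (cmod (\<alpha> r z))\<^sup>2 * (cmod (\<phi> r z $ w))\<^sup>2)"
    proof (intro sum.cong refl)
      fix w :: nat assume "w \<in> {..<2 ^ l}"
      then have "?h w < 2 ^ (2 * m + l)" using sub by blast
      from corrupted_column[OF c r m this] show "(cmod (U $$ (?h w, r)))\<^sup>2 = (cmod (\<alpha> r z))\<^sup>2 * (cmod (\<phi> r z $ w))\<^sup>2"
        unfolding h by (simp add: norm_mult power_mult_distrib)
    qed
    finally show ?thesis using phi[OF z] by (simp add: sum_distrib_left[symmetric])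
  qed
  show "z < 2 ^ m \<Longrightarrow> (\<Sum>i\<in>?I z. (cmod (U $$ (i, r)))\<^sup>2) = (cmod (\<alpha> r z))\<^sup>2" by (rule *)
  have "(\<Sum>i<2 ^ (2 * m + l). (cmod (U $$ (i, r)))\<^sup>2) =
     (\<Sum>z<2 ^ m. \<Sum>i | i \<in> {..<2 ^ (2 * m + l)} \<and> i div 2 ^ m mod 2 ^ m = z. (cmod (U $$ (i, r)))\<^sup>2)"
    by (rule sum.group[symmetric]) auto
  then show "(\<Sum>i<2 ^ (2 * m + l). (cmod (U $$ (i, r)))\<^sup>2) = 1" using * alpha by simp
qed

section \<open>Probabilities of sequential compositions\<close>

lemma prob_bind_ge: "pmf M x * measure_pmf.prob (f x) A \<le> measure_pmf.prob (bind_pmf M f) A"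
proof -
  have "ennreal (pmf M x * measure_pmf.prob (f x) A) = (\<integral>\<^sup>+y. emeasure (f x) A * indicator {x} y \<partial>M)"
    by (subst nn_integral_cmult_indicator)
       (simp_all add: emeasure_pmf_single measure_pmf.emeasure_eq_measure ennreal_mult''
         measure_pmf_single mult.commute)
  also have "\<dots> \<le> (\<integral>\<^sup>+y. emeasure (f y) A \<partial>M)"
    by (intro nn_integral_mono) (auto split: split_indicator)
  also have "\<dots> = ennreal (measure_pmf.prob (bind_pmf M f) A)"
    by (simp add: measure_pmf.emeasure_eq_measure[symmetric])
  finally show ?thesis by (simp add: ennreal_le_iff)
qed

lemma prob_bind_all:
  assumes "\<And>x. x \<in> set_pmf M \<Longrightarrow> c \<le> measure_pmf.prob (f x) A"
  shows "c \<le> measure_pmf.prob (bind_pmf M f) A"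
proof -
  have "ennreal c = (\<integral>\<^sup>+y. ennreal c \<partial>M)" by simp
  also have "\<dots> \<le> (\<integral>\<^sup>+y. emeasure (f y) A \<partial>M)"
    using assms by (intro nn_integral_mono_AE) (auto simp: AE_measure_pmf_iff measure_pmf.emeasure_eq_measure intro!: ennreal_leI)
  also have "\<dots> = ennreal (measure_pmf.prob (bind_pmf M f) A)"
    by (simp add: measure_pmf.emeasure_eq_measure[symmetric])
  finally show ?thesis by (simp add: ennreal_le_iff)
qed

lemma set_pmf_bernoulli_outcome:
  "qnorm \<psi> \<Longrightarrow> v \<in> set_pmf (bernoulli_pmf (outcome_prob a True \<psi>)) \<Longrightarrow> outcome_prob a v \<psi> > 0"
  by (metis pmf_outcome pmf_positive)

section \<open>Reasoning about structured programs, and the sampling program\<close>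

lemma setm_simps [simp]:
  "mem (setm k i v s) = (mem s)(k := (mem s k)(i := v))"
  "qst (setm k i v s) = qst s" "outp (setm k i v s) = outp s"
  by (simp_all add: setm_def)

fun pure :: "stmt \<Rightarrow> bool" where
  "pure (Flip e) \<longleftrightarrow> False"
| "pure (Ask a b c) \<longleftrightarrow> False"
| "pure (Measure k e) \<longleftrightarrow> False"
| "pure (P ;; Q) \<longleftrightarrow> pure P \<and> pure Q"
| "pure (Ite e P Q) \<longleftrightarrow> pure P \<and> pure Q"
| "pure (For k p P) \<longleftrightarrow> pure P"
| "pure _ \<longleftrightarrow> True"

fun quiet :: "stmt \<Rightarrow> bool" where
  "quiet (Out e) \<longleftrightarrow> False"
| "quiet (P ;; Q) \<longleftrightarrow> quiet P \<and> quiet Q"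
| "quiet (Ite e P Q) \<longleftrightarrow> quiet P \<and> quiet Q"
| "quiet (For k p P) \<longleftrightarrow> quiet P"
| "quiet _ \<longleftrightarrow> True"

definition frame :: "stmt \<Rightarrow> st \<Rightarrow> st \<Rightarrow> bool" where
  "frame P s t \<longleftrightarrow> (\<forall>k. k \<notin> mods P \<longrightarrow> mem t k = mem s k) \<and>
     (quiet P \<longrightarrow> outp t = outp s) \<and> (pure P \<longrightarrow> qst t = qst s)"

lemma frame_mem: "frame P s t \<Longrightarrow> k \<notin> mods P \<Longrightarrow> mem t k = mem s k"
  by (simp add: frame_def)

abbreviation "V k \<equiv> Arr k (Lit 0)"
abbreviation "Set k \<equiv> Assign k (Lit 0)"

text \<open>The symbol is read from its least significant bit on: variable 16 is the current power
  of two. Variable 14 doubles as a dummy target where a branch has nothing to do.\<close>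

definition meas_body :: stmt where
  "meas_body = Measure 14 (Add (Add (V 10) (V 5)) (V 13)) ;;
     Ite (V 14) (Set 15 (Add (V 15) (V 16))) (Set 14 (Lit 0)) ;;
     Set 16 (Add (V 16) (V 16))"

text \<open>The guard \<open>x - (x div 2 + x div 2)\<close> is the lowest bit of \<open>x\<close>,
  so the loop flips the qubits at which \<open>r\<close> has a one.\<close>

definition load_query :: stmt where
  "load_query = Set 12 (V 11) ;;
     For 13 5 (Ite (Sub (V 12) (Add (Hlf (V 12)) (Hlf (V 12)))) (Flip (Add (V 10) (V 13))) (Set 14 (Lit 0)) ;;
       Set 12 (Hlf (V 12))) ;;
     Ask (V 10) (Add (V 10) (V 5)) (Add (Add (V 10) (V 5)) (V 5))"

text \<open>
  Variables 10, 11 and 15 hold the first unused qubit, the position to be queried and the symbol read there.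
  Each query uses new qubits, so that no state has to be uncomputed.
\<close>

definition sample :: stmt where
  "sample = load_query ;; Set 15 (Lit 0) ;; Set 16 (Lit 1) ;; For 13 5 meas_body ;;
     Set 10 (Add (Add (Add (V 10) (V 5)) (V 5)) (V 6))"

context
  fixes m l :: nat and U :: "complex mat"
begin

text \<open>Speaks of all outcomes of positive probability. Probabilities are estimated separately,
  on top of the invariants established this way.\<close>

definition wp :: "stmt \<Rightarrow> (st \<Rightarrow> bool) \<Rightarrow> st \<Rightarrow> bool" where
  "wp P Q s \<longleftrightarrow> (\<forall>t\<in>set_pmf (sem m l U P s). Q t)"

lemma wp_simps [simp]:
  "wp (Assign k i e) Q s \<longleftrightarrow> Q (setm k (val (mem s) i) (val (mem s) e) s)"
  "wp (Out e) Q s \<longleftrightarrow> Q (s\<lparr>outp := outp s @ [val (mem s) e]\<rparr>)"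
  "wp (Flip e) Q s \<longleftrightarrow> Q (s\<lparr>qst := apply_op X_mat [val (mem s) e] (qst s)\<rparr>)"
  "wp (Ask a b d) Q s \<longleftrightarrow> Q (s\<lparr>qst := apply_op U
     (oracle_qubits m l (val (mem s) a) (val (mem s) b) (val (mem s) d)) (qst s)\<rparr>)"
  "wp (P1 ;; P2) Q s \<longleftrightarrow> wp P1 (wp P2 Q) s"
  "wp (Ite e P1 P2) Q s \<longleftrightarrow> (if val (mem s) e \<noteq> 0 then wp P1 Q s else wp P2 Q s)"
  by (auto simp: wp_def)

lemma frame_For_step:
  assumes "frame (For v p P) s t" "frame P (setm v 0 i t) t'"
  shows "frame (For v p P) s t'"
  using assms by (auto simp: frame_def)

lemma sem_frame: "t \<in> set_pmf (sem m l U P s) \<Longrightarrow> frame P s t"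
proof (induction P arbitrary: s t)
  case (For v p P)
  have "t' \<in> set_pmf (mfold (\<lambda>i t. sem m l U P (setm v 0 i t)) is t) \<Longrightarrow> frame (For v p P) s t \<Longrightarrow>
      frame (For v p P) s t'" for "is" t t'
  proof (induction "is" arbitrary: t)
    case (Cons i "is")
    then obtain u where u: "u \<in> set_pmf (sem m l U P (setm v 0 i t))"
      "t' \<in> set_pmf (mfold (\<lambda>i t. sem m l U P (setm v 0 i t)) is u)" by auto
    then show ?case using Cons.IH frame_For_step[OF Cons.prems(2) For.IH[OF u(1)]] by blast
  qed simp
  then show ?case using For.prems by (auto simp: frame_def)
next
  case (Seq P Q)
  then show ?case by (fastforce simp: frame_def)
next
  case (Ite e P Q)
  then show ?case by (auto simp: frame_def split: if_splits)
qed (auto simp: frame_def)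

text \<open>The frame condition comes for free, so postconditions below mention only what a program
  computes and not what it leaves alone.\<close>

lemma wp_mono: "wp P Q s \<Longrightarrow> (\<And>t. Q t \<Longrightarrow> frame P s t \<Longrightarrow> R t) \<Longrightarrow> wp P R s"
  unfolding wp_def using sem_frame by blast

lemma mfold_rule:
  assumes "I i s" "i \<le> N"
    and "\<And>j t. i \<le> j \<Longrightarrow> j < N \<Longrightarrow> I j t \<Longrightarrow> \<forall>t'\<in>set_pmf (f j t). I (Suc j) t'"
    and "t \<in> set_pmf (mfold f [i..<N] s)"
  shows "I N t"
  using assms(2,1,3,4)
proof (induction i arbitrary: s rule: inc_induct)
  case (step i)
  from step.hyps step.prems(3) obtain u where u: "u \<in> set_pmf (f i s)" "t \<in> set_pmf (mfold f [Suc i..<N] u)"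
    by (auto simp: upt_conv_Cons)
  have "I (Suc i) u" using step.prems(2)[of i s] step.prems(1) step.hyps u(1) by auto
  then show ?case using step.IH[of u] step.prems(2) u(2) by (meson Suc_leD)
qed simp

lemma wp_For:
  assumes "I 0 s"
    and "\<And>i t. i < mem s p 0 \<Longrightarrow> I i t \<Longrightarrow> frame (For v p P) s t \<Longrightarrow> wp P (I (Suc i)) (setm v 0 i t)"
    and "\<And>t. I (mem s p 0) t \<Longrightarrow> frame (For v p P) s t \<Longrightarrow> Q t"
  shows "wp (For v p P) Q s"
  unfolding wp_def
proof
  fix t assume t: "t \<in> set_pmf (sem m l U (For v p P) s)"
  have "I (mem s p 0) t \<and> frame (For v p P) s t"
  proof (rule mfold_rule[of "\<lambda>i t. I i t \<and> frame (For v p P) s t" 0 s "mem s p 0" "\<lambda>i t. sem m l U P (setm v 0 i t)"])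
    fix j t assume "j < mem s p 0" "I j t \<and> frame (For v p P) s t"
    then show "\<forall>t'\<in>set_pmf (sem m l U P (setm v 0 j t)). I (Suc j) t' \<and> frame (For v p P) s t'"
      using assms(2)[of j t] frame_For_step sem_frame unfolding wp_def by blast
  qed (use t assms(1) in \<open>auto simp: frame_def\<close>)
  then show "Q t" using assms(3) by blast
qed

lemma prob_seq:
  assumes "wp P (\<lambda>t. c \<le> measure_pmf.prob (sem m l U Q t) A) s"
  shows "c \<le> measure_pmf.prob (sem m l U (P ;; Q) s) A"
  using assms by (auto simp: wp_def intro: prob_bind_all)

definition good :: "st \<Rightarrow> bool" where
  "good s \<longleftrightarrow> mem s 5 0 = m \<and> mem s 6 0 = l \<and> qnorm (qst s) \<and> fresh (mem s 10 0) (qst s)"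

lemma load_query_wp:
  assumes s: "good s" and r: "mem s 11 0 = r" "r < 2 ^ m"
  shows "wp load_query (\<lambda>t. qst t = queried (mem s 10 0) (2 * m + l) U r (qst s)) s"
proof -
  let ?f = "mem s 10 0"
  let ?P = "Ite (Sub (V 12) (Add (Hlf (V 12)) (Hlf (V 12)))) (Flip (Add (V 10) (V 13))) (Set 14 (Lit 0)) ;;
       Set 12 (Hlf (V 12))"
  let ?s = "setm 12 0 r s"
  have q: "oracle_qubits m l f (f + m) (f + m + m) = [f..<f + (2 * m + l)]" for f
    by (simp add: oracle_qubits_def mult_2 add.assoc upt_add_eq_append[of f "f + m" "m + l", simplified add.assoc]
        upt_add_eq_append[of "f + m" "f + m + m" l, simplified add.assoc])
  have "wp (For 13 5 ?P) (\<lambda>t. qst t = loaded ?f m r (qst s) \<and> mem t 10 0 = ?f \<and> mem t 5 0 = m) ?s"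
  proof (rule wp_For[where I = "\<lambda>i t. qst t = loaded ?f i r (qst s) \<and> mem t 12 0 = r div 2 ^ i"])
    show "qst ?s = loaded ?f 0 r (qst s) \<and> mem ?s 12 0 = r div 2 ^ 0"
      using s by (simp add: good_def loaded_0)
  next
    fix i t assume t: "qst t = loaded ?f i r (qst s) \<and> mem t 12 0 = r div 2 ^ i" "frame (For 13 5 ?P) ?s t"
    have f: "mem t 10 0 = ?f" using frame_mem[OF t(2), of 10] by simp
    have b: "r div 2 ^ i - (r div 2 ^ i div 2 + r div 2 ^ i div 2) \<noteq> 0 \<longleftrightarrow> bit r i"
    proof -
      have "x - (x div 2 + x div 2) \<noteq> 0 \<longleftrightarrow> odd x" for x :: nat by presburger
      then show ?thesis by (simp add: bit_iff_odd)
    qed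
    show "wp ?P (\<lambda>t. qst t = loaded ?f (Suc i) r (qst s) \<and> mem t 12 0 = r div 2 ^ Suc i) (setm 13 0 i t)"
      using t(1) b f loaded_Suc[of ?f i r "qst s"]
      by (auto simp: div_mult2_eq[symmetric] mult.commute)
  next
    fix t assume t: "qst t = loaded ?f (mem ?s 5 0) r (qst s) \<and> mem t 12 0 = r div 2 ^ mem ?s 5 0" "frame (For 13 5 ?P) ?s t"
    then show "qst t = loaded ?f m r (qst s) \<and> mem t 10 0 = ?f \<and> mem t 5 0 = m"
      using s frame_mem[OF t(2), of 10] frame_mem[OF t(2), of 5] by (simp add: good_def)
  qed
  then have "wp (For 13 5 ?P) (wp (Ask (V 10) (Add (V 10) (V 5)) (Add (Add (V 10) (V 5)) (V 5)))
      (\<lambda>t. qst t = queried ?f (2 * m + l) U r (qst s))) ?s"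
    by (rule wp_mono) (use r in \<open>simp add: q apply_query\<close>)
  then show ?thesis using r by (simp add: load_query_def)
qed

lemma meas_body_sem:
  assumes "qnorm (qst s)" "mem s 10 0 = f" "mem s 5 0 = m"
  defines "G \<equiv> \<lambda>v. setm 16 0 (2 * mem s 16 0) (setm (if v then 15 else 14) 0 (if v then mem s 15 0 + mem s 16 0 else 0)
      (setm 14 0 (of_bool v) (s\<lparr>qst := post_measurement (f + m + mem s 13 0) v (qst s)\<rparr>)))"
  shows "sem m l U meas_body s = map_pmf G (bernoulli_pmf (outcome_prob (f + m + mem s 13 0) True (qst s)))"
  using assms(2,3)
  by (auto simp: meas_body_def map_pmf_def bind_assoc_pmf bind_return_pmf G_def mult_2 intro!: bind_pmf_cong)

lemma meas_loop_wp:
  assumes "qnorm (qst s)" "fresh g (qst s)" "mem s 5 0 = m"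
  shows "wp (For 13 5 meas_body) (\<lambda>t. qnorm (qst t) \<and> fresh g (qst t)) s"
proof (rule wp_For[where I = "\<lambda>i t. qnorm (qst t) \<and> fresh g (qst t)"])
  fix i t assume t: "qnorm (qst t) \<and> fresh g (qst t)" "frame (For 13 5 meas_body) s t"
  have "mem (setm 13 0 i t) 5 0 = m"
    using frame_mem[OF t(2), of 5] assms(3) by (simp add: meas_body_def)
  with meas_body_sem[of "setm 13 0 i t" "mem t 10 0"] t(1)
  show "wp meas_body (\<lambda>t. qnorm (qst t) \<and> fresh g (qst t)) (setm 13 0 i t)"
    by (auto simp: wp_def intro: post_measurement_qnorm post_measurement_fresh set_pmf_bernoulli_outcome)
qed (use assms in auto)

text \<open>Follow the one branch in which the measurement of bit \<open>j\<close> gives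
  \<open>bit z j\<close>. By \<open>mass_post_measurement\<close> its probability is the mass of the
  basis states carrying \<open>z\<close> in these bits. The other branches are dropped, as a lower
  bound suffices.\<close>

lemma meas_loop_prob:
  assumes "z < 2 ^ m" "i \<le> m" "qnorm (qst s)" "mem s 10 0 = f" "mem s 5 0 = m"
    "mem s 15 0 = take_bit i z" "mem s 16 0 = 2 ^ i"
  shows "mass (qst s) {S. \<forall>j. i \<le> j \<and> j < m \<longrightarrow> (f + m + j \<in> S \<longleftrightarrow> bit z j)}
    \<le> measure_pmf.prob (mfold (\<lambda>i t. sem m l U meas_body (setm 13 0 i t)) [i..<m] s) {t. mem t 15 0 = z}"
  using assms(2,3-)
proof (induction i arbitrary: s rule: inc_induct)
  case base
  then have "mem s 15 0 = z" using assms(1) by (simp add: take_bit_nat_eq_self)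
  then show ?case using mass_le_1[OF base(1)] by simp
next
  case (step i)
  define v where "v = bit z i"
  let ?a = "f + m + i"
  let ?T = "\<lambda>i. {S. \<forall>j. i \<le> j \<and> j < m \<longrightarrow> (f + m + j \<in> S \<longleftrightarrow> bit z j)}"
  let ?F = "\<lambda>i t. sem m l U meas_body (setm 13 0 i t)"
  obtain G where G: "?F i s = map_pmf G (bernoulli_pmf (outcome_prob ?a True (qst s)))"
    "G = (\<lambda>v. setm 16 0 (2 * mem s 16 0) (setm (if v then 15 else 14) 0 (if v then mem s 15 0 + mem s 16 0 else 0)
      (setm 14 0 (of_bool v) ((setm 13 0 i s)\<lparr>qst := post_measurement ?a v (qst s)\<rparr>))))"
    using meas_body_sem[of "setm 13 0 i s" f] step.prems by (auto cong: if_cong)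
  have T: "?T i = {S. ?a \<in> S \<longleftrightarrow> v} \<inter> ?T (Suc i)"
    using step.hyps by (auto simp: v_def Suc_le_eq) (metis le_neq_implies_less)+
  have "mass (qst s) (?T i) \<le> pmf (bernoulli_pmf (outcome_prob ?a True (qst s))) v *
      measure_pmf.prob (mfold ?F [Suc i..<m] (G v)) {t. mem t 15 0 = z}"
  proof (cases "outcome_prob ?a v (qst s) > 0")
    case True
    have "mass (post_measurement ?a v (qst s)) (?T (Suc i))
        \<le> measure_pmf.prob (mfold ?F [Suc i..<m] (G v)) {t. mem t 15 0 = z}"
    proof -
      have "mass (qst (G v)) (?T (Suc i)) \<le> measure_pmf.prob (mfold ?F [Suc i..<m] (G v)) {t. mem t 15 0 = z}"
        by (rule step.IH)
           (use step.prems True post_measurement_qnorm in \<open>auto simp: G(2) v_def take_bit_Suc_from_most of_bool_def\<close>)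
      then show ?thesis by (simp add: G(2))
    qed
    then show ?thesis unfolding T pmf_outcome[OF step.prems(1)] mass_post_measurement[OF True, symmetric]
      using True by (intro mult_left_mono) auto
  next
    \<comment> \<open>An outcome of probability zero cannot be followed, but then the mass to be
      bounded is zero as well.\<close>
    case False
    have "mass (qst s) (?T i) \<le> outcome_prob ?a v (qst s)"
      unfolding T outcome_prob_mass by (rule mass_mono[OF step.prems(1)]) auto
    also have "\<dots> = 0" using False mass_nonneg[of "qst s"] unfolding outcome_prob_mass by (simp add: order_antisym not_less)
    finally show ?thesis by (meson measure_nonneg mult_nonneg_nonneg order_trans pmf_nonneg)
  qed
  also have "\<dots> \<le> measure_pmf.prob (bind_pmf (bernoulli_pmf (outcome_prob ?a True (qst s)))
      (\<lambda>v. mfold ?F [Suc i..<m] (G v))) {t. mem t 15 0 = z}"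
    by (rule prob_bind_ge)
  also have "\<dots> = measure_pmf.prob (mfold ?F [i..<m] s) {t. mem t 15 0 = z}"
    using step.hyps by (simp add: upt_conv_Cons G(1) bind_map_pmf)
  finally show ?case .
qed

end

locale corrupted =
  fixes q l m :: nat and U \<alpha> \<phi>
  assumes cc: "corrupted_codeword q l U \<alpha> \<phi>" and m: "m = code_bits q"
begin

lemma q_le: "q \<le> 2 ^ m"
  unfolding m code_bits_def by (rule LeastI[of _ q]) (simp add: less_imp_le)

lemma queried_qnorm:
  assumes "fresh f \<psi>" "qnorm \<psi>" "r < q"
  shows "qnorm (queried f (2 * m + l) U r \<psi>)"
proof -
  have "{i. i < 2 ^ (2 * m + l) \<and> True} = {..<2 ^ (2 * m + l) :: nat}" by auto
  then have "mass (queried f (2 * m + l) U r \<psi>) UNIV = 1"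
    using mass_queried(2)[OF assms(1,2), of "2 * m + l" U r "\<lambda>_. True"] column_mass(2)[OF cc assms(3) q_le m] by simp
  then show ?thesis using mass_queried(1)[OF assms(1,2)] by (simp add: qnorm_def)
qed

lemma sample_wp:
  assumes s: "good m l s" and r: "mem s 11 0 < q"
  shows "wp m l U sample (good m l) s"
proof -
  define f where "f = mem s 10 0"
  define r where "r = mem s 11 0"
  define g where "g = f + (2 * m + l)"
  have fr: "fresh f (qst s)" "qnorm (qst s)" using s by (auto simp: good_def f_def)
  have "wp m l U load_query (\<lambda>t. qst t = queried f (2 * m + l) U r (qst s)) s"
    unfolding f_def r_def using load_query_wp[OF s refl] r q_le by auto
  then have "wp m l U load_query (wp m l U (Set 15 (Lit 0) ;; Set 16 (Lit 1) ;; For 13 5 meas_body ;;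
     Set 10 (Add (Add (Add (V 10) (V 5)) (V 5)) (V 6))) (good m l)) s"
  proof (rule wp_mono)
    fix t assume t: "qst t = queried f (2 * m + l) U r (qst s)" "frame load_query s t"
    have t': "mem t 5 0 = m" "mem t 6 0 = l" "mem t 10 0 = f"
      using frame_mem[OF t(2), of 5] frame_mem[OF t(2), of 6] frame_mem[OF t(2), of 10] s
      by (auto simp: load_query_def good_def f_def)
    have qt: "qnorm (qst t)" "fresh g (qst t)"
      unfolding t(1) g_def using queried_qnorm[OF fr] queried_fresh[OF fr(1)] assms(2) by (auto simp: r_def)
    let ?t = "setm 16 0 1 (setm 15 0 0 t)"
    have "wp m l U (For 13 5 meas_body) (\<lambda>u. qnorm (qst u) \<and> fresh g (qst u)) ?t"
      by (rule meas_loop_wp) (use qt t' in auto)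
    then have "wp m l U (For 13 5 meas_body) (wp m l U (Set 10 (Add (Add (Add (V 10) (V 5)) (V 5)) (V 6))) (good m l)) ?t"
    proof (rule wp_mono)
      fix u assume u: "qnorm (qst u) \<and> fresh g (qst u)" "frame (For 13 5 meas_body) ?t u"
      have "mem u 5 0 = m" "mem u 6 0 = l" "mem u 10 0 = f"
        using frame_mem[OF u(2), of 5] frame_mem[OF u(2), of 6] frame_mem[OF u(2), of 10] t'
        by (auto simp: meas_body_def)
      then show "wp m l U (Set 10 (Add (Add (Add (V 10) (V 5)) (V 5)) (V 6))) (good m l) u"
        using u(1) by (simp add: good_def g_def mult_2 add.assoc)
    qed
    then show "wp m l U (Set 15 (Lit 0) ;; Set 16 (Lit 1) ;; For 13 5 meas_body ;;
     Set 10 (Add (Add (Add (V 10) (V 5)) (V 5)) (V 6))) (good m l) t" by simp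
  qed
  then show ?thesis by (simp add: sample_def)
qed

text \<open>Joins \<open>column_mass\<close> (the mass of a symbol after the query) with
  \<open>meas_loop_prob\<close> (bitwise measurement realises this mass as a probability).\<close>

lemma sample_prob:
  assumes s: "good m l s" and r: "mem s 11 0 = r" "r < q" and z: "z < 2 ^ m"
  shows "(cmod (\<alpha> r z))\<^sup>2 \<le> measure_pmf.prob (sem m l U sample s) {t. mem t 15 0 = z}"
  unfolding sample_def
proof (rule prob_seq)
  define f where "f = mem s 10 0"
  have fr: "fresh f (qst s)" "qnorm (qst s)" using s by (auto simp: good_def f_def)
  have "wp m l U load_query (\<lambda>t. qst t = queried f (2 * m + l) U r (qst s)) s"
    unfolding f_def using load_query_wp[OF s] r q_le by auto
  then show "wp m l U load_query (\<lambda>t. (cmod (\<alpha> r z))\<^sup>2 \<le> measure_pmf.prob (sem m l U (Set 15 (Lit 0) ;; Set 16 (Lit 1) ;;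
     For 13 5 meas_body ;; Set 10 (Add (Add (Add (V 10) (V 5)) (V 5)) (V 6))) t) {t. mem t 15 0 = z}) s"
  proof (rule wp_mono)
    fix t assume t: "qst t = queried f (2 * m + l) U r (qst s)" "frame load_query s t"
    have t': "mem t 5 0 = m" "mem t 6 0 = l" "mem t 10 0 = f"
      using frame_mem[OF t(2), of 5] frame_mem[OF t(2), of 6] frame_mem[OF t(2), of 10] s
      by (auto simp: load_query_def good_def f_def)
    have qt: "qnorm (qst t)"
      unfolding t(1) using queried_qnorm[OF fr] r by auto
    let ?t = "setm 16 0 1 (setm 15 0 0 t)"
    let ?loop = "mfold (\<lambda>i t. sem m l U meas_body (setm 13 0 i t)) [0..<m] ?t"
    \<comment> \<open>The symbol register consists of the bits \<open>m, \<dots>, 2 * m - 1\<close>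
      of the oracle index; this translates between single qubits and the arithmetic form in
      \<open>column_mass\<close>.\<close>
    have bits: "(\<forall>j. 0 \<le> j \<and> j < m \<longrightarrow> (f + m + j \<in> S \<longleftrightarrow> bit z j)) \<longleftrightarrow> ridx f (2 * m + l) S div 2 ^ m mod 2 ^ m = z" for S
    proof -
      have "ridx f (2 * m + l) S div 2 ^ m mod 2 ^ m = take_bit m (drop_bit m (ridx f (2 * m + l) S))"
        by (simp add: take_bit_eq_mod drop_bit_eq_div)
      moreover have "take_bit m (drop_bit m (ridx f (2 * m + l) S)) = z \<longleftrightarrow>
         (\<forall>j<m. bit (ridx f (2 * m + l) S) (m + j) \<longleftrightarrow> bit z j)"
      proof
        assume "take_bit m (drop_bit m (ridx f (2 * m + l) S)) = z"
        then show "\<forall>j<m. bit (ridx f (2 * m + l) S) (m + j) \<longleftrightarrow> bit z j"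
          by (auto simp: bit_take_bit_iff bit_drop_bit_eq)
      next
        assume "\<forall>j<m. bit (ridx f (2 * m + l) S) (m + j) \<longleftrightarrow> bit z j"
        then show "take_bit m (drop_bit m (ridx f (2 * m + l) S)) = z"
          using z by (intro bit_eq_less[of _ m]) (auto simp: bit_take_bit_iff bit_drop_bit_eq)
      qed
      ultimately show ?thesis by (auto simp: bit_ridx add.assoc)
    qed
    have "(cmod (\<alpha> r z))\<^sup>2 = mass (qst t) {S. ridx f (2 * m + l) S div 2 ^ m mod 2 ^ m = z}"
      unfolding t(1) using mass_queried(2)[OF fr, of "2 * m + l" U r "\<lambda>i. i div 2 ^ m mod 2 ^ m = z"]
        column_mass(1)[OF cc r(2) q_le m z] by simp
    also have "\<dots> = mass (qst ?t) {S. \<forall>j. 0 \<le> j \<and> j < m \<longrightarrow> (f + m + j \<in> S \<longleftrightarrow> bit z j)}"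
      unfolding bits by simp
    also have "\<dots> \<le> measure_pmf.prob ?loop {t. mem t 15 0 = z}"
      by (rule meas_loop_prob) (use qt t' z in auto)
    also have "\<dots> = measure_pmf.prob (sem m l U (Set 15 (Lit 0) ;; Set 16 (Lit 1) ;;
     For 13 5 meas_body ;; Set 10 (Add (Add (Add (V 10) (V 5)) (V 5)) (V 6))) t) {t. mem t 15 0 = z}"
      using t' by (simp add: bind_return_pmf map_pmf_def[symmetric] vimage_def)
    finally show "(cmod (\<alpha> r z))\<^sup>2 \<le> measure_pmf.prob (sem m l U (Set 15 (Lit 0) ;; Set 16 (Lit 1) ;;
     For 13 5 meas_body ;; Set 10 (Add (Add (Add (V 10) (V 5)) (V 5)) (V 6))) t) {t. mem t 15 0 = z}" .
  qed
qed

end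

section \<open>Decoding by bivariate interpolation\<close>

text \<open>As \<open>q\<close> is a variable, polynomials over the field with \<open>q\<close>
  elements are integer polynomials up to congruence of coefficients.\<close>

definition pz :: "int \<Rightarrow> int poly \<Rightarrow> bool" where
  "pz q f \<longleftrightarrow> (\<forall>j. q dvd coeff f j)"

lemma pz_iff: "pz q f \<longleftrightarrow> [:q:] dvd f"
  by (simp add: pz_def const_poly_dvd_iff)

lemma pz_sum: "(\<And>i. i \<in> A \<Longrightarrow> pz q (f i)) \<Longrightarrow> pz q (sum f A)"
  unfolding pz_iff by (rule dvd_sum)

text \<open>Truncated at order \<open>n\<close> so that arrays holding the first coefficients of a series can be compared.\<close>

definition teq :: "int \<Rightarrow> nat \<Rightarrow> int poly \<Rightarrow> int poly \<Rightarrow> bool" where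
  "teq q n f g \<longleftrightarrow> (\<forall>j<n. q dvd coeff f j - coeff g j)"

lemma teq_refl [simp]: "teq q n f f"
  by (simp add: teq_def)

lemma teq_trans: "teq q n f g \<Longrightarrow> teq q n g h \<Longrightarrow> teq q n f h"
  unfolding teq_def by (metis (no_types, lifting) add_diff_cancel_left' diff_add_cancel diff_diff_eq2 dvd_add)

lemma teq_mono: "teq q n f g \<Longrightarrow> k \<le> n \<Longrightarrow> teq q k f g"
  by (auto simp: teq_def)

lemma teq_add: "teq q n f g \<Longrightarrow> teq q n f' g' \<Longrightarrow> teq q n (f + f') (g + g')"
  unfolding teq_def coeff_add by (simp add: add_diff_add)

lemma teq_smult: "teq q n f g \<Longrightarrow> teq q n (smult c f) (smult c g)"
  unfolding teq_def coeff_smult by (simp add: right_diff_distrib[symmetric])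

lemma teq_mult: assumes "teq q n f g" "teq q n f' g'" shows "teq q n (f * f') (g * g')"
  unfolding teq_def
proof (intro allI impI)
  fix j assume j: "j < n"
  have "q dvd coeff f i * coeff f' (j - i) - coeff g i * coeff g' (j - i)" if "i \<le> j" for i
  proof -
    have "q dvd coeff f i - coeff g i" "q dvd coeff f' (j - i) - coeff g' (j - i)"
      using assms j that by (auto simp: teq_def)
    then have "q dvd (coeff f i - coeff g i) * coeff f' (j - i) + coeff g i * (coeff f' (j - i) - coeff g' (j - i))"
      by (intro dvd_add dvd_mult2 dvd_mult)
    then show ?thesis by (simp add: algebra_simps)
  qed
  then show "q dvd coeff (f * f') j - coeff (g * g') j"
    unfolding coeff_mult sum_subtractf[symmetric] by (intro dvd_sum) auto
qed

lemma teq_power: "teq q n f g \<Longrightarrow> teq q n (f ^ k) (g ^ k)"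
  by (induction k) (auto intro: teq_mult)

lemma teq_sum: "(\<And>i. i \<in> A \<Longrightarrow> teq q n (f i) (g i)) \<Longrightarrow> teq q n (sum f A) (sum g A)"
  by (induction A rule: infinite_finite_induct) (auto intro: teq_add)

text \<open>The value at \<open>(X, Y)\<close> of the polynomial in which \<open>x ^ a * y ^ b\<close> has the coefficient \<open>c b a\<close>.\<close>

definition bev :: "nat \<Rightarrow> (nat \<Rightarrow> nat \<Rightarrow> int) \<Rightarrow> int poly \<Rightarrow> int poly \<Rightarrow> int poly" where
  "bev q c X Y = (\<Sum>b<q. \<Sum>a<q. smult (c b a) (X ^ a * Y ^ b))"

text \<open>The partial derivative by \<open>y\<close>, with coefficients reduced as they are kept
  in memory. Row \<open>q - 1\<close> becomes zero because there is no row \<open>q\<close>.\<close>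

definition dy :: "nat \<Rightarrow> (nat \<Rightarrow> nat \<Rightarrow> int) \<Rightarrow> nat \<Rightarrow> nat \<Rightarrow> int" where
  "dy q c b a = (if Suc b < q then (int (Suc b) * c (Suc b) a) mod int q else 0)"

definition wdeg :: "nat \<Rightarrow> nat \<Rightarrow> nat \<Rightarrow> (nat \<Rightarrow> nat \<Rightarrow> int) \<Rightarrow> bool" where
  "wdeg q n t c \<longleftrightarrow> (\<forall>b<q. \<forall>a<q. a + (n - 1) * b > t \<longrightarrow> c b a = 0)"

lemma wdeg_dy: "wdeg q n t c \<Longrightarrow> wdeg q n t (dy q c)"
  by (auto simp: wdeg_def dy_def)

lemma degree_sum_le':
  "(\<And>i. i \<in> A \<Longrightarrow> degree (f i :: int poly) \<le> d) \<Longrightarrow> degree (sum f A) \<le> d"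
  by (induction A rule: infinite_finite_induct) (auto intro: degree_add_le)

lemma degree_bev:
  assumes "wdeg q n t c" "degree P \<le> n - 1"
  shows "degree (bev q c [:0, 1:] P) \<le> t"
proof -
  have "degree (smult (c b a) ([:0, 1:] ^ a * P ^ b)) \<le> t" if "b < q" "a < q" for a b
  proof (cases "c b a = 0")
    case False
    then have *: "a + (n - 1) * b \<le> t" using assms(1) that by (force simp: wdeg_def)
    have "degree ([:0, 1:] ^ a * P ^ b) \<le> degree ([:0, 1::int:] ^ a) + degree (P ^ b)"
      by (rule degree_mult_le)
    also have "\<dots> \<le> a + degree P * b"
      by (intro add_mono degree_power_le) (use degree_power_le[of "[:0, 1::int:]" a] in simp)
    also have "\<dots> \<le> a + (n - 1) * b" using assms(2) by simp
    finally show ?thesis using * by (meson degree_smult_le le_trans)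
  qed simp
  then show ?thesis unfolding bev_def by (intro degree_sum_le') auto
qed

lemma poly_bev: "poly (bev q c X Y) r = (\<Sum>b<q. \<Sum>a<q. c b a * poly X r ^ a * poly Y r ^ b)"
  by (simp add: bev_def poly_sum mult.assoc)

lemma pcompose_power: "pcompose (f ^ k) g = pcompose f g ^ k" for f g :: "int poly"
  by (induction k) (simp_all add: pcompose_mult pcompose_1)

lemma pcompose_bev: "pcompose (bev q c X Y) Z = bev q c (pcompose X Z) (pcompose Y Z)"
  by (simp add: bev_def pcompose_sum pcompose_smult pcompose_mult pcompose_power)

lemma pz_pcompose: "pz q f \<Longrightarrow> pz q (pcompose f g)"
proof -
  assume "pz q f"
  then obtain h where "f = [:q:] * h" unfolding pz_iff by blast
  then have "pcompose f g = [:q:] * pcompose h g" by (simp add: pcompose_smult)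
  then show ?thesis unfolding pz_iff by (rule dvdI)
qed

text \<open>Synthetic division at a root modulo \<open>q\<close> leaves a remainder divisible by
  \<open>q\<close>. At any other point \<open>s\<close> of \<open>R\<close> the factor
  \<open>s - r\<close> is invertible modulo \<open>q\<close>, so the quotient vanishes
  there.\<close>

lemma pz_few_roots:
  fixes f :: "int poly" and q :: nat
  assumes q: "prime q" and f: "degree f \<le> t" "R \<subseteq> {..<q}" "card R > t"
    and R: "\<And>r. r \<in> R \<Longrightarrow> int q dvd poly f (int r)"
  shows "pz q f"
  using f R
proof (induction t arbitrary: f R)
  case 0
  then obtain r where r: "r \<in> R" by fastforce
  from 0 obtain a where "f = [:a:]" by (metis degree_0_id le_zero_eq)
  then show ?case using 0(4)[OF r] by (auto simp: pz_def coeff_pCons split: nat.splits)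
next
  case (Suc t)
  from Suc.prems obtain r where r: "r \<in> R" by fastforce
  define g where "g = synthetic_div f (int r)"
  have fg: "f = [:- int r, 1:] * g + [:poly f (int r):]"
    using synthetic_div_correct'[of "int r" f] by (simp add: g_def)
  have "finite R" using Suc.prems(2) finite_subset by blast
  have "pz q g"
  proof (rule Suc.IH[of g "R - {r}"])
    show "degree g \<le> t" using Suc.prems(1) by (simp add: g_def degree_synthetic_div)
    show "card (R - {r}) > t" using Suc.prems(3) r \<open>finite R\<close> by simp
    fix s assume s: "s \<in> R - {r}"
    have "poly f (int s) = (int s - int r) * poly g (int s) + poly f (int r)"
      by (subst fg) (simp add: algebra_simps)
    then have "int q dvd (int s - int r) * poly g (int s)"
      using Suc.prems(4) s r by (metis DiffD1 dvd_add_left_iff)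
    moreover have "\<not> int q dvd int s - int r"
    proof
      assume "int q dvd int s - int r"
      then have "[int s = int r] (mod int q)" by (simp add: cong_iff_dvd_diff)
      then have "[s = r] (mod q)" by (simp only: cong_int_iff)
      then have "s mod q = r mod q" by (simp only: cong_def)
      then show False using s r Suc.prems(2) by (metis DiffD1 DiffD2 insertI1 lessThan_iff mod_less subsetD)
    qed
    ultimately show "int q dvd poly g (int s)" using q prime_dvd_mult_iff[of "int q"] by auto
  qed (use Suc.prems in auto)
  moreover have "pz q [:poly f (int r):]" using Suc.prems(4)[OF r] by (auto simp: pz_def coeff_pCons split: nat.splits)
  ultimately show ?case unfolding pz_iff by (subst fg) (intro dvd_add dvd_mult)
qed

lemma dvd_power_diff: "(d::int) dvd x - y \<Longrightarrow> d dvd x ^ k - y ^ k"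
  unfolding power_diff_sumr2[of x k y] by (rule dvd_mult2)

text \<open>Where \<open>P\<close> agrees with the word, \<open>Q (r, P (r))\<close> is congruent to
  \<open>Q (r, y r)\<close>, which vanishes by interpolation. These are more zeros than the degree
  of \<open>Q (x, P (x))\<close> allows.\<close>

lemma bev_root:
  assumes "prime q" "wdeg q n t c" "degree P \<le> n - 1"
    and "card {r. r < q \<and> int q dvd poly P (int r) - int (y r)} > t"
    and "\<And>r. r < q \<Longrightarrow> int q dvd (\<Sum>b<q. \<Sum>a<q. c b a * int r ^ a * int (y r) ^ b)"
  shows "pz q (bev q c [:0, 1:] P)"
proof (rule pz_few_roots[OF assms(1) degree_bev[OF assms(2,3)] _ assms(4)])
  fix r assume r: "r \<in> {r. r < q \<and> int q dvd poly P (int r) - int (y r)}"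
  have "int q dvd (\<Sum>b<q. \<Sum>a<q. c b a * int r ^ a * poly P (int r) ^ b) -
      (\<Sum>b<q. \<Sum>a<q. c b a * int r ^ a * int (y r) ^ b)"
    unfolding sum_subtractf[symmetric] right_diff_distrib[symmetric]
    using r by (intro dvd_sum dvd_mult dvd_power_diff) auto
  from dvd_add[OF this assms(5)[of r]] show "int q dvd poly (bev q c [:0, 1:] P) (int r)"
    using r by (simp add: poly_bev)
qed auto

text \<open>If \<open>d\<close> is the degree of \<open>Q\<close> in \<open>y\<close> modulo
  \<open>q\<close>, deriving \<open>d\<close> times leaves \<open>d!\<close> times the leading
  coefficient, a nonzero polynomial in \<open>x\<close> alone. So the derivatives, evaluated at
  \<open>y = P (x)\<close>, begin with zero and reach something nonzero, and there is an order at
  which they switch.\<close>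

lemma bev_derivative_switch:
  fixes q :: nat
  assumes q: "prime q" and root: "pz q (bev q c [:0, 1:] P)"
    and nz: "b\<^sub>0 < q" "a\<^sub>0 < q" "\<not> int q dvd c b\<^sub>0 a\<^sub>0"
  shows "\<exists>h<q. pz q (bev q ((dy q ^^ h) c) [:0, 1:] P) \<and> \<not> pz q (bev q (dy q ((dy q ^^ h) c)) [:0, 1:] P)"
proof -
  define d where "d = Max {b. b < q \<and> (\<exists>a<q. \<not> int q dvd c b a)}"
  have ne: "{b. b < q \<and> (\<exists>a<q. \<not> int q dvd c b a)} \<noteq> {}" using nz by blast
  have "d \<in> {b. b < q \<and> (\<exists>a<q. \<not> int q dvd c b a)}" unfolding d_def by (rule Max_in) (use ne in auto)
  then obtain a1 where d: "d < q" "a1 < q" "\<not> int q dvd c d a1" by auto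
  have top: "int q dvd c b a" if "b > d" "b < q" "a < q" for b a
  proof (rule ccontr)
    assume "\<not> int q dvd c b a"
    then have "b \<le> d" unfolding d_def by (intro Max_ge) (use that in auto)
    then show False using that by simp
  qed
  \<comment> \<open>Each derivation moves the top row down by one and multiplies it by a number
    between 1 and \<open>q - 1\<close>, so its entry in column \<open>a1\<close> never becomes
    divisible by \<open>q\<close>.\<close>
  have *: "\<not> int q dvd (dy q ^^ h) c (d - h) a1 \<and> (\<forall>b a. d - h < b \<longrightarrow> b < q \<longrightarrow> a < q \<longrightarrow> int q dvd (dy q ^^ h) c b a)"
    if "h \<le> d" for h
    using that
  proof (induction h)
    case 0
    then show ?case using d top by auto
  next
    case (Suc h)
    let ?e = "(dy q ^^ h) c"
    have e: "\<not> int q dvd ?e (d - h) a1" "\<And>b a. d - h < b \<Longrightarrow> b < q \<Longrightarrow> a < q \<Longrightarrow> int q dvd ?e b a"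
      using Suc by auto
    have s: "Suc (d - Suc h) = d - h" using Suc.prems by simp
    have "\<not> int q dvd int (d - h)" using Suc.prems d by (auto dest: zdvd_imp_le)
    then have "\<not> int q dvd int (d - h) * ?e (d - h) a1"
      using e(1) q prime_dvd_mult_iff[of "int q"] by auto
    then have "\<not> int q dvd dy q ?e (d - Suc h) a1"
      using s d by (simp add: dy_def dvd_mod_iff)
    moreover have "int q dvd dy q ?e b a" if "d - Suc h < b" "b < q" "a < q" for b a
      using e(2)[of "Suc b" a] that by (auto simp: dy_def dvd_mod_iff)
    ultimately show ?case by simp
  qed
  let ?G = "\<lambda>h. bev q ((dy q ^^ h) c) [:0, 1:] P"
  have "\<not> pz q (?G d)"
  proof
    assume a: "pz q (?G d)"
    let ?e = "(dy q ^^ d) c"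
    have e: "int q dvd ?e b a" if "0 < b" "b < q" "a < q" for b a
      using *[of d] that by auto
    have "pz q (\<Sum>b\<in>{..<q} - {0}. \<Sum>a<q. smult (?e b a) ([:0, 1:] ^ a * P ^ b))"
      by (intro pz_sum) (auto simp: pz_def intro!: dvd_mult2 e)
    moreover have "?G d = (\<Sum>a<q. smult (?e 0 a) ([:0, 1:] ^ a)) +
        (\<Sum>b\<in>{..<q} - {0}. \<Sum>a<q. smult (?e b a) ([:0, 1:] ^ a * P ^ b))"
      unfolding bev_def using nz by (subst sum.remove[of _ 0]) auto
    ultimately have "pz q (\<Sum>a<q. smult (?e 0 a) ([:0, 1:] ^ a))"
      using a unfolding pz_iff by (simp only: dvd_add_left_iff)
    then have "int q dvd coeff (\<Sum>a<q. smult (?e 0 a) ([:0, 1:] ^ a)) a1" by (simp add: pz_def)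
    moreover have "coeff (\<Sum>a<q. smult (?e 0 a) ([:0, 1:] ^ a)) a1 = ?e 0 a1"
      using d(2) by (simp add: coeff_sum monom_altdef[symmetric] x_as_monom monom_power if_distrib sum.delta cong: if_cong)
    ultimately show False using *[of d] by simp
  qed
  moreover have "pz q (?G 0)" using root by simp
  ultimately have "\<exists>h<d. pz q (?G h) \<and> \<not> pz q (?G (Suc h))"
  proof (induction d)
    case (Suc d)
    then show ?case by (cases "pz q (?G d)") (auto simp: less_Suc_eq)
  qed simp
  then show ?thesis using d(1) by (auto intro: less_trans)
qed

lemma exists_simple_point:
  fixes q :: nat
  assumes "prime q" "wdeg q n t c" "degree P \<le> n - 1" "t < q" "\<not> pz q (bev q (dy q c) [:0, 1:] P)"
  shows "\<exists>x0<q. \<not> int q dvd poly (bev q (dy q c) [:0, 1:] P) (int x0)"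
proof (rule ccontr)
  assume "\<not> ?thesis"
  then have "pz q (bev q (dy q c) [:0, 1:] P)"
    by (intro pz_few_roots[OF assms(1) degree_bev[OF wdeg_dy[OF assms(2)] assms(3)], of "{..<q}"])
       (use assms in auto)
  then show False using assms by simp
qed

section \<open>Newton lifting modulo a prime\<close>

lemma dvd_diff_obtain:
  assumes "(q::int) dvd a - b"
  obtains u where "a = b + q * u"
proof -
  from assms obtain u where "a - b = q * u" ..
  then show thesis by (intro that[of u]) simp
qed

text \<open>The first-order expansion of \<open>A ^ b - B ^ b\<close>: as \<open>A - B\<close>
  starts at order \<open>k \<ge> 1\<close> modulo \<open>q\<close>, its square does not reach order
  \<open>k\<close>, and in the linear term only constant coefficients of \<open>B\<close>
  contribute.\<close>

lemma coeff_power_diff: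
  fixes A B :: "int poly"
  assumes "teq q k A B" "k \<ge> 1"
  shows "teq q k (A ^ b) (B ^ b) \<and>
    q dvd (coeff (A ^ b) k - coeff (B ^ b) k) - int b * coeff B 0 ^ (b - 1) * (coeff A k - coeff B k)"
proof (induction b)
  case (Suc b)
  have c0: "q dvd coeff (A ^ b) 0 - coeff (B ^ b) 0" "q dvd coeff A 0 - coeff B 0"
    using teq_power[OF assms(1), of b] assms by (auto simp: teq_def)
  define D where "D = coeff A k - coeff B k"
  have k: "coeff (F * G) k = coeff F 0 * coeff G k + (\<Sum>i\<in>{1..<k}. coeff F i * coeff G (k - i)) + coeff F k * coeff G 0"
    for F G :: "int poly"
  proof -
    have "{..k} = insert 0 (insert k {1..<k})" using assms(2) by auto
    then show ?thesis using assms(2) by (simp add: coeff_mult)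
  qed
  have mid: "q dvd (\<Sum>i\<in>{1..<k}. coeff A i * coeff (A ^ b) (k - i)) - (\<Sum>i\<in>{1..<k}. coeff B i * coeff (B ^ b) (k - i))"
    unfolding sum_subtractf[symmetric]
  proof (intro dvd_sum)
    fix i assume i: "i \<in> {1..<k}"
    have "q dvd coeff A i - coeff B i" "q dvd coeff (A ^ b) (k - i) - coeff (B ^ b) (k - i)"
      using i assms(1) teq_power[OF assms(1), of b] by (auto simp: teq_def)
    then have "q dvd (coeff A i - coeff B i) * coeff (A ^ b) (k - i) + coeff B i * (coeff (A ^ b) (k - i) - coeff (B ^ b) (k - i))"
      by (intro dvd_add dvd_mult2 dvd_mult)
    then show "q dvd coeff A i * coeff (A ^ b) (k - i) - coeff B i * coeff (B ^ b) (k - i)"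
      by (simp add: algebra_simps)
  qed
  obtain u where u: "coeff A 0 = coeff B 0 + q * u" using c0(2) by (rule dvd_diff_obtain)
  obtain v where v: "coeff (A ^ b) 0 = coeff (B ^ b) 0 + q * v" using c0(1) by (rule dvd_diff_obtain)
  have "q dvd coeff (A ^ b) k - (coeff (B ^ b) k + int b * coeff B 0 ^ (b - 1) * D)"
    using Suc unfolding D_def by (simp only: diff_diff_eq)
  then obtain w where w: "coeff (A ^ b) k = coeff (B ^ b) k + int b * coeff B 0 ^ (b - 1) * D + q * w"
    by (rule dvd_diff_obtain)
  obtain z where z: "(\<Sum>i\<in>{1..<k}. coeff A i * coeff (A ^ b) (k - i)) = (\<Sum>i\<in>{1..<k}. coeff B i * coeff (B ^ b) (k - i)) + q * z"
    using mid by (rule dvd_diff_obtain)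
  have B0: "coeff (B ^ b) 0 = coeff B 0 ^ b" by (simp add: coeff_0_power)
  have pw: "coeff B 0 * (int b * coeff B 0 ^ (b - 1)) = int b * coeff B 0 ^ b" by (cases b) auto
  have Ak: "coeff A k = coeff B k + D" by (simp add: D_def)
  \<comment> \<open>With explicit witnesses for all congruences the induction step is a ring
    identity. The last summand is zero by \<open>pw\<close>, which also covers the truncated
    exponent at \<open>b = 0\<close>.\<close>
  have "coeff (A ^ Suc b) k - coeff (B ^ Suc b) k - int (Suc b) * coeff B 0 ^ (Suc b - 1) * D =
     q * (u * coeff (A ^ b) k + coeff B 0 * w + z + coeff A k * v)
     + D * (coeff B 0 * (int b * coeff B 0 ^ (b - 1)) - int b * coeff B 0 ^ b)"
    unfolding power_Suc k u v w z Ak B0 by (simp add: algebra_simps)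
  then have "q dvd coeff (A ^ Suc b) k - coeff (B ^ Suc b) k - int (Suc b) * coeff B 0 ^ (Suc b - 1) * D"
    unfolding pw by simp
  then show ?case using teq_power[OF assms(1)] unfolding D_def by blast
qed simp

text \<open>Taylor expansion of \<open>Q\<close> in \<open>y\<close>: the coefficient of order
  \<open>k\<close> reacts linearly to that of the series, with the value of the derivative at
  \<open>(x0, coeff B 0)\<close> as slope.\<close>

lemma coeff_bev_diff:
  fixes A B :: "int poly" and q :: nat
  assumes "teq q k A B" "k \<ge> 1"
  shows "int q dvd (coeff (bev q c [:x0, 1:] A) k - coeff (bev q c [:x0, 1:] B) k)
     - (\<Sum>b<q. \<Sum>a<q. dy q c b a * x0 ^ a * coeff B 0 ^ b) * (coeff A k - coeff B k)"
proof -
  define D where "D = coeff A k - coeff B k"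
  let ?X = "[:x0, 1:]"
  have trm: "int q dvd coeff (?X ^ a * A ^ b) k - coeff (?X ^ a * B ^ b) k - x0 ^ a * (int b * coeff B 0 ^ (b - 1)) * D" for a b
  proof -
    have s: "coeff (?X ^ a * F) k = x0 ^ a * coeff F k + (\<Sum>i\<in>{1..k}. coeff (?X ^ a) i * coeff F (k - i))" for F
    proof -
      have "{..k} = insert 0 {1..k}" by auto
      then show ?thesis by (simp add: coeff_mult coeff_0_power)
    qed
    have cp: "teq q k (A ^ b) (B ^ b)"
      "int q dvd (coeff (A ^ b) k - coeff (B ^ b) k) - int b * coeff B 0 ^ (b - 1) * D"
      using coeff_power_diff[OF assms, of b] by (auto simp: D_def)
    have "int q dvd (\<Sum>i\<in>{1..k}. coeff (?X ^ a) i * (coeff (A ^ b) (k - i) - coeff (B ^ b) (k - i)))"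
      using cp(1) assms(2) by (intro dvd_sum dvd_mult) (auto simp: teq_def)
    then have "int q dvd x0 ^ a * ((coeff (A ^ b) k - coeff (B ^ b) k) - int b * coeff B 0 ^ (b - 1) * D) +
       (\<Sum>i\<in>{1..k}. coeff (?X ^ a) i * (coeff (A ^ b) (k - i) - coeff (B ^ b) (k - i)))"
      by (intro dvd_add dvd_mult cp(2))
    then show ?thesis unfolding s by (simp add: algebra_simps sum_subtractf)
  qed
  have "int q dvd (\<Sum>b<q. \<Sum>a<q. c b a * (coeff (?X ^ a * A ^ b) k - coeff (?X ^ a * B ^ b) k - x0 ^ a * (int b * coeff B 0 ^ (b - 1)) * D))"
    by (intro dvd_sum dvd_mult trm)
  then have 1: "int q dvd (coeff (bev q c ?X A) k - coeff (bev q c ?X B) k) -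
      (\<Sum>b<q. \<Sum>a<q. int b * c b a * x0 ^ a * coeff B 0 ^ (b - 1)) * D"
    unfolding bev_def coeff_sum coeff_smult
    by (simp add: algebra_simps sum_subtractf sum_distrib_left sum_distrib_right)
  \<comment> \<open>Passes from the plain derivative to \<open>dy\<close>: the term for
    \<open>b = 0\<close> vanishes, the others are shifted by one, and reduction modulo
    \<open>q\<close> does no harm.\<close>
  have "int q dvd (\<Sum>b<q. \<Sum>a<q. int b * c b a * x0 ^ a * coeff B 0 ^ (b - 1)) -
      (\<Sum>b<q. \<Sum>a<q. dy q c b a * x0 ^ a * coeff B 0 ^ b)"
  proof (cases q)
    case (Suc q')
    have "(\<Sum>b<q. \<Sum>a<q. int b * c b a * x0 ^ a * coeff B 0 ^ (b - 1)) =
        (\<Sum>b<q'. \<Sum>a<q. int (Suc b) * c (Suc b) a * x0 ^ a * coeff B 0 ^ b)"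
      unfolding Suc by (subst sum.lessThan_Suc_shift) simp
    moreover have "(\<Sum>b<q. \<Sum>a<q. dy q c b a * x0 ^ a * coeff B 0 ^ b) =
        (\<Sum>b<q'. \<Sum>a<q. dy q c b a * x0 ^ a * coeff B 0 ^ b)"
      by (simp add: Suc dy_def)
    moreover have "int q dvd (\<Sum>b<q'. \<Sum>a<q. (int (Suc b) * c (Suc b) a - dy q c b a) * (x0 ^ a * coeff B 0 ^ b))"
      by (intro dvd_sum dvd_mult2) (simp add: dy_def Suc dvd_minus_mod)
    moreover have "(\<Sum>b<q'. \<Sum>a<q. (int (Suc b) * c (Suc b) a - dy q c b a) * (x0 ^ a * coeff B 0 ^ b)) =
        (\<Sum>b<q'. \<Sum>a<q. int (Suc b) * c (Suc b) a * x0 ^ a * coeff B 0 ^ b) -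
        (\<Sum>b<q'. \<Sum>a<q. dy q c b a * x0 ^ a * coeff B 0 ^ b)"
      unfolding sum_subtractf[symmetric] by (intro sum.cong refl) (simp only: left_diff_distrib mult.assoc)
    ultimately show ?thesis by (simp only:)
  qed simp
  then have "int q dvd ((\<Sum>b<q. \<Sum>a<q. int b * c b a * x0 ^ a * coeff B 0 ^ (b - 1)) -
      (\<Sum>b<q. \<Sum>a<q. dy q c b a * x0 ^ a * coeff B 0 ^ b)) * D" by (rule dvd_mult2)
  with 1 have "int q dvd ((coeff (bev q c ?X A) k - coeff (bev q c ?X B) k) -
      (\<Sum>b<q. \<Sum>a<q. int b * c b a * x0 ^ a * coeff B 0 ^ (b - 1)) * D) +
      ((\<Sum>b<q. \<Sum>a<q. int b * c b a * x0 ^ a * coeff B 0 ^ (b - 1)) -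
      (\<Sum>b<q. \<Sum>a<q. dy q c b a * x0 ^ a * coeff B 0 ^ b)) * D" by (rule dvd_add)
  then show ?thesis by (simp add: D_def algebra_simps)
qed

text \<open>Newton lifting: at a simple point, the next coefficient of a root is determined by the preceding ones.\<close>

lemma lift_unique:
  fixes q :: nat
  assumes q: "prime q" and root: "pz q (bev q c [:0, 1:] P)"
    and simple: "\<not> int q dvd poly (bev q (dy q c) [:0, 1:] P) (int x0)"
    and A: "teq q k A (pcompose P [:int x0, 1:])" "k \<ge> 1"
  shows "int q dvd coeff (bev q c [:int x0, 1:] A) k \<longleftrightarrow> int q dvd coeff A k - coeff (pcompose P [:int x0, 1:]) k"
proof -
  let ?B = "pcompose P [:int x0, 1:]"
  have "pz q (pcompose (bev q c [:0, 1:] P) [:int x0, 1:])" by (rule pz_pcompose[OF root])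
  then have "pz q (bev q c [:int x0, 1:] ?B)" by (simp add: pcompose_bev pcompose_pCons)
  then have 1: "int q dvd coeff (bev q c [:int x0, 1:] ?B) k" by (simp add: pz_def)
  have "coeff ?B 0 = poly P (int x0)" by (simp add: poly_0_coeff_0[symmetric] poly_pcompose)
  then have "(\<Sum>b<q. \<Sum>a<q. dy q c b a * int x0 ^ a * coeff ?B 0 ^ b) = poly (bev q (dy q c) [:0, 1:] P) (int x0)"
    by (simp add: poly_bev)
  with coeff_bev_diff[OF A, of c "int x0"]
  have 2: "int q dvd (coeff (bev q c [:int x0, 1:] A) k - coeff (bev q c [:int x0, 1:] ?B) k)
     - poly (bev q (dy q c) [:0, 1:] P) (int x0) * (coeff A k - coeff ?B k)" by simp
  have "int q dvd coeff (bev q c [:int x0, 1:] A) k \<longleftrightarrow>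
     int q dvd poly (bev q (dy q c) [:0, 1:] P) (int x0) * (coeff A k - coeff ?B k)"
  proof -
    have "int q dvd coeff (bev q c [:int x0, 1:] A) k -
        poly (bev q (dy q c) [:0, 1:] P) (int x0) * (coeff A k - coeff ?B k)"
      using dvd_add[OF 2 1] by (simp add: algebra_simps)
    then show ?thesis using dvd_add_left_iff[of "int q"] by (metis diff_add_cancel dvd_add_right_iff)
  qed
  also have "\<dots> \<longleftrightarrow> int q dvd coeff A k - coeff ?B k"
    using simple q prime_dvd_mult_iff[of "int q"] by auto
  finally show ?thesis .
qed

text \<open>Lattice points under the line \<open>a + k * b = t\<close>, with
  \<open>k = n - 1\<close>, number at least \<open>(t + 1)\<twosuperior> / (2 * k)\<close>.
  Exceeding \<open>q\<close> leaves a nonzero solution of the \<open>q\<close> interpolation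
  conditions.\<close>

lemma monomial_count:
  fixes n t q :: nat
  assumes "2 \<le> n" "t < q" "real t + 1 > sqrt (2 * (real n - 1) * real q)"
  shows "card {(b, a). b < q \<and> a < q \<and> a + (n - 1) * b \<le> t} > q"
proof -
  define k where "k = n - 1"
  have k: "k \<ge> 1" "real n - 1 = real k" using assms by (auto simp: k_def of_nat_diff)
  define B where "B = t div k"
  have Bt: "k * B \<le> t" "t < k * (B + 1)" using k dividend_less_times_div[of k t] by (simp_all add: B_def)
  have B: "B \<le> t" using k Bt(1) by (metis le_trans mult_le_mono1 nat_mult_1)
  have "{(b, a). b < q \<and> a < q \<and> a + k * b \<le> t} = (SIGMA b:{..B}. {..t - k * b})"
  proof (rule Set.set_eqI)
    fix p :: "nat \<times> nat"
    obtain b a where p: "p = (b, a)" by fastforce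
    have "b \<le> B \<longleftrightarrow> k * b \<le> t" using k by (simp add: B_def less_eq_div_iff_mult_less_eq mult.commute)
    moreover have "b \<le> t" if "k * b \<le> t" using that k by (metis le_trans mult_le_mono1 nat_mult_1)
    ultimately show "p \<in> {(b, a). b < q \<and> a < q \<and> a + k * b \<le> t} \<longleftrightarrow> p \<in> (SIGMA b:{..B}. {..t - k * b})"
      using assms(2) by (auto simp: p)
  qed
  then have card: "card {(b, a). b < q \<and> a < q \<and> a + k * b \<le> t} = (\<Sum>b\<le>B. t - k * b + 1)"
    by simp
  have "real (\<Sum>b\<le>B. t - k * b + 1) = (\<Sum>b\<le>B. real t + 1 - real k * real b)"
    unfolding of_nat_sum
  proof (intro sum.cong refl)
    fix b assume "b \<in> {..B}"
    then have "k * b \<le> t" using Bt(1) by (meson atMost_iff le_trans mult_le_mono2)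
    then show "real (t - k * b + 1) = real t + 1 - real k * real b" by (simp add: of_nat_diff)
  qed
  also have "\<dots> = (real B + 1) * (real t + 1 - real k * real B / 2)"
  proof -
    have "(\<Sum>b\<le>B. real b) = real B * (real B + 1) / 2" by (induction B) (auto simp: field_simps)
    moreover have *: "(\<Sum>b\<le>B. real t + 1 - real k * real b) = (real B + 1) * (real t + 1) - real k * (\<Sum>b\<le>B. real b)"
      by (simp add: sum_subtractf sum_distrib_left algebra_simps)
    ultimately show ?thesis unfolding * by (simp add: field_simps)
  qed
  finally have eq: "real (\<Sum>b\<le>B. t - k * b + 1) = (real B + 1) * (real t + 1 - real k * real B / 2)" .
  have kb: "real k * real B \<le> real t" using Bt(1) by (metis of_nat_le_iff of_nat_mult)
  have "t + 1 \<le> k * (B + 1)" using Bt(2) by simp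
  then have kb2: "real t + 1 \<le> real k * (real B + 1)" by (metis of_nat_1 of_nat_add of_nat_le_iff of_nat_mult)
  have "2 * real k * real q < (real t + 1)\<^sup>2"
  proof -
    have "sqrt (2 * real k * real q) < real t + 1" using assms(3) k by simp
    then have "(sqrt (2 * real k * real q))\<^sup>2 < (real t + 1)\<^sup>2" by (intro power_strict_mono) auto
    then show ?thesis by simp
  qed
  \<comment> \<open>Both factors are at least \<open>t + 1\<close>: the one since
    \<open>t < k * (B + 1)\<close>, the other since \<open>k * B \<le> t\<close>.\<close>
  also have "\<dots> \<le> real k * (real B + 1) * (2 * (real t + 1 - real k * real B / 2))"
    unfolding power2_eq_square using kb kb2 by (intro mult_mono) auto
  finally have "real k * real q < real k * ((real B + 1) * (real t + 1 - real k * real B / 2))"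
  proof -
    assume *: "2 * real k * real q < real k * (real B + 1) * (2 * (real t + 1 - real k * real B / 2))"
    define X where "X = real t + 1 - real k * real B / 2"
    have "2 * (real k * real q) < 2 * (real k * ((real B + 1) * X))"
      using * unfolding X_def[symmetric] by (simp only: mult_ac)
    then show ?thesis unfolding X_def by simp
  qed
  then have "real q < real (\<Sum>b\<le>B. t - k * b + 1)" using eq k by simp
  then have "q < (\<Sum>b\<le>B. t - k * b + 1)" by (simp only: of_nat_less_iff)
  then show ?thesis using card by (simp only: k_def)
qed

section \<open>Solving a homogeneous linear system\<close>

text \<open>Position \<open>i = b * q + a\<close> stands for \<open>x ^ a * y ^ b\<close>, so that a
  bivariate polynomial is a vector of length \<open>q * q\<close>.\<close>

definition bmon :: "nat \<Rightarrow> nat \<Rightarrow> nat \<Rightarrow> nat \<Rightarrow> int" where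
  "bmon q x y i = int x ^ (i mod q) * int y ^ (i div q)"

definition allowed :: "nat \<Rightarrow> nat \<Rightarrow> nat \<Rightarrow> nat set" where
  "allowed q n t = {i. i < q * q \<and> i mod q + (n - 1) * (i div q) \<le> t}"

definition indep :: "nat \<Rightarrow> nat set \<Rightarrow> (nat \<Rightarrow> nat \<Rightarrow> int) \<Rightarrow> bool" where
  "indep q J v \<longleftrightarrow> (\<forall>c. (\<forall>i<q * q. int q dvd (\<Sum>k\<in>J. c k * v k i)) \<longrightarrow> (\<forall>k\<in>J. int q dvd c k))"

text \<open>
  The vectors \<open>v k\<close> solve the first \<open>R\<close> interpolation conditions, and the nonzero ones among them are
  linearly independent modulo \<open>q\<close>. Each further condition costs at most one vector.
\<close>

definition null_inv :: "nat \<Rightarrow> nat \<Rightarrow> nat \<Rightarrow> (nat \<Rightarrow> nat) \<Rightarrow> nat \<Rightarrow> (nat \<Rightarrow> nat \<Rightarrow> int) \<Rightarrow> bool" where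
  "null_inv q n t y R v \<longleftrightarrow>
     (\<exists>J\<subseteq>{..<q * q}. card (allowed q n t) \<le> card J + R \<and> indep q J v \<and>
        (\<forall>k<q * q. k \<notin> J \<longrightarrow> (\<forall>i<q * q. v k i = 0))) \<and>
     (\<forall>k<q * q. \<forall>i<q * q. i \<notin> allowed q n t \<longrightarrow> v k i = 0) \<and>
     (\<forall>r<R. \<forall>k<q * q. int q dvd (\<Sum>i<q * q. v k i * bmon q r (y r) i))"

lemma null_inv_init:
  assumes v: "\<And>k i. k < q * q \<Longrightarrow> i < q * q \<Longrightarrow> v k i = (if k = i \<and> i \<in> allowed q n t then 1 else 0)"
  shows "null_inv q n t y 0 v"
  unfolding null_inv_def
proof (intro conjI exI[of _ "allowed q n t"])
  have sub: "allowed q n t \<subseteq> {..<q * q}" by (auto simp: allowed_def)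
  show "indep q (allowed q n t) v" unfolding indep_def
  proof (intro allI impI ballI)
    fix c k assume h: "\<forall>i<q * q. int q dvd (\<Sum>k\<in>allowed q n t. c k * v k i)" and k: "k \<in> allowed q n t"
    have "k < q * q" using sub k by auto
    then have "(\<Sum>j\<in>allowed q n t. c j * v j k) = (\<Sum>j\<in>allowed q n t. if j = k then c j else 0)"
      using sub k by (intro sum.cong) (auto simp: v)
    also have "\<dots> = c k" using k finite_subset[OF sub] by simp
    finally show "int q dvd c k" using h \<open>k < q * q\<close> by metis
  qed
qed (auto simp: v allowed_def)

lemma null_inv_skip:
  assumes "null_inv q n t y R v" "\<And>k. k < q * q \<Longrightarrow> int q dvd (\<Sum>i<q * q. v k i * bmon q R (y R) i)"
  shows "null_inv q n t y (Suc R) v"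
proof -
  obtain J where "J \<subseteq> {..<q * q}" "card (allowed q n t) \<le> card J + R" "indep q J v"
    "\<forall>k<q * q. k \<notin> J \<longrightarrow> (\<forall>i<q * q. v k i = 0)" using assms(1) unfolding null_inv_def by blast
  then show ?thesis using assms unfolding null_inv_def
    by (intro conjI exI[of _ J]) (auto simp: less_Suc_eq)
qed

text \<open>Elimination without division: \<open>d p * v k - d k * v p\<close> vanishes at the new
  point too, and no inverse modulo \<open>q\<close> has to be computed. The pivot vector turns into
  zero and leaves \<open>J\<close>.\<close>

lemma null_inv_step:
  fixes q :: nat
  assumes q: "prime q" and inv: "null_inv q n t y R v"
    and d: "\<And>k. k < q * q \<Longrightarrow> int q dvd d k - (\<Sum>i<q * q. v k i * bmon q R (y R) i)"
    and p: "p < q * q" "\<not> int q dvd d p"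
    and v': "\<And>k i. k < q * q \<Longrightarrow> i < q * q \<Longrightarrow> v' k i = (d p * v k i - d k * v p i) mod int q"
  shows "null_inv q n t y (Suc R) v'"
proof -
  obtain J where J: "J \<subseteq> {..<q * q}" "card (allowed q n t) \<le> card J + R" "indep q J v"
    "\<forall>k<q * q. k \<notin> J \<longrightarrow> (\<forall>i<q * q. v k i = 0)" using inv unfolding null_inv_def by blast
  have fin: "finite J" using J(1) finite_subset by blast
  have d0: "int q dvd d k" if "k < q * q" "k \<notin> J" for k
    using d[OF that(1)] J(4) that by simp
  have pJ: "p \<in> J" using d0[of p] p by blast
  have v'c: "int q dvd v' k i - (d p * v k i - d k * v p i)" if "k < q * q" "i < q * q" for k i
    unfolding v'[OF that] using dvd_minus_mod[of "int q" "d p * v k i - d k * v p i"]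
    by (subst dvd_diff_commute)
  have supp: "v' k i = 0" if "k < q * q" "i < q * q" "i \<notin> allowed q n t" for k i
    using inv that p unfolding null_inv_def v'[OF that(1,2)] by simp
  have zero: "v' k i = 0" if "k < q * q" "k \<notin> J - {p}" "i < q * q" for k i
  proof (cases "k = p")
    case False
    then have "k \<notin> J" using that by simp
    then show ?thesis using J(4) that d0[OF that(1)] unfolding v'[OF that(1,3)] by simp
  qed (use v'[OF p(1) that(3)] in simp)
  have ind: "indep q (J - {p}) v'" unfolding indep_def
  proof (intro allI impI)
    fix c assume h: "\<forall>i<q * q. int q dvd (\<Sum>k\<in>J - {p}. c k * v' k i)"
    \<comment> \<open>A relation among the new vectors, rewritten for the old ones; the pivot
      collects all subtracted multiples.\<close>
    define c' where "c' k = (if k = p then - (\<Sum>k\<in>J - {p}. c k * d k) else c k * d p)" for k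
    have "int q dvd (\<Sum>k\<in>J. c' k * v k i)" if i: "i < q * q" for i
    proof -
      have "(\<Sum>k\<in>J. c' k * v k i) = c' p * v p i + (\<Sum>k\<in>J - {p}. c' k * v k i)"
        by (rule sum.remove[OF fin pJ])
      also have "(\<Sum>k\<in>J - {p}. c' k * v k i) = (\<Sum>k\<in>J - {p}. c k * d p * v k i)"
        by (intro sum.cong) (auto simp: c'_def)
      also have "c' p * v p i + (\<Sum>k\<in>J - {p}. c k * d p * v k i) = (\<Sum>k\<in>J - {p}. c k * (d p * v k i - d k * v p i))"
        by (simp add: c'_def sum_distrib_right sum_subtractf right_diff_distrib mult.assoc)
      finally have eq: "(\<Sum>k\<in>J. c' k * v k i) = (\<Sum>k\<in>J - {p}. c k * (d p * v k i - d k * v p i))" .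
      have "int q dvd (\<Sum>k\<in>J - {p}. c k * (v' k i - (d p * v k i - d k * v p i)))"
        using J(1) i by (intro dvd_sum dvd_mult v'c) auto
      then have "int q dvd (\<Sum>k\<in>J - {p}. c k * v' k i) - (\<Sum>k\<in>J. c' k * v k i)"
        unfolding eq sum_subtractf[symmetric] by (simp only: right_diff_distrib)
      from dvd_diff[OF h[rule_format, OF i] this] show ?thesis by simp
    qed
    then have c': "\<forall>k\<in>J. int q dvd c' k" using J(3) unfolding indep_def by blast
    show "\<forall>k\<in>J - {p}. int q dvd c k"
    proof (intro ballI)
      fix k assume k: "k \<in> J - {p}"
      with c' have "int q dvd c k * d p" by (auto simp: c'_def)
      then show "int q dvd c k" using p(2) q prime_dvd_mult_iff[of "int q"] by auto
    qed
  qed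
  have lin: "int q dvd (\<Sum>i<q * q. v' k i * M i) - (d p * (\<Sum>i<q * q. v k i * M i) - d k * (\<Sum>i<q * q. v p i * M i))"
    if "k < q * q" for k M
  proof -
    have "int q dvd (\<Sum>i<q * q. (v' k i - (d p * v k i - d k * v p i)) * M i)"
      using that by (intro dvd_sum dvd_mult2 v'c) auto
    then show ?thesis by (simp add: sum_subtractf sum_distrib_left algebra_simps)
  qed
  have vanish: "int q dvd (\<Sum>i<q * q. v' k i * bmon q r (y r) i)" if r: "r < Suc R" and k: "k < q * q" for r k
  proof -
    have "int q dvd d p * (\<Sum>i<q * q. v k i * bmon q r (y r) i) - d k * (\<Sum>i<q * q. v p i * bmon q r (y r) i)"
    proof (cases "r = R")
      case True
      have "int q dvd d k * (d p - (\<Sum>i<q * q. v p i * bmon q R (y R) i)) - d p * (d k - (\<Sum>i<q * q. v k i * bmon q R (y R) i))"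
        by (rule dvd_diff[OF dvd_mult[OF d[OF p(1)]] dvd_mult[OF d[OF k]]])
      then show ?thesis unfolding True by (simp add: algebra_simps)
    next
      case False
      then have "r < R" using r by simp
      then show ?thesis using inv k p(1) unfolding null_inv_def by (intro dvd_diff dvd_mult) auto
    qed
    from dvd_add[OF lin[OF k, of "bmon q r (y r)"] this] show ?thesis by simp
  qed
  show ?thesis unfolding null_inv_def
  proof (intro conjI exI[of _ "J - {p}"])
    show "card (allowed q n t) \<le> card (J - {p}) + Suc R" using J(2) pJ fin by (simp add: card_Diff_singleton)
  qed (use J(1) ind zero supp vanish in auto)
qed

text \<open>After \<open>R\<close> conditions \<open>J\<close> still has an element, and a member of
  an independent family cannot be zero modulo \<open>q\<close>.\<close>

lemma null_inv_nonzero: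
  assumes "null_inv q n t y R v" "card (allowed q n t) > R" "q > 1"
  shows "\<exists>k<q * q. \<exists>i<q * q. \<not> int q dvd v k i"
proof -
  obtain J where J: "J \<subseteq> {..<q * q}" "card (allowed q n t) \<le> card J + R" "indep q J v"
    using assms(1) unfolding null_inv_def by blast
  then have "J \<noteq> {}" using assms(2) by auto
  then obtain k where k: "k \<in> J" by blast
  have fin: "finite J" using J(1) finite_subset by blast
  have "\<exists>i<q * q. \<not> int q dvd v k i"
  proof (rule ccontr)
    assume "\<not> ?thesis"
    then have "\<forall>i<q * q. int q dvd (\<Sum>j\<in>J. of_bool (j = k) * v j i)"
      by (auto intro!: dvd_sum)
    then have "int q dvd of_bool (k = k)" using J(3) k unfolding indep_def by (metis (full_types))
    then show False using assms(3) by (auto dest: zdvd_imp_le)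
  qed
  then show ?thesis using J(1) k by blast
qed

lemma pair_less: "b < q \<Longrightarrow> a < q \<Longrightarrow> b * q + a < q * (q::nat)"
  by (metis add.commute add_less_mono1 less_le_trans mult_Suc mult_le_mono1 Suc_leI mult.commute)

lemma sum_pairs: "(\<Sum>b<q. \<Sum>a<q. f (b * q + a)) = (\<Sum>i<q * (q::nat). (f i :: int))"
proof -
  have "(\<Sum>a<q. f (b * q + a)) = sum f {b * q..<b * q + q}" for b
    using sum.shift_bounds_nat_ivl[of f 0 "b * q" q] by (simp add: lessThan_atLeast0 add.commute)
  then show ?thesis by (simp add: sum.nat_group)
qed

lemma card_allowed:
  "card (allowed q n t) = card {(b, a). b < q \<and> a < q \<and> a + (n - 1) * b \<le> t}"
proof -
  have "allowed q n t = (\<lambda>(b, a). b * q + a) ` {(b, a). b < q \<and> a < q \<and> a + (n - 1) * b \<le> t}"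
  proof (intro equalityI subsetI)
    fix i assume i: "i \<in> allowed q n t"
    then have "q > 0" by (cases q) (auto simp: allowed_def)
    then have "(i div q, i mod q) \<in> {(b, a). b < q \<and> a < q \<and> a + (n - 1) * b \<le> t}"
      using i by (auto simp: allowed_def less_mult_imp_div_less)
    then show "i \<in> (\<lambda>(b, a). b * q + a) ` {(b, a). b < q \<and> a < q \<and> a + (n - 1) * b \<le> t}"
      by (rule rev_image_eqI) simp
  qed (auto simp: allowed_def pair_less)
  moreover have "inj_on (\<lambda>(b, a). b * q + a) {(b, a). b < q \<and> a < q \<and> a + (n - 1) * b \<le> t}"
    by (rule inj_on_inverseI[of _ "\<lambda>i. (i div q, i mod q)"]) auto
  ultimately show ?thesis by (simp add: card_image)
qed

section \<open>The decoding program\<close>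

abbreviation "Skip \<equiv> Set 14 (Lit 0)"
abbreviation "ix b a \<equiv> Add (Mul (V b) (V 2)) (V a)"
abbreviation "vrow k e \<equiv> Add (Mul (Mul (V k) (V 2)) (V 2)) e"

text \<open>
  Variables 0, 2, 7 contain \<open>n\<close>, \<open>q\<close>, \<open>q * q\<close>. The arrays are used as follows.
  \<^item> 17: the received word; 20: the bound on the weighted degree
  \<^item> 40: \<open>q * q\<close> vectors of length \<open>q * q\<close>, which are bivariate polynomials with the coefficient of
    \<open>x ^ a * y ^ b\<close> at position \<open>b * q + a\<close>; 41: the values of the monomials at the point of the word
    under consideration; 42: the values of the polynomials there; 43: the pivot vector
  \<^item> 44: the polynomial \<open>Q\<close> whose roots are to be found; 32, 33: the point \<open>(x\<^sub>0, y\<^sub>0)\<close> at which the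
    lifting starts; 45: the root \<open>p (x\<^sub>0 + x)\<close>; 46: \<open>Q (x\<^sub>0 + x, p (x\<^sub>0 + x))\<close>; 50: \<open>x\<^sub>0 + x\<close>
  \<^item> 51: \<open>p\<close>; 53: \<open>x - x\<^sub>0\<close>; 47, 48, 49, 52: intermediate polynomials
\<close>

definition p_init :: stmt where
  "p_init = For 21 7 (For 23 2 (For 24 2 (
     Ite (Add (Sub (V 21) (ix 23 24)) (Sub (ix 23 24) (V 21)))
       (Assign 40 (vrow 21 (ix 23 24)) (Lit 0))
       (Ite (Sub (Add (V 24) (Mul (V 23) (Sub (V 0) (Lit 1)))) (V 20))
         (Assign 40 (vrow 21 (ix 23 24)) (Lit 0))
         (Assign 40 (vrow 21 (ix 23 24)) (Lit 1))))))"

definition p_mon :: stmt where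
  "p_mon = Set 30 (Lit 1) ;; For 23 2 (
     Set 29 (V 30) ;;
     For 24 2 (Assign 41 (ix 23 24) (V 29) ;; Set 29 (Red (Mul (V 29) (V 25)))) ;;
     Set 30 (Red (Mul (V 30) (Arr 17 (V 25)))))"

definition p_dot :: stmt where
  "p_dot = For 21 7 (Set 26 (Lit 0) ;;
     For 22 7 (Set 26 (Red (Add (V 26) (Mul (Arr 40 (vrow 21 (V 22))) (Arr 41 (V 22)))))) ;;
     Assign 42 (V 21) (V 26))"

text \<open>The last nonzero value wins. If there is none, index 0 remains, whose value is zero as
  well, so \<open>p_elim\<close> can decide by the value at the index alone.\<close>

definition p_pivot :: stmt where
  "p_pivot = Set 27 (Lit 0) ;; For 21 7 (Ite (Arr 42 (V 21)) (Set 27 (V 21)) Skip)"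

text \<open>The pivot row is copied to array 43 because the loop overwrites it;
  \<open>q - d k\<close> stands for \<open>- d k\<close> in the arithmetic of natural
  numbers.\<close>

definition p_elim :: stmt where
  "p_elim = Ite (Arr 42 (V 27)) (
     Set 28 (Arr 42 (V 27)) ;;
     For 22 7 (Assign 43 (V 22) (Arr 40 (vrow 27 (V 22)))) ;;
     For 21 7 (For 22 7 (Assign 40 (vrow 21 (V 22))
       (Red (Add (Red (Mul (V 28) (Arr 40 (vrow 21 (V 22)))))
         (Red (Mul (Sub (V 2) (Arr 42 (V 21))) (Arr 43 (V 22)))))))))
     Skip"

definition p_interp :: stmt where
  "p_interp = p_init ;; For 25 2 (p_mon ;; p_dot ;; p_pivot ;; p_elim)"

text \<open>The product is built in array 49, so the target may be one of the factors. Its indices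
  go up to \<open>2 * q - 2\<close>, which is why more than \<open>q\<close> entries are cleared;
  the result is truncated to \<open>q\<close> coefficients.\<close>

definition p_mul :: "nat \<Rightarrow> nat \<Rightarrow> nat \<Rightarrow> stmt" where
  "p_mul d a b = For 22 7 (Assign 49 (V 22) (Lit 0)) ;;
     For 22 2 (For 36 2 (Assign 49 (Add (V 22) (V 36))
       (Red (Add (Arr 49 (Add (V 22) (V 36))) (Mul (Arr a (V 22)) (Arr b (V 36))))))) ;;
     For 22 2 (Assign d (V 22) (Arr 49 (V 22)))"

definition p_axpy :: "nat \<Rightarrow> exp \<Rightarrow> nat \<Rightarrow> stmt" where
  "p_axpy d e b = For 22 2 (Assign d (V 22) (Red (Add (Arr d (V 22)) (Mul e (Arr b (V 22))))))"

definition p_const :: "nat \<Rightarrow> exp \<Rightarrow> exp \<Rightarrow> stmt" where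
  "p_const d e f = For 22 2 (Assign d (V 22) (Lit 0)) ;; Assign d (Lit 0) e ;; Assign d (Lit 1) f"

definition p_eval :: stmt where
  "p_eval = p_const 46 (Lit 0) (Lit 0) ;; p_const 47 (Lit 1) (Lit 0) ;;
     For 23 2 (
       For 22 2 (Assign 48 (V 22) (Arr 47 (V 22))) ;;
       For 24 2 (p_axpy 46 (Arr 44 (ix 23 24)) 48 ;; p_mul 48 48 50) ;;
       p_mul 47 47 45)"

text \<open>Each value is tried as coefficient \<open>k + 1\<close>, and variable 38 keeps the last
  one for which the coefficient \<open>k + 1\<close> of \<open>Q\<close> along the series vanishes.
  At a simple root exactly one value passes.\<close>

definition p_lift :: stmt where
  "p_lift = p_const 45 (V 33) (Lit 0) ;;
     For 34 0 (Set 38 (Lit 0) ;;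
       For 35 2 (Assign 45 (Add (V 34) (Lit 1)) (V 35) ;; p_eval ;;
         Ite (Arr 46 (Add (V 34) (Lit 1))) Skip (Set 38 (V 35))) ;;
       Assign 45 (Add (V 34) (Lit 1)) (V 38))"

definition p_emit :: stmt where
  "p_emit = p_const 51 (Lit 0) (Lit 0) ;; p_const 52 (Lit 1) (Lit 0) ;;
     p_const 53 (Red (Sub (V 2) (V 32))) (Lit 1) ;;
     For 34 0 (p_axpy 51 (Arr 45 (V 34)) 52 ;; p_mul 52 52 53) ;;
     For 34 0 (Out (Arr 51 (V 34)))"

definition p_deriv :: stmt where
  "p_deriv = For 23 2 (For 24 2 (Assign 44 (ix 23 24)
     (Red (Mul (Arr 44 (Add (Mul (Add (V 23) (Lit 1)) (V 2)) (V 24))) (Red (Add (V 23) (Lit 1)))))))"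

text \<open>Deriving at the end of each pass makes pass \<open>h\<close> work on the derivative of
  order \<open>h\<close>.\<close>

definition p_roots :: stmt where
  "p_roots = For 31 2 (
     For 32 2 (p_const 50 (V 32) (Lit 1) ;; For 33 2 (p_lift ;; p_emit)) ;; p_deriv)"

definition p_decode :: stmt where
  "p_decode = For 20 2 (p_interp ;;
     For 21 7 (For 22 7 (Assign 44 (V 22) (Arr 40 (vrow 21 (V 22)))) ;; p_roots))"

lemmas p_defs = p_init_def p_mon_def p_dot_def p_pivot_def p_elim_def p_mul_def p_axpy_def p_const_def
  p_eval_def p_lift_def p_emit_def p_deriv_def

lemma mods_prog [simp]:
  "mods p_init = {21, 23, 24, 40}" "mods p_mon = {23, 24, 29, 30, 41}" "mods p_dot = {21, 22, 26, 42}"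
  "mods p_pivot = {14, 21, 27}" "mods p_elim = {14, 21, 22, 28, 40, 43}"
  "mods (p_mul d a b) = {22, 36, 49, d}" "mods (p_axpy d e b) = {22, d}" "mods (p_const d e f) = {22, d}"
  "mods p_eval = {22, 23, 24, 36, 46, 47, 48, 49}"
  "mods p_lift = {14, 22, 23, 24, 34, 35, 36, 38, 45, 46, 47, 48, 49}"
  "mods p_emit = {22, 34, 36, 49, 51, 52, 53}" "mods p_deriv = {23, 24, 44}"
  by (auto simp: p_defs)

lemma mods_prog2 [simp]:
  "mods p_interp = {14, 21, 22, 23, 24, 25, 26, 27, 28, 29, 30, 40, 41, 42, 43}"
  "mods p_roots = {14, 22, 23, 24, 31, 32, 33, 34, 35, 36, 38, 44, 45, 46, 47, 48, 49, 50, 51, 52, 53}"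
  by (auto simp: p_interp_def p_roots_def)

lemma pure_prog [simp]:
  "pure p_init" "pure p_mon" "pure p_dot" "pure p_pivot" "pure p_elim" "pure (p_mul d a b)"
  "pure (p_axpy d e b)" "pure (p_const d e f)" "pure p_eval" "pure p_lift" "pure p_emit" "pure p_deriv"
  "quiet p_init" "quiet p_mon" "quiet p_dot" "quiet p_pivot" "quiet p_elim" "quiet (p_mul d a b)"
  "quiet (p_axpy d e b)" "quiet (p_const d e f)" "quiet p_eval" "quiet p_lift" "quiet p_deriv"
  by (auto simp: p_defs)

lemma pure_prog2 [simp]: "pure p_interp" "quiet p_interp" "pure p_roots"
  by (auto simp: p_interp_def p_roots_def)

text \<open>Below \<open>q * q + q\<close> the quotient is at most \<open>q\<close>, so the cut-off
  of the loop has no effect. The bound admits a product of two residues plus a residue.\<close>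

lemma red_eq: "x < q * q + q \<Longrightarrow> x - q * min q (x div q) = x mod (q::nat)"
proof -
  assume "x < q * q + q"
  then have "x < (q + 1) * q" by (simp add: algebra_simps)
  then have "x div q < q + 1" by (rule less_mult_imp_div_less)
  then have "min q (x div q) = x div q" by simp
  then show ?thesis by (simp add: minus_mult_div_eq_mod)
qed

lemma red_fma:
  assumes "a < q" "b \<le> q" "c \<le> (q::nat)"
  shows "(a + b * c) - q * min q ((a + b * c) div q) = (a + b * c) mod q"
proof (rule red_eq)
  have "b * c \<le> q * q" using assms by (intro mult_mono) auto
  then show "a + b * c < q * q + q" using assms by linarith
qed

lemma red_mul: "b \<le> q \<Longrightarrow> c \<le> q \<Longrightarrow> b * c - q * min q (b * c div q) = b * c mod (q::nat)"
  using red_fma[of 0 q b c] by (cases "q = 0") auto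

definition pol :: "nat \<Rightarrow> (nat \<Rightarrow> nat) \<Rightarrow> int poly" where
  "pol q M = (\<Sum>j<q. monom (int (M j)) j)"

lemma coeff_pol: "coeff (pol q M) j = (if j < q then int (M j) else 0)"
  by (simp add: pol_def coeff_sum if_distrib sum.delta cong: if_cong)

definition coefs :: "nat \<Rightarrow> (nat \<Rightarrow> nat) \<Rightarrow> nat \<Rightarrow> nat \<Rightarrow> int" where
  "coefs q M b a = int (M (b * q + a))"

section \<open>Correctness of the root-finding program\<close>

locale decoder =
  fixes m l :: nat and U :: "complex mat" and q n :: nat
  assumes q: "prime q" and n: "2 \<le> n" "n < q"
begin

abbreviation "W \<equiv> wp m l U"

definition par :: "st \<Rightarrow> bool" where
  "par s \<longleftrightarrow> mem s 0 0 = n \<and> mem s 2 0 = q \<and> mem s 7 0 = q * q"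

lemma par_frame: "par s \<Longrightarrow> frame P s t \<Longrightarrow> 0 \<notin> mods P \<Longrightarrow> 2 \<notin> mods P \<Longrightarrow> 7 \<notin> mods P \<Longrightarrow> par t"
  by (simp add: par_def frame_mem)

lemma q0: "0 < q" using q prime_gt_0_nat by blast

text \<open>The expressions are evaluated after variable 22 and array \<open>d\<close> have been
  overwritten, hence the quantified \<open>u\<close> and \<open>w\<close> in the hypotheses on their
  values.\<close>

lemma const_wp:
  assumes s: "par s" and d: "d \<noteq> 22" "d \<noteq> 2" and e: "\<And>u w. val ((mem s)(22 := u, d := w)) e = e'" "\<And>u w. val ((mem s)(22 := u, d := w)) f = f'"
  shows "W (p_const d e f) (\<lambda>t. \<forall>j<q. mem t d j = (if j = 0 then e' else if j = 1 then f' else 0)) s"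
proof -
  have "W (For 22 2 (Assign d (V 22) (Lit 0)))
     (\<lambda>t. (\<forall>j<q. mem t d j = 0) \<and> frame (For 22 2 (Assign d (V 22) (Lit 0))) s t) s"
    by (rule wp_For[where I = "\<lambda>i t. \<forall>j<i. mem t d j = 0"]) (use s d in \<open>auto simp: par_def less_Suc_eq\<close>)
  then show ?thesis unfolding p_const_def wp_simps(5)
  proof (rule wp_mono)
    fix t assume t: "(\<forall>j<q. mem t d j = 0) \<and> frame (For 22 2 (Assign d (V 22) (Lit 0))) s t"
    have eq: "mem t = (mem s)(22 := mem t 22, d := mem t d)"
      using t by (auto simp: fun_eq_iff frame_def)
    have "(mem t)(d := w) = (mem s)(22 := mem t 22, d := w)" for w
      by (subst eq) auto
    then show "W (Assign d (Lit 0) e) (W (Assign d (Lit 1) f)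
       (\<lambda>t. \<forall>j<q. mem t d j = (if j = 0 then e' else if j = 1 then f' else 0))) t"
      using t e(1)[of "mem t 22" "mem t d"] e(2) eq by auto
  qed
qed

lemma axpy_wp:
  assumes s: "par s" and d: "d \<notin> {0, 2, 7, 22}" "b \<notin> {d, 22}"
    and e: "\<And>u w. val ((mem s)(22 := u, d := w)) e = e'"
    and r: "\<forall>j<q. mem s d j < q" "\<forall>j<q. mem s b j < q" "e' < q"
  shows "W (p_axpy d e b) (\<lambda>t. \<forall>j<q. mem t d j = (mem s d j + e' * mem s b j) mod q) s"
  unfolding p_axpy_def
proof (rule wp_For[where I = "\<lambda>i t. \<forall>j<q. mem t d j = (if j < i then (mem s d j + e' * mem s b j) mod q else mem s d j)"])
  let ?P = "Assign d (V 22) (Red (Add (Arr d (V 22)) (Mul e (Arr b (V 22)))))"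
  fix i t assume i: "i < mem s 2 0" and t: "\<forall>j<q. mem t d j = (if j < i then (mem s d j + e' * mem s b j) mod q else mem s d j)"
    and fr: "frame (For 22 2 ?P) s t"
  have iq: "i < q" using i s by (simp add: par_def)
  have "(mem t)(22 := w) = (mem s)(22 := w, d := mem t d)" for w
    using fr d by (auto simp: fun_eq_iff frame_def)
  then have e': "val ((mem t)(22 := w)) e = e'" for w using e by simp
  have eqs: "mem t 2 0 = q" "mem t b = mem s b" using frame_mem[OF fr] s d by (auto simp: par_def)
  have lt: "mem s d i < q" "mem s b i < q" using r iq by auto
  have *: "mem s d i + e' * min (mem s b i) q - q * min q ((mem s d i + e' * min (mem s b i) q) div q)
      = (mem s d i + e' * mem s b i) mod q"
    using red_fma[of "mem s d i" q e' "mem s b i"] lt r(3) by simp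
  show "W ?P (\<lambda>t. \<forall>j<q. mem t d j = (if j < Suc i then (mem s d j + e' * mem s b j) mod q else mem s d j)) (setm 22 0 i t)"
    using d t iq by (auto simp: e' eqs * less_Suc_eq)
qed (use s in \<open>auto simp: par_def\<close>)

lemma mul_wp:
  assumes s: "par s" and d: "d \<notin> {0, 2, 7, 22, 36, 49}" "a \<notin> {22, 36, 49}" "b \<notin> {22, 36, 49}"
    and r: "\<forall>j<q. mem s a j < q" "\<forall>j<q. mem s b j < q"
  shows "W (p_mul d a b) (\<lambda>t. (\<forall>j<q. mem t d j < q) \<and> teq (int q) q (pol q (mem t d)) (pol q (mem s a) * pol q (mem s b))) s"
proof -
  \<comment> \<open>\<open>T i k\<close> is the contribution of coefficient \<open>i\<close> of the
    first factor to coefficient \<open>k\<close>; \<open>Tj i j k\<close> is the part of it added by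
    the first \<open>j\<close> rounds of the inner loop.\<close>
  define T where "T i k = (if i \<le> k \<and> k - i < q then mem s a i * mem s b (k - i) else 0)" for i k
  define Tj where "Tj i j k = (if i \<le> k \<and> k - i < j then mem s a i * mem s b (k - i) else 0)" for i j k
  have qq: "i + j < q * q" if "i < q" "j < q" for i j
  proof -
    have "i + j < 2 * q" using that by simp
    also have "2 * q \<le> q * q" using n by (intro mult_right_mono) auto
    finally show ?thesis .
  qed
  let ?P1 = "For 22 7 (Assign 49 (V 22) (Lit 0))"
  let ?B = "Assign 49 (Add (V 22) (V 36)) (Red (Add (Arr 49 (Add (V 22) (V 36))) (Mul (Arr a (V 22)) (Arr b (V 36)))))"
  let ?P2 = "For 22 2 (For 36 2 ?B)"
  let ?P3 = "For 22 2 (Assign d (V 22) (Arr 49 (V 22)))"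
  have 1: "W ?P1 (\<lambda>t. (\<forall>j<q * q. mem t 49 j = 0) \<and> frame ?P1 s t) s"
    by (rule wp_For[where I = "\<lambda>i t. \<forall>j<i. mem t 49 j = 0"]) (use s in \<open>auto simp: par_def less_Suc_eq\<close>)
  have 2: "W ?P2 (\<lambda>u. (\<forall>k<q * q. mem u 49 k = (\<Sum>i<q. T i k) mod q)) t"
    if t: "(\<forall>j<q * q. mem t 49 j = 0) \<and> frame ?P1 s t" for t
  proof (rule wp_For[where I = "\<lambda>i u. \<forall>k<q * q. mem u 49 k = (\<Sum>i'<i. T i' k) mod q"])
    have tm: "mem t 2 0 = q" "mem t a = mem s a" "mem t b = mem s b"
      using t s d by (auto simp: frame_def par_def)
    fix i u assume i: "i < mem t 2 0" and u: "\<forall>k<q * q. mem u 49 k = (\<Sum>i'<i. T i' k) mod q" and fu: "frame ?P2 t u"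
    have iq: "i < q" using i tm by simp
    have um: "mem u 2 0 = q" "mem u a = mem s a" "mem u b = mem s b"
      using frame_mem[OF fu] tm d by auto
    show "W (For 36 2 ?B) (\<lambda>u. \<forall>k<q * q. mem u 49 k = (\<Sum>i'<Suc i. T i' k) mod q) (setm 22 0 i u)"
    proof (rule wp_For[where I = "\<lambda>j v. \<forall>k<q * q. mem v 49 k = ((\<Sum>i'<i. T i' k) + Tj i j k) mod q"])
      show "\<forall>k<q * q. mem (setm 22 0 i u) 49 k = ((\<Sum>i'<i. T i' k) + Tj i 0 k) mod q"
        using u by (simp add: Tj_def)
    next
      fix j v assume j: "j < mem (setm 22 0 i u) 2 0"
        and v: "\<forall>k<q * q. mem v 49 k = ((\<Sum>i'<i. T i' k) + Tj i j k) mod q" and fv: "frame (For 36 2 ?B) (setm 22 0 i u) v"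
      have jq: "j < q" using j um by simp
      have vm: "mem v 2 0 = q" "mem v a = mem s a" "mem v b = mem s b" "mem v 22 0 = i"
        using frame_mem[OF fv] um d by auto
      have lt: "mem s a i \<le> q" "mem s b j \<le> q" using r iq jq by (auto simp: less_imp_le)
      have v49: "mem v 49 (i + j) = (\<Sum>i'<i. T i' (i + j)) mod q"
        using v qq[OF iq jq] by (simp add: Tj_def)
      have *: "mem v 49 (i + j) + mem s a i * min (mem s b j) q - q * min q ((mem v 49 (i + j) + mem s a i * min (mem s b j) q) div q)
         = (mem v 49 (i + j) + mem s a i * mem s b j) mod q"
        using red_fma[of "mem v 49 (i + j)" q "mem s a i" "mem s b j"] lt v49 q0 by (simp add: min_absorb1)
      have Tj': "Tj i (Suc j) k = Tj i j k + (if k = i + j then mem s a i * mem s b j else 0)" for k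
        by (auto simp: Tj_def less_Suc_eq)
      have "(mem v 49 (i + j) + mem s a i * mem s b j) mod q = ((\<Sum>i'<i. T i' (i + j)) + Tj i (Suc j) (i + j)) mod q"
        unfolding v49 by (simp add: Tj_def mod_simps)
      then show "W ?B (\<lambda>v. \<forall>k<q * q. mem v 49 k = ((\<Sum>i'<i. T i' k) + Tj i (Suc j) k) mod q) (setm 36 0 j v)"
        using v d by (auto simp: vm * Tj')
    next
      fix v assume v: "\<forall>k<q * q. mem v 49 k = ((\<Sum>i'<i. T i' k) + Tj i (mem (setm 22 0 i u) 2 0) k) mod q"
      then show "\<forall>k<q * q. mem v 49 k = (\<Sum>i'<Suc i. T i' k) mod q"
        using um by (simp add: Tj_def T_def)
    qed
  qed (use t s in \<open>auto simp: frame_def par_def\<close>)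
  have 3: "W ?P3 (\<lambda>v. \<forall>j<q. mem v d j = mem u 49 j) u" if "mem u 2 0 = q" for u
    by (rule wp_For[where I = "\<lambda>i v. \<forall>j<i. mem v d j = mem u 49 j"]) (use that d in \<open>auto simp: less_Suc_eq frame_def\<close>)
  have fin: "teq (int q) q (pol q M) (pol q (mem s a) * pol q (mem s b))" "\<forall>j<q. M j < q"
    if M: "\<forall>j<q. M j = (\<Sum>i<q. T i j) mod q" for M
  proof -
    show "teq (int q) q (pol q M) (pol q (mem s a) * pol q (mem s b))" unfolding teq_def
    proof (intro allI impI)
      fix j assume j: "j < q"
      have "coeff (pol q (mem s a) * pol q (mem s b)) j = (\<Sum>i\<le>j. int (T i j))"
        unfolding coeff_mult using j by (intro sum.cong) (auto simp: T_def coeff_pol)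
      also have "\<dots> = (\<Sum>i<q. int (T i j))"
        using j by (intro sum.mono_neutral_left) (auto simp: T_def)
      finally have "coeff (pol q (mem s a) * pol q (mem s b)) j = int (\<Sum>i<q. T i j)" by simp
      moreover have "coeff (pol q M) j = int (\<Sum>i<q. T i j) mod int q"
        using j M by (simp add: coeff_pol zmod_int)
      ultimately show "int q dvd coeff (pol q M) j - coeff (pol q (mem s a) * pol q (mem s b)) j"
        by (metis dvd_minus_mod dvd_diff_commute)
    qed
    show "\<forall>j<q. M j < q" using M q0 by simp
  qed
  show ?thesis unfolding p_mul_def wp_simps(5)
  proof (rule wp_mono[OF 1])
    fix t assume t: "(\<forall>j<q * q. mem t 49 j = 0) \<and> frame ?P1 s t"
    show "W ?P2 (W ?P3 (\<lambda>t. (\<forall>j<q. mem t d j < q) \<and> teq (int q) q (pol q (mem t d)) (pol q (mem s a) * pol q (mem s b)))) t"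
    proof (rule wp_mono[OF 2[OF t]])
      fix u assume u: "\<forall>k<q * q. mem u 49 k = (\<Sum>i<q. T i k) mod q" and fu: "frame ?P2 t u"
      have "mem u 2 0 = q" using frame_mem[OF fu] t s by (auto simp: frame_def par_def)
      from 3[OF this] show "W ?P3 (\<lambda>t. (\<forall>j<q. mem t d j < q) \<and> teq (int q) q (pol q (mem t d)) (pol q (mem s a) * pol q (mem s b))) u"
      proof (rule wp_mono)
        fix v assume v: "\<forall>j<q. mem v d j = mem u 49 j"
        have "\<forall>j<q. mem v d j = (\<Sum>i<q. T i j) mod q"
        proof (intro allI impI)
          fix j assume "j < q"
          then show "mem v d j = (\<Sum>i<q. T i j) mod q" using u v qq[of j 0] q0 by simp
        qed
        from fin[OF this] show "(\<forall>j<q. mem v d j < q) \<and> teq (int q) q (pol q (mem v d)) (pol q (mem s a) * pol q (mem s b))"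
          by blast
      qed
    qed
  qed
qed

lemma dvd_diff_iff: "(d::int) dvd x - y \<Longrightarrow> d dvd x \<longleftrightarrow> d dvd y"
  by (metis dvd_add_right_iff diff_add_cancel)

lemma pol_const:
  "\<forall>j<q. M j = (if j = 0 then e else if j = 1 then f else 0) \<Longrightarrow> teq r q (pol q M) [:int e, int f:]"
  by (auto simp: teq_def coeff_pol coeff_pCons split: nat.splits)

lemma pol_axpy:
  assumes "\<forall>j<q. M' j = (M j + e * Z j) mod q"
  shows "teq (int q) q (pol q M') (pol q M + smult (int e) (pol q Z))"
  unfolding teq_def
proof (intro allI impI)
  fix j assume j: "j < q"
  have "coeff (pol q M') j = (int (M j) + int e * int (Z j)) mod int q"
    using j assms by (simp add: coeff_pol zmod_int)
  moreover have "coeff (pol q M + smult (int e) (pol q Z)) j = int (M j) + int e * int (Z j)"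
    using j by (simp add: coeff_pol)
  ultimately show "int q dvd coeff (pol q M') j - coeff (pol q M + smult (int e) (pol q Z)) j"
    by (metis dvd_minus_mod dvd_diff_commute)
qed

lemma pair_eq: "i < M \<Longrightarrow> i' < M \<Longrightarrow> k * M + i = k' * M + i' \<longleftrightarrow> k = k' \<and> i = i'" for M :: nat
proof
  assume *: "i < M" "i' < M" "k * M + i = k' * M + i'"
  then have "(k * M + i) div M = (k' * M + i') div M" by simp
  moreover have "M > 0" using * by simp
  ultimately have "k = k'" using *(1,2) by simp
  then show "k = k' \<and> i = i'" using * by simp
qed simp

lemma eval_wp:
  assumes s: "par s" and c: "\<forall>i<q * q. mem s 44 i < q" and A: "\<forall>j<q. mem s 45 j < q"
    and x: "\<forall>j<q. mem s 50 j = (if j = 0 then x0 else if j = 1 then 1 else 0)" "x0 < q"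
  shows "W p_eval (\<lambda>t. (\<forall>j<q. mem t 46 j < q) \<and>
    teq (int q) q (pol q (mem t 46)) (bev q (coefs q (mem s 44)) [:int x0, 1:] (pol q (mem s 45)))) s"
proof -
  define X where "X = [:int x0, 1:]"
  define B where "B = pol q (mem s 45)"
  define C where "C = coefs q (mem s 44)"
  \<comment> \<open>\<open>S b\<close> consists of the finished rows, \<open>S' b a\<close> of the
    first \<open>a\<close> terms of the current row. Memory is related to them only by
    \<open>teq\<close>, since \<open>p_mul\<close> truncates at order \<open>q\<close>.\<close>
  define S where "S b = (\<Sum>b'<b. \<Sum>a<q. smult (C b' a) (X ^ a * B ^ b'))" for b
  define S' where "S' b a = (\<Sum>a'<a. smult (C b a') (X ^ a' * B ^ b))" for b a
  have xlt: "\<forall>j<q. mem s 50 j < q" using x n by auto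
  have teqX: "teq (int q) q (pol q (mem s 50)) X" unfolding X_def using pol_const[OF x(1)] by simp
  let ?in = "p_axpy 46 (Arr 44 (ix 23 24)) 48 ;; p_mul 48 48 50"
  let ?body = "For 22 2 (Assign 48 (V 22) (Arr 47 (V 22))) ;; For 24 2 ?in ;; p_mul 47 47 45"
  define I where "I b t \<longleftrightarrow> (\<forall>j<q. mem t 47 j < q) \<and> (\<forall>j<q. mem t 46 j < q) \<and>
      teq (int q) q (pol q (mem t 47)) (B ^ b) \<and> teq (int q) q (pol q (mem t 46)) (S b)" for b and t :: st
  have loop: "W (For 23 2 ?body) (\<lambda>t. (\<forall>j<q. mem t 46 j < q) \<and> teq (int q) q (pol q (mem t 46)) (S q)) t0"
    if t0: "I 0 t0" "par t0" "mem t0 44 = mem s 44" "mem t0 45 = mem s 45" "mem t0 50 = mem s 50" for t0 :: st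
  proof (rule wp_For[where I = I])
    show "I 0 t0" by (rule t0)
  next
    fix b t assume b: "b < mem t0 2 0" and I: "I b t" and fr: "frame (For 23 2 ?body) t0 t"
    have bq: "b < q" using b t0 by (simp add: par_def)
    have pt: "par t" by (rule par_frame[OF t0(2) fr]) simp_all
    have tm: "mem t 44 = mem s 44" "mem t 45 = mem s 45" "mem t 50 = mem s 50" using frame_mem[OF fr] t0 by auto
    let ?t = "setm 23 0 b t"
    let ?L1 = "For 22 2 (Assign 48 (V 22) (Arr 47 (V 22)))"
    have 1: "W ?L1 (\<lambda>u. \<forall>j<q. mem u 48 j = mem ?t 47 j) ?t"
      by (rule wp_For[where I = "\<lambda>i u. \<forall>j<i. mem u 48 j = mem ?t 47 j"])
         (use pt in \<open>auto simp: par_def less_Suc_eq frame_def\<close>)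
    have 2: "W (For 24 2 ?in) (\<lambda>v. (\<forall>j<q. mem v 46 j < q) \<and> teq (int q) q (pol q (mem v 46)) (S b + S' b q)) u"
      if u: "\<forall>j<q. mem u 48 j = mem ?t 47 j" and fu: "frame ?L1 ?t u" for u
    proof (rule wp_For[where I = "\<lambda>a v. (\<forall>j<q. mem v 46 j < q) \<and> (\<forall>j<q. mem v 48 j < q) \<and>
        teq (int q) q (pol q (mem v 48)) (X ^ a * B ^ b) \<and> teq (int q) q (pol q (mem v 46)) (S b + S' b a)"])
      have um: "mem u 46 = mem t 46" using frame_mem[OF fu] by simp
      have "pol q (mem u 48) = pol q (mem t 47)" unfolding pol_def using u by (intro sum.cong) auto
      then show "(\<forall>j<q. mem u 46 j < q) \<and> (\<forall>j<q. mem u 48 j < q) \<and>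
        teq (int q) q (pol q (mem u 48)) (X ^ 0 * B ^ b) \<and> teq (int q) q (pol q (mem u 46)) (S b + S' b 0)"
        using I u um by (auto simp: I_def S'_def)
    next
      fix a v assume a: "a < mem u 2 0" and v: "(\<forall>j<q. mem v 46 j < q) \<and> (\<forall>j<q. mem v 48 j < q) \<and>
        teq (int q) q (pol q (mem v 48)) (X ^ a * B ^ b) \<and> teq (int q) q (pol q (mem v 46)) (S b + S' b a)"
        and fv: "frame (For 24 2 ?in) u v"
      let ?v = "setm 24 0 a v"
      have aq: "a < q" using a frame_mem[OF fu] pt by (simp add: par_def)
      have vm: "mem v 44 = mem s 44" "mem v 50 = mem s 50" "mem v 2 0 = q" "mem v 7 0 = q * q" "mem v 0 0 = n" "mem v 23 0 = b"
        using frame_mem[OF fv] frame_mem[OF fu] tm pt by (auto simp: par_def)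
      have pv: "par ?v" using vm by (simp add: par_def)
      have ca: "mem s 44 (b * q + a) < q" using c pair_less[OF bq aq] by blast
      have "W (p_axpy 46 (Arr 44 (ix 23 24)) 48) (\<lambda>w. \<forall>j<q. mem w 46 j = (mem ?v 46 j + mem s 44 (b * q + a) * mem ?v 48 j) mod q) ?v"
        by (rule axpy_wp[OF pv]) (use v ca vm in auto)
      then show "W ?in (\<lambda>v. (\<forall>j<q. mem v 46 j < q) \<and> (\<forall>j<q. mem v 48 j < q) \<and>
        teq (int q) q (pol q (mem v 48)) (X ^ Suc a * B ^ b) \<and> teq (int q) q (pol q (mem v 46)) (S b + S' b (Suc a))) ?v"
        unfolding wp_simps(5)
      proof (rule wp_mono)
        fix w assume w: "\<forall>j<q. mem w 46 j = (mem ?v 46 j + mem s 44 (b * q + a) * mem ?v 48 j) mod q"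
          and fw: "frame (p_axpy 46 (Arr 44 (ix 23 24)) 48) ?v w"
        have wm: "mem w 48 = mem v 48" "mem w 50 = mem s 50" using frame_mem[OF fw] vm by auto
        have pw: "par w" by (rule par_frame[OF pv fw]) simp_all
        have t46: "teq (int q) q (pol q (mem w 46)) (S b + S' b (Suc a))"
        proof -
          have "teq (int q) q (pol q (mem w 46)) (pol q (mem v 46) + smult (C b a) (pol q (mem v 48)))"
            using pol_axpy[of "mem w 46" "mem v 46" "mem s 44 (b * q + a)" "mem v 48"] w by (simp add: C_def coefs_def)
          moreover have "teq (int q) q (pol q (mem v 46) + smult (C b a) (pol q (mem v 48))) ((S b + S' b a) + smult (C b a) (X ^ a * B ^ b))"
            using v by (intro teq_add teq_smult) auto
          ultimately show ?thesis by (auto simp: S'_def add.assoc intro: teq_trans)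
        qed
        have "W (p_mul 48 48 50) (\<lambda>z. (\<forall>j<q. mem z 48 j < q) \<and> teq (int q) q (pol q (mem z 48)) (pol q (mem w 48) * pol q (mem w 50))) w"
          by (rule mul_wp[OF pw]) (use v wm xlt in auto)
        then show "W (p_mul 48 48 50) (\<lambda>v. (\<forall>j<q. mem v 46 j < q) \<and> (\<forall>j<q. mem v 48 j < q) \<and>
          teq (int q) q (pol q (mem v 48)) (X ^ Suc a * B ^ b) \<and> teq (int q) q (pol q (mem v 46)) (S b + S' b (Suc a))) w"
        proof (rule wp_mono)
          fix z assume z: "(\<forall>j<q. mem z 48 j < q) \<and> teq (int q) q (pol q (mem z 48)) (pol q (mem w 48) * pol q (mem w 50))"
            and fz: "frame (p_mul 48 48 50) w z"
          have zm: "mem z 46 = mem w 46" using frame_mem[OF fz] by simp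
          have "teq (int q) q (pol q (mem w 48) * pol q (mem w 50)) (X ^ a * B ^ b * X)"
            unfolding wm using v teqX by (intro teq_mult) auto
          then have "teq (int q) q (pol q (mem z 48)) (X ^ Suc a * B ^ b)"
            using z by (auto simp: mult_ac intro: teq_trans)
          then show "(\<forall>j<q. mem z 46 j < q) \<and> (\<forall>j<q. mem z 48 j < q) \<and>
          teq (int q) q (pol q (mem z 48)) (X ^ Suc a * B ^ b) \<and> teq (int q) q (pol q (mem z 46)) (S b + S' b (Suc a))"
            using z t46 w q0 by (simp add: zm)
        qed
      qed
    next
      fix v assume "(\<forall>j<q. mem v 46 j < q) \<and> (\<forall>j<q. mem v 48 j < q) \<and>
        teq (int q) q (pol q (mem v 48)) (X ^ mem u 2 0 * B ^ b) \<and> teq (int q) q (pol q (mem v 46)) (S b + S' b (mem u 2 0))"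
      then show "(\<forall>j<q. mem v 46 j < q) \<and> teq (int q) q (pol q (mem v 46)) (S b + S' b q)"
        using frame_mem[OF fu] pt by (simp add: par_def)
    qed
    show "W ?body (I (Suc b)) ?t" unfolding wp_simps(5)
    proof (rule wp_mono[OF 1])
      fix u assume u: "\<forall>j<q. mem u 48 j = mem ?t 47 j" and fu: "frame ?L1 ?t u"
      show "W (For 24 2 ?in) (W (p_mul 47 47 45) (I (Suc b))) u"
      proof (rule wp_mono[OF 2[OF u fu]])
        fix v assume v: "(\<forall>j<q. mem v 46 j < q) \<and> teq (int q) q (pol q (mem v 46)) (S b + S' b q)"
          and fv: "frame (For 24 2 ?in) u v"
        have vm: "mem v 47 = mem t 47" "mem v 45 = mem s 45" "par v"
          using frame_mem[OF fv] frame_mem[OF fu] tm pt by (auto simp: par_def)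
        have "W (p_mul 47 47 45) (\<lambda>z. (\<forall>j<q. mem z 47 j < q) \<and> teq (int q) q (pol q (mem z 47)) (pol q (mem v 47) * pol q (mem v 45))) v"
          by (rule mul_wp[OF vm(3)]) (use I A vm in \<open>auto simp: I_def\<close>)
        then show "W (p_mul 47 47 45) (I (Suc b)) v"
        proof (rule wp_mono)
          fix z assume z: "(\<forall>j<q. mem z 47 j < q) \<and> teq (int q) q (pol q (mem z 47)) (pol q (mem v 47) * pol q (mem v 45))"
            and fz: "frame (p_mul 47 47 45) v z"
          have "teq (int q) q (pol q (mem v 47) * pol q (mem v 45)) (B ^ b * B)"
            unfolding vm using I by (intro teq_mult) (auto simp: I_def B_def)
          then have "teq (int q) q (pol q (mem z 47)) (B ^ Suc b)"
            using z by (auto simp: mult_ac intro: teq_trans)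
          moreover have "S b + S' b q = S (Suc b)" by (simp add: S_def S'_def)
          ultimately show "I (Suc b) z" using z v frame_mem[OF fz] by (simp add: I_def)
        qed
      qed
    qed
  next
    fix t assume "I (mem t0 2 0) t"
    then show "(\<forall>j<q. mem t 46 j < q) \<and> teq (int q) q (pol q (mem t 46)) (S q)"
      using t0 by (simp add: I_def par_def)
  qed
  have SB: "S q = bev q (coefs q (mem s 44)) [:int x0, 1:] (pol q (mem s 45))"
    by (simp add: S_def bev_def C_def X_def B_def)
  show ?thesis unfolding p_eval_def wp_simps(5) SB[symmetric]
  proof (rule wp_mono[OF const_wp[OF s]])
    fix t assume t: "\<forall>j<q. mem t 46 j = (if j = 0 then 0 else if j = 1 then 0 else 0)"
      and ft: "frame (p_const 46 (Lit 0) (Lit 0)) s t"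
    have pt: "par t" by (rule par_frame[OF s ft]) simp_all
    show "W (p_const 47 (Lit 1) (Lit 0)) (W (For 23 2 ?body) (\<lambda>t. (\<forall>j<q. mem t 46 j < q) \<and> teq (int q) q (pol q (mem t 46)) (S q))) t"
    proof (rule wp_mono[OF const_wp[OF pt]])
      fix u assume u: "\<forall>j<q. mem u 47 j = (if j = 0 then 1 else if j = 1 then 0 else 0)"
        and fu: "frame (p_const 47 (Lit 1) (Lit 0)) t u"
      have u46: "\<forall>j<q. mem u 46 j = (if j = 0 then 0 else if j = 1 then 0 else 0)" using t frame_mem[OF fu] by simp
      show "W (For 23 2 ?body) (\<lambda>t. (\<forall>j<q. mem t 46 j < q) \<and> teq (int q) q (pol q (mem t 46)) (S q)) u"
      proof (rule loop)
        show "par u" by (rule par_frame[OF pt fu]) simp_all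
        show "I 0 u" using u u46 n pol_const[OF u, of "int q"] pol_const[OF u46, of "int q"]
          by (auto simp: I_def S_def one_pCons)
      qed (use frame_mem[OF fu] frame_mem[OF ft] in auto)
    qed auto
  qed auto
qed

text \<open>\<open>R\<close> stands for the starting point being right for a root with expansion
  \<open>T\<close>. It guards only the second conclusion: entries below \<open>q\<close> are needed
  after wrong guesses as well, since their output also has to consist of messages.\<close>

lemma lift_wp:
  assumes s: "par s" and c: "\<forall>i<q * q. mem s 44 i < q" and g: "mem s 33 0 < q"
    and x: "\<forall>j<q. mem s 50 j = (if j = 0 then x0 else if j = 1 then 1 else 0)" "x0 < q"
    and T0: "R \<Longrightarrow> int q dvd int (mem s 33 0) - coeff T 0"
    and T: "\<And>A k. R \<Longrightarrow> 1 \<le> k \<Longrightarrow> k < q \<Longrightarrow> teq (int q) k A T \<Longrightarrow>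
      int q dvd coeff (bev q (coefs q (mem s 44)) [:int x0, 1:] A) k \<longleftrightarrow> int q dvd coeff A k - coeff T k"
  shows "W p_lift (\<lambda>t. (\<forall>j<q. mem t 45 j < q) \<and> (R \<longrightarrow> teq (int q) n (pol q (mem t 45)) T)) s"
proof -
  let ?C = "coefs q (mem s 44)"
  let ?test = "Ite (Arr 46 (Add (V 34) (Lit 1))) Skip (Set 38 (V 35))"
  let ?try = "Assign 45 (Add (V 34) (Lit 1)) (V 35) ;; p_eval ;; ?test"
  let ?last = "Assign 45 (Add (V 34) (Lit 1)) (V 38)"
  let ?body = "Set 38 (Lit 0) ;; For 35 2 ?try ;; ?last"
  define I where "I k t \<longleftrightarrow> (\<forall>j<q. mem t 45 j < q) \<and> (R \<longrightarrow> teq (int q) (Suc k) (pol q (mem t 45)) T)" for k and t :: st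
  \<comment> \<open>The only value below \<open>q\<close> that is right for coefficient
    \<open>k\<close>.\<close>
  define v where "v k = nat (coeff T k mod int q)" for k
  have v: "v k < q" "int q dvd int z - coeff T k \<longleftrightarrow> z = v k" if "z < q" for k z
  proof -
    show "v k < q" using q0 by (simp add: v_def nat_less_iff)
    have "int q dvd int z - coeff T k \<longleftrightarrow> int z mod int q = coeff T k mod int q" by (rule mod_eq_dvd_iff[symmetric])
    also have "\<dots> \<longleftrightarrow> z = v k" using that q0 by (auto simp: v_def zmod_int[symmetric])
    finally show "int q dvd int z - coeff T k \<longleftrightarrow> z = v k" .
  qed
  have loop: "W (For 34 0 ?body) (\<lambda>t. (\<forall>j<q. mem t 45 j < q) \<and> (R \<longrightarrow> teq (int q) n (pol q (mem t 45)) T)) t0"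
    if t0: "I 0 t0" "par t0" "mem t0 44 = mem s 44" "mem t0 50 = mem s 50" for t0
  proof (rule wp_For[where I = I])
    show "I 0 t0" by (rule t0)
  next
    fix k t assume k: "k < mem t0 0 0" and I: "I k t" and fr: "frame (For 34 0 ?body) t0 t"
    have kq: "k < n" "Suc k < q" using k t0 n by (auto simp: par_def)
    have pt: "par t" by (rule par_frame[OF t0(2) fr]) simp_all
    have tm: "mem t 44 = mem s 44" "mem t 50 = mem s 50" using frame_mem[OF fr] t0 by auto
    let ?t = "setm 38 0 0 (setm 34 0 k t)"
    have 1: "W (For 35 2 ?try) (\<lambda>u. (\<forall>j<q. mem u 45 j < q) \<and> mem u 38 0 < q \<and> (\<forall>j\<le>k. mem u 45 j = mem t 45 j) \<and>
       (R \<longrightarrow> mem u 38 0 = v (Suc k))) ?t"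
    proof (rule wp_For[where I = "\<lambda>z u. (\<forall>j<q. mem u 45 j < q) \<and> mem u 38 0 < q \<and> (\<forall>j\<le>k. mem u 45 j = mem t 45 j) \<and>
       (R \<longrightarrow> v (Suc k) < z \<longrightarrow> mem u 38 0 = v (Suc k))"])
      show "(\<forall>j<q. mem ?t 45 j < q) \<and> mem ?t 38 0 < q \<and> (\<forall>j\<le>k. mem ?t 45 j = mem t 45 j) \<and>
         (R \<longrightarrow> v (Suc k) < 0 \<longrightarrow> mem ?t 38 0 = v (Suc k))" using I q0 by (simp add: I_def)
    next
      fix z u assume z: "z < mem ?t 2 0" and u: "(\<forall>j<q. mem u 45 j < q) \<and> mem u 38 0 < q \<and> (\<forall>j\<le>k. mem u 45 j = mem t 45 j) \<and>
         (R \<longrightarrow> v (Suc k) < z \<longrightarrow> mem u 38 0 = v (Suc k))" and fu: "frame (For 35 2 ?try) ?t u"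
      have zq: "z < q" using z pt by (simp add: par_def)
      have um: "mem u 44 = mem s 44" "mem u 50 = mem s 50" "mem u 34 0 = k" using frame_mem[OF fu] tm by auto
      have pu: "par u" using frame_mem[OF fu] pt by (simp add: par_def)
      let ?u = "setm 45 (Suc k) z (setm 35 0 z u)"
      have pu': "par ?u" using pu by (simp add: par_def)
      have "W p_eval (\<lambda>w. (\<forall>j<q. mem w 46 j < q) \<and>
          teq (int q) q (pol q (mem w 46)) (bev q (coefs q (mem ?u 44)) [:int x0, 1:] (pol q (mem ?u 45)))) ?u"
        by (rule eval_wp[OF pu']) (use c x u zq um in auto)
      then have "W p_eval (W ?test (\<lambda>u. (\<forall>j<q. mem u 45 j < q) \<and> mem u 38 0 < q \<and> (\<forall>j\<le>k. mem u 45 j = mem t 45 j) \<and>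
         (R \<longrightarrow> v (Suc k) < Suc z \<longrightarrow> mem u 38 0 = v (Suc k)))) ?u"
      proof (rule wp_mono)
        fix w assume w: "(\<forall>j<q. mem w 46 j < q) \<and>
          teq (int q) q (pol q (mem w 46)) (bev q (coefs q (mem ?u 44)) [:int x0, 1:] (pol q (mem ?u 45)))"
          and fw: "frame p_eval ?u w"
        have wm: "mem w 45 = (mem u 45)(Suc k := z)" "mem w 38 = mem u 38" "mem w 34 0 = k" "mem w 35 0 = z"
          using frame_mem[OF fw] um by auto
        \<comment> \<open>The hypothesis on \<open>T\<close>, instantiated later by
          \<open>lift_unique\<close>, makes the test accept the right coefficient and nothing
          else.\<close>
        have test: "mem w 46 (Suc k) = 0 \<longleftrightarrow> z = v (Suc k)" if R
        proof -
          have lt: "mem w 46 (Suc k) < q" using w kq by blast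
          have "mem w 46 (Suc k) = 0 \<longleftrightarrow> int q dvd coeff (pol q (mem w 46)) (Suc k)"
            using lt kq by (auto simp: coeff_pol dest: zdvd_imp_le)
          also have "\<dots> \<longleftrightarrow> int q dvd coeff (bev q ?C [:int x0, 1:] (pol q (mem ?u 45))) (Suc k)"
          proof -
            have "int q dvd coeff (pol q (mem w 46)) (Suc k) - coeff (bev q ?C [:int x0, 1:] (pol q (mem ?u 45))) (Suc k)"
              using w kq um unfolding teq_def by simp
            then show ?thesis by (rule dvd_diff_iff)
          qed
          also have "\<dots> \<longleftrightarrow> int q dvd coeff (pol q (mem ?u 45)) (Suc k) - coeff T (Suc k)"
          proof (rule T[OF that])
            show "teq (int q) (Suc k) (pol q (mem ?u 45)) T"
              unfolding teq_def
            proof (intro allI impI)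
              fix j assume j: "j < Suc k"
              have "coeff (pol q (mem ?u 45)) j = coeff (pol q (mem t 45)) j" using j u by (simp add: coeff_pol)
              then show "int q dvd coeff (pol q (mem ?u 45)) j - coeff T j"
                using I that j unfolding I_def teq_def by simp
            qed
          qed (use kq in auto)
          also have "\<dots> \<longleftrightarrow> z = v (Suc k)" using v(2)[OF zq] kq by (simp add: coeff_pol)
          finally show ?thesis .
        qed
        show "W ?test (\<lambda>u. (\<forall>j<q. mem u 45 j < q) \<and> mem u 38 0 < q \<and> (\<forall>j\<le>k. mem u 45 j = mem t 45 j) \<and>
         (R \<longrightarrow> v (Suc k) < Suc z \<longrightarrow> mem u 38 0 = v (Suc k))) w"
          using u test zq by (auto simp: wm less_Suc_eq)
      qed
      then show "W ?try (\<lambda>u. (\<forall>j<q. mem u 45 j < q) \<and> mem u 38 0 < q \<and> (\<forall>j\<le>k. mem u 45 j = mem t 45 j) \<and>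
         (R \<longrightarrow> v (Suc k) < Suc z \<longrightarrow> mem u 38 0 = v (Suc k))) (setm 35 0 z u)"
        by (simp add: um)
    next
      fix u assume "(\<forall>j<q. mem u 45 j < q) \<and> mem u 38 0 < q \<and> (\<forall>j\<le>k. mem u 45 j = mem t 45 j) \<and>
         (R \<longrightarrow> v (Suc k) < mem ?t 2 0 \<longrightarrow> mem u 38 0 = v (Suc k))"
      then show "(\<forall>j<q. mem u 45 j < q) \<and> mem u 38 0 < q \<and> (\<forall>j\<le>k. mem u 45 j = mem t 45 j) \<and>
         (R \<longrightarrow> mem u 38 0 = v (Suc k))" using pt v(1)[OF g, of "Suc k"] by (simp add: par_def)
    qed
    have "W (For 35 2 ?try) (W ?last (I (Suc k))) ?t"
    proof (rule wp_mono[OF 1])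
      fix u assume u: "(\<forall>j<q. mem u 45 j < q) \<and> mem u 38 0 < q \<and> (\<forall>j\<le>k. mem u 45 j = mem t 45 j) \<and>
         (R \<longrightarrow> mem u 38 0 = v (Suc k))" and fu: "frame (For 35 2 ?try) ?t u"
      have uk: "mem u 34 0 = k" using frame_mem[OF fu] by simp
      have "teq (int q) (Suc (Suc k)) (pol q ((mem u 45)(Suc k := mem u 38 0))) T" if R
        unfolding teq_def
      proof (intro allI impI)
        fix j assume j: "j < Suc (Suc k)"
        show "int q dvd coeff (pol q ((mem u 45)(Suc k := mem u 38 0))) j - coeff T j"
        proof (cases "j = Suc k")
          case True
          then show ?thesis using v(2)[of "mem u 38 0" "Suc k"] u that kq by (simp add: coeff_pol)
        next
          case False
          then have "j < Suc k" using j by simp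
          then show ?thesis using I u that kq unfolding I_def teq_def by (simp add: coeff_pol)
        qed
      qed
      then show "W ?last (I (Suc k)) u" using u uk by (auto simp: I_def)
    qed
    then show "W ?body (I (Suc k)) (setm 34 0 k t)" by simp
  next
    fix t assume "I (mem t0 0 0) t"
    then show "(\<forall>j<q. mem t 45 j < q) \<and> (R \<longrightarrow> teq (int q) n (pol q (mem t 45)) T)"
      using t0 by (auto simp: I_def par_def intro: teq_mono)
  qed
  show ?thesis unfolding p_lift_def wp_simps(5)
  proof (rule wp_mono[OF const_wp[OF s]])
    fix t assume t: "\<forall>j<q. mem t 45 j = (if j = 0 then mem s 33 0 else if j = 1 then 0 else 0)"
      and ft: "frame (p_const 45 (V 33) (Lit 0)) s t"
    show "W (For 34 0 ?body) (\<lambda>t. (\<forall>j<q. mem t 45 j < q) \<and> (R \<longrightarrow> teq (int q) n (pol q (mem t 45)) T)) t"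
    proof (rule loop)
      show "par t" by (rule par_frame[OF s ft]) simp_all
      show "I 0 t" using t g T0 q0 by (auto simp: I_def teq_def coeff_pol)
    qed (use frame_mem[OF ft] in auto)
  qed auto
qed

text \<open>With \<open>B\<close> false this is mere well-formedness of the new output, which does
  not depend on \<open>x\<close>; the flag accumulates by disjunction when programs are
  composed.\<close>

definition emits :: "nat list \<Rightarrow> bool \<Rightarrow> st \<Rightarrow> st \<Rightarrow> bool" where
  "emits x B s t \<longleftrightarrow> (\<exists>ys. outp t = outp s @ concat ys \<and> set ys \<subseteq> messages q n \<and> (B \<longrightarrow> x \<in> set ys))"

lemma emits_refl: "emits x False s s"
  by (auto simp: emits_def intro!: exI[of _ "[]"])

lemma emits_trans: "emits x B s t \<Longrightarrow> emits x B' t u \<Longrightarrow> emits x (B \<or> B') s u"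
proof -
  assume "emits x B s t" "emits x B' t u"
  then obtain ys zs where "outp t = outp s @ concat ys" "set ys \<subseteq> messages q n" "B \<longrightarrow> x \<in> set ys"
    "outp u = outp t @ concat zs" "set zs \<subseteq> messages q n" "B' \<longrightarrow> x \<in> set zs" unfolding emits_def by blast
  then show ?thesis unfolding emits_def by (intro exI[of _ "ys @ zs"]) auto
qed

lemma emits_mono: "emits x B s t \<Longrightarrow> (B' \<Longrightarrow> B) \<Longrightarrow> emits x B' s t"
  unfolding emits_def by blast

lemma emits_cong: "outp s = outp s' \<Longrightarrow> outp t = outp t' \<Longrightarrow> emits x B s t \<longleftrightarrow> emits x B s' t'"
  by (simp add: emits_def)

abbreviation "mpol x \<equiv> pol n (\<lambda>i. x ! i)"

lemma degree_mpol: "degree (mpol x) \<le> n - 1"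
  by (rule degree_le) (auto simp: coeff_pol)

lemma pcompose_as_sum:
  fixes p r :: "int poly"
  assumes "degree p \<le> k"
  shows "pcompose p r = (\<Sum>i\<le>k. smult (coeff p i) (r ^ i))"
proof -
  have "pcompose p r = pcompose (\<Sum>i\<le>k. smult (coeff p i) ([:0, 1:] ^ i)) r"
    using poly_as_sum_of_monoms'[OF assms] by (simp add: monom_altdef)
  also have "\<dots> = (\<Sum>i\<le>k. smult (coeff p i) (r ^ i))"
    by (simp add: pcompose_sum pcompose_smult pcompose_power pcompose_pCons)
  finally show ?thesis .
qed

text \<open>Composition with \<open>x - x0\<close> undoes the shift by \<open>x0\<close>. The
  shifted polynomial has degree below \<open>n\<close>, so its first \<open>n\<close> coefficients
  suffice.\<close>

lemma unshift:
  assumes "teq (int q) n A (pcompose (mpol x) [:int x0, 1:])"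
  shows "teq (int q) q (\<Sum>k<n. smult (coeff A k) ([:- int x0, 1:] ^ k)) (mpol x)"
proof -
  define T where "T = pcompose (mpol x) [:int x0, 1:]"
  have "degree T \<le> n - 1" using degree_mpol[of x] by (simp add: T_def)
  then have "pcompose T [:- int x0, 1:] = (\<Sum>k\<le>n - 1. smult (coeff T k) ([:- int x0, 1:] ^ k))"
    by (rule pcompose_as_sum)
  also have "{..n - 1} = {..<n}" using n by auto
  finally have "pcompose T [:- int x0, 1:] = (\<Sum>k<n. smult (coeff T k) ([:- int x0, 1:] ^ k))" .
  moreover have "pcompose T [:- int x0, 1:] = mpol x"
    unfolding T_def pcompose_assoc[symmetric] by (simp add: pcompose_pCons)
  moreover have "teq (int q) q (\<Sum>k<n. smult (coeff A k) ([:- int x0, 1:] ^ k)) (\<Sum>k<n. smult (coeff T k) ([:- int x0, 1:] ^ k))"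
  proof (rule teq_sum)
    fix k assume "k \<in> {..<n}"
    then have "int q dvd coeff A k - coeff T k" using assms by (simp add: teq_def T_def)
    then show "teq (int q) q (smult (coeff A k) ([:- int x0, 1:] ^ k)) (smult (coeff T k) ([:- int x0, 1:] ^ k))"
      unfolding teq_def coeff_smult left_diff_distrib[symmetric] by (simp add: dvd_mult2)
  qed
  ultimately show ?thesis by simp
qed

lemma emit_wp:
  assumes s: "par s" and A: "\<forall>j<q. mem s 45 j < q" and x0: "mem s 32 0 = x0" "x0 < q"
    and x: "x \<in> messages q n" and R: "R \<Longrightarrow> teq (int q) n (pol q (mem s 45)) (pcompose (mpol x) [:int x0, 1:])"
  shows "W p_emit (emits x R s) s"
proof -
  define X where "X = [:- int x0, 1:]"
  define S where "S k = (\<Sum>i<k. smult (int (mem s 45 i)) (X ^ i))" for k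
  let ?body = "p_axpy 51 (Arr 45 (V 34)) 52 ;; p_mul 52 52 53"
  define I where "I k t \<longleftrightarrow> (\<forall>j<q. mem t 51 j < q) \<and> (\<forall>j<q. mem t 52 j < q) \<and>
    teq (int q) q (pol q (mem t 52)) (X ^ k) \<and> teq (int q) q (pol q (mem t 51)) (S k)" for k and t :: st
  have fin: "W (For 34 0 (Out (Arr 51 (V 34)))) (emits x R s) t"
    if t: "I n t" "par t" "outp t = outp s" for t :: st
  proof (rule wp_For[where I = "\<lambda>k u. outp u = outp s @ map (mem t 51) [0..<k]"])
    fix k u assume "outp u = outp s @ map (mem t 51) [0..<k]" "frame (For 34 0 (Out (Arr 51 (V 34)))) t u"
    then show "W (Out (Arr 51 (V 34))) (\<lambda>u. outp u = outp s @ map (mem t 51) [0..<Suc k]) (setm 34 0 k u)"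
      by (simp add: frame_mem)
  next
    fix u :: st assume u: "outp u = outp s @ map (mem t 51) [0..<mem t 0 0]"
    define y where "y = map (mem t 51) [0..<n]"
    have lt: "\<forall>j<q. mem t 51 j < q" using t by (simp add: I_def)
    have "y \<in> messages q n" using lt n by (auto simp: y_def messages_def)
    moreover have "y = x" if R
    proof (rule nth_equalityI)
      show len: "length y = length x" using x by (simp add: y_def messages_def)
      fix i assume i: "i < length y"
      then have i: "i < n" "i < q" using n by (auto simp: y_def)
      have "teq (int q) q (S n) (mpol x)"
        using unshift[OF R[OF that]] n by (simp add: S_def X_def coeff_pol)
      then have "teq (int q) q (pol q (mem t 51)) (mpol x)"
        using t(1) teq_trans by (auto simp: I_def)
      then have "int q dvd int (mem t 51 i) - int (x ! i)"
        using i unfolding teq_def by (metis coeff_pol)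
      then have "int (mem t 51 i) mod int q = int (x ! i) mod int q" by (simp only: mod_eq_dvd_iff)
      moreover have "x ! i < q" using x i by (auto simp: messages_def dest: nth_mem)
      ultimately have "mem t 51 i = x ! i" using lt i by simp
      then show "y ! i = x ! i" using i by (simp add: y_def)
    qed
    ultimately show "emits x R s u" using u t(2)
      by (auto simp: emits_def par_def y_def intro!: exI[of _ "[y]"])
  qed (use t in auto)
  have loop: "W (For 34 0 ?body) (W (For 34 0 (Out (Arr 51 (V 34)))) (emits x R s)) t0"
    if t0: "I 0 t0" "par t0" "outp t0 = outp s" "mem t0 45 = mem s 45" "\<forall>j<q. mem t0 53 j < q"
      "teq (int q) q (pol q (mem t0 53)) X" for t0
  proof (rule wp_For[where I = I])
    show "I 0 t0" by (rule t0)
  next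
    fix k t assume k: "k < mem t0 0 0" and I: "I k t" and fr: "frame (For 34 0 ?body) t0 t"
    have kq: "k < q" using k t0 n by (simp add: par_def)
    let ?t = "setm 34 0 k t"
    have pt: "par ?t" using par_frame[OF t0(2) fr] by (simp add: par_def)
    have tm: "mem t 45 = mem s 45" "mem t 53 = mem t0 53" using frame_mem[OF fr] t0 by auto
    have "W (p_axpy 51 (Arr 45 (V 34)) 52) (\<lambda>w. \<forall>j<q. mem w 51 j = (mem ?t 51 j + mem s 45 k * mem ?t 52 j) mod q) ?t"
      by (rule axpy_wp[OF pt]) (use I A kq tm in \<open>auto simp: I_def\<close>)
    then show "W ?body (I (Suc k)) ?t" unfolding wp_simps(5)
    proof (rule wp_mono)
      fix w assume w: "\<forall>j<q. mem w 51 j = (mem ?t 51 j + mem s 45 k * mem ?t 52 j) mod q"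
        and fw: "frame (p_axpy 51 (Arr 45 (V 34)) 52) ?t w"
      have wm: "mem w 52 = mem t 52" "mem w 53 = mem t0 53" using frame_mem[OF fw] tm by auto
      have pw: "par w" by (rule par_frame[OF pt fw]) simp_all
      have t51: "teq (int q) q (pol q (mem w 51)) (S (Suc k))"
      proof -
        have "teq (int q) q (pol q (mem w 51)) (pol q (mem t 51) + smult (int (mem s 45 k)) (pol q (mem t 52)))"
          using pol_axpy[of "mem w 51" "mem t 51" "mem s 45 k" "mem t 52"] w by simp
        moreover have "teq (int q) q (pol q (mem t 51) + smult (int (mem s 45 k)) (pol q (mem t 52))) (S k + smult (int (mem s 45 k)) (X ^ k))"
          using I by (intro teq_add teq_smult) (auto simp: I_def)
        ultimately show ?thesis by (auto simp: S_def intro: teq_trans)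
      qed
      have "W (p_mul 52 52 53) (\<lambda>z. (\<forall>j<q. mem z 52 j < q) \<and> teq (int q) q (pol q (mem z 52)) (pol q (mem w 52) * pol q (mem w 53))) w"
        by (rule mul_wp[OF pw]) (use I wm t0 in \<open>auto simp: I_def\<close>)
      then show "W (p_mul 52 52 53) (I (Suc k)) w"
      proof (rule wp_mono)
        fix z assume z: "(\<forall>j<q. mem z 52 j < q) \<and> teq (int q) q (pol q (mem z 52)) (pol q (mem w 52) * pol q (mem w 53))"
          and fz: "frame (p_mul 52 52 53) w z"
        have "teq (int q) q (pol q (mem w 52) * pol q (mem w 53)) (X ^ k * X)"
          unfolding wm using I t0 by (intro teq_mult) (auto simp: I_def)
        then have "teq (int q) q (pol q (mem z 52)) (X ^ Suc k)" using z by (auto simp: mult_ac intro: teq_trans)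
        then show "I (Suc k) z" using z w t51 q0 frame_mem[OF fz] by (simp add: I_def)
      qed
    qed
  next
    fix t assume I: "I (mem t0 0 0) t" and fr: "frame (For 34 0 ?body) t0 t"
    show "W (For 34 0 (Out (Arr 51 (V 34)))) (emits x R s) t"
    proof (rule fin)
      show "par t" by (rule par_frame[OF t0(2) fr]) simp_all
      show "I n t" using I t0 by (simp add: par_def)
      show "outp t = outp s" using fr t0 by (simp add: frame_def)
    qed
  qed
  let ?c1 = "p_const 51 (Lit 0) (Lit 0)" and ?c2 = "p_const 52 (Lit 1) (Lit 0)"
    and ?c3 = "p_const 53 (Red (Sub (V 2) (V 32))) (Lit 1)"
  \<comment> \<open>The reduction matters for \<open>x0 = 0\<close>, where \<open>q - x0\<close> is
    no residue.\<close>
  have neg: "teq (int q) q [:int ((q - x0) mod q), int 1:] X"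
  proof -
    have "int q dvd int ((q - x0) mod q) + int x0"
      using x0 by (cases "x0 = 0") (auto simp: of_nat_diff)
    then show ?thesis by (auto simp: teq_def X_def coeff_pCons split: nat.splits)
  qed
  show ?thesis unfolding p_emit_def wp_simps(5)
  proof (rule wp_mono[OF const_wp[OF s]])
    fix t assume t: "\<forall>j<q. mem t 51 j = (if j = 0 then 0 else if j = 1 then 0 else 0)" and ft: "frame ?c1 s t"
    have pt: "par t" by (rule par_frame[OF s ft]) simp_all
    show "W ?c2 (W ?c3 (W (For 34 0 ?body) (W (For 34 0 (Out (Arr 51 (V 34)))) (emits x R s)))) t"
    proof (rule wp_mono[OF const_wp[OF pt]])
      fix u assume u: "\<forall>j<q. mem u 52 j = (if j = 0 then 1 else if j = 1 then 0 else 0)" and fu: "frame ?c2 t u"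
      have pu: "par u" by (rule par_frame[OF pt fu]) simp_all
      have u32: "mem u 32 0 = x0" using frame_mem[OF fu] frame_mem[OF ft] x0 by simp
      show "W ?c3 (W (For 34 0 ?body) (W (For 34 0 (Out (Arr 51 (V 34)))) (emits x R s))) u"
      proof (rule wp_mono[OF const_wp[OF pu]])
        fix w assume w: "\<forall>j<q. mem w 53 j = (if j = 0 then (q - x0) mod q else if j = 1 then 1 else 0)" and fw: "frame ?c3 u w"
        have w51: "\<forall>j<q. mem w 51 j = (if j = 0 then 0 else if j = 1 then 0 else 0)"
          using t frame_mem[OF fu] frame_mem[OF fw] by simp
        have w52: "\<forall>j<q. mem w 52 j = (if j = 0 then 1 else if j = 1 then 0 else 0)"
          using u frame_mem[OF fw] by simp
        show "W (For 34 0 ?body) (W (For 34 0 (Out (Arr 51 (V 34)))) (emits x R s)) w"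
        proof (rule loop)
          show "I 0 w" using w51 w52 n pol_const[OF w51, of "int q"] pol_const[OF w52, of "int q"]
            by (auto simp: I_def S_def one_pCons)
          show "par w" by (rule par_frame[OF pu fw]) simp_all
          show "outp w = outp s" "mem w 45 = mem s 45"
            using ft fu fw by (auto simp: frame_def)
          show "\<forall>j<q. mem w 53 j < q" using w n by simp
          show "teq (int q) q (pol q (mem w 53)) X"
            using pol_const[OF w, of "int q"] neg teq_trans by blast
        qed
      next
        have "q - x0 - q * min q ((q - x0) div q) = (q - x0) mod q"
        proof (rule red_eq)
          have "0 < q * q" using q0 by simp
          then show "q - x0 < q * q + q" by linarith
        qed
        then show "val ((mem u)(22 := i, 53 := w)) (Red (Sub (V 2) (V 32))) = (q - x0) mod q" for i w
          using pu u32 by (simp add: par_def)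
      qed auto
    qed auto
  qed auto
qed

lemma bev_cong: "(\<And>b a. b < q \<Longrightarrow> a < q \<Longrightarrow> c b a = c' b a) \<Longrightarrow> bev q c X Y = bev q c' X Y"
  unfolding bev_def by (intro sum.cong refl) auto

lemma dy_cong: "(\<And>b. b < q \<Longrightarrow> c b a = c' b a) \<Longrightarrow> dy q c b a = dy q c' b a"
  by (simp add: dy_def)

text \<open>The derivative is taken in place: row \<open>b\<close> is overwritten from row
  \<open>b + 1\<close> in ascending order, so each source row is still the old one.\<close>

lemma deriv_wp:
  assumes s: "par s" and c: "\<forall>i<q * q. mem s 44 i < q"
  shows "W p_deriv (\<lambda>t. \<forall>b<q. \<forall>a<q. mem t 44 (b * q + a) < q \<and> coefs q (mem t 44) b a = dy q (coefs q (mem s 44)) b a) s"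
proof -
  let ?B = "Assign 44 (ix 23 24)
     (Red (Mul (Arr 44 (Add (Mul (Add (V 23) (Lit 1)) (V 2)) (V 24))) (Red (Add (V 23) (Lit 1)))))"
  define D where "D b a = nat (dy q (coefs q (mem s 44)) b a)" for b a
  have D: "D b a < q" "int (D b a) = dy q (coefs q (mem s 44)) b a" for b a
    using q0 by (auto simp: D_def dy_def nat_less_iff)
  have step: "mem s 44 (Suc b * q + a) * min (Suc b mod q) q - q * min q (mem s 44 (Suc b * q + a) * min (Suc b mod q) q div q) = D b a"
    if "b < q" "a < q" for a b
  proof (cases "Suc b < q")
    case True
    have lt: "mem s 44 (Suc b * q + a) < q" using c pair_less[OF True that(2)] by blast
    have "mem s 44 (Suc b * q + a) * min (Suc b mod q) q - q * min q (mem s 44 (Suc b * q + a) * min (Suc b mod q) q div q)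
       = (mem s 44 (Suc b * q + a) * Suc b) mod q"
      using red_mul[of "mem s 44 (Suc b * q + a)" q "Suc b"] lt True by simp
    also have "\<dots> = D b a"
    proof -
      have "int ((mem s 44 (Suc b * q + a) * Suc b) mod q) = (int (Suc b) * int (mem s 44 (Suc b * q + a))) mod int q"
        by (simp only: zmod_int of_nat_mult mult.commute)
      also have "\<dots> = int (D b a)" unfolding D(2) dy_def coefs_def using True by (simp only: if_True)
      finally have "int ((mem s 44 (Suc b * q + a) * Suc b) mod q) = int (D b a)" .
      then show ?thesis by simp
    qed
    finally show ?thesis .
  next
    \<comment> \<open>In the last row the factor \<open>Suc b = q\<close> is reduced to 0, which
      hides whatever is stored behind the coefficients.\<close>
    case False
    then have "Suc b = q" using that by simp
    then show ?thesis by (simp add: D_def dy_def)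
  qed
  have "W p_deriv (\<lambda>t. \<forall>b<q. \<forall>a<q. mem t 44 (b * q + a) = D b a) s"
    unfolding p_deriv_def
  proof (rule wp_For[where I = "\<lambda>i t. \<forall>b<q. \<forall>a<q. mem t 44 (b * q + a) = (if b < i then D b a else mem s 44 (b * q + a))"])
    fix i t assume i: "i < mem s 2 0" and t: "\<forall>b<q. \<forall>a<q. mem t 44 (b * q + a) = (if b < i then D b a else mem s 44 (b * q + a))"
      and ft: "frame (For 23 2 (For 24 2 ?B)) s t"
    have iq: "i < q" using i s by (simp add: par_def)
    have tm: "mem t 2 0 = q" using frame_mem[OF ft] s by (simp add: par_def)
    show "W (For 24 2 ?B) (\<lambda>t. \<forall>b<q. \<forall>a<q. mem t 44 (b * q + a) = (if b < Suc i then D b a else mem s 44 (b * q + a))) (setm 23 0 i t)"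
    proof (rule wp_For[where I = "\<lambda>j u. \<forall>b<q. \<forall>a<q. mem u 44 (b * q + a) = (if b < i \<or> b = i \<and> a < j then D b a else mem s 44 (b * q + a))"])
      fix j u assume j: "j < mem (setm 23 0 i t) 2 0"
        and u: "\<forall>b<q. \<forall>a<q. mem u 44 (b * q + a) = (if b < i \<or> b = i \<and> a < j then D b a else mem s 44 (b * q + a))"
        and fu: "frame (For 24 2 ?B) (setm 23 0 i t) u"
      have jq: "j < q" using j tm by simp
      have um: "mem u 2 0 = q" "mem u 23 0 = i" using frame_mem[OF fu] tm by auto
      have r: "Suc i - q * min q (Suc i div q) = Suc i mod q"
      proof (rule red_eq)
        have "0 < q * q" using q0 by simp
        then show "Suc i < q * q + q" using iq by linarith
      qed
      have val: "mem u 44 (Suc i * q + j) * min (Suc i mod q) q - q * min q (mem u 44 (Suc i * q + j) * min (Suc i mod q) q div q) = D i j"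
      proof (cases "Suc i < q")
        case True
        then have "mem u 44 (Suc i * q + j) = mem s 44 (Suc i * q + j)" using u jq by (metis Suc_n_not_le_n less_or_eq_imp_le not_less_eq)
        then show ?thesis using step[OF iq jq] by simp
      next
        case False
        then have "Suc i = q" using iq by simp
        then show ?thesis by (simp add: D_def dy_def)
      qed
      have mn: "min (Suc i mod q) q = Suc i mod q" using q0 by (simp add: min_absorb1 less_imp_le)
      have val': "val ((mem u)(24 := (mem u 24)(0 := j))) (Red (Mul (Arr 44 (Add (Mul (Add (V 23) (Lit 1)) (V 2)) (V 24)))
          (Red (Add (V 23) (Lit 1))))) = D i j"
        using val unfolding mn by (simp add: um r mn)
      have upd: "((mem u 44)(i * q + j := D i j)) (b * q + a) = (if b < i \<or> b = i \<and> a < Suc j then D b a else mem s 44 (b * q + a))"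
        if "b < q" "a < q" for b a
        using u that jq pair_eq[of a q j b i] by (auto simp: less_Suc_eq)
      show "W ?B (\<lambda>u. \<forall>b<q. \<forall>a<q. mem u 44 (b * q + a) = (if b < i \<or> b = i \<and> a < Suc j then D b a else mem s 44 (b * q + a))) (setm 24 0 j u)"
        unfolding wp_simps(1) setm_simps(1) val' using upd by (simp add: um)
    qed (use t tm in \<open>auto simp: less_Suc_eq\<close>)
  qed (use s in \<open>auto simp: par_def\<close>)
  then show ?thesis by (rule wp_mono) (simp add: D coefs_def)
qed

lemma exists_pair: "i < q * q \<Longrightarrow> \<exists>b<q. \<exists>a<q. i = b * q + a"
  using q0 by (intro exI[of _ "i div q"] exI[of _ "i mod q"] conjI) (auto simp: less_mult_imp_div_less)

text \<open>The loops run through all candidates for three witnesses: the order of the derivative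
  from \<open>bev_derivative_switch\<close>, the point from \<open>exists_simple_point\<close>, and
  the residue of \<open>P (x0)\<close> as the starting value.\<close>

lemma roots_wp:
  assumes s: "par s" and c: "\<forall>i<q * q. mem s 44 i < q" and x: "x \<in> messages q n"
    and wd: "t < q" "wdeg q n t (coefs q (mem s 44))"
  shows "W p_roots (emits x (pz q (bev q (coefs q (mem s 44)) [:0, 1:] (mpol x)) \<and>
    (\<exists>b<q. \<exists>a<q. \<not> int q dvd coefs q (mem s 44) b a)) s) s"
proof -
  define c0 where "c0 = coefs q (mem s 44)"
  define P where "P = mpol x"
  define root where "root h \<longleftrightarrow> pz q (bev q ((dy q ^^ h) c0) [:0, 1:] P) \<and> \<not> pz q (bev q (dy q ((dy q ^^ h) c0)) [:0, 1:] P)" for h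
  define simple where "simple h x0 \<longleftrightarrow> pz q (bev q ((dy q ^^ h) c0) [:0, 1:] P) \<and>
      \<not> int q dvd poly (bev q (dy q ((dy q ^^ h) c0)) [:0, 1:] P) (int x0)" for h x0
  have wdh: "wdeg q n t ((dy q ^^ h) c0)" for h
    using wd(2) by (induction h) (auto simp: c0_def wdeg_dy)
  have root_simple: "\<exists>x0<q. simple h x0" if "root h" for h
    using exists_simple_point[OF q wdh degree_mpol wd(1)] that unfolding root_def simple_def P_def by blast
  let ?g = "For 33 2 (p_lift ;; p_emit)"
  let ?x = "For 32 2 (p_const 50 (V 32) (Lit 1) ;; ?g)"
  define I where "I h u \<longleftrightarrow> (\<forall>b<q. \<forall>a<q. mem u 44 (b * q + a) < q \<and> coefs q (mem u 44) b a = (dy q ^^ h) c0 b a) \<and>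
      emits x (\<exists>h'<h. root h') s u" for h and u :: st
  have gl: "W ?g (emits x (simple h x0) w) w"
    if w: "par w" "\<forall>i<q * q. mem w 44 i < q" "\<forall>b<q. \<forall>a<q. coefs q (mem w 44) b a = (dy q ^^ h) c0 b a"
      "\<forall>j<q. mem w 50 j = (if j = 0 then x0 else if j = 1 then 1 else 0)" "mem w 32 0 = x0" "x0 < q" for h x0 w
  proof (rule wp_For[where I = "\<lambda>g u. emits x (simple h x0 \<and> (\<exists>g'<g. int q dvd int g' - poly P (int x0))) w u"])
    show "emits x (simple h x0 \<and> (\<exists>g'<0. int q dvd int g' - poly P (int x0))) w w" using emits_refl by simp
  next
    fix g u assume g: "g < mem w 2 0" and u: "emits x (simple h x0 \<and> (\<exists>g'<g. int q dvd int g' - poly P (int x0))) w u"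
      and fu: "frame ?g w u"
    let ?u = "setm 33 0 g u"
    let ?R = "simple h x0 \<and> int q dvd int g - poly P (int x0)"
    let ?T = "pcompose P [:int x0, 1:]"
    have gq: "g < q" using g w by (simp add: par_def)
    have um: "mem u 44 = mem w 44" "mem u 50 = mem w 50" "mem u 32 0 = x0" using frame_mem[OF fu] w by auto
    have pu: "par ?u" using par_frame[OF w(1) fu] by (simp add: par_def)
    have eqc: "bev q (coefs q (mem ?u 44)) X Y = bev q ((dy q ^^ h) c0) X Y" for X Y
      using w(3) um by (intro bev_cong) simp
    have "W p_lift (\<lambda>t. (\<forall>j<q. mem t 45 j < q) \<and> (?R \<longrightarrow> teq (int q) n (pol q (mem t 45)) ?T)) ?u"
    proof (rule lift_wp[OF pu])
      show "\<forall>i<q * q. mem ?u 44 i < q" "mem ?u 33 0 < q" using w um gq by auto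
      show "\<forall>j<q. mem ?u 50 j = (if j = 0 then x0 else if j = 1 then 1 else 0)" "x0 < q" using w um by auto
      have "coeff ?T 0 = poly P (int x0)" by (simp add: poly_0_coeff_0[symmetric] poly_pcompose)
      then show "?R \<Longrightarrow> int q dvd int (mem ?u 33 0) - coeff ?T 0" by simp
      fix A k assume R: "?R" "1 \<le> k" "k < q" "teq (int q) k A ?T"
      show "int q dvd coeff (bev q (coefs q (mem ?u 44)) [:int x0, 1:] A) k \<longleftrightarrow> int q dvd coeff A k - coeff ?T k"
        unfolding eqc by (rule lift_unique[OF q]) (use R in \<open>auto simp: simple_def\<close>)
    qed
    then have "W p_lift (W p_emit (emits x (simple h x0 \<and> (\<exists>g'<Suc g. int q dvd int g' - poly P (int x0))) w)) ?u"
    proof (rule wp_mono)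
      fix v assume v: "(\<forall>j<q. mem v 45 j < q) \<and> (?R \<longrightarrow> teq (int q) n (pol q (mem v 45)) ?T)" and fv: "frame p_lift ?u v"
      have pv: "par v" by (rule par_frame[OF pu fv]) simp_all
      have "W p_emit (emits x ?R v) v"
        by (rule emit_wp[OF pv, of x0]) (use v x w um frame_mem[OF fv] in \<open>auto simp: P_def\<close>)
      then show "W p_emit (emits x (simple h x0 \<and> (\<exists>g'<Suc g. int q dvd int g' - poly P (int x0))) w) v"
      proof (rule wp_mono)
        fix z assume z: "emits x ?R v z"
        have "outp v = outp u" using fv by (simp add: frame_def)
        then have "emits x ?R u z" using z emits_cong[of v u z z] by simp
        from emits_trans[OF u this] show "emits x (simple h x0 \<and> (\<exists>g'<Suc g. int q dvd int g' - poly P (int x0))) w z"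
          by (rule emits_mono) (auto simp: less_Suc_eq)
      qed
    qed
    then show "W (p_lift ;; p_emit) (emits x (simple h x0 \<and> (\<exists>g'<Suc g. int q dvd int g' - poly P (int x0))) w) ?u"
      by simp
  next
    fix u assume u: "emits x (simple h x0 \<and> (\<exists>g'<mem w 2 0. int q dvd int g' - poly P (int x0))) w u"
    have "\<exists>g'<q. int q dvd int g' - poly P (int x0)"
    proof (intro exI conjI)
      show "nat (poly P (int x0) mod int q) < q" using q0 by (simp add: nat_less_iff)
      have "int (nat (poly P (int x0) mod int q)) = poly P (int x0) mod int q" using q0 by simp
      then show "int q dvd int (nat (poly P (int x0) mod int q)) - poly P (int x0)"
        by (metis dvd_minus_mod dvd_diff_commute)
    qed
    then show "emits x (simple h x0) w u" using u w(1) by (auto simp: par_def elim!: emits_mono)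
  qed
  have xl: "W ?x (emits x (root h) u) u" if u: "par u" "I h u" for h u
  proof (rule wp_For[where I = "\<lambda>i v. emits x (\<exists>x0<i. simple h x0) u v"])
    show "emits x (\<exists>x0<0. simple h x0) u u" using emits_refl by simp
  next
    fix i v assume i: "i < mem u 2 0" and v: "emits x (\<exists>x0<i. simple h x0) u v" and fv: "frame ?x u v"
    let ?v = "setm 32 0 i v"
    have iq: "i < q" using i u by (simp add: par_def)
    have pv: "par ?v" using par_frame[OF u(1) fv] by (simp add: par_def)
    have vm: "mem v 44 = mem u 44" using frame_mem[OF fv] by simp
    have "W (p_const 50 (V 32) (Lit 1)) (\<lambda>t. \<forall>j<q. mem t 50 j = (if j = 0 then i else if j = 1 then 1 else 0)) ?v"
      by (rule const_wp[OF pv]) auto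
    then have "W (p_const 50 (V 32) (Lit 1)) (W ?g (emits x (\<exists>x0<Suc i. simple h x0) u)) ?v"
    proof (rule wp_mono)
      fix w assume w: "\<forall>j<q. mem w 50 j = (if j = 0 then i else if j = 1 then 1 else 0)"
        and fw: "frame (p_const 50 (V 32) (Lit 1)) ?v w"
      have wm: "mem w 44 = mem u 44" "mem w 32 0 = i" using frame_mem[OF fw] vm by auto
      have "W ?g (emits x (simple h i) w) w"
      proof (rule gl)
        show "par w" by (rule par_frame[OF pv fw]) simp_all
        show "\<forall>k<q * q. mem w 44 k < q" using u(2) exists_pair by (metis I_def wm(1))
        show "\<forall>b<q. \<forall>a<q. coefs q (mem w 44) b a = (dy q ^^ h) c0 b a" using u(2) by (simp add: I_def wm)
      qed (use w wm iq in auto)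
      then show "W ?g (emits x (\<exists>x0<Suc i. simple h x0) u) w"
      proof (rule wp_mono)
        fix z assume z: "emits x (simple h i) w z"
        have "outp w = outp v" using fw by (simp add: frame_def)
        then have "emits x (simple h i) v z" using z emits_cong[of w v z z] by simp
        from emits_trans[OF v this] show "emits x (\<exists>x0<Suc i. simple h x0) u z"
          by (rule emits_mono) (auto simp: less_Suc_eq)
      qed
    qed
    then show "W (p_const 50 (V 32) (Lit 1) ;; ?g) (emits x (\<exists>x0<Suc i. simple h x0) u) ?v" by simp
  next
    fix v assume "emits x (\<exists>x0<mem u 2 0. simple h x0) u v"
    then show "emits x (root h) u v" using u(1) root_simple by (auto simp: par_def elim!: emits_mono)
  qed
  show ?thesis unfolding p_roots_def
  proof (rule wp_For[where I = I])
    show "I 0 s" using c emits_refl pair_less by (auto simp: I_def c0_def)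
  next
    fix h u assume h: "h < mem s 2 0" and I: "I h u" and fu: "frame (For 31 2 (?x ;; p_deriv)) s u"
    let ?u = "setm 31 0 h u"
    have pu: "par ?u" using par_frame[OF s fu] by (simp add: par_def)
    have I': "I h ?u" using I emits_cong[of s s ?u u] by (simp add: I_def)
    show "W (?x ;; p_deriv) (I (Suc h)) ?u" unfolding wp_simps(5)
    proof (rule wp_mono[OF xl[OF pu I']])
      fix v assume v: "emits x (root h) ?u v" and fv: "frame ?x ?u v"
      have pv: "par v" by (rule par_frame[OF pu fv]) auto
      have vm: "mem v 44 = mem u 44" using frame_mem[OF fv] by simp
      have "W p_deriv (\<lambda>t. \<forall>b<q. \<forall>a<q. mem t 44 (b * q + a) < q \<and> coefs q (mem t 44) b a = dy q (coefs q (mem v 44)) b a) v"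
        by (rule deriv_wp[OF pv]) (use I exists_pair vm in \<open>metis I_def\<close>)
      then show "W p_deriv (I (Suc h)) v"
      proof (rule wp_mono)
        fix w assume w: "\<forall>b<q. \<forall>a<q. mem w 44 (b * q + a) < q \<and> coefs q (mem w 44) b a = dy q (coefs q (mem v 44)) b a"
          and fw: "frame p_deriv v w"
        have "dy q (coefs q (mem v 44)) b a = (dy q ^^ Suc h) c0 b a" if "a < q" for b a
          using I that unfolding vm funpow.simps o_apply I_def by (intro dy_cong) auto
        moreover have "emits x (root h) u w"
          using v emits_cong[of ?u u v w] fw by (simp add: frame_def)
        then have "emits x (\<exists>h'<Suc h. root h') s w"
          using emits_trans[of x "\<exists>h'<h. root h'" s u "root h" w] I unfolding I_def
          by (auto simp: less_Suc_eq elim!: emits_mono)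
        ultimately show "I (Suc h) w" using w by (simp add: I_def)
      qed
    qed
  next
    fix u assume "I (mem s 2 0) u"
    then have "emits x (\<exists>h<q. root h) s u" using s by (simp add: I_def par_def)
    then show "emits x (pz q (bev q (coefs q (mem s 44)) [:0, 1:] (mpol x)) \<and>
      (\<exists>b<q. \<exists>a<q. \<not> int q dvd coefs q (mem s 44) b a)) s u"
    proof (rule emits_mono)
      assume "pz q (bev q (coefs q (mem s 44)) [:0, 1:] (mpol x)) \<and> (\<exists>b<q. \<exists>a<q. \<not> int q dvd coefs q (mem s 44) b a)"
      then show "\<exists>h<q. root h" using bev_derivative_switch[OF q] unfolding root_def c0_def P_def by blast
    qed
  qed
qed

section \<open>Correctness of the interpolation program\<close>

lemma null_inv_cong:
  assumes "\<And>k i. k < q * q \<Longrightarrow> i < q * q \<Longrightarrow> v k i = v' k i" "null_inv q n t y R v"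
  shows "null_inv q n t y R v'"
proof -
  have "indep q J v' \<longleftrightarrow> indep q J v" if "J \<subseteq> {..<q * q}" for J
  proof -
    have "(\<Sum>k\<in>J. c k * v' k i) = (\<Sum>k\<in>J. c k * v k i)" if "i < q * q" for c i
      using assms(1) \<open>J \<subseteq> {..<q * q}\<close> that by (intro sum.cong) auto
    then show ?thesis unfolding indep_def by simp
  qed
  moreover have "(\<Sum>i<q * q. v' k i * M i) = (\<Sum>i<q * q. v k i * M i)" if "k < q * q" for k M
    using assms(1) that by (intro sum.cong) auto
  ultimately show ?thesis using assms unfolding null_inv_def by (auto; metis)
qed

lemma addr_eq: "b < q \<Longrightarrow> a < q \<Longrightarrow> b' < q \<Longrightarrow> a' < q \<Longrightarrow>
    k * q * q + (b * q + a) = k' * q * q + (b' * q + a') \<longleftrightarrow> k = k' \<and> b = b' \<and> a = a'"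
  using pair_eq[of "b * q + a" "q * q" "b' * q + a'" k k'] pair_less[of b q a] pair_less[of b' q a']
    pair_eq[of a q a' b b'] by (simp add: mult.assoc)

lemma addr_eq': "i < q * q \<Longrightarrow> i' < q * q \<Longrightarrow> k * q * q + i = k' * q * q + i' \<longleftrightarrow> k = k' \<and> i = i'"
  using pair_eq[of i "q * q" i' k k'] by (simp add: mult.assoc)

text \<open>The program compares numbers by adding both truncated differences, a sum that is zero
  only for equal ones. The invariant follows the lexicographic order of
  \<open>(k, b, a)\<close>.\<close>

lemma init_wp:
  assumes s: "par s"
  shows "W p_init (\<lambda>t. \<forall>k<q * q. \<forall>i<q * q. mem t 40 (k * q * q + i) =
    (if k = i \<and> i \<in> allowed q n (mem s 20 0) then 1 else 0)) s"
proof -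
  define E where "E k b a = (if k = b * q + a \<and> a + (n - 1) * b \<le> mem s 20 0 then 1 else 0 :: nat)" for k b a
  define I where "I k b a t \<longleftrightarrow> (\<forall>k' b' a'. b' < q \<longrightarrow> a' < q \<longrightarrow> (k' < k \<or> k' = k \<and> (b' < b \<or> b' = b \<and> a' < a)) \<longrightarrow>
      mem t 40 (k' * q * q + (b' * q + a')) = E k' b' a')" for k b a and t :: st
  let ?B = "Ite (Add (Sub (V 21) (ix 23 24)) (Sub (ix 23 24) (V 21)))
       (Assign 40 (vrow 21 (ix 23 24)) (Lit 0))
       (Ite (Sub (Add (V 24) (Mul (V 23) (Sub (V 0) (Lit 1)))) (V 20))
         (Assign 40 (vrow 21 (ix 23 24)) (Lit 0))
         (Assign 40 (vrow 21 (ix 23 24)) (Lit 1)))"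
  have "W p_init (I (q * q) 0 0) s" unfolding p_init_def
  proof (rule wp_For[where I = "\<lambda>k. I k 0 0"])
    fix k t assume It: "I k 0 0 t" and ft: "frame (For 21 7 (For 23 2 (For 24 2 ?B))) s t"
    let ?t = "setm 21 0 k t"
    have tm: "mem t 2 0 = q" "mem t 0 0 = n" "mem t 20 = mem s 20" using frame_mem[OF ft] s by (auto simp: par_def)
    show "W (For 23 2 (For 24 2 ?B)) (I (Suc k) 0 0) ?t"
    proof (rule wp_For[where I = "\<lambda>b. I k b 0"])
      show "I k 0 0 ?t" using It by (simp add: I_def)
      fix b u assume b: "b < mem ?t 2 0" and Iu: "I k b 0 u" and fu: "frame (For 23 2 (For 24 2 ?B)) ?t u"
      let ?u = "setm 23 0 b u"
      have um: "mem u 2 0 = q" "mem u 0 0 = n" "mem u 20 = mem s 20" "mem u 21 0 = k" using frame_mem[OF fu] tm by auto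
      have bq: "b < q" using b tm by simp
      show "W (For 24 2 ?B) (I k (Suc b) 0) ?u"
      proof (rule wp_For[where I = "\<lambda>a. I k b a"])
        show "I k b 0 ?u" using Iu by (simp add: I_def)
        fix a v assume a: "a < mem ?u 2 0" and Iv: "I k b a v" and fv: "frame (For 24 2 ?B) ?u v"
        have vm: "mem v 2 0 = q" "mem v 0 0 = n" "mem v 20 = mem s 20" "mem v 21 0 = k" "mem v 23 0 = b" using frame_mem[OF fv] um by auto
        have aq: "a < q" using a um by simp
        have upd: "I k b (Suc a) (setm 40 (k * q * q + (b * q + a)) (E k b a) (setm 24 0 a v))"
          using Iv addr_eq[OF _ _ bq aq] by (auto simp: I_def less_Suc_eq)
        have n1: "min (n - Suc 0) q = n - Suc 0" using n by simp
        show "W ?B (I k b (Suc a)) (setm 24 0 a v)"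
          using upd by (auto simp: vm E_def n1 mult.commute split: if_splits)
      next
        fix v assume "I k b (mem ?u 2 0) v"
        then show "I k (Suc b) 0 v" using um by (auto simp: I_def less_Suc_eq)
      qed
    next
      fix u assume "I k (mem ?t 2 0) 0 u"
      then show "I (Suc k) 0 0 u" using tm by (auto simp: I_def less_Suc_eq)
    qed
  qed (use s in \<open>auto simp: par_def I_def\<close>)
  then show ?thesis
  proof (rule wp_mono)
    fix t assume t: "I (q * q) 0 0 t"
    show "\<forall>k<q * q. \<forall>i<q * q. mem t 40 (k * q * q + i) = (if k = i \<and> i \<in> allowed q n (mem s 20 0) then 1 else 0)"
    proof (intro allI impI)
      fix k i assume k: "k < q * q" and i: "i < q * q"
      obtain b a where ba: "b < q" "a < q" "i = b * q + a" using exists_pair[OF i] by blast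
      then show "mem t 40 (k * q * q + i) = (if k = i \<and> i \<in> allowed q n (mem s 20 0) then 1 else 0)"
        using t k i unfolding I_def by (auto simp: E_def allowed_def)
    qed
  qed
qed

lemma mon_wp:
  assumes s: "par s" and r: "mem s 25 0 = r" "r < q" "mem s 17 r = y" "y < q"
  shows "W p_mon (\<lambda>t. \<forall>b<q. \<forall>a<q. mem t 41 (b * q + a) = (y ^ b * r ^ a) mod q) s"
proof -
  let ?in = "Assign 41 (ix 23 24) (V 29) ;; Set 29 (Red (Mul (V 29) (V 25)))"
  let ?body = "Set 29 (V 30) ;; For 24 2 ?in ;; Set 30 (Red (Mul (V 30) (Arr 17 (V 25))))"
  have q1: "1 < q" using n by simp
  have red: "w mod q * z - q * min q (w mod q * z div q) = w * z mod q" if "z < q" for w z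
    using red_mul[of "w mod q" q z] that q0 by (simp add: mod_simps)
  have "W (For 23 2 ?body) (\<lambda>t. \<forall>b<q. \<forall>a<q. mem t 41 (b * q + a) = (y ^ b * r ^ a) mod q) (setm 30 0 1 s)"
  proof (rule wp_For[where I = "\<lambda>i t. (\<forall>b<i. \<forall>a<q. mem t 41 (b * q + a) = (y ^ b * r ^ a) mod q) \<and> mem t 30 0 = y ^ i mod q"])
    show "(\<forall>b<0. \<forall>a<q. mem (setm 30 0 1 s) 41 (b * q + a) = (y ^ b * r ^ a) mod q) \<and> mem (setm 30 0 1 s) 30 0 = y ^ 0 mod q"
      using q1 by simp
  next
    fix i t assume i: "i < mem (setm 30 0 1 s) 2 0"
      and t: "(\<forall>b<i. \<forall>a<q. mem t 41 (b * q + a) = (y ^ b * r ^ a) mod q) \<and> mem t 30 0 = y ^ i mod q"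
      and ft: "frame (For 23 2 ?body) (setm 30 0 1 s) t"
    have iq: "i < q" using i s by (simp add: par_def)
    have tm: "mem t 2 0 = q" "mem t 25 0 = r" "mem t 17 r = y" using frame_mem[OF ft] s r by (auto simp: par_def)
    let ?t = "setm 29 0 (y ^ i mod q) (setm 23 0 i t)"
    have "W (For 24 2 ?in) (\<lambda>u. (\<forall>b<Suc i. \<forall>a<q. mem u 41 (b * q + a) = (y ^ b * r ^ a) mod q)) ?t"
    proof (rule wp_For[where I = "\<lambda>j u. (\<forall>b<q. \<forall>a<q. b < i \<or> b = i \<and> a < j \<longrightarrow> mem u 41 (b * q + a) = (y ^ b * r ^ a) mod q) \<and>
        mem u 29 0 = y ^ i * r ^ j mod q"])
      show "(\<forall>b<q. \<forall>a<q. b < i \<or> b = i \<and> a < 0 \<longrightarrow> mem ?t 41 (b * q + a) = (y ^ b * r ^ a) mod q) \<and>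
        mem ?t 29 0 = y ^ i * r ^ 0 mod q" using t by simp
    next
      fix j u assume j: "j < mem ?t 2 0"
        and u: "(\<forall>b<q. \<forall>a<q. b < i \<or> b = i \<and> a < j \<longrightarrow> mem u 41 (b * q + a) = (y ^ b * r ^ a) mod q) \<and>
        mem u 29 0 = y ^ i * r ^ j mod q" and fu: "frame (For 24 2 ?in) ?t u"
      have jq: "j < q" using j tm by simp
      have um: "mem u 2 0 = q" "mem u 25 0 = r" "mem u 23 0 = i" using frame_mem[OF fu] tm by auto
      have val: "y ^ i * r ^ j mod q * min r q - q * min q (y ^ i * r ^ j mod q * min r q div q) = y ^ i * r ^ Suc j mod q"
        using red[OF r(2), of "y ^ i * r ^ j"] r(2) by (simp add: mult_ac)
      have upd: "((mem u 41)(i * q + j := y ^ i * r ^ j mod q)) (b * q + a) = (y ^ b * r ^ a) mod q"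
        if "b < q" "a < q" "b < i \<or> b = i \<and> a < Suc j" for b a
        using u that jq iq pair_eq[of a q j b i] by (auto simp: less_Suc_eq)
      show "W ?in (\<lambda>u. (\<forall>b<q. \<forall>a<q. b < i \<or> b = i \<and> a < Suc j \<longrightarrow> mem u 41 (b * q + a) = (y ^ b * r ^ a) mod q) \<and>
        mem u 29 0 = y ^ i * r ^ Suc j mod q) (setm 24 0 j u)"
        using upd val u by (simp add: um)
    next
      fix u assume "(\<forall>b<q. \<forall>a<q. b < i \<or> b = i \<and> a < mem ?t 2 0 \<longrightarrow> mem u 41 (b * q + a) = (y ^ b * r ^ a) mod q) \<and>
        mem u 29 0 = y ^ i * r ^ mem ?t 2 0 mod q"
      then show "\<forall>b<Suc i. \<forall>a<q. mem u 41 (b * q + a) = (y ^ b * r ^ a) mod q"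
        using tm iq by (auto simp: less_Suc_eq)
    qed
    then have "W (For 24 2 ?in) (W (Set 30 (Red (Mul (V 30) (Arr 17 (V 25)))))
        (\<lambda>t. (\<forall>b<Suc i. \<forall>a<q. mem t 41 (b * q + a) = (y ^ b * r ^ a) mod q) \<and> mem t 30 0 = y ^ Suc i mod q)) ?t"
    proof (rule wp_mono)
      fix u assume u: "\<forall>b<Suc i. \<forall>a<q. mem u 41 (b * q + a) = (y ^ b * r ^ a) mod q" and fu: "frame (For 24 2 ?in) ?t u"
      have um: "mem u 2 0 = q" "mem u 25 0 = r" "mem u 17 r = y" "mem u 30 0 = y ^ i mod q" using frame_mem[OF fu] tm t by auto
      have val: "y ^ i mod q * min y q - q * min q (y ^ i mod q * min y q div q) = y ^ Suc i mod q"
        using red[OF r(4), of "y ^ i"] r(4) by (simp add: mult_ac)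
      show "W (Set 30 (Red (Mul (V 30) (Arr 17 (V 25)))))
        (\<lambda>t. (\<forall>b<Suc i. \<forall>a<q. mem t 41 (b * q + a) = (y ^ b * r ^ a) mod q) \<and> mem t 30 0 = y ^ Suc i mod q) u"
        using u val by (simp add: um)
    qed
    then show "W ?body (\<lambda>t. (\<forall>b<Suc i. \<forall>a<q. mem t 41 (b * q + a) = (y ^ b * r ^ a) mod q) \<and> mem t 30 0 = y ^ Suc i mod q) (setm 23 0 i t)"
      using t by simp
  qed (use s in \<open>auto simp: par_def\<close>)
  then show ?thesis by (simp add: p_mon_def)
qed

lemma dot_wp:
  assumes s: "par s" and v: "\<forall>k<q * q. \<forall>i<q * q. mem s 40 (k * q * q + i) < q" "\<forall>i<q * q. mem s 41 i < q"
  shows "W p_dot (\<lambda>t. \<forall>k<q * q. mem t 42 k = (\<Sum>i<q * q. mem s 40 (k * q * q + i) * mem s 41 i) mod q) s"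
  unfolding p_dot_def
proof (rule wp_For[where I = "\<lambda>k t. \<forall>k'<k. mem t 42 k' = (\<Sum>i<q * q. mem s 40 (k' * q * q + i) * mem s 41 i) mod q"])
  let ?in = "Set 26 (Red (Add (V 26) (Mul (Arr 40 (vrow 21 (V 22))) (Arr 41 (V 22)))))"
  let ?body = "Set 26 (Lit 0) ;; For 22 7 ?in ;; Assign 42 (V 21) (V 26)"
  fix k t assume k: "k < mem s 7 0" and t: "\<forall>k'<k. mem t 42 k' = (\<Sum>i<q * q. mem s 40 (k' * q * q + i) * mem s 41 i) mod q"
    and ft: "frame (For 21 7 ?body) s t"
  have kq: "k < q * q" using k s by (simp add: par_def)
  have tm: "mem t 2 0 = q" "mem t 7 0 = q * q" "mem t 40 = mem s 40" "mem t 41 = mem s 41"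
    using frame_mem[OF ft] s by (auto simp: par_def)
  let ?t = "setm 26 0 0 (setm 21 0 k t)"
  have "W (For 22 7 ?in) (\<lambda>u. mem u 26 0 = (\<Sum>i<q * q. mem s 40 (k * q * q + i) * mem s 41 i) mod q) ?t"
  proof (rule wp_For[where I = "\<lambda>j u. mem u 26 0 = (\<Sum>i<j. mem s 40 (k * q * q + i) * mem s 41 i) mod q"])
    fix j u assume j: "j < mem ?t 7 0" and u: "mem u 26 0 = (\<Sum>i<j. mem s 40 (k * q * q + i) * mem s 41 i) mod q"
      and fu: "frame (For 22 7 ?in) ?t u"
    have jq: "j < q * q" using j tm by simp
    have um: "mem u 2 0 = q" "mem u 40 = mem s 40" "mem u 41 = mem s 41" "mem u 21 0 = k" using frame_mem[OF fu] tm by auto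
    have lt: "mem s 40 (k * q * q + j) \<le> q" "mem s 41 j \<le> q" "mem u 26 0 < q" using v jq kq u q0 by (auto simp: less_imp_le)
    have "mem u 26 0 + mem s 40 (k * q * q + j) * min (mem s 41 j) q - q * min q ((mem u 26 0 + mem s 40 (k * q * q + j) * min (mem s 41 j) q) div q)
       = (mem u 26 0 + mem s 40 (k * q * q + j) * mem s 41 j) mod q"
      using red_fma[OF lt(3,1,2)] lt(2) by (simp add: min_absorb1)
    also have "\<dots> = (\<Sum>i<Suc j. mem s 40 (k * q * q + i) * mem s 41 i) mod q" unfolding u by (simp add: mod_simps)
    finally show "W ?in (\<lambda>u. mem u 26 0 = (\<Sum>i<Suc j. mem s 40 (k * q * q + i) * mem s 41 i) mod q) (setm 22 0 j u)"
      by (simp add: um)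
  qed (use tm in auto)
  then have "W (For 22 7 ?in) (W (Assign 42 (V 21) (V 26)) (\<lambda>t. \<forall>k'<Suc k. mem t 42 k' = (\<Sum>i<q * q. mem s 40 (k' * q * q + i) * mem s 41 i) mod q)) ?t"
    by (rule wp_mono) (use t in \<open>auto simp: less_Suc_eq frame_def\<close>)
  then show "W ?body (\<lambda>t. \<forall>k'<Suc k. mem t 42 k' = (\<Sum>i<q * q. mem s 40 (k' * q * q + i) * mem s 41 i) mod q) (setm 21 0 k t)"
    by simp
qed (use s in \<open>auto simp: par_def\<close>)

lemma pivot_wp:
  assumes s: "par s"
  shows "W p_pivot (\<lambda>t. mem t 27 0 < q * q \<and> (mem s 42 (mem t 27 0) = 0 \<longrightarrow> (\<forall>k<q * q. mem s 42 k = 0))) s"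
proof -
  have "W (For 21 7 (Ite (Arr 42 (V 21)) (Set 27 (V 21)) Skip))
      (\<lambda>t. mem t 27 0 < q * q \<and> (mem s 42 (mem t 27 0) = 0 \<longrightarrow> (\<forall>k<q * q. mem s 42 k = 0))) (setm 27 0 0 s)"
    by (rule wp_For[where I = "\<lambda>i t. mem t 27 0 < q * q \<and> (mem s 42 (mem t 27 0) = 0 \<longrightarrow> (\<forall>k<i. mem s 42 k = 0))"])
       (use s q0 in \<open>auto simp: par_def less_Suc_eq frame_def\<close>)
  then show ?thesis by (simp add: p_pivot_def)
qed

lemma elim_wp:
  assumes s: "par s" and v: "\<forall>k<q * q. \<forall>i<q * q. mem s 40 (k * q * q + i) < q" "\<forall>k<q * q. mem s 42 k < q"
    and p: "mem s 27 0 = p" "p < q * q"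
  shows "W p_elim (\<lambda>t. \<forall>k<q * q. \<forall>i<q * q. mem t 40 (k * q * q + i) =
    (if mem s 42 p \<noteq> 0 then (mem s 42 p * mem s 40 (k * q * q + i) + (q - mem s 42 k) * mem s 40 (p * q * q + i)) mod q
     else mem s 40 (k * q * q + i))) s"
proof (cases "mem s 42 p = 0")
  case False
  define E where "E k i = (mem s 42 p * mem s 40 (k * q * q + i) + (q - mem s 42 k) * mem s 40 (p * q * q + i)) mod q" for k i
  let ?copy = "For 22 7 (Assign 43 (V 22) (Arr 40 (vrow 27 (V 22))))"
  let ?B = "Assign 40 (vrow 21 (V 22))
       (Red (Add (Red (Mul (V 28) (Arr 40 (vrow 21 (V 22)))))
         (Red (Mul (Sub (V 2) (Arr 42 (V 21))) (Arr 43 (V 22))))))"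
  let ?s = "setm 28 0 (mem s 42 p) s"
  have 1: "W ?copy (\<lambda>t. \<forall>i<q * q. mem t 43 i = mem s 40 (p * q * q + i)) ?s"
    by (rule wp_For[where I = "\<lambda>j t. \<forall>i<j. mem t 43 i = mem s 40 (p * q * q + i)"])
       (use s p in \<open>auto simp: par_def less_Suc_eq frame_def\<close>)
  have 2: "W (For 21 7 (For 22 7 ?B)) (\<lambda>t. \<forall>k<q * q. \<forall>i<q * q. mem t 40 (k * q * q + i) = E k i) t0"
    if t0: "\<forall>i<q * q. mem t0 43 i = mem s 40 (p * q * q + i)" "frame ?copy ?s t0" for t0
  proof (rule wp_For[where I = "\<lambda>k t. \<forall>k'<q * q. \<forall>i<q * q. mem t 40 (k' * q * q + i) = (if k' < k then E k' i else mem s 40 (k' * q * q + i))"])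
    fix k t assume k: "k < mem t0 7 0" and t: "\<forall>k'<q * q. \<forall>i<q * q. mem t 40 (k' * q * q + i) = (if k' < k then E k' i else mem s 40 (k' * q * q + i))"
      and ft: "frame (For 21 7 (For 22 7 ?B)) t0 t"
    have tm: "mem t 2 0 = q" "mem t 7 0 = q * q" "mem t 42 = mem s 42" "mem t 43 = mem t0 43" "mem t 28 0 = mem s 42 p"
      using frame_mem[OF ft] frame_mem[OF t0(2)] s by (auto simp: par_def)
    have kq: "k < q * q" using k frame_mem[OF t0(2)] s by (simp add: par_def)
    let ?t = "setm 21 0 k t"
    show "W (For 22 7 ?B) (\<lambda>t. \<forall>k'<q * q. \<forall>i<q * q. mem t 40 (k' * q * q + i) = (if k' < Suc k then E k' i else mem s 40 (k' * q * q + i))) ?t"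
    proof (rule wp_For[where I = "\<lambda>j t. \<forall>k'<q * q. \<forall>i<q * q. mem t 40 (k' * q * q + i) = (if k' < k \<or> k' = k \<and> i < j then E k' i else mem s 40 (k' * q * q + i))"])
      fix j u assume j: "j < mem ?t 7 0" and u: "\<forall>k'<q * q. \<forall>i<q * q. mem u 40 (k' * q * q + i) = (if k' < k \<or> k' = k \<and> i < j then E k' i else mem s 40 (k' * q * q + i))"
        and fu: "frame (For 22 7 ?B) ?t u"
      have jq: "j < q * q" using j tm by simp
      have um: "mem u 2 0 = q" "mem u 42 = mem s 42" "mem u 43 j = mem s 40 (p * q * q + j)" "mem u 28 0 = mem s 42 p" "mem u 21 0 = k"
        "mem u 40 (k * q * q + j) = mem s 40 (k * q * q + j)"
        using frame_mem[OF fu] tm t0 jq u kq by auto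
      define x y z w where "x = mem s 42 p" and "y = mem s 40 (k * q * q + j)" and "z = q - mem s 42 k" and "w = mem s 40 (p * q * q + j)"
      have lt: "x \<le> q" "y < q" "z \<le> q" "w < q" using v p kq jq by (auto simp: x_def y_def z_def w_def less_imp_le)
      have r1: "x * min y q - q * min q (x * min y q div q) = x * y mod q" "z * min w q - q * min q (z * min w q div q) = z * w mod q"
        using red_mul[of x q y] red_mul[of z q w] lt by simp_all
      have r2: "(a mod q + b mod q) - q * min q ((a mod q + b mod q) div q) = (a + b) mod q" for a b
      proof -
        have "a mod q < q" "b mod q < q" using q0 by auto
        moreover have "q \<le> q * q" using q0 by simp
        ultimately have "a mod q + b mod q < q * q + q" by linarith
        from red_eq[OF this] show ?thesis by (simp add: mod_simps)
      qed
      have val: "val ((mem u)(22 := (mem u 22)(0 := j))) (Red (Add (Red (Mul (V 28) (Arr 40 (vrow 21 (V 22)))))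
         (Red (Mul (Sub (V 2) (Arr 42 (V 21))) (Arr 43 (V 22)))))) = E k j"
        using r1 r2[of "x * y" "z * w"] by (simp add: um E_def x_def[symmetric] y_def[symmetric] z_def[symmetric] w_def[symmetric])
      have upd: "((mem u 40)(k * q * q + j := E k j)) (k' * q * q + i) = (if k' < k \<or> k' = k \<and> i < Suc j then E k' i else mem s 40 (k' * q * q + i))"
        if "k' < q * q" "i < q * q" for k' i
        using u that addr_eq'[OF that(2) jq, of k' k] by (auto simp: less_Suc_eq)
      show "W ?B (\<lambda>t. \<forall>k'<q * q. \<forall>i<q * q. mem t 40 (k' * q * q + i) = (if k' < k \<or> k' = k \<and> i < Suc j then E k' i else mem s 40 (k' * q * q + i))) (setm 22 0 j u)"
        unfolding wp_simps(1) setm_simps(1) val using upd by (simp add: um)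
    qed (use t tm in \<open>auto simp: less_Suc_eq\<close>)
  qed (use s frame_mem[OF t0(2)] in \<open>auto simp: par_def\<close>)
  from 1 have "W ?copy (W (For 21 7 (For 22 7 ?B)) (\<lambda>t. \<forall>k<q * q. \<forall>i<q * q. mem t 40 (k * q * q + i) = E k i)) ?s"
    by (rule wp_mono) (rule 2)
  then show ?thesis using False p by (simp add: p_elim_def E_def)
qed (use p in \<open>simp add: p_elim_def\<close>)

text \<open>One point of the word per iteration, by \<open>null_inv_step\<close> if some vector has
  a nonzero value there and by \<open>null_inv_skip\<close> otherwise.\<close>

lemma interp_wp:
  assumes s: "par s" and Y: "\<forall>r<q. mem s 17 r < q"
  shows "W p_interp (\<lambda>t. null_inv q n (mem s 20 0) (mem s 17) q (\<lambda>k i. int (mem t 40 (k * q * q + i))) \<and>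
    (\<forall>k<q * q. \<forall>i<q * q. mem t 40 (k * q * q + i) < q)) s"
proof -
  define I where "I r t \<longleftrightarrow> null_inv q n (mem s 20 0) (mem s 17) r (\<lambda>k i. int (mem t 40 (k * q * q + i))) \<and>
    (\<forall>k<q * q. \<forall>i<q * q. mem t 40 (k * q * q + i) < q)" for r and t :: st
  let ?body = "p_mon ;; p_dot ;; p_pivot ;; p_elim"
  show ?thesis unfolding p_interp_def wp_simps(5) I_def[symmetric]
  proof (rule wp_mono[OF init_wp[OF s]])
    fix t0 assume t0: "\<forall>k<q * q. \<forall>i<q * q. mem t0 40 (k * q * q + i) = (if k = i \<and> i \<in> allowed q n (mem s 20 0) then 1 else 0)"
      and f0: "frame p_init s t0"
    have p0: "par t0" by (rule par_frame[OF s f0]) auto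
    have "W (For 25 2 ?body) (I q) t0"
    proof (rule wp_For[where I = I])
      show "I 0 t0" unfolding I_def using t0 n by (intro conjI null_inv_init) auto
    next
      fix r t assume r: "r < mem t0 2 0" and I: "I r t" and ft: "frame (For 25 2 ?body) t0 t"
      have rq: "r < q" using r p0 by (simp add: par_def)
      let ?t = "setm 25 0 r t"
      have pt: "par ?t" using par_frame[OF p0 ft] by (simp add: par_def)
      have tm: "mem t 17 = mem s 17" using frame_mem[OF ft] frame_mem[OF f0] by auto
      define y where "y = mem s 17 r"
      have yq: "y < q" using Y rq by (simp add: y_def)
      have "W p_mon (\<lambda>t. \<forall>b<q. \<forall>a<q. mem t 41 (b * q + a) = (y ^ b * r ^ a) mod q) ?t"
        by (rule mon_wp[OF pt]) (use rq yq tm in \<open>auto simp: y_def\<close>)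
      then show "W ?body (I (Suc r)) ?t" unfolding wp_simps(5)
      proof (rule wp_mono)
        fix u assume u: "\<forall>b<q. \<forall>a<q. mem u 41 (b * q + a) = (y ^ b * r ^ a) mod q" and fu: "frame p_mon ?t u"
        have pu: "par u" by (rule par_frame[OF pt fu]) auto
        have u40: "mem u 40 = mem t 40" using frame_mem[OF fu] by simp
        have u41: "mem u 41 i < q" "int q dvd int (mem u 41 i) - bmon q r y i" if i: "i < q * q" for i
        proof -
          obtain b a where ba: "b < q" "a < q" "i = b * q + a" using exists_pair[OF i] by blast
          then have v: "mem u 41 i = (y ^ b * r ^ a) mod q" using u by blast
          then show "mem u 41 i < q" using q0 by simp
          have "bmon q r y i = int (y ^ b * r ^ a)" using ba by (simp add: bmon_def)
          then show "int q dvd int (mem u 41 i) - bmon q r y i"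
            unfolding v zmod_int by (metis dvd_minus_mod dvd_diff_commute)
        qed
        have vlt: "\<forall>k<q * q. \<forall>i<q * q. mem u 40 (k * q * q + i) < q" using I by (simp add: I_def u40)
        have "W p_dot (\<lambda>t. \<forall>k<q * q. mem t 42 k = (\<Sum>i<q * q. mem u 40 (k * q * q + i) * mem u 41 i) mod q) u"
          by (rule dot_wp[OF pu vlt]) (use u41 in auto)
        then show "W p_dot (W p_pivot (W p_elim (I (Suc r)))) u"
        proof (rule wp_mono)
          fix w assume w: "\<forall>k<q * q. mem w 42 k = (\<Sum>i<q * q. mem u 40 (k * q * q + i) * mem u 41 i) mod q"
            and fw: "frame p_dot u w"
          have pw: "par w" by (rule par_frame[OF pu fw]) auto
          have w40: "mem w 40 = mem t 40" using frame_mem[OF fw] u40 by simp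
          have wlt: "\<forall>k<q * q. mem w 42 k < q" using w q0 by simp
          have d: "int q dvd int (mem w 42 k) - (\<Sum>i<q * q. int (mem t 40 (k * q * q + i)) * bmon q r y i)" if k: "k < q * q" for k
          proof -
            have "int q dvd (\<Sum>i<q * q. int (mem t 40 (k * q * q + i)) * (int (mem u 41 i) - bmon q r y i))"
              using u41 by (intro dvd_sum dvd_mult) auto
            then have 1: "int q dvd (\<Sum>i<q * q. int (mem t 40 (k * q * q + i)) * int (mem u 41 i)) - (\<Sum>i<q * q. int (mem t 40 (k * q * q + i)) * bmon q r y i)"
              by (simp add: right_diff_distrib sum_subtractf)
            have "int (mem w 42 k) = (\<Sum>i<q * q. int (mem t 40 (k * q * q + i)) * int (mem u 41 i)) mod int q"
              using w k by (simp add: zmod_int u40)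
            then have "int q dvd int (mem w 42 k) - (\<Sum>i<q * q. int (mem t 40 (k * q * q + i)) * int (mem u 41 i))"
              by (metis dvd_minus_mod dvd_diff_commute)
            from dvd_add[OF this 1] show ?thesis by simp
          qed
          show "W p_pivot (W p_elim (I (Suc r))) w"
          proof (rule wp_mono[OF pivot_wp[OF pw]])
            fix z assume z: "mem z 27 0 < q * q \<and> (mem w 42 (mem z 27 0) = 0 \<longrightarrow> (\<forall>k<q * q. mem w 42 k = 0))"
              and fz: "frame p_pivot w z"
            define p where "p = mem z 27 0"
            have pz: "par z" by (rule par_frame[OF pw fz]) auto
            have zm: "mem z 40 = mem t 40" "mem z 42 = mem w 42" using frame_mem[OF fz] w40 by auto
            have "W p_elim (\<lambda>t. \<forall>k<q * q. \<forall>i<q * q. mem t 40 (k * q * q + i) =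
              (if mem z 42 p \<noteq> 0 then (mem z 42 p * mem z 40 (k * q * q + i) + (q - mem z 42 k) * mem z 40 (p * q * q + i)) mod q
               else mem z 40 (k * q * q + i))) z"
              by (rule elim_wp[OF pz]) (use z vlt u40 wlt zm in \<open>auto simp: p_def\<close>)
            then show "W p_elim (I (Suc r)) z"
            proof (rule wp_mono)
              fix e :: st assume e: "\<forall>k<q * q. \<forall>i<q * q. mem e 40 (k * q * q + i) =
              (if mem z 42 p \<noteq> 0 then (mem z 42 p * mem z 40 (k * q * q + i) + (q - mem z 42 k) * mem z 40 (p * q * q + i)) mod q
               else mem z 40 (k * q * q + i))"
              have lt: "\<forall>k<q * q. \<forall>i<q * q. mem e 40 (k * q * q + i) < q"
                using e vlt u40 zm q0 by auto
              have inv: "null_inv q n (mem s 20 0) (mem s 17) r (\<lambda>k i. int (mem t 40 (k * q * q + i)))"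
                using I by (simp add: I_def)
              have "null_inv q n (mem s 20 0) (mem s 17) (Suc r) (\<lambda>k i. int (mem e 40 (k * q * q + i)))"
              proof (cases "mem w 42 p = 0")
                case True
                then have "\<forall>k<q * q. mem w 42 k = 0" using z by (simp add: p_def)
                then have "null_inv q n (mem s 20 0) (mem s 17) (Suc r) (\<lambda>k i. int (mem t 40 (k * q * q + i)))"
                  using d by (intro null_inv_skip[OF inv]) (simp add: y_def)
                then show ?thesis
                  by (rule null_inv_cong[rotated]) (use e True zm in auto)
              next
                case False
                show ?thesis
                proof (rule null_inv_step[OF q inv, of "\<lambda>k. int (mem w 42 k)" p])
                  show "int q dvd int (mem w 42 k) - (\<Sum>i<q * q. int (mem t 40 (k * q * q + i)) * bmon q r (mem s 17 r) i)"
                    if "k < q * q" for k using d[OF that] by (simp add: y_def)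
                  show "p < q * q" using z by (simp add: p_def)
                  then show "\<not> int q dvd int (mem w 42 p)"
                    using False wlt by (auto simp: linorder_not_less[symmetric] dest!: dvd_imp_le)
                  fix k i assume k: "k < q * q" and i: "i < q * q"
                  \<comment> \<open>Makes the truncated \<open>q - d k\<close> a true difference, so
                    that it is congruent to \<open>- d k\<close> in the integers.\<close>
                  have "mem w 42 k \<le> q" using wlt k by (simp add: less_imp_le)
                  then have "int (mem e 40 (k * q * q + i)) = (int (mem w 42 p) * int (mem t 40 (k * q * q + i)) +
                      (int q - int (mem w 42 k)) * int (mem t 40 (p * q * q + i))) mod int q"
                    using e k i False zm by (simp add: zmod_int of_nat_diff)
                  also have "\<dots> = (int (mem w 42 p) * int (mem t 40 (k * q * q + i)) - int (mem w 42 k) * int (mem t 40 (p * q * q + i)) + int q * int (mem t 40 (p * q * q + i))) mod int q"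
                    by (simp add: algebra_simps)
                  also have "\<dots> = (int (mem w 42 p) * int (mem t 40 (k * q * q + i)) - int (mem w 42 k) * int (mem t 40 (p * q * q + i))) mod int q"
                    by simp
                  finally show "int (mem e 40 (k * q * q + i)) = (int (mem w 42 p) * int (mem t 40 (k * q * q + i)) - int (mem w 42 k) * int (mem t 40 (p * q * q + i))) mod int q" .
                qed
              qed
              then show "I (Suc r) e" using lt by (simp add: I_def)
            qed
          qed
        qed
      qed
    next
      fix t assume "I (mem t0 2 0) t"
      then show "I q t" using p0 by (simp add: par_def)
    qed
    then show "W (For 25 2 ?body) (I q) t0" .
  qed
qed

lemma GRS_poly:
  assumes "GRS q n x r = y"
  shows "int q dvd poly (mpol x) (int r) - int y"
proof -
  have "poly (mpol x) (int r) = int (\<Sum>i<n. x ! i * r ^ i)"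
    by (simp add: pol_def poly_sum poly_monom)
  moreover have "int y = int (\<Sum>i<n. x ! i * r ^ i) mod int q"
    by (subst zmod_int[symmetric]) (use assms in \<open>simp only: GRS_def\<close>)
  ultimately show ?thesis by (metis dvd_minus_mod)
qed

text \<open>The two requirements of interpolation on a threshold \<open>t\<close>: a nonzero
  polynomial exists since there are more monomials than conditions, and the message agrees with the
  word in more positions than the weighted degree.\<close>

definition hit :: "nat list \<Rightarrow> (nat \<Rightarrow> nat) \<Rightarrow> nat \<Rightarrow> bool" where
  "hit x y t \<longleftrightarrow> card (allowed q n t) > q \<and> card {r. r < q \<and> GRS q n x r = y r} > t"

text \<open>No nonzero vector is singled out: all \<open>q * q\<close> are handed to
  \<open>p_roots\<close>, and \<open>null_inv_nonzero\<close> with \<open>bev_root\<close> shows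
  that one of them leads to \<open>x\<close>.\<close>

lemma solutions_wp:
  assumes s: "par s" and x: "x \<in> messages q n" and t: "t < q"
    and v: "null_inv q n t y q (\<lambda>k i. int (mem s 40 (k * q * q + i)))"
      "\<forall>k<q * q. \<forall>i<q * q. mem s 40 (k * q * q + i) < q"
  shows "W (For 21 7 (For 22 7 (Assign 44 (V 22) (Arr 40 (vrow 21 (V 22)))) ;; p_roots)) (emits x (hit x y t) s) s"
proof -
  define c where "c k b a = int (mem s 40 (k * q * q + (b * q + a)))" for k b a
  define P where "P = mpol x"
  define cond where "cond k \<longleftrightarrow> pz q (bev q (c k) [:0, 1:] P) \<and> (\<exists>b<q. \<exists>a<q. \<not> int q dvd c k b a)" for k
  have wd: "wdeg q n t (c k)" if "k < q * q" for k
    using v(1) that pair_less unfolding null_inv_def wdeg_def c_def allowed_def by fastforce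
  have found: "\<exists>k<q * q. cond k" if h: "hit x y t"
  proof -
    have "1 < q" using n by simp
    then obtain k i where k: "k < q * q" "i < q * q" "\<not> int q dvd int (mem s 40 (k * q * q + i))"
      using null_inv_nonzero[OF v(1)] h unfolding hit_def by blast
    obtain b a where ba: "b < q" "a < q" "i = b * q + a" using exists_pair[OF k(2)] by blast
    have "pz q (bev q (c k) [:0, 1:] P)"
    proof (rule bev_root[OF q wd[OF k(1)], of P y])
      show "degree P \<le> n - 1" unfolding P_def by (rule degree_mpol)
      have "card {r. r < q \<and> GRS q n x r = y r} \<le> card {r. r < q \<and> int q dvd poly P (int r) - int (y r)}"
        unfolding P_def by (intro card_mono) (auto intro: GRS_poly)
      then show "t < card {r. r < q \<and> int q dvd poly P (int r) - int (y r)}" using h by (simp add: hit_def)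
      fix r assume r: "r < q"
      have "(\<Sum>i<q * q. int (mem s 40 (k * q * q + i)) * bmon q r (y r) i) =
          (\<Sum>b<q. \<Sum>a<q. c k b a * int r ^ a * int (y r) ^ b)"
        unfolding sum_pairs[symmetric] by (intro sum.cong refl) (simp add: c_def bmon_def)
      moreover have "int q dvd (\<Sum>i<q * q. int (mem s 40 (k * q * q + i)) * bmon q r (y r) i)"
        using v(1) r k(1) unfolding null_inv_def by blast
      ultimately show "int q dvd (\<Sum>b<q. \<Sum>a<q. c k b a * int r ^ a * int (y r) ^ b)" by simp
    qed
    then show ?thesis using k ba unfolding cond_def c_def by blast
  qed
  let ?copy = "For 22 7 (Assign 44 (V 22) (Arr 40 (vrow 21 (V 22))))"
  show ?thesis
  proof (rule wp_For[where I = "\<lambda>k u. emits x (\<exists>k'<k. cond k') s u"])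
    show "emits x (\<exists>k'<0. cond k') s s" using emits_refl by simp
  next
    fix k u assume k: "k < mem s 7 0" and u: "emits x (\<exists>k'<k. cond k') s u" and fu: "frame (For 21 7 (?copy ;; p_roots)) s u"
    let ?u = "setm 21 0 k u"
    have kq: "k < q * q" using k s by (simp add: par_def)
    have pu: "par ?u" using par_frame[OF s fu] by (simp add: par_def)
    have um: "mem u 40 = mem s 40" using frame_mem[OF fu] by simp
    have "W ?copy (\<lambda>w. \<forall>i<q * q. mem w 44 i = mem s 40 (k * q * q + i)) ?u"
      by (rule wp_For[where I = "\<lambda>j w. \<forall>i<j. mem w 44 i = mem s 40 (k * q * q + i)"])
         (use pu um in \<open>auto simp: par_def less_Suc_eq frame_def\<close>)
    then have "W ?copy (W p_roots (emits x (\<exists>k'<Suc k. cond k') s)) ?u"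
    proof (rule wp_mono)
      fix w assume w: "\<forall>i<q * q. mem w 44 i = mem s 40 (k * q * q + i)" and fw: "frame ?copy ?u w"
      have pw: "par w" by (rule par_frame[OF pu fw]) auto
      have cw: "coefs q (mem w 44) b a = c k b a" if "b < q" "a < q" for b a
        using w pair_less[OF that] by (simp add: coefs_def c_def)
      have bw: "bev q (coefs q (mem w 44)) X Y = bev q (c k) X Y" for X Y
        by (rule bev_cong) (rule cw)
      have "W p_roots (emits x (pz q (bev q (coefs q (mem w 44)) [:0, 1:] (mpol x)) \<and>
         (\<exists>b<q. \<exists>a<q. \<not> int q dvd coefs q (mem w 44) b a)) w) w"
      proof (rule roots_wp[OF pw _ x t])
        show "\<forall>i<q * q. mem w 44 i < q" using w v(2) kq by simp
        show "wdeg q n t (coefs q (mem w 44))" using wd[OF kq] cw by (auto simp: wdeg_def)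
      qed
      then show "W p_roots (emits x (\<exists>k'<Suc k. cond k') s) w"
      proof (rule wp_mono)
        fix z assume "emits x (pz q (bev q (coefs q (mem w 44)) [:0, 1:] (mpol x)) \<and>
         (\<exists>b<q. \<exists>a<q. \<not> int q dvd coefs q (mem w 44) b a)) w z"
        then have "emits x (cond k) w z"
        proof (rule emits_mono)
          assume "cond k"
          then obtain b a where "b < q" "a < q" "\<not> int q dvd c k b a" "pz q (bev q (c k) [:0, 1:] P)"
            unfolding cond_def by blast
          then show "pz q (bev q (coefs q (mem w 44)) [:0, 1:] (mpol x)) \<and>
              (\<exists>b<q. \<exists>a<q. \<not> int q dvd coefs q (mem w 44) b a)"
            unfolding bw P_def by (metis cw)
        qed
        moreover have "outp w = outp u" using fw by (simp add: frame_def)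
        ultimately have "emits x (cond k) u z" using emits_cong[of w u z z] by simp
        from emits_trans[OF u this] show "emits x (\<exists>k'<Suc k. cond k') s z"
          by (rule emits_mono) (auto simp: less_Suc_eq)
      qed
    qed
    then show "W (?copy ;; p_roots) (emits x (\<exists>k'<Suc k. cond k') s) ?u" by simp
  next
    fix u assume "emits x (\<exists>k'<mem s 7 0. cond k') s u"
    then show "emits x (hit x y t) s u" using s found by (auto simp: par_def elim!: emits_mono)
  qed
qed

lemma decode_wp:
  assumes s: "par s" and Y: "\<forall>r<q. mem s 17 r < q" and x: "x \<in> messages q n"
  shows "W p_decode (emits x (\<exists>t<q. hit x (mem s 17) t) s) s"
  unfolding p_decode_def
proof (rule wp_For[where I = "\<lambda>i u. emits x (\<exists>t<i. hit x (mem s 17) t) s u"])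
  let ?sol = "For 21 7 (For 22 7 (Assign 44 (V 22) (Arr 40 (vrow 21 (V 22)))) ;; p_roots)"
  show "emits x (\<exists>t<0. hit x (mem s 17) t) s s" using emits_refl by simp
  fix t u assume t: "t < mem s 2 0" and u: "emits x (\<exists>t'<t. hit x (mem s 17) t') s u" and fu: "frame (For 20 2 (p_interp ;; ?sol)) s u"
  let ?u = "setm 20 0 t u"
  have tq: "t < q" using t s by (simp add: par_def)
  have pu: "par ?u" using par_frame[OF s fu] by (simp add: par_def)
  have um: "mem u 17 = mem s 17" using frame_mem[OF fu] by simp
  have "W p_interp (\<lambda>t. null_inv q n (mem ?u 20 0) (mem ?u 17) q (\<lambda>k i. int (mem t 40 (k * q * q + i))) \<and>
    (\<forall>k<q * q. \<forall>i<q * q. mem t 40 (k * q * q + i) < q)) ?u"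
    by (rule interp_wp[OF pu]) (use Y um in auto)
  then have "W p_interp (W ?sol (emits x (\<exists>t'<Suc t. hit x (mem s 17) t') s)) ?u"
  proof (rule wp_mono)
    fix w assume w: "null_inv q n (mem ?u 20 0) (mem ?u 17) q (\<lambda>k i. int (mem w 40 (k * q * q + i))) \<and>
      (\<forall>k<q * q. \<forall>i<q * q. mem w 40 (k * q * q + i) < q)" and fw: "frame p_interp ?u w"
    have pw: "par w" by (rule par_frame[OF pu fw]) auto
    have "W ?sol (emits x (hit x (mem s 17) t) w) w"
      by (rule solutions_wp[OF pw x tq]) (use w um in auto)
    then show "W ?sol (emits x (\<exists>t'<Suc t. hit x (mem s 17) t') s) w"
    proof (rule wp_mono)
      fix z assume z: "emits x (hit x (mem s 17) t) w z"
      have "outp w = outp u" using fw by (simp add: frame_def)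
      then have "emits x (hit x (mem s 17) t) u z" using z emits_cong[of w u z z] by simp
      from emits_trans[OF u this] show "emits x (\<exists>t'<Suc t. hit x (mem s 17) t') s z"
        by (rule emits_mono) (auto simp: less_Suc_eq)
    qed
  qed
  then show "W (p_interp ;; ?sol) (emits x (\<exists>t'<Suc t. hit x (mem s 17) t') s) ?u" by simp
next
  fix u assume "emits x (\<exists>t<mem s 2 0. hit x (mem s 17) t) s u"
  then show "emits x (\<exists>t<q. hit x (mem s 17) t) s u" using s by (simp add: par_def)
qed

end

section \<open>Repeated rounds\<close>

text \<open>A measured string may encode a number from \<open>q\<close> on. It differs from any
  codeword symbol, so replacing it by 0 loses no agreement and keeps the word inside the
  field.\<close>

definition p_word :: stmt where
  "p_word = For 11 2 (sample ;;
     Ite (Sub (V 2) (V 15)) (Assign 17 (V 11) (V 15)) (Assign 17 (V 11) (Lit 0)))"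

definition p_round :: stmt where
  "p_round = p_word ;; p_decode"

text \<open>Loop bounds are variables, so \<open>q ^ 8 * D\<close> rounds are nested loops over
  \<open>q * q\<close> and \<open>D\<close>. They can share variable 54, as the true counters are
  temporaries and the body never reads it.\<close>

definition p_rounds :: stmt where
  "p_rounds = For 54 7 (For 54 7 (For 54 7 (For 54 7 (For 54 4 p_round))))"

definition p_main :: stmt where
  "p_main = Set 7 (Mul (V 2) (V 2)) ;; p_rounds"

lemmas p_round_defs = p_round_def p_word_def sample_def load_query_def meas_body_def p_decode_def
  p_interp_def p_roots_def p_defs

lemma mods_sample [simp]: "mods sample = {10, 12, 13, 14, 15, 16}"
  by (auto simp: sample_def load_query_def meas_body_def)

lemma quiet_sample [simp]: "quiet sample"
  by (auto simp: sample_def load_query_def meas_body_def)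

lemma mods_decode [simp]:
  "mods p_decode = {14, 20, 21, 22, 23, 24, 25, 26, 27, 28, 29, 30, 31, 32, 33, 34, 35, 36, 38, 40, 41, 42, 43,
     44, 45, 46, 47, 48, 49, 50, 51, 52, 53}" "pure p_decode"
  by (auto simp: p_decode_def)

lemma mods_word [simp]: "mods p_word = {10, 11, 12, 13, 14, 15, 16, 17}" "quiet p_word"
  by (auto simp: p_word_def)

lemma wfs_rounds: "wfs {0, 2, 4, 5, 7} p_rounds" "mods p_rounds \<inter> {0, 2, 4, 5, 7} = {}"
  by (auto simp: p_rounds_def p_round_defs)

fun outs :: "(nat \<Rightarrow> nat) \<Rightarrow> stmt \<Rightarrow> nat" where
  "outs \<rho> (Out e) = 1"
| "outs \<rho> (P ;; Q) = outs \<rho> P + outs \<rho> Q"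
| "outs \<rho> (Ite e P Q) = outs \<rho> P + outs \<rho> Q"
| "outs \<rho> (For k p P) = \<rho> p * outs \<rho> P"
| "outs \<rho> _ = 0"

lemma sem_outs:
  assumes "t \<in> set_pmf (sem m l U P s)" "wfs L P" "mods P \<inter> L = {}" "\<And>p. p \<in> L \<Longrightarrow> mem s p 0 = \<rho> p"
  shows "length (outp t) \<le> length (outp s) + outs \<rho> P"
  using assms
proof (induction P arbitrary: s t)
  case (Seq P Q)
  then obtain u where u: "u \<in> set_pmf (sem m l U P s)" "t \<in> set_pmf (sem m l U Q u)" by auto
  have "length (outp u) \<le> length (outp s) + outs \<rho> P" using Seq.IH(1)[OF u(1)] Seq.prems by auto
  moreover have "mem u p 0 = \<rho> p" if "p \<in> L" for p
  proof -
    have "p \<notin> mods P" using Seq.prems(3) that by auto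
    then show ?thesis using frame_mem[OF sem_frame[OF u(1)]] Seq.prems(4)[OF that] by simp
  qed
  then have "length (outp t) \<le> length (outp u) + outs \<rho> Q" using Seq.IH(2)[OF u(2)] Seq.prems by auto
  ultimately show ?case by simp
next
  case (Ite e P Q)
  have d: "mods P \<inter> L = {}" "mods Q \<inter> L = {}" "wfs L P" "wfs L Q" using Ite.prems by auto
  show ?case
  proof (cases "val (mem s) e = 0")
    case True
    then have "t \<in> set_pmf (sem m l U Q s)" using Ite.prems(1) by simp
    from Ite.IH(2)[OF this d(4,2) Ite.prems(4)] show ?thesis by simp
  next
    case False
    then have "t \<in> set_pmf (sem m l U P s)" using Ite.prems(1) by simp
    from Ite.IH(1)[OF this d(3,1) Ite.prems(4)] show ?thesis by simp
  qed
next
  case (For k p P)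
  let ?f = "\<lambda>i t. sem m l U P (setm k 0 i t)"
  have "t' \<in> set_pmf (mfold ?f is s') \<Longrightarrow> (\<And>p. p \<in> L \<Longrightarrow> mem s' p 0 = \<rho> p) \<Longrightarrow>
      length (outp t') \<le> length (outp s') + length is * outs \<rho> P" for "is" s' t'
  proof (induction "is" arbitrary: s')
    case (Cons i "is")
    then obtain u where u: "u \<in> set_pmf (?f i s')" "t' \<in> set_pmf (mfold ?f is u)" by auto
    have s': "mem (setm k 0 i s') p 0 = \<rho> p" if "p \<in> L" for p
      using Cons.prems(2)[OF that] For.prems(3) that by auto
    then have 1: "length (outp u) \<le> length (outp s') + outs \<rho> P"
      using For.IH[OF u(1)] For.prems by auto
    have "mem u p 0 = \<rho> p" if "p \<in> L" for p
    proof -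
      have "p \<notin> mods P" using For.prems(3) that by auto
      then show ?thesis using frame_mem[OF sem_frame[OF u(1)]] s'[OF that] by simp
    qed
    then have "length (outp t') \<le> length (outp u) + length is * outs \<rho> P" by (rule Cons.IH[OF u(2)])
    with 1 show ?case by simp
  qed simp
  from this[of t "[0..<mem s p 0]" s] show ?case using For.prems by auto
qed auto

section \<open>Auxiliary estimates for the repetition\<close>

lemma emeasure_prob: "emeasure (measure_pmf M) A = ennreal (measure_pmf.prob M A)"
  by (rule measure_pmf.emeasure_eq_measure)

lemma prob_bind_mono:
  assumes "\<And>x. x \<in> set_pmf M \<Longrightarrow> x \<in> B \<Longrightarrow> set_pmf (f x) \<subseteq> A"
  shows "measure_pmf.prob M B \<le> measure_pmf.prob (bind_pmf M f) A"
proof -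
  have "ennreal (measure_pmf.prob M B) = (\<integral>\<^sup>+x. indicator B x \<partial>M)"
    by (simp add: emeasure_prob)
  also have "\<dots> \<le> (\<integral>\<^sup>+x. emeasure (f x) A \<partial>M)"
  proof (intro nn_integral_mono_AE, unfold AE_measure_pmf_iff, intro ballI)
    fix x assume x: "x \<in> set_pmf M"
    show "indicator B x \<le> emeasure (measure_pmf (f x)) A"
    proof (cases "x \<in> B")
      case True
      then have "measure_pmf.prob (f x) A = 1"
        using assms[OF x] by (subst measure_pmf.prob_eq_1) (auto simp: AE_measure_pmf_iff)
      then show ?thesis using True by (simp add: emeasure_prob)
    qed simp
  qed
  also have "\<dots> = ennreal (measure_pmf.prob (bind_pmf M f) A)" by (simp add: emeasure_prob[symmetric])
  finally show ?thesis by (simp add: ennreal_le_iff)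
qed

lemma prob_bind_le:
  assumes "\<And>x. x \<in> set_pmf M \<Longrightarrow> x \<in> B \<Longrightarrow> measure_pmf.prob (f x) A \<le> c" "0 \<le> c"
    and "\<And>x. x \<in> set_pmf M \<Longrightarrow> x \<notin> B \<Longrightarrow> set_pmf (f x) \<inter> A = {}"
  shows "measure_pmf.prob (bind_pmf M f) A \<le> c * measure_pmf.prob M B"
proof -
  have "ennreal (measure_pmf.prob (bind_pmf M f) A) = (\<integral>\<^sup>+x. emeasure (f x) A \<partial>M)"
    by (simp add: emeasure_prob[symmetric])
  also have "\<dots> \<le> (\<integral>\<^sup>+x. ennreal c * indicator B x \<partial>M)"
  proof (intro nn_integral_mono_AE, unfold AE_measure_pmf_iff, intro ballI)
    fix x assume x: "x \<in> set_pmf M"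
    show "emeasure (measure_pmf (f x)) A \<le> ennreal c * indicator B x"
    proof (cases "x \<in> B")
      case True
      then show ?thesis using assms(1)[OF x] by (simp add: emeasure_prob ennreal_leI)
    next
      case False
      then have "measure_pmf.prob (f x) A = 0"
        using assms(3)[OF x] by (simp add: measure_pmf_zero_iff)
      then show ?thesis by (simp add: emeasure_prob)
    qed
  qed
  also have "\<dots> = ennreal c * emeasure M B" by (rule nn_integral_cmult_indicator) simp
  also have "\<dots> = ennreal (c * measure_pmf.prob M B)" using assms(2) by (simp add: emeasure_prob ennreal_mult)
  finally show ?thesis using assms(2) by (simp add: ennreal_le_iff)
qed

text \<open>Messages have a common positive length, so the flat output determines its division into
  messages. This identifies the lists obtained separately for different messages.\<close>

lemma concat_inject:
  assumes "concat ys = concat zs" "\<forall>y\<in>set ys. length y = n" "\<forall>z\<in>set zs. length z = n" "0 < n"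
  shows "ys = zs"
  using assms
proof (induction ys arbitrary: zs)
  case Nil
  then show ?case by (cases zs) auto
next
  case (Cons y ys)
  then obtain z zs' where zs: "zs = z # zs'" by (cases zs) auto
  have "y = z \<and> concat ys = concat zs'"
    using Cons.prems unfolding zs by (simp add: append_eq_append_conv)
  then show ?case using Cons.IH[of zs'] Cons.prems unfolding zs by auto
qed

lemma sum_prob_le:
  assumes "finite G" "\<And>t. t \<in> set_pmf M \<Longrightarrow> card {x \<in> G. E x t} \<le> B"
  shows "(\<Sum>x\<in>G. measure_pmf.prob M {t. E x t}) \<le> real B"
proof -
  have "ennreal (\<Sum>x\<in>G. measure_pmf.prob M {t. E x t}) = (\<Sum>x\<in>G. \<integral>\<^sup>+t. indicator {t. E x t} t \<partial>M)"
    by (simp add: emeasure_prob sum_ennreal)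
  also have "\<dots> = (\<integral>\<^sup>+t. (\<Sum>x\<in>G. indicator {t. E x t} t) \<partial>M)" by (rule nn_integral_sum[symmetric]) simp
  also have "\<dots> \<le> (\<integral>\<^sup>+t. of_nat B \<partial>M)"
  proof (intro nn_integral_mono_AE, unfold AE_measure_pmf_iff, intro ballI)
    fix t assume t: "t \<in> set_pmf M"
    have "(\<Sum>x\<in>G. indicator {t. E x t} t :: ennreal) = of_nat (card {x \<in> G. E x t})"
      using assms(1) by (simp add: indicator_def sum.If_cases Int_def flip: of_bool_def)
    then show "(\<Sum>x\<in>G. indicator {t. E x t} t :: ennreal) \<le> of_nat B"
      using assms(2)[OF t] by simp
  qed
  also have "\<dots> = ennreal (real B)" by (simp add: ennreal_of_nat_eq_real_of_nat)
  finally show ?thesis by (simp add: ennreal_le_iff)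
qed

text \<open>\<open>(1 + 1 / q) ^ k\<close> is at least \<open>k / q\<close> by Bernoulli, and its
  product with \<open>(1 - 1 / q) ^ k\<close> is at most 1. This decay is enough for the union
  bound, and it keeps the number of rounds a monomial in the inputs.\<close>

lemma one_minus_power_le:
  fixes q :: real
  assumes "1 \<le> q" "0 < k"
  shows "(1 - 1 / q) ^ k \<le> q / real k"
proof -
  have "1 + real k * (1 / q) \<le> (1 + 1 / q) ^ k"
    by (rule Bernoulli_inequality) (use assms in \<open>simp add: order_trans[of _ 0]\<close>)
  then have "real k / q \<le> (1 + 1 / q) ^ k" by simp
  then have "(1 - 1 / q) ^ k * (real k / q) \<le> (1 - 1 / q) ^ k * (1 + 1 / q) ^ k"
    using assms by (intro mult_left_mono zero_le_power) (auto simp: field_simps)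
  also have "\<dots> = ((1 - 1 / q) * (1 + 1 / q)) ^ k" by (rule power_mult_distrib[symmetric])
  also have "\<dots> \<le> 1"
  proof (rule power_le_one)
    show "0 \<le> (1 - 1 / q) * (1 + 1 / q)" using assms by (intro mult_nonneg_nonneg) auto
    have "(1 - x) * (1 + x) \<le> 1" for x :: real by (simp add: algebra_simps)
    then show "(1 - 1 / q) * (1 + 1 / q) \<le> 1" .
  qed
  finally have "(1 - 1 / q) ^ k * (real k / q) \<le> 1" .
  then show ?thesis using assms by (simp add: field_simps)
qed

section \<open>Success probability of one round and of all rounds\<close>

locale list_decoding = corrupted q l m U \<alpha> \<phi> + decoder m l U q n
  for q l m :: nat and U \<alpha> \<phi> and n :: nat +
  fixes D :: nat
  assumes D: "0 < D"
begin

definition rinv :: "st \<Rightarrow> bool" where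
  "rinv s \<longleftrightarrow> par s \<and> good m l s \<and> mem s 4 0 = D"

definition wrong :: "nat list \<Rightarrow> nat \<Rightarrow> st \<Rightarrow> nat" where
  "wrong x i t = card {r. r < i \<and> mem t 17 r \<noteq> GRS q n x r}"

lemma GRS_less: "GRS q n x r < q"
  using q0 by (simp add: GRS_def)

lemma wrong_Suc: "wrong x (Suc i) t = wrong x i t + of_bool (mem t 17 i \<noteq> GRS q n x i)"
proof -
  have "{r. r < Suc i \<and> mem t 17 r \<noteq> GRS q n x r} = {r. r < i \<and> mem t 17 r \<noteq> GRS q n x r} \<union>
      (if mem t 17 i \<noteq> GRS q n x i then {i} else {})" by (auto simp: less_Suc_eq)
  then show ?thesis unfolding wrong_def by (simp add: card_insert_if)
qed

definition p_read :: stmt where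
  "p_read = sample ;; Ite (Sub (V 2) (V 15)) (Assign 17 (V 11) (V 15)) (Assign 17 (V 11) (Lit 0))"

lemma read_wp:
  assumes s: "rinv s" and i: "i < q"
  shows "wp m l U p_read (\<lambda>t. rinv t \<and> mem t 17 i < q \<and> (\<forall>j. j \<noteq> i \<longrightarrow> mem t 17 j = mem s 17 j)) (setm 11 0 i s)"
proof -
  let ?s = "setm 11 0 i s"
  have g: "good m l ?s" using s by (simp add: rinv_def good_def)
  have "wp m l U sample (good m l) ?s" by (rule sample_wp[OF g]) (use i in simp)
  then show ?thesis unfolding p_read_def wp_simps(5)
  proof (rule wp_mono)
    fix t assume t: "good m l t" and ft: "frame sample ?s t"
    have tm: "mem t 11 0 = i" "mem t 17 = mem s 17" "mem t 2 0 = q" "mem t 0 0 = n" "mem t 7 0 = q * q" "mem t 4 0 = D"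
      using frame_mem[OF ft] s by (auto simp: rinv_def par_def)
    show "wp m l U (Ite (Sub (V 2) (V 15)) (Assign 17 (V 11) (V 15)) (Assign 17 (V 11) (Lit 0)))
      (\<lambda>t. rinv t \<and> mem t 17 i < q \<and> (\<forall>j. j \<noteq> i \<longrightarrow> mem t 17 j = mem s 17 j)) t"
      using t q0 by (auto simp: tm rinv_def par_def good_def)
  qed
qed

lemma read_prob:
  assumes s: "rinv s" and i: "i < q" and c: "c < q"
  shows "(cmod (\<alpha> i c))\<^sup>2 \<le> measure_pmf.prob (sem m l U p_read (setm 11 0 i s)) {t. mem t 17 i = c}"
proof -
  let ?s = "setm 11 0 i s"
  have g: "good m l ?s" using s by (simp add: rinv_def good_def)
  have "(cmod (\<alpha> i c))\<^sup>2 \<le> measure_pmf.prob (sem m l U sample ?s) {t. mem t 15 0 = c}"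
    by (rule sample_prob[OF g]) (use i c q_le in auto)
  also have "\<dots> \<le> measure_pmf.prob (sem m l U p_read ?s) {t. mem t 17 i = c}"
    unfolding p_read_def sem.simps(6)
  proof (rule prob_bind_mono)
    fix t assume t: "t \<in> set_pmf (sem m l U sample ?s)" "t \<in> {t. mem t 15 0 = c}"
    have "mem t 11 0 = i" "mem t 2 0 = q"
      using frame_mem[OF sem_frame[OF t(1)]] s by (auto simp: rinv_def par_def)
    then show "set_pmf (sem m l U (Ite (Sub (V 2) (V 15)) (Assign 17 (V 11) (V 15)) (Assign 17 (V 11) (Lit 0))) t) \<subseteq> {t. mem t 17 i = c}"
      using t(2) c by auto
  qed
  finally show ?thesis .
qed

lemma word_wp:
  assumes "rinv s"
  shows "wp m l U p_word (\<lambda>t. rinv t \<and> (\<forall>r<q. mem t 17 r < q)) s"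
  unfolding p_word_def p_read_def[symmetric]
proof (rule wp_For[where I = "\<lambda>i t. rinv t \<and> (\<forall>r<i. mem t 17 r < q)"])
  fix i t assume i: "i < mem s 2 0" and t: "rinv t \<and> (\<forall>r<i. mem t 17 r < q)"
  have "i < q" using i assms by (simp add: rinv_def par_def)
  from read_wp[OF _ this, of t] t
  have "wp m l U p_read (\<lambda>u. rinv u \<and> mem u 17 i < q \<and> (\<forall>j. j \<noteq> i \<longrightarrow> mem u 17 j = mem t 17 j)) (setm 11 0 i t)" by blast
  then show "wp m l U p_read (\<lambda>t. rinv t \<and> (\<forall>r<Suc i. mem t 17 r < q)) (setm 11 0 i t)"
    by (rule wp_mono) (use t in \<open>auto simp: less_Suc_eq\<close>)
qed (use assms in \<open>auto simp: rinv_def par_def\<close>)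

lemma column_le_1: "i < q \<Longrightarrow> c < q \<Longrightarrow> (cmod (\<alpha> i c))\<^sup>2 \<le> 1"
proof -
  assume i: "i < q" and c: "c < q"
  have "(\<Sum>z<2 ^ m. (cmod (\<alpha> i z))\<^sup>2) = 1"
    using cc i unfolding corrupted_codeword_def m Let_def by auto
  moreover have "(cmod (\<alpha> i c))\<^sup>2 \<le> (\<Sum>z<2 ^ m. (cmod (\<alpha> i z))\<^sup>2)"
    by (rule member_le_sum) (use c q_le in auto)
  ultimately show ?thesis by simp
qed

text \<open>Linearity of expectation, one query at a time: from every state with
  \<open>rinv\<close>, the next symbol is wrong with at most the stated probability, so nothing
  about independence of the queries is required.\<close>

lemma expected_wrong:
  assumes "i \<le> q" "rinv s"
  shows "(\<integral>\<^sup>+t. of_nat (wrong x q t) \<partial>mfold (\<lambda>i t. sem m l U p_read (setm 11 0 i t)) [i..<q] s)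
    \<le> of_nat (wrong x i s) + ennreal (\<Sum>r=i..<q. 1 - (cmod (\<alpha> r (GRS q n x r)))\<^sup>2)"
  using assms
proof (induction i arbitrary: s rule: inc_induct)
  case base
  then show ?case by simp
next
  case (step i)
  let ?f = "\<lambda>i t. sem m l U p_read (setm 11 0 i t)"
  define w where "w r = 1 - (cmod (\<alpha> r (GRS q n x r)))\<^sup>2" for r
  have w0: "0 \<le> w r" if "r < q" for r using column_le_1[OF that GRS_less] by (simp add: w_def)
  let ?S = "\<Sum>r=Suc i..<q. w r"
  have S0: "0 \<le> ?S" using w0 by (intro sum_nonneg) auto
  have supp: "rinv u \<and> wrong x (Suc i) u = wrong x i s + of_bool (mem u 17 i \<noteq> GRS q n x i)"
    if "u \<in> set_pmf (?f i s)" for u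
  proof -
    have u: "rinv u" "\<forall>j. j \<noteq> i \<longrightarrow> mem u 17 j = mem s 17 j"
      using read_wp[OF step.prems step.hyps(2)] that by (auto simp: wp_def)
    have "wrong x i u = wrong x i s" unfolding wrong_def using u(2) by (intro arg_cong[of _ _ card]) auto
    then show ?thesis using u wrong_Suc by simp
  qed
  have "(\<integral>\<^sup>+t. of_nat (wrong x q t) \<partial>mfold ?f [i..<q] s) =
      (\<integral>\<^sup>+u. (\<integral>\<^sup>+t. of_nat (wrong x q t) \<partial>mfold ?f [Suc i..<q] u) \<partial>?f i s)"
    using step.hyps by (simp add: upt_conv_Cons)
  also have "\<dots> \<le> (\<integral>\<^sup>+u. (of_nat (wrong x i s) + ennreal ?S) + indicator {u. mem u 17 i \<noteq> GRS q n x i} u \<partial>?f i s)"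
  proof (intro nn_integral_mono_AE, unfold AE_measure_pmf_iff, intro ballI)
    fix u assume u: "u \<in> set_pmf (?f i s)"
    have "(\<integral>\<^sup>+t. of_nat (wrong x q t) \<partial>mfold ?f [Suc i..<q] u) \<le> of_nat (wrong x (Suc i) u) + ennreal ?S"
      unfolding w_def using step.IH supp[OF u] by blast
    also have "\<dots> = (of_nat (wrong x i s) + ennreal ?S) + indicator {u. mem u 17 i \<noteq> GRS q n x i} u"
      using supp[OF u] by (simp add: indicator_def add_ac)
    finally show "(\<integral>\<^sup>+t. of_nat (wrong x q t) \<partial>mfold ?f [Suc i..<q] u)
       \<le> (of_nat (wrong x i s) + ennreal ?S) + indicator {u. mem u 17 i \<noteq> GRS q n x i} u" .
  qed
  also have "\<dots> = (of_nat (wrong x i s) + ennreal ?S) + emeasure (?f i s) {u. mem u 17 i \<noteq> GRS q n x i}"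
    by (subst nn_integral_add) auto
  also have "\<dots> \<le> (of_nat (wrong x i s) + ennreal ?S) + ennreal (w i)"
  proof (rule add_left_mono)
    have "measure_pmf.prob (?f i s) {u. mem u 17 i \<noteq> GRS q n x i} = 1 - measure_pmf.prob (?f i s) {u. mem u 17 i = GRS q n x i}"
      using measure_pmf.prob_compl[of "{u. mem u 17 i = GRS q n x i}" "?f i s"] by (simp add: Collect_neg_eq Compl_eq_Diff_UNIV)
    also have "\<dots> \<le> w i" using read_prob[OF step.prems step.hyps(2) GRS_less] by (simp add: w_def)
    finally show "emeasure (?f i s) {u. mem u 17 i \<noteq> GRS q n x i} \<le> ennreal (w i)"
      by (simp add: emeasure_prob ennreal_leI)
  qed
  also have "\<dots> = of_nat (wrong x i s) + ennreal (\<Sum>r=i..<q. w r)"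
    using S0 w0 step.hyps by (simp add: sum.atLeast_Suc_lessThan ennreal_plus[symmetric] add_ac del: ennreal_plus)
  finally show ?case by (simp add: w_def)
qed

text \<open>
  Markov's inequality for the number of wrong symbols. A single round succeeds only with a small
  probability, which the repetition amplifies.
\<close>

lemma round_prob:
  assumes s: "rinv s" and x: "x \<in> messages q n"
    and T: "real t + 1 > sqrt (2 * (real n - 1) * real q)" "t < q"
    and pre: "real t + 1 \<le> (\<Sum>r<q. (cmod (\<alpha> r (GRS q n x r)))\<^sup>2)"
  shows "1 / real q \<le> measure_pmf.prob (sem m l U p_round s) {u. emits x True s u}"
proof -
  define S where "S = (\<Sum>r=0..<q. 1 - (cmod (\<alpha> r (GRS q n x r)))\<^sup>2)"
  let ?M = "sem m l U p_word s"
  let ?A = "{u. wrong x q u \<ge> q - t}"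
  have S: "S \<le> real q - (real t + 1)" using pre by (simp add: S_def sum_subtractf lessThan_atLeast0)
  have S0: "0 \<le> S" unfolding S_def using column_le_1[OF _ GRS_less] by (intro sum_nonneg) auto
  have M: "?M = mfold (\<lambda>i t. sem m l U p_read (setm 11 0 i t)) [0..<q] s"
    using s by (simp add: p_word_def p_read_def rinv_def par_def)
  have "ennreal (real (q - t) * measure_pmf.prob ?M ?A) = (\<integral>\<^sup>+u. of_nat (q - t) * indicator ?A u \<partial>?M)"
    by (subst nn_integral_cmult_indicator)
       (simp_all add: emeasure_prob ennreal_mult ennreal_of_nat_eq_real_of_nat)
  also have "\<dots> \<le> (\<integral>\<^sup>+u. of_nat (wrong x q u) \<partial>?M)"
    by (intro nn_integral_mono) (auto split: split_indicator)
  also have "\<dots> \<le> ennreal S"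
    using expected_wrong[of 0 s x] s unfolding M S_def by (simp add: wrong_def)
  finally have "real (q - t) * measure_pmf.prob ?M ?A \<le> S" using S0 by (simp add: ennreal_le_iff)
  \<comment> \<open>The expected number of wrong symbols is at least 1 below \<open>q - t\<close>;
    this gap is what leaves a probability of \<open>1 / (q - t)\<close> for fewer than
    \<open>q - t\<close> errors.\<close>
  then have "(real q - real t) * measure_pmf.prob ?M ?A \<le> real q - real t - 1" using S T by (simp add: of_nat_diff)
  then have "measure_pmf.prob ?M ?A \<le> 1 - 1 / (real q - real t)" using T by (simp add: field_simps)
  also have "\<dots> \<le> 1 - 1 / real q" using T by (simp add: frac_le)
  finally have A: "measure_pmf.prob ?M ?A \<le> 1 - 1 / real q" .
  have "1 / real q \<le> measure_pmf.prob ?M (- ?A)"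
    using A measure_pmf.prob_compl[of ?A ?M] by (simp add: Compl_eq_Diff_UNIV)
  also have "\<dots> \<le> measure_pmf.prob (sem m l U p_round s) {u. emits x True s u}"
    unfolding p_round_def sem.simps(6)
  proof (rule prob_bind_mono)
    fix u assume u: "u \<in> set_pmf ?M" "u \<in> - ?A"
    have ru: "rinv u" "\<forall>r<q. mem u 17 r < q" using word_wp[OF s] u(1) by (auto simp: wp_def)
    have "{r. r < q \<and> GRS q n x r = mem u 17 r} = {..<q} - {r. r < q \<and> mem u 17 r \<noteq> GRS q n x r}" by auto
    then have "card {r. r < q \<and> GRS q n x r = mem u 17 r} = q - wrong x q u"
      unfolding wrong_def by (simp add: card_Diff_subset subset_eq)
    then have "hit x (mem u 17) t"
      unfolding hit_def card_allowed using monomial_count[OF n(1) T(2,1)] u(2) T(2) by auto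
    then have h: "\<exists>t<q. hit x (mem u 17) t" using T(2) by blast
    have o: "outp u = outp s" using sem_frame[OF u(1)] by (simp add: frame_def)
    have "wp m l U p_decode (emits x (\<exists>t<q. hit x (mem u 17) t) u) u"
      by (rule decode_wp) (use ru x in \<open>auto simp: rinv_def\<close>)
    then show "set_pmf (sem m l U p_decode u) \<subseteq> {u. emits x True s u}"
      using h emits_cong[OF o refl] by (auto simp: wp_def)
  qed
  finally show ?thesis .
qed

lemma round_wp:
  assumes s: "rinv s" and x: "x \<in> messages q n"
  shows "wp m l U p_round (\<lambda>t. rinv t \<and> emits x False s t) s"
  unfolding p_round_def wp_simps(5)
proof (rule wp_mono[OF word_wp[OF s]])
  fix t assume t: "rinv t \<and> (\<forall>r<q. mem t 17 r < q)" and ft: "frame p_word s t"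
  have o: "outp t = outp s" using ft by (simp add: frame_def)
  have "wp m l U p_decode (emits x (\<exists>i<q. hit x (mem t 17) i) t) t"
    by (rule decode_wp) (use t x in \<open>auto simp: rinv_def\<close>)
  then show "wp m l U p_decode (\<lambda>t. rinv t \<and> emits x False s t) t"
  proof (rule wp_mono)
    fix u assume u: "emits x (\<exists>i<q. hit x (mem t 17) i) t u" and fu: "frame p_decode t u"
    have "par u" by (rule par_frame[OF _ fu]) (use t in \<open>auto simp: rinv_def\<close>)
    moreover have "mem u 4 = mem t 4" "mem u 5 = mem t 5" "mem u 6 = mem t 6" "mem u 10 = mem t 10"
      using frame_mem[OF fu] by auto
    moreover have "qst u = qst t" using fu by (simp add: frame_def)
    ultimately have "rinv u" using t by (simp add: rinv_def good_def)
    moreover have "emits x False t u" by (rule emits_mono[OF u]) simp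
    then have "emits x False s u" using emits_cong[OF o refl] by simp
    ultimately show "rinv u \<and> emits x False s u" by blast
  qed
qed

text \<open>The bound on failure is uniform over all states with \<open>rinv\<close>, and
  \<open>rinv\<close> is restored on every branch, so bounds of successive rounds multiply without
  tracking the distribution in between.\<close>

definition amplified :: "nat list \<Rightarrow> real \<Rightarrow> stmt \<Rightarrow> bool" where
  "amplified x \<beta> P \<longleftrightarrow> (\<forall>s. rinv s \<longrightarrow> wp m l U P (\<lambda>t. rinv t \<and> emits x False s t) s \<and>
     measure_pmf.prob (sem m l U P s) {t. \<not> emits x True s t} \<le> \<beta>)"

text \<open>Output is never retracted, so the loop misses \<open>x\<close> only if every iteration
  does. Premise and conclusion have the same form, which lets the lemma be applied to nested
  loops.\<close>

lemma amplified_For: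
  assumes P: "amplified x \<beta> P" and \<beta>: "0 \<le> \<beta>" and p: "\<And>s. rinv s \<Longrightarrow> mem s p 0 = K"
  shows "amplified x (\<beta> ^ K) (For 54 p P)"
  unfolding amplified_def
proof (intro allI impI conjI)
  fix s assume s: "rinv s"
  let ?f = "\<lambda>i t. sem m l U P (setm 54 0 i t)"
  have step: "rinv u \<and> emits x False t u" if "rinv t" "u \<in> set_pmf (?f i t)" for t u i
  proof -
    have "rinv (setm 54 0 i t)" using that(1) by (simp add: rinv_def par_def good_def)
    then have "rinv u \<and> emits x False (setm 54 0 i t) u" using P that(2) unfolding amplified_def wp_def by blast
    then show ?thesis using emits_cong[of "setm 54 0 i t" t u u] by simp
  qed
  have prob: "measure_pmf.prob (?f i t) {u. \<not> emits x True t u} \<le> \<beta>" if "rinv t" for t i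
  proof -
    have "rinv (setm 54 0 i t)" using that(1) by (simp add: rinv_def par_def good_def)
    moreover have "emits x True (setm 54 0 i t) = emits x True t" by (intro ext emits_cong) simp_all
    ultimately show ?thesis using P unfolding amplified_def by metis
  qed
  have fold: "rinv t \<Longrightarrow> (\<forall>u\<in>set_pmf (mfold ?f is t). rinv u \<and> emits x False t u) \<and>
      measure_pmf.prob (mfold ?f is t) {u. \<not> emits x True t u} \<le> \<beta> ^ length is" for "is" t
  proof (induction "is" arbitrary: t)
    case Nil
    then show ?case using emits_refl by simp
  next
    case (Cons i "is")
    have "rinv u \<and> emits x False t u" if u: "u \<in> set_pmf (mfold ?f (i # is) t)" for u
    proof -
      obtain v where v: "v \<in> set_pmf (?f i t)" "u \<in> set_pmf (mfold ?f is v)" using u by auto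
      then have "rinv v \<and> emits x False t v" using step[OF Cons.prems] by blast
      moreover have "rinv u \<and> emits x False v u" using Cons.IH calculation v by blast
      ultimately show ?thesis using emits_trans[of x False t v False u] by simp
    qed
    moreover have "measure_pmf.prob (bind_pmf (?f i t) (mfold ?f is)) {u. \<not> emits x True t u}
        \<le> \<beta> ^ length is * measure_pmf.prob (?f i t) {u. \<not> emits x True t u}"
    proof (rule prob_bind_le)
      show "0 \<le> \<beta> ^ length is" using \<beta> by simp
      fix v assume v: "v \<in> set_pmf (?f i t)"
      have v': "rinv v" "emits x False t v" using step[OF Cons.prems v] by auto
      have "measure_pmf.prob (mfold ?f is v) {u. \<not> emits x True t u} \<le> measure_pmf.prob (mfold ?f is v) {u. \<not> emits x True v u}"
        using emits_trans[OF v'(2), of True] by (intro measure_pmf.finite_measure_mono) auto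
      then show "measure_pmf.prob (mfold ?f is v) {u. \<not> emits x True t u} \<le> \<beta> ^ length is"
        using Cons.IH[OF v'(1)] by linarith
      show "v \<notin> {u. \<not> emits x True t u} \<Longrightarrow> set_pmf (mfold ?f is v) \<inter> {u. \<not> emits x True t u} = {}"
        using Cons.IH[OF v'(1)] emits_trans[of x True t v False] by auto
    qed
    moreover have "\<beta> ^ length is * measure_pmf.prob (?f i t) {u. \<not> emits x True t u} \<le> \<beta> ^ length is * \<beta>"
      using prob[OF Cons.prems] \<beta> by (intro mult_left_mono) auto
    ultimately show ?case by (simp add: mult.commute)
  qed
  show "wp m l U (For 54 p P) (\<lambda>t. rinv t \<and> emits x False s t) s"
    using fold[OF s] by (simp add: wp_def)
  show "measure_pmf.prob (sem m l U (For 54 p P) s) {t. \<not> emits x True s t} \<le> \<beta> ^ K"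
    using fold[OF s, of "[0..<mem s p 0]"] p[OF s] by simp
qed

lemma amplified_round:
  assumes x: "x \<in> messages q n"
    and T: "real t + 1 > sqrt (2 * (real n - 1) * real q)" "t < q"
    and pre: "real t + 1 \<le> (\<Sum>r<q. (cmod (\<alpha> r (GRS q n x r)))\<^sup>2)"
  shows "amplified x (1 - 1 / real q) p_round"
  unfolding amplified_def
proof (intro allI impI conjI round_wp[OF _ x])
  fix s assume s: "rinv s"
  show "measure_pmf.prob (sem m l U p_round s) {t. \<not> emits x True s t} \<le> 1 - 1 / real q"
    using round_prob[OF s x T pre] measure_pmf.prob_compl[of "{t. emits x True s t}" "sem m l U p_round s"]
    by (simp add: Collect_neg_eq Compl_eq_Diff_UNIV)
qed

lemma amplified_rounds:
  assumes "x \<in> messages q n" "real t + 1 > sqrt (2 * (real n - 1) * real q)" "t < q"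
    and "real t + 1 \<le> (\<Sum>r<q. (cmod (\<alpha> r (GRS q n x r)))\<^sup>2)"
  shows "amplified x ((1 - 1 / real q) ^ (q ^ 8 * D)) p_rounds"
proof -
  have N: "mem s 7 0 = q * q" "mem s 4 0 = D" if "rinv s" for s using that by (auto simp: rinv_def par_def)
  have \<beta>: "0 \<le> 1 - 1 / real q" using q0 by (simp add: field_simps)
  have "amplified x ((((((1 - 1 / real q) ^ D) ^ (q * q)) ^ (q * q)) ^ (q * q)) ^ (q * q)) p_rounds"
    unfolding p_rounds_def
    by (intro amplified_For amplified_round[OF assms] N zero_le_power \<beta>)
  moreover have "D * (q * q) * (q * q) * (q * q) * (q * q) = q ^ 8 * D" by (simp add: eval_nat_numeral)
  ultimately show ?thesis by (simp only: power_mult[symmetric])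
qed

lemma finite_messages: "finite (messages q n)"
proof -
  have "messages q n = {xs. set xs \<subseteq> {0..<q} \<and> length xs = n}" by (auto simp: messages_def)
  then show ?thesis using finite_lists_length_eq[of "{0..<q}" n] by simp
qed

text \<open>
  The list size is bounded without a combinatorial argument: each good message is output by
  a single round with probability at least \<open>1 / q\<close>, and a round outputs at most \<open>q ^ 6\<close> messages.
\<close>

lemma card_good:
  assumes s: "rinv s" and G: "G \<subseteq> messages q n"
    and pr: "\<And>x. x \<in> G \<Longrightarrow> 1 / real q \<le> measure_pmf.prob (sem m l U p_round s) {t. emits x True s t}"
  shows "real (card G) \<le> real q ^ 7"
proof -
  have fin: "finite G" using G finite_messages finite_subset by blast
  define \<rho> where "\<rho> p = mem s p 0" for p
  have out: "length (outp t) \<le> length (outp s) + q ^ 6 * n" if t: "t \<in> set_pmf (sem m l U p_round s)" for t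
  proof -
    have "length (outp t) \<le> length (outp s) + outs \<rho> p_round"
      by (rule sem_outs[OF t, of "{0, 2, 5, 7}"])
         (use wfs_rounds in \<open>auto simp: p_rounds_def \<rho>_def p_round_defs\<close>)
    \<comment> \<open>The factors belong to thresholds, vectors, derivatives, points, values at the
      point, and the symbols of one message.\<close>
    also have "outs \<rho> p_round = q * (q * q * (q * (q * (q * n))))"
      using s by (simp add: \<rho>_def rinv_def par_def p_round_defs)
    also have "\<dots> = q ^ 6 * n" by (simp add: eval_nat_numeral)
    finally show ?thesis .
  qed
  have card: "card {x \<in> G. emits x True s t} \<le> q ^ 6" if t: "t \<in> set_pmf (sem m l U p_round s)" for t
  proof (cases "{x \<in> G. emits x True s t} = {}")
    case False
    then obtain y where "emits y True s t" by blast
    then obtain ys where ys: "outp t = outp s @ concat ys" "set ys \<subseteq> messages q n" by (auto simp: emits_def)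
    have len: "\<forall>y\<in>set ys. length y = n" using ys(2) by (auto simp: messages_def)
    have "{x \<in> G. emits x True s t} \<subseteq> set ys"
    proof
      fix x assume "x \<in> {x \<in> G. emits x True s t}"
      then obtain zs where zs: "outp t = outp s @ concat zs" "set zs \<subseteq> messages q n" "x \<in> set zs" by (auto simp: emits_def)
      have "zs = ys" by (rule concat_inject[of _ _ n]) (use zs ys len n in \<open>auto simp: messages_def\<close>)
      then show "x \<in> set ys" using zs by simp
    qed
    then have "card {x \<in> G. emits x True s t} \<le> card (set ys)" by (intro card_mono) auto
    also have "\<dots> \<le> length ys" by (rule card_length)
    also have "\<dots> \<le> q ^ 6"
    proof -
      have "length (concat ys) = length ys * n" using len by (induction ys) auto
      then have "length ys * n \<le> q ^ 6 * n" using out[OF t] ys(1) by simp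
      then show ?thesis using n by simp
    qed
    finally show ?thesis .
  next
    case True
    then show ?thesis by (simp only: card.empty)
  qed
  have "real (card G) * (1 / real q) \<le> (\<Sum>x\<in>G. measure_pmf.prob (sem m l U p_round s) {t. emits x True s t})"
    using sum_mono[of G "\<lambda>_. 1 / real q", OF pr] by simp
  also have "\<dots> \<le> real (q ^ 6)" by (rule sum_prob_le[OF fin card])
  finally show ?thesis using q0 by (simp add: field_simps eval_nat_numeral)
qed

text \<open>Union bound over the messages of large presence. Their number, at most
  \<open>q ^ 7\<close>, times the failure bound \<open>q / (q ^ 8 * D)\<close> gives
  \<open>1 / D\<close>.\<close>

lemma rounds_prob:
  assumes s: "rinv s" "outp s = []"
    and T: "real t + 1 > sqrt (2 * (real n - 1) * real q)" "t < q"
    and \<epsilon>: "real t + 1 \<le> 1 + real q * \<epsilon>"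
  shows "measure_pmf.prob (sem m l U p_rounds s) {u. \<exists>xs. outp u = concat xs \<and> set xs \<subseteq> messages q n \<and>
     {x \<in> messages q n. presence q \<alpha> (GRS q n x) \<ge> 1 / real q + \<epsilon>} \<subseteq> set xs} \<ge> 1 - 1 / real D"
proof -
  define G where "G = {x \<in> messages q n. presence q \<alpha> (GRS q n x) \<ge> 1 / real q + \<epsilon>}"
  let ?M = "sem m l U p_rounds s"
  let ?\<beta> = "(1 - 1 / real q) ^ (q ^ 8 * D)"
  have Gm: "G \<subseteq> messages q n" "finite G" unfolding G_def using finite_messages by auto
  have pre: "real t + 1 \<le> (\<Sum>r<q. (cmod (\<alpha> r (GRS q n x r)))\<^sup>2)" if "x \<in> G" for x
  proof -
    have "1 / real q + \<epsilon> \<le> (\<Sum>r<q. (cmod (\<alpha> r (GRS q n x r)))\<^sup>2) / real q"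
      using that by (simp add: G_def presence_def)
    then have "real q * (1 / real q + \<epsilon>) \<le> real q * ((\<Sum>r<q. (cmod (\<alpha> r (GRS q n x r)))\<^sup>2) / real q)"
      by (intro mult_left_mono) auto
    then have "1 + real q * \<epsilon> \<le> (\<Sum>r<q. (cmod (\<alpha> r (GRS q n x r)))\<^sup>2)" using q0 by (simp add: distrib_left)
    then show ?thesis using \<epsilon> by linarith
  qed
  have amp: "amplified x ?\<beta> p_rounds" if "x \<in> G" for x
    using amplified_rounds[OF _ T pre[OF that]] Gm that by blast
  have cG: "real (card G) \<le> real q ^ 7"
    by (rule card_good[OF s(1) Gm(1)]) (use round_prob[OF s(1) _ T pre] Gm in blast)
  have \<beta>: "?\<beta> \<le> real q / (real q ^ 8 * real D)"
    using one_minus_power_le[of "real q" "q ^ 8 * D"] q0 D by simp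
  \<comment> \<open>Well-formed output on all branches is obtained from \<open>amplified\<close>
    with the trivial bound 1, for which any message will do.\<close>
  have x0: "replicate n 0 \<in> messages q n" using q0 by (auto simp: messages_def)
  have em0: "emits x False s u" if "u \<in> set_pmf ?M" for u x
  proof -
    have a: "amplified x 1 p_round" if x: "x \<in> messages q n" for x
      unfolding amplified_def using round_wp[OF _ x] by auto
    have N: "mem s 7 0 = q * q" "mem s 4 0 = D" if "rinv s" for s using that by (auto simp: rinv_def par_def)
    have "amplified (replicate n 0) (((((1 ^ D) ^ (q * q)) ^ (q * q)) ^ (q * q)) ^ (q * q)) p_rounds"
      unfolding p_rounds_def by (intro amplified_For a x0 N) auto
    then have "emits (replicate n 0) False s u" using s that unfolding amplified_def wp_def by blast
    then show ?thesis by (simp add: emits_def)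
  qed
  let ?good = "{u. \<exists>xs. outp u = concat xs \<and> set xs \<subseteq> messages q n \<and> G \<subseteq> set xs}"
  have sub: "u \<in> ?good" if u: "u \<in> set_pmf ?M" "\<forall>x\<in>G. emits x True s u" for u
  proof -
    obtain xs where xs: "outp u = concat xs" "set xs \<subseteq> messages q n"
      using em0[OF u(1), of "[]"] s(2) by (auto simp: emits_def)
    have "x \<in> set xs" if x: "x \<in> G" for x
    proof -
      obtain zs where zs: "outp u = concat zs" "set zs \<subseteq> messages q n" "x \<in> set zs"
        using u(2) x s(2) by (auto simp: emits_def)
      have "zs = xs" by (rule concat_inject[of _ _ n]) (use zs xs n in \<open>auto simp: messages_def\<close>)
      then show ?thesis using zs by simp
    qed
    then show ?thesis using xs by blast
  qed
  have "1 - measure_pmf.prob ?M ?good = measure_pmf.prob ?M (- ?good)"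
    using measure_pmf.prob_compl[of ?good ?M] by (simp add: Compl_eq_Diff_UNIV)
  also have "\<dots> = measure_pmf.prob ?M (- ?good \<inter> set_pmf ?M)" by (simp add: measure_Int_set_pmf)
  also have "\<dots> \<le> measure_pmf.prob ?M (\<Union>x\<in>G. {u. \<not> emits x True s u})"
    using sub by (intro measure_pmf.finite_measure_mono) auto
  also have "\<dots> \<le> (\<Sum>x\<in>G. measure_pmf.prob ?M {u. \<not> emits x True s u})"
    by (rule measure_pmf.finite_measure_subadditive_finite) (use Gm in auto)
  also have "\<dots> \<le> (\<Sum>x\<in>G. ?\<beta>)" using amp s by (intro sum_mono) (auto simp: amplified_def)
  also have "\<dots> = real (card G) * ?\<beta>" by simp
  also have "\<dots> \<le> real q ^ 7 * (real q / (real q ^ 8 * real D))"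
    using cG \<beta> q0 by (intro mult_mono) auto
  also have "\<dots> = 1 / real D" using q0 D by (simp add: field_simps eval_nat_numeral)
  finally show ?thesis by (simp add: G_def)
qed

end


section \<open>The decoder\<close>

lemma code_bits_le: "code_bits q \<le> q"
  unfolding code_bits_def by (rule Least_le) (simp add: less_imp_le)

lemma polynomial4_monomial: "polynomial4 (\<lambda>w x y z. C * x ^ i * z ^ j)"
  unfolding polynomial4_def
proof (intro exI allI)
  fix w x y z :: real
  let ?a = "\<lambda>a b c d. if a = 0 \<and> b = i \<and> c = 0 \<and> d = j then C else (0::real)"
  let ?d = "i + j"
  have "(\<Sum>a\<le>?d. \<Sum>b\<le>?d. \<Sum>c\<le>?d. \<Sum>d\<le>?d. ?a a b c d * w ^ a * x ^ b * y ^ c * z ^ d) =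
      (\<Sum>a\<le>?d. \<Sum>b\<le>?d. \<Sum>c\<le>?d. \<Sum>d\<le>?d. if d = j then (if c = 0 then (if b = i then (if a = 0 then C * x ^ i * z ^ j else 0) else 0) else 0) else 0)"
    by (intro sum.cong refl) auto
  also have "\<dots> = C * x ^ i * z ^ j" by (simp add: sum.delta)
  finally show "C * x ^ i * z ^ j = (\<Sum>a\<le>?d. \<Sum>b\<le>?d. \<Sum>c\<le>?d. \<Sum>d\<le>?d. ?a a b c d * w ^ a * x ^ b * y ^ c * z ^ d)" ..
qed

text \<open>
  The hypothesis on \<open>\<epsilon>\<close> says that the expected agreement \<open>1 + q \<epsilon>\<close> exceeds the threshold of the
  interpolation method. With \<open>A = 1 + q \<epsilon>'\<close> and \<open>s = sqrt (\<Delta> / A)\<close> it reads \<open>A + (q - A) s < 1 + q \<epsilon>\<close>, and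
  the left-hand side is at least \<open>s sqrt (q A) = sqrt (q \<Delta>)\<close>.
\<close>

lemma bias_bound:
  fixes n q :: nat and \<epsilon> \<delta> \<epsilon>' \<Delta> :: real
  assumes h: "prime q" "0 < \<delta>" "\<delta> < 1" "2 \<le> n" "0 < \<epsilon>'" "\<epsilon>' < 1 - 1 / real q"
    "\<Delta> = 2 * (real n - 1) * ln ((real q)\<^sup>2 / (1 - \<delta>))"
    "\<epsilon>' + (1 - 1 / real q - \<epsilon>') * sqrt (\<Delta> / (1 + real q * \<epsilon>')) < \<epsilon>" "\<epsilon> \<le> 1 - 1 / real q"
  shows "n < q" and "sqrt (2 * (real n - 1) * real q) + 1 \<le> 1 + real q * \<epsilon>"
proof -
  have q2: "2 \<le> q" using h(1) prime_ge_2_nat by blast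
  define A where "A = 1 + real q * \<epsilon>'"
  define s where "s = sqrt (\<Delta> / A)"
  define L where "L = ln ((real q)\<^sup>2 / (1 - \<delta>))"
  have A: "0 < A" "A < real q" "1 < A"
    using h(5,6) q2 by (auto simp: A_def field_simps intro: add_pos_pos)
  have L: "2 * ln (real q) \<le> L"
  proof -
    have "(real q)\<^sup>2 \<le> (real q)\<^sup>2 / (1 - \<delta>)" using h(2,3) by (simp add: field_simps)
    then have "ln ((real q)\<^sup>2) \<le> L" unfolding L_def using q2 h(2,3) by (subst ln_le_cancel_iff) auto
    then show ?thesis using q2 by (simp add: ln_realpow)
  qed
  have lnq: "0 < ln (real q)" using q2 by simp
  have n1: "1 \<le> real n - 1" using h(4) by linarith
  have \<Delta>: "\<Delta> = 2 * (real n - 1) * L" "0 < \<Delta>" using h(7) L lnq n1 by (auto simp: L_def)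
  have s0: "0 < s" using \<Delta> A by (simp add: s_def)
  have main: "A + (real q - A) * s < 1 + real q * \<epsilon>"
  proof -
    have "real q * (\<epsilon>' + (1 - 1 / real q - \<epsilon>') * s) < real q * \<epsilon>"
      using h(8) q2 unfolding s_def A_def by (intro mult_strict_left_mono) auto
    moreover have "real q * (1 - 1 / real q - \<epsilon>') = real q - A" using q2 by (simp add: A_def field_simps)
    ultimately show ?thesis by (simp add: A_def distrib_left mult.assoc[symmetric])
  qed
  have \<mu>q: "1 + real q * \<epsilon> \<le> real q"
  proof -
    have "real q * \<epsilon> \<le> real q * (1 - 1 / real q)" using h(9) by (intro mult_left_mono) auto
    then show ?thesis using q2 by (simp add: right_diff_distrib)
  qed
  \<comment> \<open>Otherwise \<open>A + (q - A) * s\<close> is at least \<open>q\<close>, which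
    \<open>1 + q * \<epsilon>\<close> does not exceed.\<close>
  have s1: "s < 1"
  proof (rule ccontr)
    assume "\<not> s < 1"
    then have "(real q - A) * 1 \<le> (real q - A) * s" using A by (intro mult_left_mono) auto
    then show False using main \<mu>q by simp
  qed
  have "\<Delta> / A < 1" using s1 by (simp add: s_def)
  then have \<Delta>q: "\<Delta> < real q" using A by (simp add: field_simps)
  have "4 * (real n - 1) * ln (real q) \<le> \<Delta>"
  proof -
    have "2 * (real n - 1) * (2 * ln (real q)) \<le> 2 * (real n - 1) * L"
      using n1 by (intro mult_left_mono L) simp
    moreover have "4 * (real n - 1) * ln (real q) = 2 * (real n - 1) * (2 * ln (real q))" by simp
    ultimately show ?thesis unfolding \<Delta>(1) by linarith
  qed
  then have nq: "4 * (real n - 1) * ln (real q) < real q" using \<Delta>q by linarith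
  have ln2: "1 / 2 < ln (2::real)" using ln2_ge_two_thirds by linarith
  \<comment> \<open>\<open>4 * (n - 1) * ln q < q\<close> fails for 2 and 3, because
    \<open>4 * ln 2 > 2\<close> and \<open>ln 3 \<ge> 1\<close>, and 4 is no prime.\<close>
  have q5: "5 \<le> q"
  proof (rule ccontr)
    assume "\<not> 5 \<le> q"
    moreover have "\<not> prime (4::nat)" by (simp add: prime_nat_iff) (auto intro!: exI[of _ 2])
    ultimately consider "q = 2" | "q = 3" using q2 h(1) by (cases "q = 2"; cases "q = 3"; cases "q = 4") auto
    then show False
    proof cases
      case 1
      have "4 * 1 * ln 2 \<le> 4 * (real n - 1) * ln (2::real)" using n1 by (intro mult_right_mono) auto
      moreover have "4 * (real n - 1) * ln 2 < 2" using nq unfolding 1 by (simp only: of_nat_numeral)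
      ultimately show False using ln2 by linarith
    next
      case 2
      have "ln (exp 1) \<le> ln (3::real)" using exp_le by (subst ln_le_cancel_iff) auto
      then have "4 * 1 * 1 \<le> 4 * (real n - 1) * ln (3::real)" using n1 by (intro mult_mono) auto
      then show False using nq 2 by simp
    qed
  qed
  have lnq4: "2 * ln 2 \<le> ln (real q)"
  proof -
    have "ln ((2::real) ^ 2) \<le> ln (real q)" using q5 by (subst ln_le_cancel_iff) auto
    then show ?thesis by (simp only: ln_realpow)
  qed
  have "4 * (real n - 1) * 1 \<le> 4 * (real n - 1) * ln (real q)"
    using lnq4 ln2 n1 by (intro mult_left_mono) auto
  then have "4 * (real n - 1) < real q" using nq by linarith
  then have "real n < real q" using n1 by simp
  then show "n < q" by simp
  define T where "T = sqrt (2 * (real n - 1) * real q)"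
  have T2: "2 \<le> T"
  proof -
    have "1 * 2 \<le> (real n - 1) * real q" using n1 q5 by (intro mult_mono) auto
    then have "4 \<le> 2 * (real n - 1) * real q" by (simp only: mult.assoc)
    then show ?thesis using real_sqrt_le_mono[of 4 "2 * (real n - 1) * real q"] by (simp add: T_def)
  qed
  \<comment> \<open>\<open>L \<ge> 2 * ln q \<ge> 4 * ln 2 \<ge> 8 / 3\<close>. The square
    \<open>9 / 4\<close> gives the factor \<open>3 / 2\<close>, and \<open>T * (3 / 2)\<close> is at
    least \<open>T + 1\<close> because \<open>T \<ge> 2\<close>.\<close>
  have "9 / 4 \<le> L" using L lnq4 ln2_ge_two_thirds by linarith
  then have "sqrt (9 / 4) \<le> sqrt L" by (rule real_sqrt_le_mono)
  moreover have "sqrt (9 / 4) = 3 / 2" by (rule real_sqrt_unique) (auto simp: power2_eq_square)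
  ultimately have sL: "3 / 2 \<le> sqrt L" by simp
  have "T + 1 \<le> T * (3 / 2)" using T2 by simp
  also have "\<dots> \<le> T * sqrt L" using sL T2 by (intro mult_left_mono) auto
  also have "\<dots> = sqrt (\<Delta> * real q)" by (simp add: T_def \<Delta>(1) real_sqrt_mult mult_ac)
  also have "\<dots> = s * sqrt (real q * A)"
    using A by (simp add: s_def real_sqrt_mult[symmetric])
  also have "\<dots> \<le> s * real q"
  proof (rule mult_left_mono)
    have "sqrt (real q * A) \<le> sqrt (real q * real q)" using A by (intro real_sqrt_le_mono mult_left_mono) auto
    then show "sqrt (real q * A) \<le> real q" by simp
  qed (use s0 in simp)
  also have "\<dots> \<le> A + (real q - A) * s"
    using mult_left_mono[of s 1 A] s1 A by (simp add: algebra_simps)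
  finally show "sqrt (2 * (real n - 1) * real q) + 1 \<le> 1 + real q * \<epsilon>" using main by (simp add: T_def)
qed

text \<open>Variable 7 is written once, by the first command, and is a loop bound afterwards. So the
  two parts are compiled with different sets of read-only variables.\<close>

lemma main_implements:
  fixes \<sigma> :: "nat \<Rightarrow> nat"
  assumes "\<sigma> 0 \<le> W" "\<sigma> 2 \<le> W" "\<sigma> 4 \<le> W" "\<sigma> 5 \<le> W" "\<sigma> 2 * \<sigma> 2 \<le> W"
  shows "implements m l U (cost W p_main) 0 (compile 0 p_main) \<sigma> \<psi> out
     (sem m l U p_main \<lparr>mem = absm \<sigma>, qst = \<psi>, outp = out\<rparr>)"
  unfolding p_main_def cost.simps(6) compile.simps(6) sem.simps(6)
proof (rule implements_bind)
  show "implements m l U (cost W (Set 7 (Mul (V 2) (V 2)))) 0 (compile 0 (Set 7 (Mul (V 2) (V 2)))) \<sigma> \<psi> out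
     (sem m l U (Set 7 (Mul (V 2) (V 2))) \<lparr>mem = absm \<sigma>, qst = \<psi>, outp = out\<rparr>)"
    by (rule compile_implements[of "{2}"]) (use assms in auto)
  fix \<sigma>' :: "nat \<Rightarrow> nat" and \<psi>' out'
  assume "\<lparr>mem = absm \<sigma>', qst = \<psi>', outp = out'\<rparr>
      \<in> set_pmf (sem m l U (Set 7 (Mul (V 2) (V 2))) \<lparr>mem = absm \<sigma>, qst = \<psi>, outp = out\<rparr>)"
  then have eq: "absm \<sigma>' = (absm \<sigma>)(7 := (absm \<sigma> 7)(0 := \<sigma> 2 * \<sigma> 2))"
    by (simp add: setm_def absm_def numeral_2_eq_2)
  have \<sigma>': "\<sigma>' k = (if k = 7 then \<sigma> 2 * \<sigma> 2 else \<sigma> k)" if "k < 63" for k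
    using fun_cong[OF fun_cong[OF eq, of k], of 0] that by (auto simp: absm_def)
  show "implements m l U (cost W p_rounds) 0 (compile 0 p_rounds) \<sigma>' \<psi>' out'
     (sem m l U p_rounds \<lparr>mem = absm \<sigma>', qst = \<psi>', outp = out'\<rparr>)"
    by (rule compile_implements[OF wfs_rounds]) (use assms \<sigma>' in auto)
qed simp

lemma decoder_correct:
  fixes n q :: nat and \<epsilon> \<delta> :: real
  assumes "prime q" "2 \<le> n" "n < q" "0 < \<delta>" "\<delta> < 1" "\<epsilon> \<le> 1 - 1 / real q"
    and bias: "sqrt (2 * (real n - 1) * real q) + 1 \<le> 1 + real q * \<epsilon>"
    and cost: "\<And>W. 1 \<le> W \<Longrightarrow> cost W p_main \<le> C * W ^ k"
  shows "quantum_list_decoder (GRS q n) q n \<epsilon> \<delta> (real C * 2 ^ k * real q ^ (2 * k) * (1 / (1 - \<delta>)) ^ k) (compile 0 p_main)"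
  unfolding quantum_list_decoder_def
proof (intro allI impI)
  fix l U \<alpha> \<phi> assume cc: "corrupted_codeword q l U \<alpha> \<phi>"
  define D where "D = nat \<lceil>1 / (1 - \<delta>)\<rceil>"
  define m where "m = code_bits q"
  define inp where "inp = decoder_input n q \<epsilon> \<delta> l"
  \<comment> \<open>Dominates all loop bounds at once: \<open>n\<close>, \<open>q\<close>,
    \<open>q * q\<close>, \<open>D\<close> and the number of bits.\<close>
  define W where "W = q\<^sup>2 * D"
  have ge1: "1 \<le> 1 / (1 - \<delta>)" using assms(4,5) by (simp add: field_simps)
  \<comment> \<open>Rounding up at most doubles a number that is at least 1; this is the origin of
    the factor \<open>2 ^ k\<close> in the time bound.\<close>
  have D1: "1 / (1 - \<delta>) \<le> real D" "real D \<le> 2 * (1 / (1 - \<delta>))"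
    using ge1 unfolding D_def by linarith+
  have D0: "0 < D" using D1 ge1 by linarith
  interpret list_decoding q l m U \<alpha> \<phi> n D
    by unfold_locales (use cc assms D0 m_def in auto)
  let ?\<sigma> = "\<lambda>i. if i < length inp then inp ! i else 0"
  let ?\<psi> = "\<lambda>S. if S = {} then 1 else (0::complex)"
  let ?s = "\<lparr>mem = absm ?\<sigma>, qst = ?\<psi>, outp = []\<rparr>"
  let ?S = "sem m l U p_main ?s"
  have len: "length inp = 7" by (simp add: inp_def decoder_input_def)
  have inp: "?\<sigma> 0 = n" "?\<sigma> 2 = q" "?\<sigma> 4 = D" "?\<sigma> 5 = m" "?\<sigma> 6 = l" "?\<sigma> 10 = 0"
    by (simp_all add: inp_def decoder_input_def D_def m_def)
  have W: "n \<le> W" "q \<le> W" "D \<le> W" "m \<le> W" "q * q \<le> W" "1 \<le> W"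
  proof -
    show qq: "q * q \<le> W" using D0 by (simp add: W_def power2_eq_square)
    have "q \<le> q * q" by simp
    then show "q \<le> W" using qq by (rule le_trans)
    then show "n \<le> W" "m \<le> W" "1 \<le> W" using n(2) code_bits_le[of q] q0 by (auto simp: m_def)
    show "D \<le> W" using q0 by (simp add: W_def)
  qed
  have imp: "implements m l U (cost W p_main) 0 (compile 0 p_main) ?\<sigma> ?\<psi> [] ?S"
    by (rule main_implements) (use inp W in simp_all)
  have "\<exists>R. ev m l U (cost W p_main) \<lparr>ctrl = compile 0 p_main @ [], cells = ?\<sigma>, qubits = ?\<psi>, emitted = []\<rparr> R \<and>
      map_pmf abst R = ?S \<and> (\<forall>c\<in>set_pmf R. ctrl c = [] \<and> (\<forall>j<0. cells c (tm j) = ?\<sigma> (tm j)))"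
    using imp unfolding implements_def by (rule spec)
  then obtain R where "ev m l U (cost W p_main) \<lparr>ctrl = compile 0 p_main @ [], cells = ?\<sigma>, qubits = ?\<psi>, emitted = []\<rparr> R"
      "map_pmf abst R = ?S" "\<forall>c\<in>set_pmf R. ctrl c = [] \<and> (\<forall>j<0. cells c (tm j) = ?\<sigma> (tm j))"
    by (elim exE conjE)
  then have R: "ev m l U (cost W p_main) (initial (compile 0 p_main) inp) R" "map_pmf abst R = ?S"
    "\<And>c. c \<in> set_pmf R \<Longrightarrow> ctrl c = []"
    by (simp_all only: initial_def append_Nil2)
  have run: "run m l U (cost W p_main) (initial (compile 0 p_main) inp) = R"
    by (rule ev_run[OF R(1,3)])
  show "\<exists>t. real t \<le> real C * 2 ^ k * real q ^ (2 * k) * (1 / (1 - \<delta>)) ^ k \<and>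
     (let R = run (code_bits q) l U t (initial (compile 0 p_main) (decoder_input n q \<epsilon> \<delta> l)) in
       (\<forall>c\<in>set_pmf R. ctrl c = []) \<and>
       \<delta> \<le> measure_pmf.prob R {c. \<exists>xs. emitted c = concat xs \<and> set xs \<subseteq> messages q n \<and>
         {x \<in> messages q n. 1 / real q + \<epsilon> \<le> presence q \<alpha> (GRS q n x)} \<subseteq> set xs})"
    unfolding Let_def m_def[symmetric] inp_def[symmetric]
  proof (intro exI[of _ "cost W p_main"] conjI, unfold run)
    have "real (cost W p_main) \<le> real (C * W ^ k)" using cost[OF W(6)] by (simp only: of_nat_le_iff)
    also have "\<dots> = real C * real q ^ (2 * k) * real D ^ k"
      by (simp add: W_def power_mult_distrib power_mult)
    also have "\<dots> \<le> real C * real q ^ (2 * k) * (2 * (1 / (1 - \<delta>))) ^ k"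
      using D1 by (intro mult_left_mono power_mono) auto
    also have "\<dots> = real C * 2 ^ k * real q ^ (2 * k) * (1 / (1 - \<delta>)) ^ k"
      by (simp only: power_mult_distrib mult_ac)
    finally show "real (cost W p_main) \<le> real C * 2 ^ k * real q ^ (2 * k) * (1 / (1 - \<delta>)) ^ k" .
    show "\<forall>c\<in>set_pmf R. ctrl c = []" using R(3) by blast
    define Good where "Good = (\<lambda>out. \<exists>xs. out = concat xs \<and> set xs \<subseteq> messages q n \<and>
         {x \<in> messages q n. 1 / real q + \<epsilon> \<le> presence q \<alpha> (GRS q n x)} \<subseteq> set xs)"
    define s1 where "s1 = setm 7 0 (q * q) ?s"
    have abs: "absm ?\<sigma> k 0 = ?\<sigma> k" if "k < 63" for k using that by (simp add: absm_def)
    have S: "?S = sem m l U p_rounds s1"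
      using abs[of 2] inp by (simp add: p_main_def bind_return_pmf s1_def)
    have supp: "{S. ?\<psi> S \<noteq> 0} = {{}}" by auto
    have "qnorm ?\<psi>" unfolding qnorm_def mass_def supp by (simp add: Collect_conv_if)
    moreover have "fresh 0 ?\<psi>" by (simp add: fresh_def)
    ultimately have rinv: "rinv s1"
      using abs[of 0] abs[of 2] abs[of 4] abs[of 5] abs[of 6] abs[of 10] inp
      by (simp add: rinv_def par_def good_def s1_def)
    define T where "T = sqrt (2 * (real n - 1) * real q)"
    \<comment> \<open>The threshold that succeeds is only named here, not computed by the program.
      Rounding down gives \<open>T < t + 1\<close> for the monomial count, and
      \<open>t + 1 \<le> T + 1\<close> keeps it within the expected agreement.\<close>
    define t where "t = nat \<lfloor>T\<rfloor>"
    have T0: "0 \<le> T" using n by (simp add: T_def)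
    have tT: "real t \<le> T" "T < real t + 1" using T0 unfolding t_def by linarith+
    have "1 + real q * \<epsilon> \<le> real q"
    proof -
      have "real q * \<epsilon> \<le> real q * (1 - 1 / real q)" using assms(6) by (intro mult_left_mono) auto
      then show ?thesis using q0 by (simp add: right_diff_distrib)
    qed
    then have tq: "t < q" and t\<epsilon>: "real t + 1 \<le> 1 + real q * \<epsilon>" using bias tT unfolding T_def by linarith+
    have "\<delta> \<le> 1 - 1 / real D"
    proof -
      have "1 / real D \<le> 1 - \<delta>" using D1(1) D0 assms(5) by (simp add: field_simps)
      then show ?thesis by simp
    qed
    also have "\<dots> \<le> measure_pmf.prob ?S {u. Good (outp u)}"
      unfolding S Good_def by (rule rounds_prob[OF rinv _ _ tq t\<epsilon>]) (use tT in \<open>auto simp: s1_def T_def\<close>)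
    also have "\<dots> = measure_pmf.prob R {c. Good (emitted c)}"
      unfolding R(2)[symmetric] by (simp add: abst_def vimage_def)
    finally show "\<delta> \<le> measure_pmf.prob R {c. \<exists>xs. emitted c = concat xs \<and> set xs \<subseteq> messages q n \<and>
         {x \<in> messages q n. 1 / real q + \<epsilon> \<le> presence q \<alpha> (GRS q n x)} \<subseteq> set xs}"
      by (simp only: Good_def)
  qed
qed

theorem lemma11:
  shows "\<exists>(P :: command list) p. polynomial4 p \<and>
    (\<forall>(n::nat) (q::nat) (\<epsilon>::real) (\<delta>::real) (\<epsilon>'::real) (\<Delta>::real).
       prime q \<and> 0 < \<epsilon> \<and> \<epsilon> < 1 \<and> 0 < \<delta> \<and> \<delta> < 1 \<and> 2 \<le> n \<and> n \<le> q \<and>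
       0 < \<epsilon>' \<and> \<epsilon>' < 1 \<and> \<epsilon>' < 1 - 1 / real q \<and>
       \<Delta> = 2 * (real n - 1) * ln ((real q)\<^sup>2 / (1 - \<delta>)) \<and>
       \<epsilon>' + (1 - 1 / real q - \<epsilon>') * sqrt (\<Delta> / (1 + real q * \<epsilon>')) < \<epsilon> \<and>
       \<epsilon> \<le> 1 - 1 / real q
       \<longrightarrow> quantum_list_decoder (GRS q n) q n \<epsilon> \<delta>
             (p (real n) (real q) (1 / \<delta>) (1 / (1 - \<delta>))) P)"
proof -
  \<comment> \<open>\<open>C\<close> and \<open>k\<close> depend only on the text of
    \<open>p_main\<close>, so the time polynomial is fixed before all parameters.\<close>
  obtain C k where cost: "\<forall>W\<ge>1. cost W p_main \<le> C * W ^ k" using cost_poly by blast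
  show ?thesis
  proof (intro exI conjI allI impI)
    show "polynomial4 (\<lambda>w x y z. (real C * 2 ^ k) * x ^ (2 * k) * z ^ k)" by (rule polynomial4_monomial)
    fix n q :: nat and \<epsilon> \<delta> \<epsilon>' \<Delta> :: real
    assume h: "prime q \<and> 0 < \<epsilon> \<and> \<epsilon> < 1 \<and> 0 < \<delta> \<and> \<delta> < 1 \<and> 2 \<le> n \<and> n \<le> q \<and>
       0 < \<epsilon>' \<and> \<epsilon>' < 1 \<and> \<epsilon>' < 1 - 1 / real q \<and>
       \<Delta> = 2 * (real n - 1) * ln ((real q)\<^sup>2 / (1 - \<delta>)) \<and>
       \<epsilon>' + (1 - 1 / real q - \<epsilon>') * sqrt (\<Delta> / (1 + real q * \<epsilon>')) < \<epsilon> \<and>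
       \<epsilon> \<le> 1 - 1 / real q"
    then have "n < q" "sqrt (2 * (real n - 1) * real q) + 1 \<le> 1 + real q * \<epsilon>"
      using bias_bound(1)[of q \<delta> n \<epsilon>' \<Delta> \<epsilon>] bias_bound(2)[of q \<delta> n \<epsilon>' \<Delta> \<epsilon>] by blast+
    then show "quantum_list_decoder (GRS q n) q n \<epsilon> \<delta>
        (real C * 2 ^ k * real q ^ (2 * k) * (1 / (1 - \<delta>)) ^ k) (compile 0 p_main)"
      using h cost by (intro decoder_correct) auto
  qed
qed

end
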